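(* Let $K\ge1$. (i) If $f\in\mathcal{K}_H$ is $K$-quasiconformal, then $f\in h^p$ for every $0<p<1$. (ii) If $f$ is $K$-quasiconformal and belongs to one of the classes $\mathcal{C}_H$, $\mathcal{S}_H^{*}$, or $\mathcal{K}_H(\theta)$ ($0\le\theta<\pi$), then $f\in h^p$ for every $0<p<1/2$.
   Context: $\mathbb{D}=\{z\in\mathbb{C}:|z|<1\}$. Every complex-valued harmonic function $f$ in $\mathbb{D}$ has a unique representation $f=h+\overline{g}$ with $h,g$ analytic in $\mathbb{D}$ and $g(0)=0$. $\mathcal{S}_H$ denotes the class of sense-preserving univalent harmonic functions $f=h+\overline{g}$ in $\mathbb{D}$ with $h(0)=g(0)=0$, $h'(0)=1$. $\mathcal{K}_H$, $\mathcal{C}_H$, $\mathcal{S}_H^*$, $\mathcal{K}_H(\theta)$ are the subclasses of $\mathcal{S}_H$ of functions mapping $\mathbb{D}$ onto a convex domain, a close-to-convex domain (complement is a union of non-crossing half-lines), a domain starlike with respect to the origin, and a domain convex in the direction $e^{i\theta}$ (every line parallel to $e^{i\theta}$ meets it in a connected set), respectively. For $K\ge1$, a sense-preserving harmonic $f=h+\overline g$ is $K$-quasiconformal if it is a homeomorphism of $\mathbb{D}$ and its analytic dilatation $\omega=g'/h'$ satisfies $|\omega(z)|\le \frac{K-1}{K+1}$ for all $z\in\mathbb{D}$. For harmonic $f$ in $\mathbb{D}$ and $0<p<\infty$, $M_p(r,f)=\left(\frac{1}{2\pi}\int_0^{2\pi}|f(re^{i\theta})|^p\,d\theta\right)^{1/p}$;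 the harmonic Hardy space $h^p$ consists of harmonic $f$ in $\mathbb{D}$ with $\sup_{0\le r<1}M_p(r,f)<\infty$. *)

theory Defs
  imports "HOL-Analysis.Analysis"
begin

abbreviation unit_disc :: "complex set" where
  "unit_disc \<equiv> ball 0 1"

text \<open>Harmonic functions in the unit disc, via the canonical representation
  f = h + conj g with h, g analytic in the disc (every harmonic function in the
  disc has such a representation).\<close>
definition harmonic_decomp :: "(complex \<Rightarrow> complex) \<Rightarrow> (complex \<Rightarrow> complex) \<Rightarrow> (complex \<Rightarrow> complex) \<Rightarrow> bool" where
  "harmonic_decomp f h g \<longleftrightarrow> h holomorphic_on unit_disc \<and> g holomorphic_on unit_disc \<and> g 0 = 0
     \<and> (\<forall>z\<in>unit_disc. f z = h z + cnj (g z))"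

definition harmonic_disc :: "(complex \<Rightarrow> complex) \<Rightarrow> bool" where
  "harmonic_disc f \<longleftrightarrow> (\<exists>h g. harmonic_decomp f h g)"

text \<open>Sense-preserving: positive Jacobian |h'|^2 - |g'|^2 > 0.\<close>
definition sense_preserving :: "(complex \<Rightarrow> complex) \<Rightarrow> bool" where
  "sense_preserving f \<longleftrightarrow> (\<exists>h g. harmonic_decomp f h g \<and>
      (\<forall>z\<in>unit_disc. (norm (deriv g z))\<^sup>2 < (norm (deriv h z))\<^sup>2))"

definition class_SH :: "(complex \<Rightarrow> complex) set" where
  "class_SH = {f. \<exists>h g. harmonic_decomp f h g
      \<and> (\<forall>z\<in>unit_disc. (norm (deriv g z))\<^sup>2 < (norm (deriv h z))\<^sup>2)
      \<and> inj_on f unit_disc \<and> h 0 = 0 \<and> deriv h 0 = 1}"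

definition class_KH :: "(complex \<Rightarrow> complex) set" where
  "class_KH = {f \<in> class_SH. convex (f ` unit_disc)}"

definition half_line :: "complex \<Rightarrow> complex \<Rightarrow> complex set" where
  "half_line a d = {a + complex_of_real t * d | t. t \<ge> 0}"

definition close_to_convex_domain :: "complex set \<Rightarrow> bool" where
  "close_to_convex_domain \<Omega> \<longleftrightarrow> (\<exists>R :: (complex \<times> complex) set.
      (\<forall>(a,d)\<in>R. d \<noteq> 0) \<and>
      - \<Omega> = (\<Union>(a,d)\<in>R. half_line a d) \<and>
      (\<forall>(a1,d1)\<in>R. \<forall>(a2,d2)\<in>R. half_line a1 d1 \<noteq> half_line a2 d2 \<longrightarrow>
          half_line a1 d1 \<inter> half_line a2 d2 \<subseteq> {a1, a2}))"

definition class_CH :: "(complex \<Rightarrow> complex) set" where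
  "class_CH = {f \<in> class_SH. close_to_convex_domain (f ` unit_disc)}"

definition class_SH_star :: "(complex \<Rightarrow> complex) set" where
  "class_SH_star = {f \<in> class_SH. \<forall>w\<in>f ` unit_disc. closed_segment 0 w \<subseteq> f ` unit_disc}"

definition class_KH_dir :: "real \<Rightarrow> (complex \<Rightarrow> complex) set" where
  "class_KH_dir \<theta> = {f \<in> class_SH. \<forall>a::complex.
      connected ({a + complex_of_real t * exp (\<i> * complex_of_real \<theta>) | t. True} \<inter> f ` unit_disc)}"

definition K_qc :: "real \<Rightarrow> (complex \<Rightarrow> complex) \<Rightarrow> bool" where
  "K_qc K f \<longleftrightarrow> sense_preserving f \<and> (\<exists>f'. homeomorphism unit_disc (f ` unit_disc) f f') \<and>
     (\<exists>h g. harmonic_decomp f h g \<and>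
        (\<forall>z\<in>unit_disc. norm (deriv g z / deriv h z) \<le> (K - 1) / (K + 1)))"

definition Mp :: "real \<Rightarrow> real \<Rightarrow> (complex \<Rightarrow> complex) \<Rightarrow> real" where
  "Mp p r f = ((1 / (2 * pi)) * integral {0..2*pi}
       (\<lambda>\<theta>. norm (f (complex_of_real r * exp (\<i> * complex_of_real \<theta>))) powr p)) powr (1 / p)"

definition harmonic_hardy :: "real \<Rightarrow> (complex \<Rightarrow> complex) set" where
  "harmonic_hardy p = {f. harmonic_disc f \<and> (\<exists>B. \<forall>r. 0 \<le> r \<and> r < 1 \<longrightarrow> Mp p r f \<le> B)}"

end

theory Submission
  imports Defs "HOL-Complex_Analysis.Complex_Analysis"
begin

text \<open>
  Write \<open>f = h + cnj g\<close> with \<open>|g'| \<le> k |h'|\<close>, \<open>k < 1\<close>. Then \<open>F = h - g\<close> has the imaginary part of \<open>f\<close>, and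
  \<open>|F'|\<close>, \<open>|h'|\<close> are comparable. If \<open>Re Q > 0\<close> and \<open>|h'| \<le> C |(Q\<^sup>n)'|\<close>, then \<open>h\<close> has bounded \<open>p\<close>-means for
  \<open>p < 1/n\<close>, because a multiple of \<open>(Re Q)\<^bsup>np\<^esup>\<close> compensates the Laplacian of \<open>|h|\<^sup>p\<close>. A half plane containing
  a convex image gives such a \<open>Q\<close> with \<open>n = 1\<close>. If some line meets the image in a proper connected subset of the
  line, then (the line being horizontal) \<open>F\<close> omits a ray, and a square root of \<open>F\<close> gives \<open>n = 2\<close>; this covers
  starlike images and images convex in one direction.

  For a close-to-convex image, send an accessible boundary point to infinity by a Cayley map and follow the
  argument of \<open>f (z + i t) - f z\<close> on the half plane. Near the boundary the point \<open>f z\<close> can be left along omitted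
  rays that do not cross a reference ray, which confines the argument to \<open>[-2\<pi>, \<pi>]\<close>; a length-area estimate
  controls infinity, and the maximum principle extends the bound to the whole half plane. For \<open>t \<rightarrow> 0\<close> this says
  \<open>F' = - P\<^sup>3\<close> with \<open>Re P \<ge> 0\<close>. Two different accessible points together give
  \<open>|h'| \<le> C (|P\<^sub>1|\<^sup>3 + |P\<^sub>2|\<^sup>3)\<close> on the disc, and summing over dyadic annuli yields all \<open>p < 1/2\<close>.
\<close>

subsection \<open>Integral means and superharmonic majorants\<close>

text \<open>The geometric hypothesis concerns the image of \<open>f\<close>, not that of the shear
  \<open>F\<close>, and \<open>f\<close> is not assumed to extend continuously to the circle. So
  there is no boundary curve with a tangent to follow. Chords of \<open>f\<close> take the place of
  the tangent: at boundary sequences their argument can be estimated from omitted rays alone, while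
  length-area estimates replace boundary continuity. The interval \<open>[-2 pi, pi]\<close>
  combines two estimates. Leaving the image near \<open>f z\<close> confines the argument of the
  chord to \<open>[-3 pi, pi]\<close>. Leaving it near the other end \<open>f (z + i t)\<close>
  gives the same interval for the reversed chord, whose argument is smaller by \<open>pi\<close>;
  this raises the lower bound to \<open>-2 pi\<close>. An interval of length \<open>3 pi\<close> is
  exactly what a cube root turns into a nonnegative real part. The exponent fits the claim:
  \<open>|P|^3\<close> is of order at most \<open>(1 - |z|)^(-3)\<close>, as for the derivative of
  the Koebe function. One accessible point \<open>b\<close> is not enough, since the Cayley map
  contributes the factor \<open>|b - z|^(-2)\<close>, unbounded near \<open>b\<close>. With two
  different points one of the two factors is harmless at every \<open>z\<close>.\<close>

lemma circle_integral_antimono: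
  fixes S St Stt Sh Shh :: "real \<Rightarrow> real \<Rightarrow> real"
  assumes dt: "\<And>t x. t < 0 \<Longrightarrow> ((\<lambda>t. S t x) has_real_derivative St t x) (at t)"
    and dtt: "\<And>t x. t < 0 \<Longrightarrow> ((\<lambda>t. St t x) has_real_derivative Stt t x) (at t)"
    and dh: "\<And>t x. t < 0 \<Longrightarrow> (S t has_real_derivative Sh t x) (at x)"
    and dhh: "\<And>t x. t < 0 \<Longrightarrow> (Sh t has_real_derivative Shh t x) (at x)"
    and ct: "continuous_on ({..<0} \<times> UNIV) (\<lambda>(t,x). St t x)"
    and ctt: "continuous_on ({..<0} \<times> UNIV) (\<lambda>(t,x). Stt t x)"
    and per: "\<And>t. t < 0 \<Longrightarrow> Sh t (2 * pi) = Sh t 0"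
    and lap: "\<And>t x. t < 0 \<Longrightarrow> Stt t x + Shh t x \<le> 0"
    and nonneg: "\<And>t x. t < 0 \<Longrightarrow> 0 \<le> S t x"
    and le: "t1 \<le> t2" "t2 < 0"
  shows "integral {0..2*pi} (S t2) \<le> integral {0..2*pi} (S t1)"
proof -
  define J where "J t = integral {0..2*pi} (S t)" for t
  define K where "K t = integral {0..2*pi} (St t)" for t
  have cS: "continuous_on {0..2*pi} (S t)" if "t < 0" for t
    using dh[OF that] by (intro continuous_at_imp_continuous_on ballI) (metis DERIV_isCont)
  have slice: "continuous_on {0..2*pi} (G t)" if "t < 0" "continuous_on ({..<0} \<times> UNIV) (\<lambda>(t,x). G t x)"
    for t and G :: "real \<Rightarrow> real \<Rightarrow> real"
  proof -
    have "continuous_on {0..2*pi} ((\<lambda>(t,x). G t x) \<circ> (\<lambda>x. (t,x)))"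
      by (rule continuous_on_compose) (auto intro!: continuous_intros continuous_on_subset[OF that(2)] simp: that)
    then show ?thesis by (simp add: o_def)
  qed
  have J': "(J has_real_derivative K t) (at t)" if "t < 0" for t
  proof -
    have "((\<lambda>t. integral (cbox 0 (2*pi)) (S t)) has_field_derivative integral (cbox 0 (2*pi)) (St t)) (at t within {..<0})"
      by (rule leibniz_rule_field_derivative)
        (auto intro!: has_field_derivative_at_within dt continuous_on_subset[OF ct] integrable_continuous_real cS simp: that)
    then show ?thesis
      using that at_within_open[of t "{..<0}"] by (simp add: J_def[abs_def] K_def)
  qed
  have K': "(K has_real_derivative integral {0..2*pi} (Stt t)) (at t)" if "t < 0" for t
  proof -
    have "((\<lambda>t. integral (cbox 0 (2*pi)) (St t)) has_field_derivative integral (cbox 0 (2*pi)) (Stt t)) (at t within {..<0})"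
      by (rule leibniz_rule_field_derivative)
        (auto intro!: has_field_derivative_at_within dtt continuous_on_subset[OF ctt] integrable_continuous_real slice ct simp: that)
    then show ?thesis
      using that at_within_open[of t "{..<0}"] by (simp add: K_def[abs_def])
  qed
  \<comment> \<open>The second \<open>x\<close>-derivative integrates to zero over a period, so the
    left side is the integral of the full Laplacian.\<close>
  have K'_le: "integral {0..2*pi} (Stt t) \<le> 0" if t: "t < 0" for t
  proof -
    have 1: "((\<lambda>x. Shh t x) has_integral (Sh t (2*pi) - Sh t 0)) {0..2*pi}"
      by (rule fundamental_theorem_of_calculus)
        (auto intro!: has_field_derivative_at_within dhh simp: t simp flip: has_real_derivative_iff_has_vector_derivative)
    then have 2: "((\<lambda>x. Shh t x) has_integral 0) {0..2*pi}" using per t by simp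
    have "Stt t integrable_on {0..2*pi}"
      by (rule integrable_continuous_real[OF slice[OF t ctt]])
    then have 3: "(Stt t has_integral integral {0..2*pi} (Stt t)) {0..2*pi}" by blast
    from has_integral_add[OF 3 2] have "((\<lambda>x. Stt t x + Shh t x) has_integral integral {0..2*pi} (Stt t)) {0..2*pi}"
      by simp
    then show ?thesis
      by (rule has_integral_le[OF _ has_integral_0, of _ _ "{0..2*pi}"]) (use lap t in auto)
  qed
  have K_mono: "K b \<le> K a" if "a \<le> b" "b < 0" for a b
    by (rule DERIV_nonpos_imp_nonincreasing[OF that(1)]) (use K' K'_le that in \<open>meson le_less_trans\<close>)
  have K_le0: "K t \<le> 0" if t: "t < 0" for t
  proof (rule ccontr)
    assume "\<not> K t \<le> 0"
    then have pos: "K t > 0" by simp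
    have bd: "J a \<le> J t - K t * (t - a)" if at: "a < t" for a
    proof -
      obtain z where z: "a < z" "z < t" "J t - J a = (t - a) * K z"
        using MVT2[OF at, of J K] J' t by auto
      then have "K t \<le> K z" using K_mono t by auto
      then have "(t - a) * K t \<le> (t - a) * K z" using at by (intro mult_left_mono) auto
      then show ?thesis using z(3) by (simp add: algebra_simps)
    qed
    have Jpos: "J a \<ge> 0" if "a < 0" for a
      unfolding J_def by (rule integral_nonneg) (auto intro!: integrable_continuous_real cS nonneg that)
    \<comment> \<open>By concavity \<open>J\<close> lies below its tangent at \<open>t\<close>. If
      the slope \<open>K t\<close> is positive, this tangent has the value \<open>-1\<close> at the
      chosen \<open>a\<close>, against nonnegativity of \<open>J\<close>.\<close>
    define a where "a = t - (J t + 1) / K t"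
    have "a < t" using pos Jpos[OF t] by (simp add: a_def field_simps)
    moreover have "K t * (t - a) = J t + 1" using pos by (simp add: a_def)
    ultimately show False using bd[of a] Jpos[of a] t by simp
  qed
  have "J t2 \<le> J t1"
    by (rule DERIV_nonpos_imp_nonincreasing[OF le(1)]) (use J' K_le0 le in \<open>meson le_less_trans\<close>)
  then show ?thesis by (simp add: J_def)
qed


lemma powr_sum_second_derivative:
  fixes w w1 w2 u u1 u2 :: "real \<Rightarrow> real"
  assumes "\<And>t. t \<in> U \<Longrightarrow> (w has_real_derivative w1 t) (at t)"
    and "\<And>t. t \<in> U \<Longrightarrow> (w1 has_real_derivative w2 t) (at t)"
    and "\<And>t. t \<in> U \<Longrightarrow> (u has_real_derivative u1 t) (at t)"
    and "\<And>t. t \<in> U \<Longrightarrow> (u1 has_real_derivative u2 t) (at t)"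
    and "\<And>t. t \<in> U \<Longrightarrow> w t > 0" "\<And>t. t \<in> U \<Longrightarrow> u t > 0" "t \<in> U"
  shows "((\<lambda>t. w t powr a + A * u t powr b) has_real_derivative
          a * w t powr (a - 1) * w1 t + A * (b * u t powr (b - 1) * u1 t)) (at t)"
    and "((\<lambda>t. a * w t powr (a - 1) * w1 t + A * (b * u t powr (b - 1) * u1 t)) has_real_derivative
          a * (a - 1) * w t powr (a - 2) * (w1 t)\<^sup>2 + a * w t powr (a - 1) * w2 t
          + A * (b * (b - 1) * u t powr (b - 2) * (u1 t)\<^sup>2 + b * u t powr (b - 1) * u2 t)) (at t)"
  using assms by (auto intro!: derivative_eq_intros simp: algebra_simps power2_eq_square)

text \<open>For a holomorphic function, \<open>F2\<close> is the second complex derivative along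
  horizontal lines and its negative along vertical lines. The mixed terms therefore cancel in the
  Laplacian, and only four times the squared modulus of the first derivative remains.\<close>

lemma norm_sq_second_derivative:
  fixes F F1 F2 :: "real \<Rightarrow> complex"
  assumes "\<And>t. t \<in> U \<Longrightarrow> (F has_vector_derivative F1 t) (at t)"
    and "\<And>t. t \<in> U \<Longrightarrow> (F1 has_vector_derivative F2 t) (at t)" and t: "t \<in> U"
  shows "((\<lambda>t. (norm (F t))\<^sup>2) has_real_derivative 2 * Re (cnj (F t) * F1 t)) (at t)"
    and "((\<lambda>t. 2 * Re (cnj (F t) * F1 t)) has_real_derivative
           2 * (norm (F1 t))\<^sup>2 + 2 * Re (cnj (F t) * F2 t)) (at t)"
proof -
  have r: "((\<lambda>t. Re (F t)) has_real_derivative Re (F1 t)) (at t)" "((\<lambda>t. Im (F t)) has_real_derivative Im (F1 t)) (at t)"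
     "((\<lambda>t. Re (F1 t)) has_real_derivative Re (F2 t)) (at t)" "((\<lambda>t. Im (F1 t)) has_real_derivative Im (F2 t)) (at t)"
    unfolding has_real_derivative_iff_has_vector_derivative using assms
    by (auto intro!: bounded_linear.has_vector_derivative[OF bounded_linear_Re]
        bounded_linear.has_vector_derivative[OF bounded_linear_Im])
  show "((\<lambda>t. (norm (F t))\<^sup>2) has_real_derivative 2 * Re (cnj (F t) * F1 t)) (at t)"
    using DERIV_add[OF DERIV_power[OF r(1), of 2] DERIV_power[OF r(2), of 2]] unfolding cmod_power2
    by (simp add: algebra_simps)
  show "((\<lambda>t. 2 * Re (cnj (F t) * F1 t)) has_real_derivative
           2 * (norm (F1 t))\<^sup>2 + 2 * Re (cnj (F t) * F2 t)) (at t)"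
    using DERIV_cmult[OF DERIV_add[OF DERIV_mult[OF r(1) r(3)] DERIV_mult[OF r(2) r(4)]], of 2]
    unfolding cmod_power2 by (simp add: algebra_simps power2_eq_square)
qed


text \<open>With \<open>b = n p\<close>, the function \<open>(|q\<^sup>n|\<^sup>2 + |H|\<^sup>2)\<^bsup>p/2\<^esup> + A (Re q)\<^sup>b\<close> has nonpositive Laplacian
  for large \<open>A\<close>, so its integrals over vertical periods are concave in \<open>t\<close>; being nonnegative
  on a half line, they decrease towards the imaginary axis.\<close>
lemma lhp_integral_bounded:
  fixes q H :: "complex \<Rightarrow> complex" and C p :: real and n :: nat
  assumes q: "q holomorphic_on {s. Re s < 0}" and H: "H holomorphic_on {s. Re s < 0}"
    and perq: "\<And>s. Re s < 0 \<Longrightarrow> q (s + 2 * pi * \<i>) = q s"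
    and perH: "\<And>s. Re s < 0 \<Longrightarrow> H (s + 2 * pi * \<i>) = H s"
    and pos: "\<And>s. Re s < 0 \<Longrightarrow> Re (q s) > 0"
    and bd: "\<And>s. Re s < 0 \<Longrightarrow> norm (deriv H s) \<le> C * (norm (q s) ^ (n - 1) * norm (deriv q s))"
    and p: "0 < p" "n * p < 1" "n \<ge> 1"
  shows "\<exists>B. \<forall>t. -1 \<le> t \<and> t < 0 \<longrightarrow> integral {0..2*pi} (\<lambda>x. norm (H (Complex t x)) powr p) \<le> B"
proof -
  define L where "L = {s::complex. Re s < 0}"
  have oL: "open L" unfolding L_def by (rule open_halfspace_Re_lt)
  define F where "F s = q s ^ n" for s
  have hol: "F holomorphic_on L" unfolding F_def using q by (auto intro!: holomorphic_intros simp: L_def)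
  have hq: "q holomorphic_on L" and hH: "H holomorphic_on L" using q H by (auto simp: L_def)
  have d1: "(\<phi> has_field_derivative deriv \<phi> s) (at s)" "(deriv \<phi> has_field_derivative deriv (deriv \<phi>) s) (at s)"
    if "\<phi> holomorphic_on L" "s \<in> L" for \<phi> s
    using that oL by (auto intro!: holomorphic_derivI holomorphic_deriv)
  have vt: "((\<lambda>t. \<phi> (Complex t x)) has_vector_derivative deriv \<phi> (Complex t x)) (at t)"
    "((\<lambda>t. deriv \<phi> (Complex t x)) has_vector_derivative deriv (deriv \<phi>) (Complex t x)) (at t)"
    "((\<lambda>x. \<phi> (Complex t x)) has_vector_derivative \<i> * deriv \<phi> (Complex t x)) (at x)"
    "((\<lambda>x. \<i> * deriv \<phi> (Complex t x)) has_vector_derivative - deriv (deriv \<phi>) (Complex t x)) (at x)"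
    if h: "\<phi> holomorphic_on L" and t: "t \<in> {..<0}" for \<phi> t x
  proof -
    have s: "Complex t x \<in> L" using t by (simp add: L_def)
    have c1: "((\<lambda>t. Complex t x) has_vector_derivative 1) (at t)"
      unfolding Complex_eq by (auto intro!: derivative_eq_intros)
    have c2: "((\<lambda>x. Complex t x) has_vector_derivative \<i>) (at x)"
      unfolding Complex_eq by (auto intro!: derivative_eq_intros)
    show "((\<lambda>t. \<phi> (Complex t x)) has_vector_derivative deriv \<phi> (Complex t x)) (at t)"
      using field_vector_diff_chain_at[OF c1 d1(1)[OF h s]] by (simp add: o_def)
    show "((\<lambda>t. deriv \<phi> (Complex t x)) has_vector_derivative deriv (deriv \<phi>) (Complex t x)) (at t)"
      using field_vector_diff_chain_at[OF c1 d1(2)[OF h s]] by (simp add: o_def)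
    show "((\<lambda>x. \<phi> (Complex t x)) has_vector_derivative \<i> * deriv \<phi> (Complex t x)) (at x)"
      using field_vector_diff_chain_at[OF c2 d1(1)[OF h s]] by (simp add: o_def)
    show "((\<lambda>x. \<i> * deriv \<phi> (Complex t x)) has_vector_derivative - deriv (deriv \<phi>) (Complex t x)) (at x)"
      using has_vector_derivative_mult_right[OF field_vector_diff_chain_at[OF c2 d1(2)[OF h s]], of \<i>]
      by (simp add: o_def mult.assoc[symmetric])
  qed
  define a where "a = p / 2"
  define b where "b = n * p"
  have "1 * p \<le> n * p" using p by (intro mult_right_mono) auto
  then have "p < 1" using p by linarith
  then have a: "0 < a" "a < 1" using p(1) by (auto simp: a_def)
  have b: "0 < b" "b < 1" using p by (auto simp: b_def)
  \<comment> \<open>Chosen so that the negative Laplacian of \<open>A * Re q powr b\<close> carries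
    exactly the coefficient of the positive part estimated below.\<close>
  define A where "A = 4 * a * (1 + C\<^sup>2) * n\<^sup>2 / (b * (1 - b))"
  have A: "A \<ge> 0" using a b by (auto simp: A_def)
  \<comment> \<open>Adding the square of \<open>|F|\<close> keeps the base positive, so that the
    power \<open>a < 1\<close> is smooth, and bounds it below by \<open>|q|^(2 n)\<close>, which is
    needed because \<open>a - 1\<close> is negative.\<close>
  define w where "w s = (norm (F s))\<^sup>2 + (norm (H s))\<^sup>2" for s
  define w1 where "w1 s = 2 * Re (cnj (F s) * deriv F s) + 2 * Re (cnj (H s) * deriv H s)" for s
  define w2 where "w2 s = 2 * (norm (deriv F s))\<^sup>2 + 2 * Re (cnj (F s) * deriv (deriv F) s)
      + (2 * (norm (deriv H s))\<^sup>2 + 2 * Re (cnj (H s) * deriv (deriv H) s))" for s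
  define v1 where "v1 s = 2 * Re (cnj (F s) * (\<i> * deriv F s)) + 2 * Re (cnj (H s) * (\<i> * deriv H s))" for s
  define v2 where "v2 s = 2 * (norm (\<i> * deriv F s))\<^sup>2 + 2 * Re (cnj (F s) * (- deriv (deriv F) s))
      + (2 * (norm (\<i> * deriv H s))\<^sup>2 + 2 * Re (cnj (H s) * (- deriv (deriv H) s)))" for s
  have q0: "q s \<noteq> 0" if "s \<in> L" for s using pos[of s] that by (auto simp: L_def)
  have wpos: "w s > 0" if "s \<in> L" for s
    using q0[OF that] by (auto simp: w_def F_def intro!: add_pos_nonneg)
  define S where "S s = w s powr a + A * Re (q s) powr b" for s
  define St where "St s = a * w s powr (a - 1) * w1 s + A * (b * Re (q s) powr (b - 1) * Re (deriv q s))" for s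
  define Sh where "Sh s = a * w s powr (a - 1) * v1 s + A * (b * Re (q s) powr (b - 1) * Re (\<i> * deriv q s))" for s
  define Stt where "Stt s = a * (a - 1) * w s powr (a - 2) * (w1 s)\<^sup>2 + a * w s powr (a - 1) * w2 s
          + A * (b * (b - 1) * Re (q s) powr (b - 2) * (Re (deriv q s))\<^sup>2 + b * Re (q s) powr (b - 1) * Re (deriv (deriv q) s))" for s
  define Shh where "Shh s = a * (a - 1) * w s powr (a - 2) * (v1 s)\<^sup>2 + a * w s powr (a - 1) * v2 s
          + A * (b * (b - 1) * Re (q s) powr (b - 2) * (Re (\<i> * deriv q s))\<^sup>2 + b * Re (q s) powr (b - 1) * Re (- deriv (deriv q) s))" for s
  have ReD: "((\<lambda>t. Re (\<phi> t)) has_real_derivative Re \<phi>') (at t)" if "(\<phi> has_vector_derivative \<phi>') (at t)" for \<phi> \<phi>' t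
    unfolding has_real_derivative_iff_has_vector_derivative
    by (rule bounded_linear.has_vector_derivative[OF bounded_linear_Re that])
  have inL: "Complex t x \<in> L \<longleftrightarrow> t \<in> {..<0}" for t x by (simp add: L_def)
  have Q: "((\<lambda>t. w (Complex t x)) has_real_derivative w1 (Complex t x)) (at t)"
       "((\<lambda>t. w1 (Complex t x)) has_real_derivative w2 (Complex t x)) (at t)"
       "((\<lambda>x. w (Complex t x)) has_real_derivative v1 (Complex t x)) (at x)"
       "((\<lambda>x. v1 (Complex t x)) has_real_derivative v2 (Complex t x)) (at x)"
    if t: "t \<in> {..<0}" for t x
  proof -
    note nt = norm_sq_second_derivative[where U = "{..<0}", OF vt(1,2) t]
    note nx = norm_sq_second_derivative[where U = UNIV, OF vt(3,4) UNIV_I]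
    show "((\<lambda>t. w (Complex t x)) has_real_derivative w1 (Complex t x)) (at t)"
      unfolding w_def w1_def by (rule DERIV_add[OF nt(1) nt(1)]) (use hol hH in auto)
    show "((\<lambda>t. w1 (Complex t x)) has_real_derivative w2 (Complex t x)) (at t)"
      unfolding w2_def w1_def by (rule DERIV_add[OF nt(2) nt(2)]) (use hol hH in auto)
    show "((\<lambda>x. w (Complex t x)) has_real_derivative v1 (Complex t x)) (at x)"
      unfolding w_def v1_def by (rule DERIV_add[OF nx(1) nx(1)]) (use hol hH t in auto)
    show "((\<lambda>x. v1 (Complex t x)) has_real_derivative v2 (Complex t x)) (at x)"
      unfolding v2_def v1_def by (rule DERIV_add[OF nx(2) nx(2)]) (use hol hH t in auto)
  qed
  have contF: "continuous_on L \<phi>" if "\<phi> \<in> {F, q, H, deriv F, deriv q, deriv H, deriv (deriv F), deriv (deriv q), deriv (deriv H)}" for \<phi>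
    using that hol hH hq oL by (auto intro!: holomorphic_on_imp_continuous_on holomorphic_deriv)
  have contw: "continuous_on L w" "continuous_on L w1" "continuous_on L w2"
    unfolding w_def w1_def w2_def by (intro continuous_intros contF; simp)+
  have Rq: "Re (q s) > 0" if "s \<in> L" for s using pos that by (simp add: L_def)
  have cwp: "continuous_on L (\<lambda>s. w s powr e)" "continuous_on L (\<lambda>s. Re (q s) powr e)" for e
    using wpos Rq by (intro continuous_on_powr continuous_intros contw contF; force)+
  have contS: "continuous_on L S" "continuous_on L St" "continuous_on L Stt"
    unfolding S_def St_def Stt_def
    by (intro continuous_on_add continuous_on_mult continuous_on_const continuous_on_power continuous_on_Re cwp contw contF; simp)+
  have cpair: "continuous_on ({..<0} \<times> UNIV) (\<lambda>(t,x). G (Complex t x))" if "continuous_on L G" for G :: "complex \<Rightarrow> real"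
  proof -
    have "continuous_on ({..<0} \<times> UNIV) (\<lambda>tx. G (Complex (fst tx) (snd tx)))"
      by (rule continuous_on_compose2[OF that]) (auto intro!: continuous_intros simp: L_def Complex_eq)
    then show ?thesis by (simp add: case_prod_unfold)
  qed
  have lapl: "Stt s + Shh s \<le> 0" if s: "s \<in> L" for s
  proof -
    have dF: "norm (deriv F s) = n * (norm (q s) ^ (n - 1) * norm (deriv q s))"
    proof -
      have "deriv F s = n * (q s ^ (n - 1) * deriv q s)"
        unfolding F_def by (rule DERIV_imp_deriv) (auto intro!: derivative_eq_intros d1[OF hq s])
      then show ?thesis by (simp add: norm_mult norm_power)
    qed
    define m where "m = norm (q s) ^ (n - 1) * norm (deriv q s)"
    have m: "m \<ge> 0" by (simp add: m_def)
    have "(norm (deriv H s))\<^sup>2 \<le> (C * m)\<^sup>2"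
      using bd[of s] s unfolding m_def L_def by (intro power_mono) auto
    also have "\<dots> \<le> C\<^sup>2 * (n\<^sup>2 * m\<^sup>2)"
    proof -
      have "1 \<le> (real n)\<^sup>2" using p(3) by simp
      then have "m\<^sup>2 \<le> n\<^sup>2 * m\<^sup>2" by (simp add: mult_le_cancel_right1)
      then show ?thesis by (simp add: power_mult_distrib mult_left_mono)
    qed
    finally have dH: "(norm (deriv F s))\<^sup>2 + (norm (deriv H s))\<^sup>2 \<le> (1 + C\<^sup>2) * n\<^sup>2 * m\<^sup>2"
      unfolding dF m_def[symmetric] by (simp add: power_mult_distrib algebra_simps)
    have qn: "norm (q s) > 0" using q0[OF s] by simp
    \<comment> \<open>Since \<open>a < 1\<close>, the bound \<open>w \<ge> |q|^(2 n)\<close> is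
      reversed by the power \<open>a - 1\<close>. The exponents of \<open>|q|\<close> add up to
      \<open>b - 2\<close>, which is negative, so \<open>|q|\<close> may then be replaced by the
      smaller \<open>Re q\<close>.\<close>
    have le1: "w s powr (a - 1) * m\<^sup>2 \<le> Re (q s) powr (b - 2) * (norm (deriv q s))\<^sup>2"
    proof -
      have "(norm (q s) ^ n)\<^sup>2 \<le> w s" by (simp add: w_def F_def norm_power)
      then have "w s powr (a - 1) \<le> ((norm (q s) ^ n)\<^sup>2) powr (a - 1)"
        using a qn by (intro powr_mono2') auto
      also have "(norm (q s) ^ n)\<^sup>2 = norm (q s) powr (2 * n)"
        using qn powr_realpow[OF qn, of "n * 2"] by (simp add: power_mult mult.commute)
      also have "\<dots> powr (a - 1) = norm (q s) powr (2 * n * (a - 1))"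
        by (rule powr_powr)
      finally have "w s powr (a - 1) * m\<^sup>2 \<le> norm (q s) powr (2 * n * (a - 1)) * m\<^sup>2"
        by (rule mult_right_mono) simp
      moreover have msq: "m\<^sup>2 = norm (q s) powr (2 * (real n - 1)) * (norm (deriv q s))\<^sup>2"
      proof -
        have "(norm (q s) ^ (n - 1))\<^sup>2 = norm (q s) powr (real ((n - 1) * 2))"
          unfolding powr_realpow[OF qn] by (rule power_mult[symmetric])
        also have "real ((n - 1) * 2) = 2 * (real n - 1)" using p(3) by (simp add: of_nat_diff)
        finally show ?thesis by (simp add: m_def power_mult_distrib)
      qed
      moreover have "norm (q s) powr (2 * n * (a - 1)) * m\<^sup>2
          = norm (q s) powr (b - 2) * (norm (deriv q s))\<^sup>2"
      proof -
        have "2 * n * (a - 1) + 2 * (real n - 1) = b - 2" by (simp add: a_def b_def algebra_simps)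
        then show ?thesis unfolding msq by (metis powr_add mult.assoc)
      qed
      moreover have "norm (q s) powr (b - 2) * (norm (deriv q s))\<^sup>2 \<le> Re (q s) powr (b - 2) * (norm (deriv q s))\<^sup>2"
        using b Rq[OF s] by (intro mult_right_mono powr_mono2') (auto simp: complex_Re_le_cmod)
      ultimately show ?thesis by linarith
    qed
    have e1: "w2 s + v2 s = 4 * ((norm (deriv F s))\<^sup>2 + (norm (deriv H s))\<^sup>2)"
      unfolding w2_def v2_def norm_mult by simp
    have e2: "(Re (deriv q s))\<^sup>2 + (Re (\<i> * deriv q s))\<^sup>2 = (norm (deriv q s))\<^sup>2"
      by (simp add: cmod_power2)
    have alg: "x * r1 + y * r2 + A * (z * r3 + v * r4) + (x * r5 + y * r6 + A * (z * r7 + v * (- r4)))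
       = x * (r1 + r5) + y * (r2 + r6) + A * (z * (r3 + r7))" for x y z v r1 r2 r3 r4 r5 r6 r7 :: real
      by (simp add: algebra_simps)
    have "Stt s + Shh s = a * (a - 1) * w s powr (a - 2) * ((w1 s)\<^sup>2 + (v1 s)\<^sup>2)
       + a * w s powr (a - 1) * (w2 s + v2 s)
       + A * (b * (b - 1) * Re (q s) powr (b - 2) * ((Re (deriv q s))\<^sup>2 + (Re (\<i> * deriv q s))\<^sup>2))"
      unfolding Stt_def Shh_def by (subst uminus_complex.simps) (rule alg)
    also have "\<dots> = a * (a - 1) * w s powr (a - 2) * ((w1 s)\<^sup>2 + (v1 s)\<^sup>2)
       + 4 * a * w s powr (a - 1) * ((norm (deriv F s))\<^sup>2 + (norm (deriv H s))\<^sup>2)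
       + A * (b * (b - 1) * Re (q s) powr (b - 2) * (norm (deriv q s))\<^sup>2)"
      unfolding e1 e2 by simp
    also have "\<dots> \<le> 4 * a * w s powr (a - 1) * ((1 + C\<^sup>2) * n\<^sup>2 * m\<^sup>2)
       + A * (b * (b - 1) * Re (q s) powr (b - 2) * (norm (deriv q s))\<^sup>2)"
    proof -
      have "a * (a - 1) \<le> 0" using a by (simp add: mult_nonneg_nonpos)
      then have "a * (a - 1) * w s powr (a - 2) * ((w1 s)\<^sup>2 + (v1 s)\<^sup>2) \<le> 0"
        by (intro mult_nonpos_nonneg[OF mult_nonpos_nonneg]) auto
      moreover have "4 * a * w s powr (a - 1) * ((norm (deriv F s))\<^sup>2 + (norm (deriv H s))\<^sup>2)
          \<le> 4 * a * w s powr (a - 1) * ((1 + C\<^sup>2) * n\<^sup>2 * m\<^sup>2)"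
        using a dH by (intro mult_left_mono) auto
      ultimately show ?thesis by linarith
    qed
    also have "4 * a * w s powr (a - 1) * ((1 + C\<^sup>2) * n\<^sup>2 * m\<^sup>2) = A * (b * (1 - b)) * (w s powr (a - 1) * m\<^sup>2)"
      using b by (simp add: A_def)
    also have "\<dots> \<le> A * (b * (1 - b)) * (Re (q s) powr (b - 2) * (norm (deriv q s))\<^sup>2)"
      using le1 A b by (intro mult_left_mono) auto
    finally show ?thesis by (simp add: algebra_simps)
  qed
  have der: "((\<lambda>t. S (Complex t x)) has_real_derivative St (Complex t x)) (at t)"
     "((\<lambda>t. St (Complex t x)) has_real_derivative Stt (Complex t x)) (at t)"
     "((\<lambda>x. S (Complex t x)) has_real_derivative Sh (Complex t x)) (at x)"
     "((\<lambda>x. Sh (Complex t x)) has_real_derivative Shh (Complex t x)) (at x)" if "t < 0" for t x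
  proof -
    have t: "t \<in> {..<0}" using that by simp
    note ps = powr_sum_second_derivative[where U = "{..<0}", OF Q(1,2) ReD[OF vt(1)[OF hq]] ReD[OF vt(2)[OF hq]] wpos Rq t]
    note px = powr_sum_second_derivative[where U = UNIV, OF Q(3,4)[OF t] ReD[OF vt(3)[OF hq t]] ReD[OF vt(4)[OF hq t]] wpos Rq UNIV_I]
    show "((\<lambda>t. S (Complex t x)) has_real_derivative St (Complex t x)) (at t)"
      unfolding S_def St_def by (rule ps(1)) (use inL in auto)
    show "((\<lambda>t. St (Complex t x)) has_real_derivative Stt (Complex t x)) (at t)"
      unfolding St_def Stt_def by (rule ps(2)) (use inL in auto)
    show "((\<lambda>x. S (Complex t x)) has_real_derivative Sh (Complex t x)) (at x)"
      unfolding S_def Sh_def by (rule px(1)) (use t inL in auto)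
    show "((\<lambda>x. Sh (Complex t x)) has_real_derivative Shh (Complex t x)) (at x)"
      unfolding Sh_def Shh_def by (rule px(2)) (use t inL in auto)
  qed
  have dper: "deriv \<phi> (s + 2 * pi * \<i>) = deriv \<phi> s"
    if "\<phi> holomorphic_on L" "\<And>s. s \<in> L \<Longrightarrow> \<phi> (s + 2 * pi * \<i>) = \<phi> s" "s \<in> L" for \<phi> s
  proof -
    have s': "s + 2 * pi * \<i> \<in> L" using that(3) by (simp add: L_def)
    have "((\<lambda>s. \<phi> (s + 2 * pi * \<i>)) has_field_derivative deriv \<phi> (s + 2 * pi * \<i>)) (at s)"
      using d1(1)[OF that(1) s'] by (simp add: DERIV_shift)
    then have "(\<phi> has_field_derivative deriv \<phi> (s + 2 * pi * \<i>)) (at s)"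
      by (rule has_field_derivative_transform_within_open[OF _ oL that(3)]) (use that(2) in auto)
    then show ?thesis by (metis DERIV_imp_deriv)
  qed
  have perShh: "Sh (Complex t (2*pi)) = Sh (Complex t 0)" if "t < 0" for t
  proof -
    have e: "Complex t (2*pi) = Complex t 0 + 2 * pi * \<i>" by (simp add: complex_eq_iff)
    have i: "Complex t 0 \<in> L" using that by (simp add: L_def)
    have 1: "\<phi> (Complex t (2*pi)) = \<phi> (Complex t 0)" "deriv \<phi> (Complex t (2*pi)) = deriv \<phi> (Complex t 0)" if "\<phi> \<in> {F, q, H}" for \<phi>
    proof -
      have per: "\<phi> (s + 2 * pi * \<i>) = \<phi> s" if "s \<in> L" for s
        using \<open>\<phi> \<in> {F, q, H}\<close> perq[of s] perH[of s] that by (auto simp: F_def L_def)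
      have "\<phi> holomorphic_on L" using that hol hq hH by auto
      then show "\<phi> (Complex t (2*pi)) = \<phi> (Complex t 0)" "deriv \<phi> (Complex t (2*pi)) = deriv \<phi> (Complex t 0)"
        unfolding e using per[OF i] dper[where \<phi> = \<phi>, OF _ per i] by auto
    qed
    show ?thesis unfolding Sh_def v1_def w_def by (simp add: 1)
  qed
  define B where "B = integral {0..2*pi} (\<lambda>x. S (Complex (-1) x))"
  have "integral {0..2*pi} (\<lambda>x. norm (H (Complex t x)) powr p) \<le> B" if t: "-1 \<le> t" "t < 0" for t
  proof -
    have cx: "continuous_on {0..2*pi} (\<lambda>x. G (Complex t x))" if "continuous_on L G" for G :: "complex \<Rightarrow> real"
      by (rule continuous_on_compose2[OF that]) (use t in \<open>auto intro!: continuous_intros simp: L_def Complex_eq\<close>)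
    have "integral {0..2*pi} (\<lambda>x. norm (H (Complex t x)) powr p) \<le> integral {0..2*pi} (\<lambda>x. S (Complex t x))"
    proof (rule integral_le)
      show "(\<lambda>x. norm (H (Complex t x)) powr p) integrable_on {0..2*pi}"
        using p(1) by (intro integrable_continuous_real cx[where G = "\<lambda>s. norm (H s) powr p"] continuous_on_powr' continuous_intros contF) auto
      show "(\<lambda>x. S (Complex t x)) integrable_on {0..2*pi}"
        by (intro integrable_continuous_real cx contS)
      fix x
      have s: "Complex t x \<in> L" using t by (simp add: L_def)
      have "norm (H (Complex t x)) powr p = ((norm (H (Complex t x)))\<^sup>2) powr a"
        by (cases "H (Complex t x) = 0") (simp_all add: a_def powr_powr flip: powr_numeral)
      also have "\<dots> \<le> w (Complex t x) powr a" using a by (intro powr_mono2) (auto simp: w_def)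
      also have "\<dots> \<le> S (Complex t x)" using A by (simp add: S_def)
      finally show "norm (H (Complex t x)) powr p \<le> S (Complex t x)" .
    qed
    also have "\<dots> \<le> B" unfolding B_def
    proof (rule circle_integral_antimono[where S = "\<lambda>t x. S (Complex t x)", OF der])
      show "continuous_on ({..<0} \<times> UNIV) (\<lambda>(t, x). St (Complex t x))" by (rule cpair[OF contS(2)])
      show "continuous_on ({..<0} \<times> UNIV) (\<lambda>(t, x). Stt (Complex t x))" by (rule cpair[OF contS(3)])
    qed (use perShh lapl t A in \<open>auto simp: S_def L_def\<close>)
    finally show ?thesis .
  qed
  then show ?thesis by blast
qed


section \<open>Circle means in the disc and their passage to harmonic functions\<close>

definition bounded_means :: "real \<Rightarrow> (complex \<Rightarrow> complex) \<Rightarrow> bool" where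
  "bounded_means p h \<longleftrightarrow> (\<exists>B. \<forall>r. 0 \<le> r \<and> r < 1 \<longrightarrow>
     integral {0..2*pi} (\<lambda>x. norm (h (complex_of_real r * exp (\<i> * complex_of_real x))) powr p) \<le> B)"

lemma circle_integrable:
  assumes "continuous_on unit_disc h" "0 \<le> r" "r < 1" "0 < p"
  shows "(\<lambda>x. norm (h (complex_of_real r * exp (\<i> * complex_of_real x))) powr p) integrable_on {0..2*pi}"
proof -
  have "continuous_on {0..2*pi} (\<lambda>x. h (complex_of_real r * exp (\<i> * complex_of_real x)))"
    by (rule continuous_on_compose2[OF assms(1)]) (auto intro!: continuous_intros simp: norm_mult assms)
  then show ?thesis
    by (intro integrable_continuous_real continuous_on_powr' continuous_intros) (use assms in auto)
qed

text \<open>The exponential turns the circle of radius \<open>r\<close> into a vertical period at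
  abscissa \<open>ln r\<close>, where the Laplacian has constant coefficients. The half plane
  estimate covers abscissas from \<open>-1\<close> on; radii up to \<open>exp (-1)\<close> belong to
  a compact disc.\<close>

lemma bounded_means_of_derivative_bound:
  fixes Q h :: "complex \<Rightarrow> complex" and C p :: real and n :: nat
  assumes Q: "Q holomorphic_on unit_disc" and h: "h holomorphic_on unit_disc"
    and pos: "\<And>z. z \<in> unit_disc \<Longrightarrow> Re (Q z) > 0"
    and bd: "\<And>z. z \<in> unit_disc \<Longrightarrow> norm (deriv h z) \<le> C * (norm (Q z) ^ (n - 1) * norm (deriv Q z))"
    and p: "0 < p" "n * p < 1" "n \<ge> 1"
  shows "bounded_means p h"
proof -
  define L where "L = {s::complex. Re s < 0}"
  have ein: "exp s \<in> unit_disc" if "s \<in> L" for s using that by (simp add: L_def)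
  have hol: "(\<lambda>s. \<phi> (exp s)) holomorphic_on L" if "\<phi> holomorphic_on unit_disc" for \<phi>
    using holomorphic_on_compose_gen[OF holomorphic_on_exp that image_subsetI[OF ein]] by (auto simp: o_def)
  have der: "deriv (\<lambda>s. \<phi> (exp s)) s = deriv \<phi> (exp s) * exp s" if "\<phi> holomorphic_on unit_disc" "s \<in> L" for \<phi> s
    by (rule DERIV_imp_deriv)
      (use DERIV_chain2[OF holomorphic_derivI[OF that(1) open_ball ein[OF that(2)]] DERIV_exp] in simp)
  have per: "exp (s + 2 * pi * \<i>) = exp s" for s :: complex
    by (simp add: exp_add exp_two_pi_i)
  have "\<exists>B. \<forall>t. -1 \<le> t \<and> t < 0 \<longrightarrow> integral {0..2*pi} (\<lambda>x. norm (h (exp (Complex t x))) powr p) \<le> B"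
  proof (rule lhp_integral_bounded[where q = "\<lambda>s. Q (exp s)" and C = C and n = n])
    show "(\<lambda>s. Q (exp s)) holomorphic_on {s. Re s < 0}" "(\<lambda>s. h (exp s)) holomorphic_on {s. Re s < 0}"
      using hol[OF Q] hol[OF h] by (auto simp: L_def)
    show "Re (Q (exp s)) > 0" if "Re s < 0" for s using pos ein that by (simp add: L_def)
    show "norm (deriv (\<lambda>s. h (exp s)) s) \<le> C * (norm (Q (exp s)) ^ (n - 1) * norm (deriv (\<lambda>s. Q (exp s)) s))"
      if "Re s < 0" for s
    proof -
      have s: "s \<in> L" using that by (simp add: L_def)
      have "norm (deriv h (exp s)) * norm (exp s) \<le> C * (norm (Q (exp s)) ^ (n - 1) * norm (deriv Q (exp s))) * norm (exp s)"
        by (intro mult_right_mono bd ein s) simp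
      then show ?thesis unfolding der[OF Q s] der[OF h s] norm_mult by (simp add: mult_ac)
    qed
  qed (use p per in auto)
  then obtain B where B: "integral {0..2*pi} (\<lambda>x. norm (h (exp (Complex t x))) powr p) \<le> B" if "-1 \<le> t" "t < 0" for t
    by blast
  have ch: "continuous_on unit_disc h" using h by (rule holomorphic_on_imp_continuous_on)
  have e1: "exp (-1::real) < 1" by simp
  have "compact (h ` cball 0 (exp (-1)))"
    by (intro compact_continuous_image continuous_on_subset[OF ch] compact_cball)
      (auto simp: dist_norm dest: le_less_trans[OF _ e1])
  then obtain M where M: "\<And>z. z \<in> cball 0 (exp (-1)) \<Longrightarrow> norm (h z) \<le> M"
    by (meson bounded_iff compact_imp_bounded imageI)
  have "integral {0..2*pi} (\<lambda>x. norm (h (complex_of_real r * exp (\<i> * complex_of_real x))) powr p) \<le> max B (2 * pi * M powr p)"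
    if r: "0 \<le> r" "r < 1" for r
  proof (cases "r \<le> exp (-1)")
    case True
    have "integral {0..2*pi} (\<lambda>x. norm (h (complex_of_real r * exp (\<i> * complex_of_real x))) powr p)
        \<le> integral {0..2*pi} (\<lambda>x. M powr p)"
      using True r p by (intro integral_le circle_integrable ch powr_mono2 M) (auto simp: norm_mult)
    then show ?thesis by simp
  next
    case False
    then have r0: "r > 0" by (smt (verit) exp_gt_zero)
    have "complex_of_real r * exp (\<i> * complex_of_real x) = exp (Complex (ln r) x)" for x
      using r0 by (simp add: Complex_eq exp_add exp_of_real)
    moreover have "-1 \<le> ln r" "ln r < 0" using False r0 r by (auto simp: ln_ge_iff)
    ultimately show ?thesis using B[of "ln r"] by simp
  qed
  then show ?thesis unfolding bounded_means_def by blast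
qed

text \<open>After scaling to \<open>x + y = 1\<close> it suffices that
  \<open>u \<le> u powr p\<close> on the unit interval.\<close>

lemma powr_subadditive:
  fixes x y p :: real
  assumes "0 \<le> x" "0 \<le> y" "0 < p" "p \<le> 1"
  shows "(x + y) powr p \<le> x powr p + y powr p"
proof (cases "x + y = 0")
  case False
  define s where "s = x + y"
  have s: "s > 0" using False assms by (simp add: s_def)
  have *: "u / s \<le> (u / s) powr p" if "0 \<le> u" "u \<le> s" for u
    using powr_mono'[of p 1 "u / s"] that s assms by (cases "u = 0") auto
  have "1 = x / s + y / s" using s by (simp add: s_def add_divide_distrib[symmetric])
  also have "\<dots> \<le> (x / s) powr p + (y / s) powr p"
    using assms by (intro add_mono *) (auto simp: s_def)
  also have "\<dots> = (x powr p + y powr p) / s powr p"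
    using assms s by (simp add: powr_divide add_divide_distrib)
  finally show ?thesis using s by (simp add: s_def field_simps)
qed (use assms in auto)

lemma harmonic_hardyI:
  assumes dec: "harmonic_decomp f h g" and p: "0 < p" "p \<le> 1"
    and h: "bounded_means p h" and g: "bounded_means p g"
  shows "f \<in> harmonic_hardy p"
proof -
  let ?e = "\<lambda>r x. complex_of_real r * exp (\<i> * complex_of_real x)"
  have ch: "continuous_on unit_disc h" and cg: "continuous_on unit_disc g"
    and f: "\<And>z. z \<in> unit_disc \<Longrightarrow> f z = h z + cnj (g z)"
    using dec by (auto simp: harmonic_decomp_def intro: holomorphic_on_imp_continuous_on)
  have "continuous_on unit_disc (\<lambda>z. h z + cnj (g z))" by (intro continuous_intros ch cg)
  then have cf: "continuous_on unit_disc f" by (rule continuous_on_eq) (use f in simp)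
  obtain A B where A: "\<And>r. 0 \<le> r \<and> r < 1 \<Longrightarrow> integral {0..2*pi} (\<lambda>x. norm (h (?e r x)) powr p) \<le> A"
    and B: "\<And>r. 0 \<le> r \<and> r < 1 \<Longrightarrow> integral {0..2*pi} (\<lambda>x. norm (g (?e r x)) powr p) \<le> B"
    using h g unfolding bounded_means_def by blast
  have "Mp p r f \<le> ((1 / (2 * pi)) * (A + B)) powr (1 / p)" if r: "0 \<le> r" "r < 1" for r
  proof -
    note ci = circle_integrable[OF _ r p(1)]
    have "integral {0..2*pi} (\<lambda>x. norm (f (?e r x)) powr p)
        \<le> integral {0..2*pi} (\<lambda>x. norm (h (?e r x)) powr p + norm (g (?e r x)) powr p)"
    proof (rule integral_le)
      fix x
      have "norm (f (?e r x)) powr p \<le> (norm (h (?e r x)) + norm (g (?e r x))) powr p"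
        using r f[of "?e r x"] p by (intro powr_mono2) (auto simp: norm_mult intro: norm_triangle_le)
      also have "\<dots> \<le> norm (h (?e r x)) powr p + norm (g (?e r x)) powr p"
        using p by (intro powr_subadditive) auto
      finally show "norm (f (?e r x)) powr p \<le> norm (h (?e r x)) powr p + norm (g (?e r x)) powr p" .
    qed (intro ci cf integrable_add ch cg)+
    also have "\<dots> = integral {0..2*pi} (\<lambda>x. norm (h (?e r x)) powr p) + integral {0..2*pi} (\<lambda>x. norm (g (?e r x)) powr p)"
      by (intro integral_add ci ch cg)
    also have "\<dots> \<le> A + B" using A B r by (intro add_mono) auto
    finally show ?thesis unfolding Mp_def
      using p by (intro powr_mono2 mult_left_mono mult_nonneg_nonneg integral_nonneg ci cf) auto
  qed
  then show ?thesis using dec by (auto simp: harmonic_hardy_def harmonic_disc_def)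
qed

subsection \<open>The horizontal shear\<close>

text \<open>The domain is a parameter because the same estimates are applied on the disc, on the
  right half plane and on rectangles in logarithmic coordinates. The bound \<open>k\<close> survives
  injective holomorphic changes of variable and complex affine maps of the image.\<close>

locale harmonic_qc =
  fixes f h g :: "complex \<Rightarrow> complex" and k :: real and U :: "complex set"
  assumes open_U: "open U"
    and h_hol: "h holomorphic_on U" and g_hol: "g holomorphic_on U"
    and f_eq: "\<And>z. z \<in> U \<Longrightarrow> f z = h z + cnj (g z)"
    and f_inj: "inj_on f U"
    and dil: "\<And>z. z \<in> U \<Longrightarrow> norm (deriv g z) \<le> k * norm (deriv h z)"
    and dh_nz: "\<And>z. z \<in> U \<Longrightarrow> deriv h z \<noteq> 0"
    and k: "0 \<le> k" "k < 1"
begin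

lemma f_cont: "continuous_on U f"
proof -
  have "continuous_on U (\<lambda>z. h z + cnj (g z))"
    by (intro continuous_intros holomorphic_on_imp_continuous_on h_hol g_hol)
  then show ?thesis by (rule continuous_on_eq) (use f_eq in simp)
qed

lemma f_has_derivative:
  assumes z: "z \<in> U"
  shows "(f has_derivative (\<lambda>v. deriv h z * v + cnj (deriv g z * v))) (at z)"
proof -
  have "(h has_derivative (*) (deriv h z)) (at z)" "(g has_derivative (*) (deriv g z)) (at z)"
    using holomorphic_derivI[OF h_hol open_U z] holomorphic_derivI[OF g_hol open_U z]
    by (simp_all add: has_field_derivative_def)
  then have "((\<lambda>z. h z + cnj (g z)) has_derivative (\<lambda>v. deriv h z * v + cnj (deriv g z * v))) (at z)"
    by (intro has_derivative_add has_derivative_cnj)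
  then show ?thesis
    by (rule has_derivative_transform_within_open[OF _ open_U z]) (use f_eq in simp)
qed

lemma open_image: "open (f ` U)"
  by (rule invariance_of_domain[OF f_cont open_U f_inj])

definition "fi = inv_into U f"

lemma fi: "z \<in> U \<Longrightarrow> fi (f z) = z" "w \<in> f ` U \<Longrightarrow> fi w \<in> U" "w \<in> f ` U \<Longrightarrow> f (fi w) = w"
  using f_inj by (auto simp: fi_def f_inv_into_f inv_into_into)

lemma fi_cont: "continuous_on (f ` U) fi"
proof -
  obtain g where g: "homeomorphism U (f ` U) f g"
    using invariance_of_domain_homeomorphism[OF open_U f_cont _ f_inj] by auto
  have "continuous_on (f ` U) g" using g by (simp add: homeomorphism_def)
  then show ?thesis by (rule continuous_on_eq) (use g fi in \<open>auto simp: homeomorphism_def\<close>)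
qed

text \<open>The derivative of \<open>f\<close> is the real linear map
  \<open>v \<mapsto> a v + cnj (b v)\<close> with determinant \<open>|a|^2 - |b|^2\<close>.
  Eliminating \<open>cnj v\<close> between the equation for \<open>y\<close> and its conjugate gives
  this inverse.\<close>

lemma fi_has_derivative:
  assumes z: "z \<in> U"
  shows "(fi has_derivative (\<lambda>y. (cnj (deriv h z) * y - cnj (deriv g z) * cnj y) /
            of_real ((norm (deriv h z))\<^sup>2 - (norm (deriv g z))\<^sup>2))) (at (f z))"
proof (rule has_derivative_inverse_strong[OF open_U z f_cont fi(1) f_has_derivative[OF z]])
  define a b where "a = deriv h z" and "b = deriv g z"
  have "k * norm a < 1 * norm a"
    using dh_nz[OF z] k by (intro mult_strict_right_mono) (auto simp: a_def)
  then have "norm b < norm a" using dil[OF z] by (simp add: a_def b_def)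
  then have J: "(norm a)\<^sup>2 - (norm b)\<^sup>2 \<noteq> 0" by (simp add: power2_eq_iff_nonneg)
  have J': "complex_of_real ((norm a)\<^sup>2 - (norm b)\<^sup>2) = a * cnj a - b * cnj b"
    by (simp only: of_real_diff complex_norm_square)
  then have J2: "a * cnj a - b * cnj b \<noteq> 0" using J by (metis of_real_eq_0_iff)
  show "(\<lambda>v. deriv h z * v + cnj (deriv g z * v)) \<circ> (\<lambda>y. (cnj (deriv h z) * y - cnj (deriv g z) * cnj y) /
            of_real ((norm (deriv h z))\<^sup>2 - (norm (deriv g z))\<^sup>2)) = id"
    unfolding a_def[symmetric] b_def[symmetric] J'
  proof
    fix y
    have c: "cnj (a * cnj a - b * cnj b) = a * cnj a - b * cnj b" by (simp add: mult.commute)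
    have "a * ((cnj a * y - cnj b * cnj y) / (a * cnj a - b * cnj b)) +
          cnj (b * ((cnj a * y - cnj b * cnj y) / (a * cnj a - b * cnj b))) =
          (a * (cnj a * y - cnj b * cnj y) + cnj b * (a * cnj y - b * y)) / (a * cnj a - b * cnj b)"
      unfolding complex_cnj_mult complex_cnj_divide c by (simp add: add_divide_distrib)
    also have "a * (cnj a * y - cnj b * cnj y) + cnj b * (a * cnj y - b * y) = (a * cnj a - b * cnj b) * y"
      by (simp add: algebra_simps)
    finally show "((\<lambda>v. a * v + cnj (b * v)) \<circ> (\<lambda>y. (cnj a * y - cnj b * cnj y) / (a * cnj a - b * cnj b))) y = id y"
      using J2 by simp
  qed
qed

definition "F z = h z - g z"

lemma F_hol: "F holomorphic_on U" unfolding F_def using h_hol g_hol by (intro holomorphic_intros)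

lemma deriv_F: "z \<in> U \<Longrightarrow> deriv F z = deriv h z - deriv g z"
  unfolding F_def using h_hol g_hol open_U by (intro deriv_diff) (auto intro: holomorphic_on_imp_differentiable_at)

lemma Im_F: "z \<in> U \<Longrightarrow> Im (F z) = Im (f z)" by (simp add: F_def f_eq)

lemma norm_deriv_F:
  assumes "z \<in> U"
  shows "(1 - k) * norm (deriv h z) \<le> norm (deriv F z)" "norm (deriv F z) \<le> (1 + k) * norm (deriv h z)"
  using dil[OF assms] norm_triangle_ineq2[of "deriv h z" "deriv g z"] norm_triangle_ineq4[of "deriv h z" "deriv g z"]
  by (auto simp: deriv_F[OF assms] algebra_simps)

text \<open>With \<open>a\<close> and \<open>b\<close> the derivatives of \<open>h\<close> and
  \<open>g\<close>, a horizontal motion in the image changes \<open>Re F\<close> at the rate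
  \<open>|a - b|^2 / J\<close>, where \<open>J = |a|^2 - |b|^2\<close>. The bounds follow from
  \<open>(1 - k) |a| \<le> |a - b| \<le> (1 + k) |a|\<close> and
  \<open>(1 - k^2) |a|^2 \<le> J \<le> |a|^2\<close>.\<close>

lemma shear_derivative:
  assumes w: "Complex x c \<in> f ` U"
  obtains D where "((\<lambda>x. Re (F (fi (Complex x c)))) has_real_derivative D) (at x)"
    "(1 - k)\<^sup>2 \<le> D" "D \<le> (1 + k) / (1 - k)"
proof -
  define z where "z = fi (Complex x c)"
  have z: "z \<in> U" "f z = Complex x c" using fi w by (auto simp: z_def)
  define a b where "a = deriv h z" and "b = deriv g z"
  define J where "J = (norm a)\<^sup>2 - (norm b)\<^sup>2"
  have ba: "norm b \<le> k * norm a" "norm a > 0" using dil[OF z(1)] dh_nz[OF z(1)] by (auto simp: a_def b_def)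
  have Jk: "J \<ge> (1 - k\<^sup>2) * (norm a)\<^sup>2"
    using power_mono[OF ba(1), of 2] by (simp add: J_def power_mult_distrib algebra_simps)
  have "k\<^sup>2 < 1" using k by (simp add: power_less_one_iff abs_square_less_1)
  then have Jpos: "J > 0" using Jk ba(2) by (smt (verit) mult_pos_pos zero_less_power)
  have F': "(F has_derivative (*) (a - b)) (at z)"
    using holomorphic_derivI[OF F_hol open_U z(1)] deriv_F[OF z(1)] by (simp add: has_field_derivative_def a_def b_def)
  have c1: "((\<lambda>x. Complex x c) has_derivative of_real) (at x)"
    unfolding Complex_eq by (auto intro!: derivative_eq_intros)
  have c2: "(fi has_derivative (\<lambda>y. (cnj a * y - cnj b * cnj y) / of_real J)) (at (Complex x c))"
    using fi_has_derivative[OF z(1)] unfolding z(2) a_def b_def J_def by simp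
  have "((\<lambda>x. F (fi (Complex x c))) has_derivative (\<lambda>y. (a - b) * ((cnj a * of_real y - cnj b * cnj (of_real y)) / of_real J))) (at x)"
    using has_derivative_compose[OF has_derivative_compose[OF c1 c2] F'[unfolded z_def]] by simp
  then have dR: "((\<lambda>x. Re (F (fi (Complex x c)))) has_derivative (\<lambda>y. Re ((a - b) * ((cnj a * of_real y - cnj b * cnj (of_real y)) / of_real J)))) (at x)"
    by (rule has_derivative_Re)
  have "Re ((a - b) * ((cnj a * of_real y - cnj b * cnj (of_real y)) / of_real J)) = (norm (a - b))\<^sup>2 / J * y" for y
  proof -
    have "(a - b) * ((cnj a * of_real y - cnj b * cnj (of_real y)) / of_real J) = of_real y * ((a - b) * cnj (a - b)) / of_real J"
      by (simp add: algebra_simps)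
    also have "\<dots> = of_real (y * (norm (a - b))\<^sup>2 / J)"
      by (simp only: complex_norm_square[symmetric] of_real_mult of_real_divide)
    finally show ?thesis by (simp only: Re_complex_of_real) (simp add: mult.commute)
  qed
  then have "(\<lambda>y. Re ((a - b) * ((cnj a * of_real y - cnj b * cnj (of_real y)) / of_real J))) = (*) ((norm (a - b))\<^sup>2 / J)"
    by (rule ext)
  with dR have "((\<lambda>x. Re (F (fi (Complex x c)))) has_real_derivative (norm (a - b))\<^sup>2 / J) (at x)"
    unfolding has_field_derivative_def by (simp only:)
  moreover have "(1 - k)\<^sup>2 \<le> (norm (a - b))\<^sup>2 / J"
  proof -
    have "(1 - k)\<^sup>2 * J \<le> (1 - k)\<^sup>2 * (norm a)\<^sup>2" by (intro mult_left_mono) (auto simp: J_def)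
    also have "\<dots> \<le> (norm (a - b))\<^sup>2"
      using norm_deriv_F(1)[OF z(1)] k unfolding deriv_F[OF z(1)] a_def b_def power_mult_distrib[symmetric]
      by (intro power_mono) auto
    finally show ?thesis using Jpos by (simp add: field_simps)
  qed
  moreover have "(norm (a - b))\<^sup>2 / J \<le> (1 + k) / (1 - k)"
  proof -
    have "(norm (a - b))\<^sup>2 * (1 - k) \<le> ((1 + k) * norm a)\<^sup>2 * (1 - k)"
      using norm_deriv_F(2)[OF z(1)] k unfolding deriv_F[OF z(1)] a_def b_def
      by (intro mult_right_mono power_mono) auto
    also have "\<dots> = (1 + k) * ((1 - k\<^sup>2) * (norm a)\<^sup>2)" by (simp add: power2_eq_square algebra_simps)
    also have "\<dots> \<le> (1 + k) * J" using Jk k by (intro mult_left_mono) auto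
    finally show ?thesis using Jpos k by (simp add: field_simps)
  qed
  ultimately show ?thesis using that by blast
qed

lemma shear_mono:
  assumes "x \<le> y" "\<And>t. x \<le> t \<Longrightarrow> t \<le> y \<Longrightarrow> Complex t c \<in> f ` U"
  shows "(1 - k)\<^sup>2 * (y - x) \<le> Re (F (fi (Complex y c))) - Re (F (fi (Complex x c)))"
    "Re (F (fi (Complex y c))) - Re (F (fi (Complex x c))) \<le> (1 + k) / (1 - k) * (y - x)"
proof -
  let ?G = "\<lambda>x. Re (F (fi (Complex x c)))"
  have "(1 - k)\<^sup>2 * (y - x) \<le> ?G y - ?G x \<and> ?G y - ?G x \<le> (1 + k) / (1 - k) * (y - x)"
  proof (cases "x = y")
    case False
    then have xy: "x < y" using assms by simp
    have "\<forall>t\<in>{x..y}. \<exists>D. (?G has_real_derivative D) (at t) \<and> (1 - k)\<^sup>2 \<le> D \<and> D \<le> (1 + k) / (1 - k)"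
      using shear_derivative assms(2) by (metis atLeastAtMost_iff)
    then obtain D where D: "\<And>t. t \<in> {x..y} \<Longrightarrow> (?G has_real_derivative D t) (at t) \<and> (1 - k)\<^sup>2 \<le> D t \<and> D t \<le> (1 + k) / (1 - k)"
      by metis
    obtain t where "x < t" "t < y" "?G y - ?G x = (y - x) * D t"
      using MVT2[OF xy, of ?G D] D by auto
    moreover from this have "(1 - k)\<^sup>2 * (y - x) \<le> D t * (y - x)" "D t * (y - x) \<le> (1 + k) / (1 - k) * (y - x)"
      using D[of t] xy by (intro mult_right_mono; simp)+
    ultimately show ?thesis by (simp only: mult.commute[of _ "D t"])
  qed auto
  then show "(1 - k)\<^sup>2 * (y - x) \<le> ?G y - ?G x" "?G y - ?G x \<le> (1 + k) / (1 - k) * (y - x)" by auto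
qed


text \<open>\<open>F\<close> and \<open>f\<close> have the same imaginary part, so \<open>F\<close>
  after the inverse of \<open>f\<close> maps every horizontal line into itself, increasingly and
  with slope bounded below. When all these lines are full, the result is a bijection of the
  plane.\<close>

lemma inj_on_F_UNIV:
  assumes "f ` U = UNIV"
  shows "inj_on F U" "F ` U = UNIV"
proof -
  have k1: "(1 - k)\<^sup>2 > 0" using k by simp
  show "inj_on F U"
  proof (rule inj_onI)
    fix z1 z2 assume z: "z1 \<in> U" "z2 \<in> U" "F z1 = F z2"
    define c where "c = Im (f z1)"
    have f1: "f z1 = Complex (Re (f z1)) c" by (simp add: c_def)
    have f2: "f z2 = Complex (Re (f z2)) c"
      using z Im_F[of z1] Im_F[of z2] by (simp add: c_def complex_eq_iff)
    have *: "Re (f z1) = Re (f z2)" if "f z1 = Complex (Re (f z1)) c" "f z2 = Complex (Re (f z2)) c" "F z1 = F z2" "z1 \<in> U" "z2 \<in> U" "Re (f z1) \<le> Re (f z2)" for z1 z2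
    proof -
      have "(1 - k)\<^sup>2 * (Re (f z2) - Re (f z1)) \<le> Re (F (fi (f z2))) - Re (F (fi (f z1)))"
        using shear_mono(1)[of "Re (f z1)" "Re (f z2)" c] that assms by auto
      also have "\<dots> = 0" using fi(1) that by simp
      finally show ?thesis using that(6) k1 by (simp add: mult_le_0_iff)
    qed
    have "Re (f z1) = Re (f z2)" using *[of z1 z2] *[of z2 z1] f1 f2 z by (metis linear)
    then have "f z1 = f z2" using f1 f2 by metis
    then show "z1 = z2" using f_inj z by (auto dest: inj_onD)
  qed
  show "F ` U = UNIV"
  proof (rule set_eqI, simp)
    fix w
    define c where "c = Im w"
    let ?G = "\<lambda>x. Re (F (fi (Complex x c)))"
    have G: "(1 - k)\<^sup>2 * (y - x) \<le> ?G y - ?G x" if "x \<le> y" for x y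
      using shear_mono(1)[OF that, of c] assms by auto
    define R where "R = \<bar>Re w - ?G 0\<bar> / (1 - k)\<^sup>2"
    have R: "R \<ge> 0" "(1 - k)\<^sup>2 * R = \<bar>Re w - ?G 0\<bar>" using k by (auto simp: R_def)
    have "?G (-R) \<le> Re w" "Re w \<le> ?G R" using G[of 0 R] G[of "-R" 0] R by auto
    moreover have "continuous_on {-R..R} ?G"
      using shear_derivative[of _ c] assms by (intro continuous_at_imp_continuous_on ballI) (metis DERIV_isCont UNIV_I)
    ultimately obtain x where "?G x = Re w" using IVT'[of ?G "-R" "Re w" R] R by auto
    moreover have "Im (F (fi (Complex x c))) = c" "fi (Complex x c) \<in> U"
      using Im_F fi assms by auto
    ultimately show "w \<in> F ` U" by (intro image_eqI[of _ _ "fi (Complex x c)"]) (auto simp: c_def complex_eq_iff)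
  qed
qed

text \<open>Otherwise the inverse of the conformal map \<open>F\<close> would be a bounded entire
  function, against Liouville. The omitted point obtained here is the starting point for every
  geometric class.\<close>

lemma image_neq_UNIV:
  assumes "bounded U"
  shows "f ` U \<noteq> UNIV"
proof
  assume "f ` U = UNIV"
  then have F: "inj_on F U" "F ` U = UNIV" by (rule inj_on_F_UNIV)+
  obtain G where G: "G holomorphic_on F ` U" "\<And>z. z \<in> U \<Longrightarrow> G (F z) = z"
    using holomorphic_has_inverse[OF F_hol open_U F(1)] by metis
  have "range G \<subseteq> U" using F(2) G(2) by (metis (no_types, lifting) UNIV_I imageE image_subsetI)
  then have "bounded (range G)" using assms bounded_subset by blast
  then obtain c where "\<And>z. G z = c"
    using Liouville_theorem[of G] G(1) F(2) by (auto simp: constant_on_def)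
  then have "\<And>z. z \<in> U \<Longrightarrow> z = c" using G(2) by metis
  then have "F ` U \<subseteq> {F c}" by auto
  then show False using F(2) by (metis UNIV_I singletonD subset_singletonD singleton_iff subsetD zero_neq_one)
qed

lemma bounded_means_convex:
  assumes U: "U = unit_disc" and conv: "convex (f ` U)" and p: "0 < p" "p < 1"
  shows "bounded_means p h \<and> bounded_means p g"
proof -
  obtain c where c: "c \<notin> f ` U" using image_neq_UNIV U by auto
  have 1: "convex ((\<lambda>x. x - c) ` f ` U)" using conv by (rule convex_translation_subtract)
  have 2: "0 \<notin> (\<lambda>x. x - c) ` f ` U"
  proof
    assume "0 \<in> (\<lambda>x. x - c) ` f ` U"
    then obtain w where "w \<in> f ` U" "0 = w - c" by blast
    then show False using c by simp
  qed
  obtain a where a0: "a \<noteq> 0" "\<forall>w\<in>(\<lambda>x. x - c) ` f ` U. 0 \<le> inner a w"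
    using separating_hyperplane_set_0[OF 1 2] by blast
  have a: "a \<noteq> 0" "\<And>z. z \<in> U \<Longrightarrow> 0 \<le> inner a (f z - c)" using a0 by blast+
  define Q where "Q z = cnj a * (h z - c) + a * g z + 1" for z
  have Q: "Q holomorphic_on U" unfolding Q_def by (intro holomorphic_intros h_hol g_hol)
  have pos: "Re (Q z) > 0" if z: "z \<in> U" for z
  proof -
    have "Re (Q z) = inner a (f z - c) + 1"
      by (simp add: Q_def f_eq[OF z] inner_complex_def algebra_simps)
    then show ?thesis using a(2)[OF z] by simp
  qed
  have dQ: "deriv Q z = cnj a * deriv h z + a * deriv g z" if z: "z \<in> U" for z
    unfolding Q_def
    by (rule DERIV_imp_deriv) (auto intro!: derivative_eq_intros holomorphic_derivI[OF h_hol open_U z] holomorphic_derivI[OF g_hol open_U z])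
  have bd: "norm (deriv h z) \<le> 1 / (norm a * (1 - k)) * (norm (Q z) ^ (1 - 1) * norm (deriv Q z))" if z: "z \<in> U" for z
  proof -
    have "norm a * norm (deriv g z) \<le> norm a * (k * norm (deriv h z))" using dil[OF z] by (intro mult_left_mono) auto
    moreover have "norm (deriv Q z) \<ge> norm (cnj a * deriv h z) - norm (a * deriv g z)"
      unfolding dQ[OF z] by (rule norm_diff_ineq)
    ultimately have "norm a * (1 - k) * norm (deriv h z) \<le> norm (deriv Q z)"
      by (simp add: norm_mult algebra_simps)
    then show ?thesis using a(1) k by (simp add: field_simps)
  qed
  have bg: "norm (deriv g z) \<le> 1 / (norm a * (1 - k)) * (norm (Q z) ^ (1 - 1) * norm (deriv Q z))" if z: "z \<in> U" for z
  proof -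
    have "k * norm (deriv h z) \<le> 1 * norm (deriv h z)" using k by (intro mult_right_mono) auto
    then show ?thesis using bd[OF z] dil[OF z] by linarith
  qed
  show ?thesis
    using bounded_means_of_derivative_bound[of Q h "1 / (norm a * (1 - k))" 1 p]
       bounded_means_of_derivative_bound[of Q g "1 / (norm a * (1 - k))" 1 p] Q h_hol g_hol pos bd bg p U
    by auto
qed

text \<open>On a horizontal line \<open>Re (F \<circ> f\<^sup>-\<^sup>1)\<close> is increasing with derivative bounded above and below,
  so it stays bounded at an end of a slice where \<open>f\<close> omits a point.\<close>
lemma shear_omits_ray:
  assumes conn: "connected {x. Complex x c \<in> f ` U}" and x0: "Complex x0 c \<notin> f ` U"
  obtains M \<sigma> :: real where "\<sigma> \<in> {1, -1}" "\<And>z. z \<in> U \<Longrightarrow> Im (F z) = c \<Longrightarrow> \<sigma> * Re (F z) < M"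
proof -
  define I where "I = {x. Complex x c \<in> f ` U}"
  let ?G = "\<lambda>x. Re (F (fi (Complex x c)))"
  let ?C = "(1 + k) / (1 - k)"
  have C: "?C \<ge> 0" using k by simp
  have int: "t \<in> I" if "x \<in> I" "y \<in> I" "x \<le> t" "t \<le> y" for x y t
    using conn that unfolding I_def by (meson connected_contains_Icc atLeastAtMost_iff subsetD)
  have red: "\<exists>x\<in>I. Re (F z) = ?G x" if "z \<in> U" "Im (F z) = c" for z
  proof -
    have "f z = Complex (Re (f z)) c" using that Im_F by (simp add: complex_eq_iff)
    then show ?thesis using that fi(1)[of z] by (intro bexI[of _ "Re (f z)"]) (auto simp: I_def)
  qed
  have sm: "?G y - ?G x \<le> ?C * (y - x)" "?G x \<le> ?G y" if "x \<in> I" "y \<in> I" "x \<le> y" for x y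
  proof -
    have i: "\<And>t. x \<le> t \<Longrightarrow> t \<le> y \<Longrightarrow> Complex t c \<in> f ` U" using int[OF that(1,2)] by (auto simp: I_def)
    show "?G y - ?G x \<le> ?C * (y - x)" using shear_mono(2)[OF that(3) i] .
    have "0 \<le> (1 - k)\<^sup>2 * (y - x)" using that by simp
    then show "?G x \<le> ?G y" using shear_mono(1)[OF that(3) i] by linarith
  qed
  show thesis
  proof (cases "I = {}")
    case True
    then show ?thesis using that[of 1 0] red by blast
  next
    case False
    then obtain x1 where x1: "x1 \<in> I" by blast
    have x0I: "x0 \<notin> I" using x0 by (simp add: I_def)
    consider "x1 < x0" | "x0 < x1" using x1 x0I by (metis linorder_cases)
    then show ?thesis
    proof cases
      case 1
      have lt: "x < x0" if "x \<in> I" for x using int[OF x1 that, of x0] 1 x0I by force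
      have "?G x \<le> ?G x1 + ?C * (x0 - x1)" if x: "x \<in> I" for x
      proof (cases "x1 \<le> x")
        case True
        have "?C * (x - x1) \<le> ?C * (x0 - x1)" using lt[OF x] C by (intro mult_left_mono) auto
        then show ?thesis using sm(1)[OF x1 x True] by linarith
      next
        case False
        have "0 \<le> ?C * (x0 - x1)" using C 1 by (intro mult_nonneg_nonneg) auto
        then show ?thesis using sm(2)[OF x x1] False by linarith
      qed
      then show ?thesis using that[of 1 "?G x1 + ?C * (x0 - x1) + 1"] red by (smt (verit) insertI1)
    next
      case 2
      have lt: "x0 < x" if "x \<in> I" for x using int[OF that x1, of x0] 2 x0I by force
      have "- ?G x \<le> - ?G x1 + ?C * (x1 - x0)" if x: "x \<in> I" for x
      proof (cases "x \<le> x1")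
        case True
        have "?C * (x1 - x) \<le> ?C * (x1 - x0)" using lt[OF x] C by (intro mult_left_mono) auto
        then show ?thesis using sm(1)[OF x x1 True] by linarith
      next
        case False
        have "0 \<le> ?C * (x1 - x0)" using C 2 by (intro mult_nonneg_nonneg) auto
        then show ?thesis using sm(2)[OF x1 x] False by linarith
      qed
      then show ?thesis using that[of "-1" "- ?G x1 + ?C * (x1 - x0) + 1"] red by (smt (verit) insertI1 insertI2)
    qed
  qed
qed

lemma bounded_means_horizontal:
  assumes U: "U = unit_disc"
    and conn: "connected {x. Complex x c \<in> f ` U}" and x0: "Complex x0 c \<notin> f ` U"
    and p: "0 < p" "p < 1/2"
  shows "bounded_means p h \<and> bounded_means p g"
proof -
  obtain M \<sigma> :: real where s: "\<sigma> \<in> {1, -1}" and M: "\<And>z. z \<in> U \<Longrightarrow> Im (F z) = c \<Longrightarrow> \<sigma> * Re (F z) < M"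
    using shear_omits_ray[OF conn x0] by metis
  \<comment> \<open>The omitted ray at height \<open>c\<close> is carried to the nonpositive real
    axis, the cut of the principal square root. Up to sign, the derivative of \<open>F\<close> is
    then \<open>2 * Q\<close> times that of \<open>Q\<close>, which is the case
    \<open>n = 2\<close>.\<close>
  define G where "G z = of_real M - of_real \<sigma> * (F z - \<i> * of_real c)" for z
  define Q where "Q z = csqrt (G z)" for z
  have nG: "G z \<notin> \<real>\<^sub>\<le>\<^sub>0" if z: "z \<in> U" for z
  proof
    assume "G z \<in> \<real>\<^sub>\<le>\<^sub>0"
    then have "Im (G z) = 0" "Re (G z) \<le> 0" by (auto simp: complex_nonpos_Reals_iff)
    then have "Im (F z) = c" "M \<le> \<sigma> * Re (F z)" using s by (auto simp: G_def)
    then show False using M[OF z] by simp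
  qed
  have G: "G holomorphic_on U" unfolding G_def by (intro holomorphic_intros F_hol)
  have Q: "Q holomorphic_on U" unfolding Q_def by (intro holomorphic_intros G nG)
  have pos: "Re (Q z) > 0" if z: "z \<in> U" for z
  proof (rule ccontr)
    assume "\<not> Re (Q z) > 0"
    then have "Re (Q z) = 0" using Re_csqrt[of "G z"] by (simp add: Q_def)
    moreover have "G z = Q z ^ 2" by (simp add: Q_def)
    ultimately have "Im (G z) = 0" "Re (G z) \<le> 0" by (simp_all add: Re_power2 Im_power2)
    then show False using nG[OF z] by (simp add: complex_nonpos_Reals_iff)
  qed
  have dQ: "norm (deriv F z) = 2 * (norm (Q z) * norm (deriv Q z))" if z: "z \<in> U" for z
  proof -
    have "((\<lambda>z. Q z ^ 2) has_field_derivative 2 * Q z * deriv Q z) (at z)"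
      using DERIV_power[OF holomorphic_derivI[OF Q open_U z], of 2] by (simp add: mult_ac)
    moreover have "(\<lambda>z. Q z ^ 2) = G" by (simp add: Q_def fun_eq_iff)
    moreover have "(G has_field_derivative - of_real \<sigma> * deriv F z) (at z)"
      unfolding G_def by (auto intro!: derivative_eq_intros holomorphic_derivI[OF F_hol open_U z])
    ultimately have "2 * Q z * deriv Q z = - of_real \<sigma> * deriv F z" using DERIV_unique by metis
    then have "norm (2 * Q z * deriv Q z) = norm (- of_real \<sigma> * deriv F z)" by simp
    then show ?thesis using s by (auto simp: norm_mult)
  qed
  have bd: "norm (deriv h z) \<le> 2 / (1 - k) * (norm (Q z) ^ (2 - 1) * norm (deriv Q z))" if z: "z \<in> U" for z
    using norm_deriv_F(1)[OF z] k unfolding dQ[OF z] by (simp add: field_simps)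
  have bg: "norm (deriv g z) \<le> 2 / (1 - k) * (norm (Q z) ^ (2 - 1) * norm (deriv Q z))" if z: "z \<in> U" for z
  proof -
    have "k * norm (deriv h z) \<le> 1 * norm (deriv h z)" using k by (intro mult_right_mono) auto
    then show ?thesis using bd[OF z] dil[OF z] by linarith
  qed
  show ?thesis
    using bounded_means_of_derivative_bound[of Q h "2 / (1 - k)" 2 p]
       bounded_means_of_derivative_bound[of Q g "2 / (1 - k)" 2 p] Q h_hol g_hol pos bd bg p U
    by auto
qed

end

subsection \<open>Length and area\<close>

text \<open>Change of variables with determinants is carried out in \<open>real^2\<close>, iterated
  integration in \<open>real \<times> real\<close>, and holomorphic functions live on
  \<open>complex\<close>. These maps connect the three models of the plane.\<close>

definition pr :: "real^2 \<Rightarrow> real \<times> real" where "pr v = (v $ 1, v $ 2)"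

definition cx :: "real^2 \<Rightarrow> complex" where "cx v = Complex (v $ 1) (v $ 2)"

definition vc :: "complex \<Rightarrow> real^2" where "vc z = vector [Re z, Im z]"

lemma cx_vc [simp]: "cx (vc z) = z" and vc_cx [simp]: "vc (cx v) = v"
  by (simp_all add: cx_def vc_def vec_eq_iff forall_2)

lemma bounded_linear_cx: "bounded_linear cx"
  unfolding linear_conv_bounded_linear[symmetric]
  by (intro linearI) (simp_all add: cx_def complex_eq_iff)

lemma bounded_linear_vc: "bounded_linear vc"
  unfolding linear_conv_bounded_linear[symmetric]
  by (intro linearI) (simp_all add: vc_def vec_eq_iff forall_2)

lemma lborel_pr: "distr lborel borel pr = (lborel :: (real \<times> real) measure)"
proof (rule lborel_eqI[symmetric])
  have m: "pr \<in> borel_measurable borel"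
    unfolding pr_def by (intro borel_measurable_continuous_onI continuous_intros)
  show "sets (distr lborel borel pr) = sets borel" by simp
  fix l u :: "real \<times> real" assume le: "\<And>b. b \<in> Basis \<Longrightarrow> l \<bullet> b \<le> u \<bullet> b"
  have lu: "fst l \<le> fst u" "snd l \<le> snd u" using le[of "(1,0)"] le[of "(0,1)"]
    by (cases l; cases u; simp add: Basis_prod_def)+
  have B2: "Basis = {axis 1 1, axis 2 1 :: real^2}" by (auto simp: Basis_vec_def UNIV_2)
  have "pr -` box l u = box (vector [fst l, snd l]) (vector [fst u, snd u])"
    by (auto simp: pr_def mem_box_cart forall_2 mem_box Basis_prod_def inner_prod_def)
  then have "emeasure (distr lborel borel pr) (box l u) = emeasure lborel (box (vector [fst l, snd l]) (vector [fst u, snd u]) :: (real^2) set)"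
    using m by (simp add: emeasure_distr)
  also have "\<dots> = ennreal (\<Prod>b\<in>Basis. (vector [fst u, snd u] - vector [fst l, snd l] :: real^2) \<bullet> b)"
    using lu by (intro emeasure_lborel_box) (auto simp: B2 inner_axis)
  also have "\<dots> = (\<Prod>b\<in>Basis. (u - l) \<bullet> b)"
  proof -
    have "(\<Prod>b\<in>Basis. (vector [fst u, snd u] - vector [fst l, snd l] :: real^2) \<bullet> b) = (fst u - fst l) * (snd u - snd l)"
    proof -
      show ?thesis by (simp add: B2 axis_eq_axis inner_axis)
    qed
    moreover have "(\<Prod>b\<in>Basis. (u - l) \<bullet> b) = (fst u - fst l) * (snd u - snd l)"
    proof -
      have B: "Basis = {(1, 0), (0, 1) :: real \<times> real}" by (auto simp: Basis_prod_def)
      show ?thesis unfolding B by (simp add: inner_prod_def)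
    qed
    ultimately show ?thesis by simp
  qed
  finally show "emeasure (distr lborel borel pr) (box l u) = ennreal (\<Prod>b\<in>Basis. (u - l) \<bullet> b)" .
qed

context harmonic_qc
begin

text \<open>\<open>f\<close> is injective, so the integral of its Jacobian over \<open>S\<close> is
  the area of the image, which lies in a square of side \<open>2 * \<rho>\<close>. The Jacobian is
  at least \<open>1 - k^2\<close> times the square of \<open>|h'|\<close>.\<close>

lemma area_bound:
  assumes S: "open S" "S \<subseteq> U" "f ` S \<subseteq> ball c \<rho>" and \<rho>: "\<rho> > 0"
  shows "(\<integral>\<^sup>+v. ennreal ((norm (deriv h (Complex (fst v) (snd v))))\<^sup>2) * indicator {v. Complex (fst v) (snd v) \<in> S} v \<partial>lborel)
     \<le> ennreal (4 * \<rho>\<^sup>2 / (1 - k\<^sup>2))"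
proof -
  define S' where "S' = cx -` S"
  define ff where "ff v = vc (f (cx v))" for v
  define D where "D v y = vc (deriv h (cx v) * cx y + cnj (deriv g (cx v) * cx y))" for v y
  define J where "J z = (norm (deriv h z))\<^sup>2 - (norm (deriv g z))\<^sup>2" for z
  have k2: "k\<^sup>2 < 1" using k by (simp add: abs_square_less_1)
  have contcx: "continuous_on A cx" for A
    using bounded_linear_cx linear_continuous_on by blast
  have oS': "open S'" unfolding S'_def using S(1) contcx by (intro open_vimage) auto
  have mS': "S' \<in> sets lebesgue" using oS' by auto
  have der: "(ff has_derivative D v) (at v within S')" if "v \<in> S'" for v
  proof -
    have z: "cx v \<in> U" using that S(2) by (auto simp: S'_def)
    have "(cx has_derivative cx) (at v)" by (rule bounded_linear_imp_has_derivative[OF bounded_linear_cx])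
    from has_derivative_compose[OF this f_has_derivative[OF z]]
    have "((\<lambda>v. f (cx v)) has_derivative (\<lambda>y. deriv h (cx v) * cx y + cnj (deriv g (cx v) * cx y))) (at v)" .
    from bounded_linear.has_derivative[OF bounded_linear_vc this]
    show ?thesis unfolding ff_def D_def by (rule has_derivative_at_withinI)
  qed
  have inj: "inj_on ff S'"
  proof (rule inj_onI)
    fix v w assume "v \<in> S'" "w \<in> S'" "ff v = ff w"
    then have "f (cx v) = f (cx w)" "cx v \<in> U" "cx w \<in> U" using S(2) by (auto simp: S'_def ff_def) (metis cx_vc)
    then show "v = w" using f_inj by (metis inj_onD vc_cx)
  qed
  have det: "\<bar>det (matrix (D v))\<bar> = J (cx v)" if "v \<in> S'" for v
  proof -
    have z: "cx v \<in> U" using that S(2) by (auto simp: S'_def)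
    have "norm (deriv g (cx v)) \<le> norm (deriv h (cx v))"
      using dil[OF z] k mult_right_mono[of k 1 "norm (deriv h (cx v))"] by simp
    then have "J (cx v) \<ge> 0" by (simp add: J_def power_mono)
    moreover have "det (matrix (D v)) = J (cx v)"
      unfolding det_2 matrix_def D_def vc_def J_def cmod_power2
      by (simp add: cx_def axis_def power2_eq_square algebra_simps)
    ultimately show ?thesis by simp
  qed
  have "cx ` S' = S" unfolding S'_def using cx_vc by (metis surj_def surj_image_vimage_eq)
  then have im: "ff ` S' = vc ` (f ` S)" unfolding ff_def by (metis image_image)
  have vb: "vc ` ball c \<rho> \<subseteq> cbox (vc c - vec \<rho>) (vc c + vec \<rho>)"
  proof
    fix v assume "v \<in> vc ` ball c \<rho>"
    then obtain z where z: "v = vc z" "norm (z - c) < \<rho>" by (auto simp: dist_norm norm_minus_commute)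
    have "\<bar>Re z - Re c\<bar> \<le> \<rho>" "\<bar>Im z - Im c\<bar> \<le> \<rho>"
      using abs_Re_le_cmod[of "z - c"] abs_Im_le_cmod[of "z - c"] z(2) by auto
    then show "v \<in> cbox (vc c - vec \<rho>) (vc c + vec \<rho>)"
      by (auto simp: z(1) mem_box_cart forall_2 vc_def)
  qed
  have sub: "ff ` S' \<subseteq> cbox (vc c - vec \<rho>) (vc c + vec \<rho>)" using im vb S(3) by blast
  have "open (ff ` S')"
    by (rule invariance_of_domain[OF _ oS' inj]) (use der in \<open>meson has_derivative_continuous continuous_on_eq_continuous_within\<close>)
  then have lm: "ff ` S' \<in> lmeasurable"
    using sub bounded_cbox bounded_subset lmeasurable_open by blast
  have meas: "measure lebesgue (ff ` S') \<le> 4 * \<rho>\<^sup>2"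
  proof -
    have "measure lebesgue (ff ` S') \<le> measure lebesgue (cbox (vc c - vec \<rho>) (vc c + vec \<rho>))"
      by (intro measure_mono_fmeasurable sub) (use lm in auto)
    also have "\<dots> = 4 * \<rho>\<^sup>2"
    proof -
      have "cbox (vc c - vec \<rho>) (vc c + vec \<rho>) \<noteq> {}" using \<rho> by (auto simp: interval_ne_empty_cart)
      then show ?thesis by (simp add: content_cbox_cart UNIV_2 power2_eq_square)
    qed
    finally show ?thesis .
  qed
  have "((\<lambda>v. \<bar>det (matrix (D v))\<bar>) has_integral measure lebesgue (ff ` S')) S'"
    using has_measure_differentiable_image[OF mS' der inj] lm by blast
  then have "((\<lambda>v. J (cx v)) has_integral measure lebesgue (ff ` S')) S'"
    using det by (simp cong: has_integral_cong)
  then have NI: "(\<integral>\<^sup>+v. ennreal (J (cx v)) * indicator S' v \<partial>lborel) = ennreal (measure lebesgue (ff ` S'))"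
    by (rule nn_integral_has_integral_lebesgue'[rotated]) (use det in \<open>metis abs_ge_zero\<close>)
  have Jh: "(1 - k\<^sup>2) * (norm (deriv h z))\<^sup>2 \<le> J z" if "z \<in> U" for z
    using power_mono[OF dil[OF that], of 2] by (simp add: J_def power_mult_distrib algebra_simps)
  let ?G = "\<lambda>v. ennreal ((norm (deriv h (Complex (fst v) (snd v))))\<^sup>2) * indicator {v. Complex (fst v) (snd v) \<in> S} v"
  have "continuous_on S (deriv h)"
    using h_hol open_U S(2) by (meson continuous_on_subset holomorphic_deriv holomorphic_on_imp_continuous_on)
  have mG: "?G \<in> borel_measurable borel"
  proof -
    have op: "open {v. Complex (fst v) (snd v) \<in> S}"
    proof -
      have "continuous_on UNIV (\<lambda>v::real\<times>real. Complex (fst v) (snd v))" unfolding Complex_eq by (intro continuous_intros)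
      from open_vimage[OF S(1) this] show ?thesis by (simp add: vimage_def)
    qed
    have cc: "continuous_on {v. Complex (fst v) (snd v) \<in> S} (\<lambda>v. (norm (deriv h (Complex (fst v) (snd v))))\<^sup>2)"
      by (intro continuous_intros continuous_on_compose2[OF \<open>continuous_on S (deriv h)\<close>]) (auto simp: Complex_eq intro!: continuous_intros)
    have "(\<lambda>v. indicator {v. Complex (fst v) (snd v) \<in> S} v *\<^sub>R (norm (deriv h (Complex (fst v) (snd v))))\<^sup>2) \<in> borel_measurable borel"
      by (rule borel_measurable_continuous_on_indicator[OF _ cc]) (use op in auto)
    then have "(\<lambda>v. ennreal (indicator {v. Complex (fst v) (snd v) \<in> S} v *\<^sub>R (norm (deriv h (Complex (fst v) (snd v))))\<^sup>2)) \<in> borel_measurable borel"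
      by measurable
    also have "(\<lambda>v. ennreal (indicator {v. Complex (fst v) (snd v) \<in> S} v *\<^sub>R (norm (deriv h (Complex (fst v) (snd v))))\<^sup>2)) = ?G"
      by (auto simp: fun_eq_iff indicator_def)
    finally show ?thesis .
  qed
  have mpr: "pr \<in> borel_measurable borel"
    unfolding pr_def by (intro borel_measurable_continuous_onI continuous_intros)
  have "(\<integral>\<^sup>+v. ?G v \<partial>lborel) = (\<integral>\<^sup>+v. ?G (pr v) \<partial>lborel)"
    unfolding lborel_pr[symmetric] using mG mpr by (subst nn_integral_distr) auto
  also have "\<dots> \<le> (\<integral>\<^sup>+v. ennreal (1 / (1 - k\<^sup>2)) * (ennreal (J (cx v)) * indicator S' v) \<partial>lborel)"
  proof (intro nn_integral_mono)
    fix v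
    show "?G (pr v) \<le> ennreal (1 / (1 - k\<^sup>2)) * (ennreal (J (cx v)) * indicator S' v)"
    proof (cases "cx v \<in> S")
      case True
      then have "(norm (deriv h (cx v)))\<^sup>2 \<le> 1 / (1 - k\<^sup>2) * J (cx v)"
        using Jh[of "cx v"] S(2) k2 by (auto simp: field_simps)
      then show ?thesis using True k2
        by (simp add: pr_def S'_def cx_def ennreal_mult'[symmetric] ennreal_leI)
    qed (simp add: pr_def S'_def cx_def)
  qed
  also have "\<dots> = ennreal (1 / (1 - k\<^sup>2)) * (\<integral>\<^sup>+v. ennreal (J (cx v)) * indicator S' v \<partial>lborel)"
  proof (rule nn_integral_cmult)
    have "continuous_on S' (\<lambda>v. J (cx v))" unfolding J_def
      using h_hol g_hol open_U S(2)
      by (intro continuous_intros continuous_on_compose2[OF holomorphic_on_imp_continuous_on[OF holomorphic_deriv[OF h_hol open_U]] contcx]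
           continuous_on_compose2[OF holomorphic_on_imp_continuous_on[OF holomorphic_deriv[OF g_hol open_U]] contcx]) (auto simp: S'_def)
    then have "(\<lambda>v. indicator S' v *\<^sub>R J (cx v)) \<in> borel_measurable borel"
      using oS' by (intro borel_measurable_continuous_on_indicator) auto
    then have "(\<lambda>v. ennreal (indicator S' v *\<^sub>R J (cx v))) \<in> borel_measurable borel" by measurable
    also have "(\<lambda>v. ennreal (indicator S' v *\<^sub>R J (cx v))) = (\<lambda>v. ennreal (J (cx v)) * indicator S' v)"
      by (auto simp: fun_eq_iff indicator_def)
    finally show "(\<lambda>v. ennreal (J (cx v)) * indicator S' v) \<in> borel_measurable lborel" by simp
  qed
  also have "\<dots> = ennreal (1 / (1 - k\<^sup>2) * measure lebesgue (ff ` S'))"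
    using k2 by (simp only: NI) (rule ennreal_mult'[symmetric], simp)
  also have "\<dots> \<le> ennreal (4 * \<rho>\<^sup>2 / (1 - k\<^sup>2))"
    using meas k2 by (intro ennreal_leI) (simp add: divide_right_mono)
  finally show ?thesis .
qed


end

text \<open>The first point \<open>t\<close> where the value \<open>B\<close> is reached and the
  last point \<open>s\<close> before it with value \<open>A\<close> bound an interval on which the
  values stay strictly between.\<close>

lemma real_crossing:
  fixes \<phi> :: "real \<Rightarrow> real"
  assumes cont: "continuous_on {a..b} \<phi>" and ab: "a \<le> b" and A: "\<phi> a \<le> A" "A < B" "B \<le> \<phi> b"
  obtains s t where "a \<le> s" "s < t" "t \<le> b" "\<phi> s = A" "\<phi> t = B" "\<And>x. s < x \<Longrightarrow> x < t \<Longrightarrow> A < \<phi> x \<and> \<phi> x < B"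
proof -
  define T where "T = {x \<in> {a..b}. \<phi> x = B}"
  have "\<exists>x\<ge>a. x \<le> b \<and> \<phi> x = B" using IVT'[of \<phi> a B b] cont ab A by force
  then have "T \<noteq> {}" by (auto simp: T_def)
  moreover have "closed T" unfolding T_def by (rule continuous_closed_preimage_constant[OF cont]) simp
  moreover have "bounded T" by (rule bounded_subset[of "{a..b}"]) (auto simp: T_def)
  ultimately obtain t where t: "t \<in> T" "\<And>x. x \<in> T \<Longrightarrow> t \<le> x"
    using compact_attains_inf[of T] compact_eq_bounded_closed by blast
  have tab: "a \<le> t" "t \<le> b" "\<phi> t = B" using t(1) by (auto simp: T_def)
  have ct: "continuous_on {a..t} \<phi>" by (rule continuous_on_subset[OF cont]) (use tab in auto)
  define S where "S = {x \<in> {a..t}. \<phi> x = A}"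
  have "\<exists>x\<ge>a. x \<le> t \<and> \<phi> x = A" using IVT'[of \<phi> a A t] ct tab A by force
  then have "S \<noteq> {}" by (auto simp: S_def)
  moreover have "closed S" unfolding S_def by (rule continuous_closed_preimage_constant[OF ct]) simp
  moreover have "bounded S" by (rule bounded_subset[of "{a..t}"]) (auto simp: S_def)
  ultimately obtain s where s: "s \<in> S" "\<And>x. x \<in> S \<Longrightarrow> x \<le> s"
    using compact_attains_sup[of S] compact_eq_bounded_closed by blast
  have sab: "a \<le> s" "s \<le> t" "\<phi> s = A" using s(1) by (auto simp: S_def)
  have "s < t" using sab tab A by (metis less_le less_irrefl)
  moreover have "A < \<phi> x \<and> \<phi> x < B" if x: "s < x" "x < t" for x
  proof
    show "A < \<phi> x"
    proof (rule ccontr)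
      assume "\<not> A < \<phi> x"
      moreover have "continuous_on {x..t} \<phi>" by (rule continuous_on_subset[OF ct]) (use x sab in auto)
      ultimately obtain y where "x \<le> y" "y \<le> t" "\<phi> y = A" using IVT'[of \<phi> x A t] tab A x by force
      then have "y \<in> S" using x sab by (auto simp: S_def)
      then show False using s(2)[of y] x \<open>x \<le> y\<close> by simp
    qed
    show "\<phi> x < B"
    proof (rule ccontr)
      assume "\<not> \<phi> x < B"
      moreover have "continuous_on {a..x} \<phi>" by (rule continuous_on_subset[OF ct]) (use x sab in auto)
      ultimately obtain y where "a \<le> y" "y \<le> x" "\<phi> y = B" using IVT'[of \<phi> a B x] tab A x sab by force
      then have "y \<in> T" using x tab by (auto simp: T_def)
      then show False using t(2)[of y] x \<open>y \<le> x\<close> by simp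
    qed
  qed
  ultimately show thesis using that sab tab by blast
qed

text \<open>Either value may be reached first, so only the unordered pair of end values is recorded;
  the decreasing case is obtained by reflection.\<close>

lemma real_crossing_sym:
  fixes \<phi> :: "real \<Rightarrow> real"
  assumes cont: "continuous_on {x1<..<x2} \<phi>" and ab: "a \<in> {x1<..<x2}" "b \<in> {x1<..<x2}" and A: "\<phi> a \<le> A" "A < B" "B \<le> \<phi> b"
  obtains s t where "x1 < s" "s < t" "t < x2" "{\<phi> s, \<phi> t} = {A, B}" "\<And>x. s < x \<Longrightarrow> x < t \<Longrightarrow> A < \<phi> x \<and> \<phi> x < B"
proof (cases "a \<le> b")
  case True
  have "continuous_on {a..b} \<phi>" by (rule continuous_on_subset[OF cont]) (use ab in auto)
  then obtain s t
    where "a \<le> s" "s < t" "t \<le> b" "\<phi> s = A" "\<phi> t = B" "\<And>x. s < x \<Longrightarrow> x < t \<Longrightarrow> A < \<phi> x \<and> \<phi> x < B"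
    by (rule real_crossing[OF _ True A]) blast
  then show thesis using that[of s t] ab by auto
next
  case False
  have "continuous_on {-a..-b} (\<lambda>x. \<phi> (- x))"
    by (rule continuous_on_compose2[OF cont]) (use ab in \<open>auto intro!: continuous_intros\<close>)
  then obtain s t
    where "- a \<le> s" "s < t" "t \<le> - b" "\<phi> (-s) = A" "\<phi> (-t) = B" and st: "\<And>x. s < x \<Longrightarrow> x < t \<Longrightarrow> A < \<phi> (-x) \<and> \<phi> (-x) < B"
    by (rule real_crossing[of _ _ _ A B]) (use False A in auto)
  moreover have "A < \<phi> x \<and> \<phi> x < B" if "- t < x" "x < - s" for x
    using st[of "-x"] that by simp
  ultimately show thesis using that[of "-t" "-s"] ab by auto
qed


text \<open>Each dyadic annulus about \<open>c\<close> that the segments at heights in \<open>B\<close> have to cross contributes a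
  fixed multiple of \<open>|B|\<^sup>2\<close> to the bound, by Cauchy--Schwarz and the area of the annulus.\<close>
lemma (in harmonic_qc) length_area:
  assumes R: "\<And>x y. x1 < x \<Longrightarrow> x < x2 \<Longrightarrow> y1 < y \<Longrightarrow> y < y2 \<Longrightarrow> Complex x y \<in> U"
    and B: "B \<in> sets borel" "B \<subseteq> {y1<..<y2}" and r: "r > 0"
    and cross: "\<And>y. y \<in> B \<Longrightarrow> \<exists>xa\<in>{x1<..<x2}. \<exists>xb\<in>{x1<..<x2}.
        norm (f (Complex xa y) - c) \<le> r \<and> 2 ^ N * r \<le> norm (f (Complex xb y) - c)"
    and xy: "x1 < x2" "y1 < y2"
  shows "real N * (measure lborel B)\<^sup>2 * (1 - k\<^sup>2) \<le> 64 * ((x2 - x1) * (y2 - y1))"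
proof (cases "measure lborel B = 0")
  case True
  then show ?thesis using xy by simp
next
  case False
  define m where "m = measure lborel B"
  have m: "m > 0" using False by (simp add: m_def zero_less_measure_iff)
  have eB: "emeasure lborel B = ennreal m"
  proof -
    have "emeasure lborel B \<le> emeasure lborel {y1<..<y2}" using B by (intro emeasure_mono) auto
    then have "emeasure lborel B < \<infinity>" using xy by (simp add: le_less_trans)
    then show ?thesis by (simp add: m_def emeasure_eq_ennreal_measure)
  qed
  have k2: "k\<^sup>2 < 1" using k by (simp add: abs_square_less_1)
  define Rz where "Rz = {z. x1 < Re z \<and> Re z < x2 \<and> y1 < Im z \<and> Im z < y2}"
  have RzU: "Rz \<subseteq> U" using R unfolding Rz_def by (metis (mono_tags, lifting) complex.exhaust_sel mem_Collect_eq subsetI)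
  have oRz: "open Rz" unfolding Rz_def
    by (intro open_Collect_conj open_Collect_less continuous_intros)
  define A where "A j = 2 ^ j * r" for j :: nat
  have A: "A j > 0" "A (Suc j) = 2 * A j" for j using r by (auto simp: A_def)
  \<comment> \<open>The part of the rectangle sent into the \<open>j\<close>-th dyadic annulus about
    \<open>c\<close>. Every segment at a height in \<open>B\<close> has to traverse the annuli with
    \<open>j < N\<close>.\<close>
  define S where "S j = Rz \<inter> (\<lambda>z. norm (f z - c)) -` {A j <..< A (Suc j)}" for j
  have oS: "open (S j)" for j
    unfolding S_def using f_cont RzU
    by (intro continuous_open_preimage oRz continuous_intros continuous_on_subset[OF f_cont]) auto
  define S' where "S' j = {v. Complex (fst v) (snd v) \<in> S j}" for j
  have oS': "open (S' j)" for j
  proof -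
    have "continuous_on UNIV (\<lambda>v::real\<times>real. Complex (fst v) (snd v))" unfolding Complex_eq by (intro continuous_intros)
    from open_vimage[OF oS this] show ?thesis by (simp add: vimage_def S'_def)
  qed
  have Sb: "S' j \<subseteq> {x1<..<x2} \<times> {y1<..<y2}" for j by (auto simp: S'_def S_def Rz_def)
  have eR: "emeasure lborel ({x1<..<x2} \<times> {y1<..<y2}) = ennreal ((x2 - x1) * (y2 - y1))"
    unfolding lborel_prod[symmetric] using xy by (subst lborel.emeasure_pair_measure_Times) (auto simp: ennreal_mult)
  define s where "s j = measure lborel (S' j)" for j
  have es: "emeasure lborel (S' j) = ennreal (s j)" for j
  proof -
    have "emeasure lborel (S' j) \<le> emeasure lborel ({x1<..<x2} \<times> {y1<..<y2})"
      by (intro emeasure_mono Sb) (auto intro!: borel_open open_Times)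
    then have "emeasure lborel (S' j) < \<infinity>" unfolding eR by (simp add: le_less_trans)
    then show ?thesis by (simp add: s_def emeasure_eq_ennreal_measure)
  qed
  have conth: "continuous_on U (deriv h)"
    using h_hol open_U by (meson holomorphic_deriv holomorphic_on_imp_continuous_on)
  let ?H = "\<lambda>v::real\<times>real. norm (deriv h (Complex (fst v) (snd v)))"
  have mHp: "(\<lambda>v. ennreal (?H v ^ n) * indicator (S' j) v) \<in> borel_measurable borel" for j n
  proof -
    have "continuous_on (S' j) (\<lambda>v. ?H v ^ n)"
      by (intro continuous_intros continuous_on_compose2[OF conth])
        (use RzU in \<open>auto simp: S'_def S_def Complex_eq intro!: continuous_intros\<close>)
    then have "(\<lambda>v. indicator (S' j) v *\<^sub>R (?H v ^ n)) \<in> borel_measurable borel"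
      using oS' by (intro borel_measurable_continuous_on_indicator) auto
    then have "(\<lambda>v. ennreal (indicator (S' j) v *\<^sub>R (?H v ^ n))) \<in> borel_measurable borel" by measurable
    also have "(\<lambda>v. ennreal (indicator (S' j) v *\<^sub>R (?H v ^ n))) = (\<lambda>v. ennreal (?H v ^ n) * indicator (S' j) v)"
      by (auto simp: fun_eq_iff indicator_def)
    finally show ?thesis .
  qed
  \<comment> \<open>Between the two crossings \<open>f\<close> moves by at least the width
    \<open>A j\<close> of the annulus, while its horizontal derivative is at most
    \<open>|h'| + |g'| \<le> 2 |h'|\<close>. This is the origin of the factor one half.\<close>
  have line: "ennreal (A j / 2) \<le> (\<integral>\<^sup>+x. ennreal (?H (x, y) ^ 1) * indicator (S' j) (x, y) \<partial>lborel)"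
    if j: "j < N" and y: "y \<in> B" for j y
  proof -
    have yy: "y1 < y" "y < y2" using y B by auto
    define p where "p x = f (Complex x y)" for x
    have der: "(p has_vector_derivative (deriv h (Complex x y) + cnj (deriv g (Complex x y)))) (at x)"
      if "x \<in> {x1<..<x2}" for x
    proof -
      have z: "Complex x y \<in> U" using that R yy by auto
      have c1: "((\<lambda>x. Complex x y) has_derivative of_real) (at x)"
        unfolding Complex_eq by (auto intro!: derivative_eq_intros)
      show ?thesis using has_derivative_compose[OF c1 f_has_derivative[OF z]]
        unfolding p_def has_vector_derivative_def by (simp add: scaleR_conv_of_real algebra_simps)
    qed
    have cp: "continuous_on {x1<..<x2} p"
      using der by (intro continuous_at_imp_continuous_on ballI) (meson has_vector_derivative_continuous)
    have cn: "continuous_on {x1<..<x2} (\<lambda>x. norm (p x - c))" by (intro continuous_intros cp)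
    obtain xa xb where x: "xa \<in> {x1<..<x2}" "xb \<in> {x1<..<x2}" "norm (p xa - c) \<le> r" "2 ^ N * r \<le> norm (p xb - c)"
      using cross[OF y] unfolding p_def by blast
    have "r \<le> A j" using r by (simp add: A_def)
    with x have xa: "norm (p xa - c) \<le> A j" by simp
    have "A (Suc j) \<le> 2 ^ N * r" unfolding A_def using r j by (intro mult_right_mono power_increasing) auto
    with x have xb: "A (Suc j) \<le> norm (p xb - c)" by simp
    have AA: "A j < A (Suc j)" using A by simp
    obtain a b where ab: "x1 < a" "a < b" "b < x2" "{norm (p a - c), norm (p b - c)} = {A j, A (Suc j)}"
       and btw: "\<And>x. a < x \<Longrightarrow> x < b \<Longrightarrow> A j < norm (p x - c) \<and> norm (p x - c) < A (Suc j)"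
      using real_crossing_sym[OF cn x(1,2) xa AA xb] by blast
    have "\<bar>norm (p a - c) - norm (p b - c)\<bar> = A j"
      using ab(4) A(2)[of j] A(1)[of j] by (auto simp: doubleton_eq_iff)
    then have Ap: "A j \<le> norm (p b - p a)"
      using norm_triangle_ineq3[of "p a - c" "p b - c"] by (simp add: norm_minus_commute)
    have ftc: "((\<lambda>x. deriv h (Complex x y) + cnj (deriv g (Complex x y))) has_integral p b - p a) {a..b}"
      using ab by (intro fundamental_theorem_of_calculus) (auto intro!: has_vector_derivative_at_within der)
    have ch: "continuous_on {a..b} (\<lambda>x. norm (deriv h (Complex x y)))"
      by (intro continuous_intros continuous_on_compose2[OF conth])
         (use ab yy R in \<open>auto simp: Complex_eq[symmetric] intro!: continuous_intros\<close>)
    note Ap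
    also have "norm (p b - p a) \<le> integral {a..b} (\<lambda>x. 2 * norm (deriv h (Complex x y)))"
      unfolding integral_unique[OF ftc, symmetric]
    proof (rule integral_norm_bound_integral)
      show "(\<lambda>x. deriv h (Complex x y) + cnj (deriv g (Complex x y))) integrable_on {a..b}" using ftc by blast
      show "(\<lambda>x. 2 * norm (deriv h (Complex x y))) integrable_on {a..b}"
        by (intro integrable_continuous_real continuous_intros ch)
      fix x assume "x \<in> {a..b}"
      then have z: "Complex x y \<in> U" using R yy ab by auto
      have "norm (deriv g (Complex x y)) \<le> 1 * norm (deriv h (Complex x y))"
        using dil[OF z] k mult_right_mono[of k 1 "norm (deriv h (Complex x y))"] by simp
      then show "norm (deriv h (Complex x y) + cnj (deriv g (Complex x y))) \<le> 2 * norm (deriv h (Complex x y))"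
        by (intro norm_triangle_le) simp
    qed
    finally have Aj: "A j / 2 \<le> integral {a..b} (\<lambda>x. norm (deriv h (Complex x y)))" by simp
    have "((\<lambda>x. norm (deriv h (Complex x y))) has_integral integral {a..b} (\<lambda>x. norm (deriv h (Complex x y)))) (cbox a b)"
      using integrable_continuous_real[OF ch] by (simp add: has_integral_integral[symmetric])
    then have "((\<lambda>x. norm (deriv h (Complex x y))) has_integral integral {a..b} (\<lambda>x. norm (deriv h (Complex x y)))) (box a b)"
      by (simp only: has_integral_open_interval)
    then have "(\<integral>\<^sup>+x. ennreal (norm (deriv h (Complex x y))) * indicator (box a b) x \<partial>lborel) = ennreal (integral {a..b} (\<lambda>x. norm (deriv h (Complex x y))))"
      by (rule nn_integral_has_integral_lebesgue'[rotated]) simp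
    then have "ennreal (A j / 2) \<le> (\<integral>\<^sup>+x. ennreal (norm (deriv h (Complex x y))) * indicator (box a b) x \<partial>lborel)"
      using Aj by (simp add: ennreal_leI)
    also have "\<dots> \<le> (\<integral>\<^sup>+x. ennreal (?H (x, y) ^ 1) * indicator (S' j) (x, y) \<partial>lborel)"
    proof (intro nn_integral_mono)
      fix x
      show "ennreal (norm (deriv h (Complex x y))) * indicator (box a b) x \<le> ennreal (?H (x, y) ^ 1) * indicator (S' j) (x, y)"
        using btw[of x] ab yy by (auto simp: indicator_def S'_def S_def Rz_def p_def)
    qed
    finally show ?thesis .
  qed
  have main: "m\<^sup>2 * (1 - k\<^sup>2) \<le> 64 * s j" if j: "j < N" for j
  proof -
    \<comment> \<open>The weight in \<open>H \<le> l / 2 + H^2 / (2 l)\<close>. With this value the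
      area term uses up half of the left side \<open>A j / 2 * m\<close>, and the other half bounds
      \<open>s j\<close> from below.\<close>
    define l where "l = 32 * A j / (m * (1 - k\<^sup>2))"
    have l: "l > 0" using A m k2 by (auto simp: l_def)
    have "ennreal (A j / 2 * m) = (\<integral>\<^sup>+y. ennreal (A j / 2) * indicator B y \<partial>lborel)"
      using B(1) A(1)[of j] m by (subst nn_integral_cmult_indicator) (simp_all add: eB ennreal_mult'[symmetric])
    also have "\<dots> \<le> (\<integral>\<^sup>+y. (\<integral>\<^sup>+x. ennreal (?H (x, y) ^ 1) * indicator (S' j) (x, y) \<partial>lborel) \<partial>lborel)"
      using line[OF j] by (intro nn_integral_mono) (auto simp: indicator_def)
    also have "\<dots> = (\<integral>\<^sup>+v. ennreal (?H v ^ 1) * indicator (S' j) v \<partial>(lborel \<Otimes>\<^sub>M lborel))"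
      using mHp[of 1 j] by (intro lborel_pair.nn_integral_snd) (simp add: lborel_prod)
    also have "\<dots> = (\<integral>\<^sup>+v. ennreal (?H v ^ 1) * indicator (S' j) v \<partial>lborel)" by (simp only: lborel_prod)
    also have "\<dots> \<le> (\<integral>\<^sup>+v. ennreal (l / 2) * indicator (S' j) v + ennreal (1 / (2 * l)) * (ennreal (?H v ^ 2) * indicator (S' j) v) \<partial>lborel)"
    proof (intro nn_integral_mono)
      fix v
      have "?H v \<le> l / 2 + 1 / (2 * l) * (?H v)\<^sup>2"
      proof -
        have "0 \<le> (l - ?H v)\<^sup>2" by simp
        then have "2 * l * ?H v \<le> l\<^sup>2 + (?H v)\<^sup>2" by (simp add: power2_diff)
        then have "?H v \<le> (l\<^sup>2 + (?H v)\<^sup>2) / (2 * l)" using l by (simp add: pos_le_divide_eq mult.commute)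
        also have "\<dots> = l / 2 + 1 / (2 * l) * (?H v)\<^sup>2" using l by (simp add: add_divide_distrib power2_eq_square)
        finally show ?thesis .
      qed
      then have "ennreal (?H v) \<le> ennreal (l / 2 + 1 / (2 * l) * (?H v)\<^sup>2)" by (rule ennreal_leI)
      also have "\<dots> = ennreal (l / 2) + ennreal (1 / (2 * l)) * ennreal ((?H v)\<^sup>2)"
        using l by (subst ennreal_plus) (auto simp: ennreal_mult[symmetric])
      finally show "ennreal (?H v ^ 1) * indicator (S' j) v \<le> ennreal (l / 2) * indicator (S' j) v + ennreal (1 / (2 * l)) * (ennreal (?H v ^ 2) * indicator (S' j) v)"
        by (auto simp: indicator_def)
    qed
    also have "\<dots> = ennreal (l / 2) * emeasure lborel (S' j) + ennreal (1 / (2 * l)) * (\<integral>\<^sup>+v. ennreal (?H v ^ 2) * indicator (S' j) v \<partial>lborel)"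
      using oS'[of j] mHp[of 2 j] by (subst nn_integral_add) (auto simp: nn_integral_cmult)
    also have "\<dots> \<le> ennreal (l / 2) * ennreal (s j) + ennreal (1 / (2 * l)) * ennreal (4 * (A (Suc j))\<^sup>2 / (1 - k\<^sup>2))"
    proof -
      have "f ` S j \<subseteq> ball c (A (Suc j))" by (auto simp: S_def dist_norm norm_minus_commute)
      moreover have "S j \<subseteq> U" using RzU by (auto simp: S_def)
      ultimately have "(\<integral>\<^sup>+v. ennreal (?H v ^ 2) * indicator (S' j) v \<partial>lborel) \<le> ennreal (4 * (A (Suc j))\<^sup>2 / (1 - k\<^sup>2))"
        unfolding S'_def by (intro area_bound oS A)
      then show ?thesis unfolding es by (intro add_left_mono mult_left_mono) auto
    qed
    also have "\<dots> = ennreal (l / 2 * s j + 1 / (2 * l) * (4 * (A (Suc j))\<^sup>2 / (1 - k\<^sup>2)))"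
      using l k2 by (subst ennreal_plus) (auto simp: ennreal_mult[symmetric] s_def)
    finally have "A j / 2 * m \<le> l / 2 * s j + 1 / (2 * l) * (4 * (A (Suc j))\<^sup>2 / (1 - k\<^sup>2))"
      using l k2 by (subst (asm) ennreal_le_iff) (auto simp: s_def intro!: add_nonneg_nonneg)
    also have "1 / (2 * l) * (4 * (A (Suc j))\<^sup>2 / (1 - k\<^sup>2)) = A j * m / 4"
      using A(1)[of j] m k2 unfolding l_def A(2) by (simp add: field_simps power2_eq_square)
    finally have "A j * m / 4 \<le> l / 2 * s j" by (simp add: mult.commute)
    moreover have "l / 2 * s j = A j * (16 / (m * (1 - k\<^sup>2)) * s j)" by (simp add: l_def)
    ultimately have "A j * (m / 4) \<le> A j * (16 / (m * (1 - k\<^sup>2)) * s j)" by (simp add: mult.commute)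
    then have "m / 4 \<le> 16 / (m * (1 - k\<^sup>2)) * s j"
      by (subst (asm) mult_le_cancel_left_pos[OF A(1)])
    then show ?thesis using m k2 by (simp add: field_simps power2_eq_square)
  qed
  have "real N * (m\<^sup>2 * (1 - k\<^sup>2)) = (\<Sum>j<N. m\<^sup>2 * (1 - k\<^sup>2))" by simp
  also have "\<dots> \<le> (\<Sum>j<N. 64 * s j)" by (intro sum_mono main) auto
  also have "\<dots> = 64 * (\<Sum>j<N. s j)" by (simp add: sum_distrib_left)
  also have "(\<Sum>j<N. s j) \<le> (x2 - x1) * (y2 - y1)"
  proof -
    have disj: "disjoint_family_on S' {..<N}"
    proof -
      have "S' i \<inter> S' j = {}" if "i < j" for i j
      proof -
        have "A (Suc i) \<le> A j" unfolding A_def using r that by (intro mult_right_mono power_increasing) auto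
        then show ?thesis by (auto simp: S'_def S_def)
      qed
      then show ?thesis unfolding disjoint_family_on_def by (metis inf_commute nat_neq_iff)
    qed
    have "ennreal (\<Sum>j<N. s j) = (\<Sum>j<N. emeasure lborel (S' j))"
      unfolding es by (rule sum_ennreal[symmetric]) (simp add: s_def)
    also have "\<dots> = emeasure lborel (\<Union>j<N. S' j)"
      by (rule sum_emeasure) (use disj oS' in auto)
    also have "\<dots> \<le> emeasure lborel ({x1<..<x2} \<times> {y1<..<y2})"
      using Sb by (intro emeasure_mono) (auto intro!: borel_open open_Times)
    finally show ?thesis unfolding eR using xy by (subst (asm) ennreal_le_iff) auto
  qed
  finally show ?thesis by (simp add: m_def mult.assoc)
qed

subsection \<open>Half circles at boundary points of a half plane\<close>

lemma (in harmonic_qc) harmonic_qc_compose: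
  assumes V: "open V" and \<psi>: "\<psi> holomorphic_on V" "inj_on \<psi> V" "\<psi> ` V \<subseteq> U"
  shows "harmonic_qc (\<lambda>z. f (\<psi> z)) (\<lambda>z. h (\<psi> z)) (\<lambda>z. g (\<psi> z)) k V"
proof -
  have der: "deriv (\<lambda>z. \<phi> (\<psi> z)) z = deriv \<phi> (\<psi> z) * deriv \<psi> z" if "\<phi> holomorphic_on U" "z \<in> V" for \<phi> z
    by (rule DERIV_imp_deriv)
      (use DERIV_chain2[OF holomorphic_derivI[OF that(1) open_U] holomorphic_derivI[OF \<psi>(1) V that(2)]] that \<psi> in auto)
  have nz: "deriv \<psi> z \<noteq> 0" if "z \<in> V" for z
    using holomorphic_injective_imp_regular[OF \<psi>(1) V \<psi>(2) that] .
  show ?thesis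
  proof
    show "(\<lambda>z. h (\<psi> z)) holomorphic_on V" "(\<lambda>z. g (\<psi> z)) holomorphic_on V"
      using holomorphic_on_compose_gen[OF \<psi>(1) h_hol \<psi>(3)] holomorphic_on_compose_gen[OF \<psi>(1) g_hol \<psi>(3)]
      by (auto simp: o_def)
    show "inj_on (\<lambda>z. f (\<psi> z)) V"
      using comp_inj_on[OF \<psi>(2) inj_on_subset[OF f_inj \<psi>(3)]] by (simp add: o_def)
    show "norm (deriv (\<lambda>z. g (\<psi> z)) z) \<le> k * norm (deriv (\<lambda>z. h (\<psi> z)) z)" if z: "z \<in> V" for z
    proof -
      have "norm (deriv g (\<psi> z)) * norm (deriv \<psi> z) \<le> k * norm (deriv h (\<psi> z)) * norm (deriv \<psi> z)"
        using z \<psi>(3) by (intro mult_right_mono dil) auto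
      then show ?thesis unfolding der[OF h_hol z] der[OF g_hol z] norm_mult by (simp add: mult.assoc)
    qed
    show "deriv (\<lambda>z. h (\<psi> z)) z \<noteq> 0" if z: "z \<in> V" for z
      unfolding der[OF h_hol z] using nz[OF z] dh_nz z \<psi>(3) by auto
  qed (use V k f_eq \<psi>(3) in auto)
qed

abbreviation right_half :: "complex set" where "right_half \<equiv> {z. Re z > 0}"

lemma open_right_half: "open right_half"
  by (rule open_halfspace_Re_gt)

text \<open>Logarithmic coordinates about the boundary point \<open>\<i> \<eta>\<close>:
  \<open>x\<close> is the angle and \<open>y\<close> is minus the logarithm of the radius, so half
  circles become horizontal segments of length \<open>pi\<close>.\<close>

lemma half_circle_param:
  assumes "z \<in> right_half" "norm (z - \<i> * of_real \<eta>) = exp (- y)"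
  obtains x where "- pi / 2 < x" "x < pi / 2" "z = \<i> * of_real \<eta> + exp (\<i> * Complex x y)"
proof -
  define w where "w = z - \<i> * of_real \<eta>"
  have w: "Re w > 0" "norm w = exp (-y)" using assms by (auto simp: w_def)
  define x where "x = Im (Ln w)"
  have x: "- pi / 2 < x" "x < pi / 2" using Re_Ln_pos_lt_imp[of w] w(1) by (auto simp: x_def)
  have w0: "w \<noteq> 0" using w by auto
  have L: "Ln w = \<i> * Complex x y"
  proof (rule complex_eqI)
    have "Re (Ln w) = ln (norm w)" using w0 by (rule Re_Ln)
    then show "Re (Ln w) = Re (\<i> * Complex x y)" by (simp add: w(2))
  qed (simp add: x_def)
  have "w = exp (\<i> * Complex x y)" using exp_Ln[OF w0] unfolding L by (rule sym)
  then have "z = \<i> * of_real \<eta> + exp (\<i> * Complex x y)" unfolding w_def by (metis add_diff_cancel_left' diff_add_cancel add.commute)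
  with x show thesis by (rule that)
qed

locale half_plane_qc = harmonic_qc f h g k right_half for f h g k
begin

lemma half_circle_length_area:
  assumes B: "B \<in> sets borel" "B \<subseteq> {y1<..<y2}" and r: "r > 0" and y12: "y1 < y2"
    and cross: "\<And>y. y \<in> B \<Longrightarrow> \<exists>za\<in>right_half. \<exists>zb\<in>right_half.
        norm (za - \<i> * of_real \<eta>) = exp (- y) \<and> norm (zb - \<i> * of_real \<eta>) = exp (- y) \<and>
        norm (f za - c) \<le> r \<and> 2 ^ N * r \<le> norm (f zb - c)"
  shows "real N * (measure lborel B)\<^sup>2 * (1 - k\<^sup>2) \<le> 64 * (pi * (y2 - y1))"
proof -
  define V where "V = {z. - pi / 2 < Re z \<and> Re z < pi / 2 \<and> y1 < Im z \<and> Im z < y2}"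
  define \<psi> where "\<psi> z = \<i> * of_real \<eta> + exp (\<i> * z)" for z
  have oV: "open V" unfolding V_def
    by (intro open_Collect_conj open_Collect_less continuous_intros)
  have inj: "inj_on \<psi> V"
  proof (rule inj_onI)
    fix z w assume zw: "z \<in> V" "w \<in> V" "\<psi> z = \<psi> w"
    then have "exp (\<i> * z) = exp (\<i> * w)" by (simp add: \<psi>_def)
    moreover have "\<bar>Im (\<i> * z) - Im (\<i> * w)\<bar> < 2 * pi" using zw by (auto simp: V_def)
    ultimately have "\<i> * z = \<i> * w" using exp_complex_eqI by blast
    then show "z = w" by simp
  qed
  have im: "\<psi> ` V \<subseteq> right_half"
    by (auto simp: \<psi>_def V_def Re_exp intro!: mult_pos_pos cos_gt_zero_pi)
  interpret c: harmonic_qc "\<lambda>z. f (\<psi> z)" "\<lambda>z. h (\<psi> z)" "\<lambda>z. g (\<psi> z)" k V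
    by (rule harmonic_qc_compose[OF oV _ inj im]) (auto simp: \<psi>_def[abs_def] intro!: holomorphic_intros)
  have "real N * (measure lborel B)\<^sup>2 * (1 - k\<^sup>2) \<le> 64 * ((pi / 2 - (- pi / 2)) * (y2 - y1))"
  proof (rule c.length_area[where c = c, OF _ B r])
    show "\<exists>xa\<in>{- pi / 2<..<pi / 2}. \<exists>xb\<in>{- pi / 2<..<pi / 2}.
            norm (f (\<psi> (Complex xa y)) - c) \<le> r \<and> 2 ^ N * r \<le> norm (f (\<psi> (Complex xb y)) - c)" if yB: "y \<in> B" for y
    proof -
      obtain za zb where z: "za \<in> right_half" "zb \<in> right_half" "norm (za - \<i> * of_real \<eta>) = exp (- y)" "norm (zb - \<i> * of_real \<eta>) = exp (- y)"
        "norm (f za - c) \<le> r" "2 ^ N * r \<le> norm (f zb - c)" using cross[OF yB] by blast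
      obtain xa where xa: "- pi / 2 < xa" "xa < pi / 2" "za = \<psi> (Complex xa y)"
        using half_circle_param[OF z(1,3)] unfolding \<psi>_def by blast
      obtain xb where xb: "- pi / 2 < xb" "xb < pi / 2" "zb = \<psi> (Complex xb y)"
        using half_circle_param[OF z(2,4)] unfolding \<psi>_def by blast
      show ?thesis using xa xb z(5,6) by (intro bexI[of _ xa] bexI[of _ xb]) auto
    qed
  qed (use y12 in \<open>auto simp: V_def\<close>)
  then show ?thesis by simp
qed

text \<open>A connected set reaching from within \<open>r0 / 4\<close> of the boundary point to
  distance \<open>r0 / 2\<close> meets every half circle in between, and so does the horizontal
  segment of radii \<open>\<rho>\<close>. If the values of \<open>f\<close> on the two are separated
  by \<open>N\<close> dyadic annuli, length-area bounds \<open>N\<close> in terms of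
  \<open>k\<close> alone.\<close>

lemma half_circle_crossing:
  assumes S: "connected S" "S \<subseteq> right_half" "p \<in> S" "z \<in> S"
    and p: "norm (p - \<i> * of_real \<eta>) \<le> r0 / 4" and z: "r0 / 2 \<le> norm (z - \<i> * of_real \<eta>)" and r: "r > 0" "r0 > 0"
    and alt: "(\<forall>z\<in>S. norm (f z - c) \<le> r) \<and> (\<forall>\<rho>\<in>{r0/4..r0/2}. 2 ^ N * r \<le> norm (f (\<i> * of_real \<eta> + of_real \<rho>) - c)) \<or>
              (\<forall>z\<in>S. 2 ^ N * r \<le> norm (f z - c)) \<and> (\<forall>\<rho>\<in>{r0/4..r0/2}. norm (f (\<i> * of_real \<eta> + of_real \<rho>) - c) \<le> r)"
  shows "real N * ln 2 * (1 - k\<^sup>2) \<le> 64 * pi"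
proof -
  define y1 y2 where "y1 = - ln (r0 / 2)" and "y2 = - ln (r0 / 4)"
  have "r0 / 2 = 2 * (r0 / 4)" by simp
  then have "ln (r0 / 2) = ln 2 + ln (r0 / 4)" using r by (metis ln_mult_pos divide_pos_pos zero_less_numeral)
  then have y: "y2 - y1 = ln 2" by (simp add: y1_def y2_def)
  then have y12: "y1 < y2" using ln_gt_zero[of 2] by linarith
  have "real N * (measure lborel {y1<..<y2})\<^sup>2 * (1 - k\<^sup>2) \<le> 64 * (pi * (y2 - y1))"
  proof (rule half_circle_length_area[where \<eta> = \<eta> and c = c and r = r])
    fix y assume yy: "y \<in> {y1<..<y2}"
    define \<rho> where "\<rho> = exp (- y)"
    have "ln (r0 / 4) < - y" "- y < ln (r0 / 2)" using yy by (auto simp: y1_def y2_def)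
    then have "exp (ln (r0 / 4)) < exp (- y)" "exp (- y) < exp (ln (r0 / 2))" by (simp_all only: exp_less_mono)
    then have \<rho>: "r0 / 4 < \<rho>" "\<rho> < r0 / 2" using r by (simp_all add: \<rho>_def)
    have "connected ((\<lambda>z. norm (z - \<i> * of_real \<eta>)) ` S)"
      by (intro connected_continuous_image continuous_intros S)
    then have "\<rho> \<in> (\<lambda>z. norm (z - \<i> * of_real \<eta>)) ` S"
      using connectedD_interval[of "(\<lambda>z. norm (z - \<i> * of_real \<eta>)) ` S" "norm (p - \<i> * of_real \<eta>)" "norm (z - \<i> * of_real \<eta>)" \<rho>]
        S p z \<rho> by auto
    then obtain s where s: "s \<in> S" "norm (s - \<i> * of_real \<eta>) = exp (- y)" by (auto simp: \<rho>_def)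
    define t where "t = \<i> * of_real \<eta> + (of_real \<rho> :: complex)"
    have t: "t \<in> right_half" "norm (t - \<i> * of_real \<eta>) = exp (- y)" using \<rho> r by (auto simp: t_def \<rho>_def)
    have "\<rho> \<in> {r0/4..r0/2}" using \<rho> by simp
    with alt have "norm (f s - c) \<le> r \<and> 2 ^ N * r \<le> norm (f t - c) \<or> 2 ^ N * r \<le> norm (f s - c) \<and> norm (f t - c) \<le> r"
      using s(1) unfolding t_def by blast
    then show "\<exists>za\<in>right_half. \<exists>zb\<in>right_half.
        norm (za - \<i> * of_real \<eta>) = exp (- y) \<and> norm (zb - \<i> * of_real \<eta>) = exp (- y) \<and>
        norm (f za - c) \<le> r \<and> 2 ^ N * r \<le> norm (f zb - c)"
      using s t S(2) by blast
  qed (use r y12 in auto)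
  then have "real N * ln 2 * (1 - k\<^sup>2) * ln 2 \<le> 64 * pi * ln 2"
    using y y12 by (simp add: power2_eq_square mult_ac)
  then show ?thesis using ln_gt_zero[of 2] by (simp only: mult_le_cancel_right_pos) 
qed

lemma large_N: "\<exists>N. real N * X * (1 - k\<^sup>2) > Y" if "X > 0"
proof -
  have "k\<^sup>2 < 1" using k by (simp add: abs_square_less_1)
  then have "X * (1 - k\<^sup>2) > 0" using that by simp
  then show ?thesis using reals_Archimedean3[of "X * (1 - k\<^sup>2)"] by (metis mult.assoc)
qed

section \<open>Collapsing sets and good half circles\<close>

lemma segment_compact:
  assumes "r0 > 0"
  shows "compact ((\<lambda>(\<eta>, \<rho>). f (\<i> * of_real \<eta> + of_real \<rho>)) ` ({y0 - 1..y0 + 1} \<times> {r0 / 4..r0 / 2}))"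
  unfolding case_prod_unfold
  by (intro compact_continuous_image compact_Times compact_Icc continuous_on_compose2[OF f_cont] continuous_intros)
     (use assms in auto)

text \<open>A substitute for continuity of the inverse of \<open>f\<close> at the boundary:
  connected sets through \<open>p n\<close> whose images shrink to an omitted value must shrink
  themselves. On the compact family \<open>K\<close> of horizontal segments \<open>f\<close> keeps a
  positive distance \<open>d\<close> from \<open>c\<close>, so a large set \<open>S n\<close> would
  separate more dyadic annuli than the half circles permit.\<close>

lemma small_sets_finite:
  assumes p: "p \<longlonglongrightarrow> \<i> * of_real y0" and S: "\<And>n. connected (S n)" "\<And>n. S n \<subseteq> right_half" "\<And>n. p n \<in> S n"
    and c: "c \<notin> f ` right_half" and lim: "\<And>\<epsilon>. \<epsilon> > 0 \<Longrightarrow> \<forall>\<^sub>F n in sequentially. \<forall>z\<in>S n. norm (f z - c) < \<epsilon>"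
    and r0: "r0 > 0"
  shows "\<forall>\<^sub>F n in sequentially. S n \<subseteq> ball (p n) r0"
proof -
  define K where "K = (\<lambda>(\<eta>, \<rho>). f (\<i> * of_real \<eta> + of_real \<rho>)) ` ({y0 - 1..y0 + 1} \<times> {r0 / 4..r0 / 2})"
  have K: "compact K" unfolding K_def by (rule segment_compact[OF r0])
  have "c \<notin> K"
  proof
    assume "c \<in> K"
    then obtain \<eta> \<rho> where e: "c = f (\<i> * of_real \<eta> + of_real \<rho>)" "\<rho> \<ge> r0 / 4" by (auto simp: K_def)
    then have "\<i> * of_real \<eta> + of_real \<rho> \<in> right_half" using r0 by simp
    then show False using c e(1) by blast
  qed
  then obtain d where d: "d > 0" "\<And>w. w \<in> K \<Longrightarrow> d \<le> dist c w"
    using separate_point_closed[of K c] K compact_imp_closed by blast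
  obtain N where N: "real N * ln 2 * (1 - k\<^sup>2) > 64 * pi" using large_N[of "ln 2"] by auto
  define r where "r = d / 2 ^ N"
  have r: "r > 0" "2 ^ N * r = d" using d by (auto simp: r_def)
  have "\<forall>\<^sub>F n in sequentially. dist (p n) (\<i> * of_real y0) < min 1 (r0 / 8)"
    using p r0 by (intro tendstoD) auto
  with lim[OF r(1)] show ?thesis
  proof eventually_elim
    case (elim n)
    show ?case
    proof (rule ccontr)
      assume "\<not> S n \<subseteq> ball (p n) r0"
      then obtain z where z: "z \<in> S n" "r0 \<le> norm (z - p n)"
        unfolding subset_eq mem_ball dist_norm by (metis norm_minus_commute not_le)
      define \<eta> where "\<eta> = Im (p n)"
      have pe: "norm (p n - \<i> * of_real \<eta>) = Re (p n)"
        using S(2,3)[of n] by (auto simp: \<eta>_def cmod_def)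
      have Rp: "Re (p n) < r0 / 8" using elim(2) abs_Re_le_cmod[of "p n - \<i> * of_real y0"] by (auto simp: dist_norm)
      have \<eta>: "\<eta> \<in> {y0 - 1..y0 + 1}" using elim(2) abs_Im_le_cmod[of "p n - \<i> * of_real y0"] by (auto simp: dist_norm \<eta>_def)
      have "norm (z - p n) \<le> norm (z - \<i> * of_real \<eta>) + norm (p n - \<i> * of_real \<eta>)"
        using norm_triangle_ineq4[of "z - \<i> * of_real \<eta>" "p n - \<i> * of_real \<eta>"] by simp
      then have zf: "r0 / 2 \<le> norm (z - \<i> * of_real \<eta>)" using z(2) pe Rp r0 by linarith
      have "real N * ln 2 * (1 - k\<^sup>2) \<le> 64 * pi"
      proof (rule half_circle_crossing[OF S(1,2,3) z(1) _ zf r(1) r0])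
        show "norm (p n - \<i> * of_real \<eta>) \<le> r0 / 4" using pe Rp r0 by simp
        have "2 ^ N * r \<le> norm (f (\<i> * of_real \<eta> + of_real \<rho>) - c)" if "\<rho> \<in> {r0/4..r0/2}" for \<rho>
        proof -
          have "f (\<i> * of_real \<eta> + of_real \<rho>) \<in> K" unfolding K_def using that \<eta> by (intro image_eqI[of _ _ "(\<eta>, \<rho>)"]) auto
          from d(2)[OF this] show ?thesis by (simp add: r(2) dist_norm norm_minus_commute)
        qed
        then show "(\<forall>z\<in>S n. norm (f z - c) \<le> r) \<and> (\<forall>\<rho>\<in>{r0/4..r0/2}. 2 ^ N * r \<le> norm (f (\<i> * of_real \<eta> + of_real \<rho>) - c)) \<or>
              (\<forall>z\<in>S n. 2 ^ N * r \<le> norm (f z - c)) \<and> (\<forall>\<rho>\<in>{r0/4..r0/2}. norm (f (\<i> * of_real \<eta> + of_real \<rho>) - c) \<le> r)"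
          using elim(1) by (auto intro: less_imp_le)
      qed
      then show False using N by simp
    qed
  qed
qed

text \<open>The same comparison with the roles reversed: \<open>f\<close> is bounded on the
  horizontal segments and tends to infinity on the sets \<open>S n\<close>.\<close>

lemma small_sets_infinite:
  assumes p: "p \<longlonglongrightarrow> \<i> * of_real y0" and S: "\<And>n. connected (S n)" "\<And>n. S n \<subseteq> right_half" "\<And>n. p n \<in> S n"
    and lim: "\<And>M. \<forall>\<^sub>F n in sequentially. \<forall>z\<in>S n. M < norm (f z)"
    and r0: "r0 > 0"
  shows "\<forall>\<^sub>F n in sequentially. S n \<subseteq> ball (p n) r0"
proof -
  define K where "K = (\<lambda>(\<eta>, \<rho>). f (\<i> * of_real \<eta> + of_real \<rho>)) ` ({y0 - 1..y0 + 1} \<times> {r0 / 4..r0 / 2})"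
  have K: "compact K" unfolding K_def by (rule segment_compact[OF r0])
  obtain r where r: "r > 0" "\<And>w. w \<in> K \<Longrightarrow> norm w \<le> r"
    using compact_imp_bounded[OF K] bounded_pos by blast
  obtain N where N: "real N * ln 2 * (1 - k\<^sup>2) > 64 * pi" using large_N[of "ln 2"] by auto
  have "\<forall>\<^sub>F n in sequentially. dist (p n) (\<i> * of_real y0) < min 1 (r0 / 8)"
    using p r0 by (intro tendstoD) auto
  with lim[of "2 ^ N * r"] show ?thesis
  proof eventually_elim
    case (elim n)
    show ?case
    proof (rule ccontr)
      assume "\<not> S n \<subseteq> ball (p n) r0"
      then obtain z where z: "z \<in> S n" "r0 \<le> norm (z - p n)"
        unfolding subset_eq mem_ball dist_norm by (metis norm_minus_commute not_le)
      define \<eta> where "\<eta> = Im (p n)"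
      have pe: "norm (p n - \<i> * of_real \<eta>) = Re (p n)"
        using S(2,3)[of n] by (auto simp: \<eta>_def cmod_def)
      have Rp: "Re (p n) < r0 / 8" using elim(2) abs_Re_le_cmod[of "p n - \<i> * of_real y0"] by (auto simp: dist_norm)
      have \<eta>: "\<eta> \<in> {y0 - 1..y0 + 1}" using elim(2) abs_Im_le_cmod[of "p n - \<i> * of_real y0"] by (auto simp: dist_norm \<eta>_def)
      have "norm (z - p n) \<le> norm (z - \<i> * of_real \<eta>) + norm (p n - \<i> * of_real \<eta>)"
        using norm_triangle_ineq4[of "z - \<i> * of_real \<eta>" "p n - \<i> * of_real \<eta>"] by simp
      then have zf: "r0 / 2 \<le> norm (z - \<i> * of_real \<eta>)" using z(2) pe Rp r0 by linarith
      have "real N * ln 2 * (1 - k\<^sup>2) \<le> 64 * pi"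
      proof (rule half_circle_crossing[OF S(1,2,3) z(1) _ zf r(1) r0, where c = 0])
        show "norm (p n - \<i> * of_real \<eta>) \<le> r0 / 4" using pe Rp r0 by simp
        have "norm (f (\<i> * of_real \<eta> + of_real \<rho>)) \<le> r" if "\<rho> \<in> {r0/4..r0/2}" for \<rho>
          using that \<eta> by (intro r(2)) (auto simp: K_def intro!: image_eqI[of _ _ "(\<eta>, \<rho>)"])
        then show "(\<forall>z\<in>S n. norm (f z - 0) \<le> r) \<and> (\<forall>\<rho>\<in>{r0/4..r0/2}. 2 ^ N * r \<le> norm (f (\<i> * of_real \<eta> + of_real \<rho>) - 0)) \<or>
              (\<forall>z\<in>S n. 2 ^ N * r \<le> norm (f z - 0)) \<and> (\<forall>\<rho>\<in>{r0/4..r0/2}. norm (f (\<i> * of_real \<eta> + of_real \<rho>) - 0) \<le> r)"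
          using elim(1) by (auto intro: less_imp_le)
      qed
      then show False using N by simp
    qed
  qed
qed

text \<open>Every sufficiently large half circle meets \<open>\<gamma>\<close> where
  \<open>f\<close> is close to \<open>c\<close>. Its logarithmic radius is bad if it also carries a
  point with \<open>|f - c| > \<epsilon> / 2\<close>. Length-area makes the bad set of each centre
  smaller than half of a unit interval, so some radius is good for both centres. Two centres are
  needed because both ends of the chord from \<open>z\<close> to \<open>z + \<i> t\<close> have to
  be controlled later.\<close>

lemma good_half_circles:
  fixes \<gamma> :: "real \<Rightarrow> complex"
  assumes \<gamma>: "continuous_on {0..<1} \<gamma>" "\<And>s. s \<in> {0..<1} \<Longrightarrow> \<gamma> s \<in> right_half"
    and inf: "filterlim \<gamma> at_infinity (at_left 1)" and lim: "((\<lambda>s. f (\<gamma> s)) \<longlongrightarrow> c) (at_left 1)"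
    and \<epsilon>: "\<epsilon> > 0"
  shows "\<exists>R>R0. \<forall>z\<in>right_half. (norm (z - \<i> * of_real \<eta>1) = R \<or> norm (z - \<i> * of_real \<eta>2) = R) \<longrightarrow> norm (f z - c) < \<epsilon>"
proof -
  \<comment> \<open>For a bad set of measure at least \<open>1 / 2\<close> the length-area bound
    would read \<open>N / 4 * (1 - k^2) \<le> 64 * pi\<close>.\<close>
  obtain N where N: "real N * 1 * (1 - k\<^sup>2) > 256 * pi" using large_N[of 1] by auto
  define r where "r = \<epsilon> / 2 / 2 ^ N"
  have r: "r > 0" "2 ^ N * r = \<epsilon> / 2" using \<epsilon> by (auto simp: r_def)
  have "\<forall>\<^sub>F s in at_left 1. norm (f (\<gamma> s) - c) < r"
    using tendstoD[OF lim r(1)] by (simp add: dist_norm)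
  then obtain b where b: "b < 1" "\<And>s. b < s \<Longrightarrow> s < 1 \<Longrightarrow> norm (f (\<gamma> s) - c) < r"
    by (auto simp: eventually_at_left_field)
  define s0 where "s0 = max 0 ((b + 1) / 2)"
  have s0: "s0 \<in> {0..<1}" "b < s0" using b(1) by (auto simp: s0_def max_def field_simps)
  define R1 where "R1 = max (max R0 1) (norm (\<gamma> s0) + \<bar>\<eta>1\<bar> + \<bar>\<eta>2\<bar>) + 1"
  have R1: "R1 > 0" by (simp add: R1_def)
  \<comment> \<open>Heights in the unit interval above \<open>y1\<close> stand for radii between
    \<open>R1\<close> and \<open>exp 1 * R1\<close>. They exceed \<open>R0\<close> and are so large
    that \<open>\<gamma> s0\<close> lies inside the half circle.\<close>
  define y1 where "y1 = - ln R1 - 1"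
  define E where "E \<eta> y x = f (\<i> * of_real \<eta> + exp (\<i> * Complex x y))" for \<eta> y x
  define B where "B \<eta> = {y\<in>{y1<..<y1 + 1}. \<exists>x\<in>{-pi/2<..<pi/2}. \<epsilon> / 2 < norm (E \<eta> y x - c)}" for \<eta>
  have inH: "\<i> * of_real \<eta> + exp (\<i> * Complex x y) \<in> right_half" if "x \<in> {-pi/2<..<pi/2}" for x y \<eta>
    using that by (auto simp: Re_exp intro!: mult_pos_pos cos_gt_zero_pi)
  have oB: "open (B \<eta>)" for \<eta>
  proof -
    have "open ({y1<..<y1 + 1} \<inter> (\<lambda>y. norm (E \<eta> y x - c)) -` {\<epsilon>/2<..})" if x: "x \<in> {-pi/2<..<pi/2}" for x
    proof (rule continuous_open_preimage)
      show "continuous_on {y1<..<y1 + 1} (\<lambda>y. norm (E \<eta> y x - c))" unfolding E_def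
        using inH[OF x] by (intro continuous_intros continuous_on_compose2[OF f_cont]) (auto simp: Complex_eq intro!: continuous_intros)
    qed auto
    then have "open (\<Union>x\<in>{-pi/2<..<pi/2}. {y1<..<y1 + 1} \<inter> (\<lambda>y. norm (E \<eta> y x - c)) -` {\<epsilon>/2<..})" by blast
    also have "(\<Union>x\<in>{-pi/2<..<pi/2}. {y1<..<y1 + 1} \<inter> (\<lambda>y. norm (E \<eta> y x - c)) -` {\<epsilon>/2<..}) = B \<eta>" by (auto simp: B_def)
    finally show ?thesis .
  qed
  have small: "measure lborel (B \<eta>) < 1 / 2" if \<eta>: "\<eta> = \<eta>1 \<or> \<eta> = \<eta>2" for \<eta>
  proof (rule ccontr)
    assume "\<not> measure lborel (B \<eta>) < 1 / 2"
    then have "(1/2)\<^sup>2 \<le> (measure lborel (B \<eta>))\<^sup>2" by (intro power_mono) auto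
    moreover have "k\<^sup>2 < 1" using k by (simp add: abs_square_less_1)
    ultimately have "real N * (1/2)\<^sup>2 * (1 - k\<^sup>2) \<le> real N * (measure lborel (B \<eta>))\<^sup>2 * (1 - k\<^sup>2)"
      by (intro mult_right_mono mult_left_mono) auto
    also have "\<dots> \<le> 64 * (pi * ((y1 + 1) - y1))"
    proof (rule half_circle_length_area[where \<eta> = \<eta> and c = c and r = r])
      fix y assume y: "y \<in> B \<eta>"
      have y': "y1 < y" "y < y1 + 1" using y by (auto simp: B_def)
      then have "ln R1 < - y" by (simp add: y1_def)
      then have big: "R1 < exp (- y)" using R1 by (metis exp_less_mono exp_ln)
      obtain x where x: "x \<in> {-pi/2<..<pi/2}" "\<epsilon> / 2 < norm (E \<eta> y x - c)" using y by (auto simp: B_def)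
      define zb where "zb = \<i> * of_real \<eta> + exp (\<i> * Complex x y)"
      have zb: "zb \<in> right_half" "norm (zb - \<i> * of_real \<eta>) = exp (-y)" "2 ^ N * r \<le> norm (f zb - c)"
        using inH[OF x(1)] x(2) by (auto simp: zb_def E_def r(2))
      have e1: "\<forall>\<^sub>F s in at_left 1. norm (\<gamma> s) > exp (- y) + \<bar>\<eta>\<bar>"
        using inf by (auto simp: filterlim_at_infinity_conv_norm_at_top filterlim_at_top_dense)
      have e2: "\<forall>\<^sub>F s in at_left 1. s > s0 \<and> s < (1::real)"
        using s0 by (auto simp: eventually_at_left_field intro!: exI[of _ s0])
      obtain s1 where s1: "norm (\<gamma> s1) > exp (- y) + \<bar>\<eta>\<bar>" "s1 > s0" "s1 < 1"
        using eventually_happens'[OF trivial_limit_at_left_real eventually_conj[OF e1 e2]] by blast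
      have "norm (\<gamma> s1 - \<i> * of_real \<eta>) \<ge> exp (- y)"
        using s1(1) norm_triangle_ineq2[of "\<gamma> s1" "\<i> * of_real \<eta>"] by (simp add: norm_mult)
      moreover have "norm (\<gamma> s0 - \<i> * of_real \<eta>) \<le> exp (- y)"
        using norm_triangle_ineq4[of "\<gamma> s0" "\<i> * of_real \<eta>"] big \<eta> by (auto simp: norm_mult R1_def)
      moreover have "continuous_on {s0..s1} (\<lambda>s. norm (\<gamma> s - \<i> * of_real \<eta>))"
        using s0 s1 by (intro continuous_intros continuous_on_subset[OF \<gamma>(1)]) auto
      ultimately obtain s where s: "s0 \<le> s" "s \<le> s1" "norm (\<gamma> s - \<i> * of_real \<eta>) = exp (-y)"
        using IVT'[of "\<lambda>s. norm (\<gamma> s - \<i> * of_real \<eta>)" s0 "exp (-y)" s1] s1 by auto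
      show "\<exists>za\<in>right_half. \<exists>zb\<in>right_half.
          norm (za - \<i> * of_real \<eta>) = exp (- y) \<and> norm (zb - \<i> * of_real \<eta>) = exp (- y) \<and>
          norm (f za - c) \<le> r \<and> 2 ^ N * r \<le> norm (f zb - c)"
        using zb s b(2)[of s] s0 s1 \<gamma>(2)[of s] by (intro bexI[of _ "\<gamma> s"] bexI[of _ zb]) auto
    qed (use oB r in \<open>auto simp: B_def\<close>)
    finally show False using N by (simp add: power2_eq_square)
  qed
  have "\<exists>y\<in>{y1<..<y1+1}. y \<notin> B \<eta>1 \<and> y \<notin> B \<eta>2"
  proof (rule ccontr)
    assume "\<not> ?thesis"
    then have sub: "{y1<..<y1+1} \<subseteq> B \<eta>1 \<union> B \<eta>2" by auto
    have "{y1..y1+1} \<in> fmeasurable lborel" by (rule fmeasurableI) auto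
    then have fm: "B \<eta> \<in> fmeasurable lborel" for \<eta>
      by (rule fmeasurableI2) (use oB[of \<eta>] in \<open>auto simp: B_def\<close>)
    have "1 = measure lborel {y1<..<y1+1}" by simp
    also have "\<dots> \<le> measure lborel (B \<eta>1 \<union> B \<eta>2)"
      using sub by (intro measure_mono_fmeasurable fmeasurable.Un fm) auto
    also have "\<dots> \<le> measure lborel (B \<eta>1) + measure lborel (B \<eta>2)"
      using oB by (intro measure_Un_le) auto
    finally show False using small[of \<eta>1] small[of \<eta>2] by simp
  qed
  then obtain y where y: "y1 < y" "y < y1 + 1" "y \<notin> B \<eta>1" "y \<notin> B \<eta>2" by auto
  have "norm (f z - c) < \<epsilon>" if z: "z \<in> right_half" "norm (z - \<i> * of_real \<eta>) = exp (-y)" "y \<notin> B \<eta>" for z \<eta>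
  proof -
    obtain x where "- pi / 2 < x" "x < pi / 2" "z = \<i> * of_real \<eta> + exp (\<i> * Complex x y)"
      using half_circle_param[OF z(1,2)] .
    then have "\<not> \<epsilon> / 2 < norm (f z - c)" using z(3) y(1,2) by (auto simp: B_def E_def)
    then show ?thesis using \<epsilon> by simp
  qed
  moreover have "ln R1 < - y" using y by (simp add: y1_def)
  then have "R1 < exp (- y)" using R1 by (metis exp_less_mono exp_ln)
  then have "R0 < exp (- y)" by (simp add: R1_def)
  ultimately show ?thesis using y by (intro exI[of _ "exp (-y)"]) auto
qed

end

subsection \<open>A continuous argument of the chords\<close>

text \<open>Distinct values with equal \<open>cis\<close> are at least \<open>2 * pi\<close> apart,
  so a continuous choice on a connected set cannot change. All comparisons of branches of arguments
  below rest on this.\<close>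

lemma cis_constant_imp_constant:
  fixes a :: "'a::topological_space \<Rightarrow> real"
  assumes S: "connected S" and a: "continuous_on S a" and c: "\<And>s. s \<in> S \<Longrightarrow> cis (a s) = c"
    and st: "s \<in> S" "t \<in> S"
  shows "a s = a t"
proof -
  have "a constant_on S"
  proof (rule continuous_discrete_range_constant[OF S a])
    fix x assume x: "x \<in> S"
    have "2 * pi \<le> norm (a y - a x)" if y: "y \<in> S" "a y \<noteq> a x" for y
    proof -
      have "cis (a y - a x) = 1" using c[OF x] c[OF y(1)] by (metis cis_divide cis_neq_zero divide_self)
      then have "cos (a y - a x) = 1" by (metis cis.sel(1) one_complex.sel(1))
      then obtain n :: int where n: "a y - a x = of_int n * 2 * pi" using cos_one_2pi_int by auto
      then have "n \<noteq> 0" using y by auto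
      then have "1 \<le> \<bar>real_of_int n\<bar>" by linarith
      then have "1 * (2 * pi) \<le> \<bar>real_of_int n\<bar> * (2 * pi)" by (intro mult_right_mono) auto
      then show ?thesis by (simp add: n abs_mult)
    qed
    then show "\<exists>e>0. \<forall>y. y \<in> S \<and> a y \<noteq> a x \<longrightarrow> e \<le> norm (a y - a x)"
      by (intro exI[of _ "2 * pi"]) auto
  qed
  then show ?thesis using st unfolding constant_on_def by metis
qed

text \<open>The integral form of the difference quotient; it extends continuously to the diagonal,
  with the derivative as its value there.\<close>

definition divided_diff :: "(complex \<Rightarrow> complex) \<Rightarrow> complex \<Rightarrow> complex \<Rightarrow> complex" where
  "divided_diff \<phi> x y = integral {0..1} (\<lambda>s. deriv \<phi> (x + of_real s * (y - x)))"

lemma divided_diff: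
  assumes "\<phi> holomorphic_on U" "open U" "convex U" "x \<in> U" "y \<in> U"
  shows "(y - x) * divided_diff \<phi> x y = \<phi> y - \<phi> x"
proof -
  have in_U: "x + of_real s * (y - x) \<in> U" if "s \<in> {0..1}" for s
    using convexD_alt[OF assms(3,4,5), of s] that by (simp add: scaleR_conv_of_real algebra_simps)
  have "((\<lambda>s. (y - x) * deriv \<phi> (x + of_real s * (y - x))) has_integral \<phi> (x + of_real 1 * (y - x)) - \<phi> (x + of_real 0 * (y - x))) {0..1}"
  proof (rule fundamental_theorem_of_calculus)
    fix s :: real assume s: "s \<in> {0..1}"
    have "((\<lambda>s. x + of_real s * (y - x)) has_vector_derivative (y - x)) (at s within {0..1})"
      by (auto intro!: derivative_eq_intros)
    moreover have "(\<phi> has_field_derivative deriv \<phi> (x + of_real s * (y - x))) (at (x + of_real s * (y - x)) within (\<lambda>s. x + of_real s * (y - x)) ` {0..1})"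
      using holomorphic_derivI[OF assms(1,2) in_U[OF s]] by (rule has_field_derivative_at_within)
    ultimately show "((\<lambda>s. \<phi> (x + of_real s * (y - x))) has_vector_derivative (y - x) * deriv \<phi> (x + of_real s * (y - x))) (at s within {0..1})"
      using field_vector_diff_chain_within by (fastforce simp: o_def)
  qed simp
  then have *: "((\<lambda>s. (y - x) * deriv \<phi> (x + of_real s * (y - x))) has_integral \<phi> y - \<phi> x) {0..1}" by simp
  show ?thesis
    unfolding divided_diff_def using integral_unique[OF *] by simp
qed

lemma divided_diff_same: "divided_diff \<phi> x x = deriv \<phi> x"
  by (simp add: divided_diff_def)

lemma continuous_on_divided_diff:
  assumes "\<phi> holomorphic_on U" "open U" "convex U"
  shows "continuous_on (U \<times> U) (\<lambda>v. divided_diff \<phi> (fst v) (snd v))"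
proof -
  have in_U: "x + of_real s * (y - x) \<in> U" if "s \<in> {0..1}" "x \<in> U" "y \<in> U" for s x y
    using convexD_alt[OF assms(3) that(2,3), of s] that by (simp add: scaleR_conv_of_real algebra_simps)
  have "continuous_on (U \<times> U) (\<lambda>v. integral (cbox 0 1) ((\<lambda>v s. deriv \<phi> (fst v + of_real s * (snd v - fst v))) v))"
    by (rule integral_continuous_on_param)
      (use in_U in \<open>auto simp: case_prod_unfold intro!: continuous_intros
         continuous_on_compose2[OF holomorphic_on_imp_continuous_on[OF holomorphic_deriv[OF assms(1,2)]]]\<close>)
  then show ?thesis by (simp add: divided_diff_def)
qed

lemma convex_right_half: "convex right_half" by (rule convex_halfspace_Re_gt)

text \<open>Removing the leftward horizontal chords cuts the circle of directions, so that one
  continuous argument can serve all remaining chords. Vertical chords of both orientations are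
  kept.\<close>

definition chord_set :: "(complex \<times> complex) set" where
  "chord_set = {(p, x). p \<in> right_half \<and> x \<in> right_half \<and> x - p \<notin> \<real>\<^sub>\<le>\<^sub>0}"

lemma nonpos_Reals_scale: "0 < s \<Longrightarrow> of_real s * z \<in> \<real>\<^sub>\<le>\<^sub>0 \<longleftrightarrow> z \<in> \<real>\<^sub>\<le>\<^sub>0" for s :: real and z :: complex
  by (auto simp: complex_nonpos_Reals_iff mult_le_0_iff)

lemma Arg_small:
  assumes "norm q < 1"
  shows "1 + q \<notin> \<real>\<^sub>\<le>\<^sub>0" "\<bar>Arg (1 + q)\<bar> < pi / 2"
proof -
  have R: "Re (1 + q) > 0" using assms abs_Re_le_cmod[of q] by auto
  then show "1 + q \<notin> \<real>\<^sub>\<le>\<^sub>0" by (auto simp: complex_nonpos_Reals_iff)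
  show "\<bar>Arg (1 + q)\<bar> < pi / 2" using R by (metis Arg_Re_pos)
qed

context half_plane_qc
begin

text \<open>Reversing an upward chord subtracts \<open>pi\<close> instead of adding it, because its
  direction can be turned only clockwise through the right, away from the cut. \<open>a0\<close> is
  an argument of the vertical derivative of \<open>f\<close>, reached as the limit of short upward
  chords.\<close>

definition chord_argument :: "(complex \<Rightarrow> complex \<Rightarrow> real) \<Rightarrow> (complex \<Rightarrow> real) \<Rightarrow> bool" where
  "chord_argument \<Theta> a0 \<longleftrightarrow>
     continuous_on chord_set (\<lambda>(p, x). \<Theta> p x) \<and>
     (\<forall>p x. (p, x) \<in> chord_set \<longrightarrow> f x - f p = of_real (norm (f x - f p)) * cis (\<Theta> p x)) \<and>
     (\<forall>p\<in>right_half. \<forall>x\<in>right_half. Im p < Im x \<longrightarrow> \<Theta> x p = \<Theta> p x - pi) \<and>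
     (\<forall>z\<in>right_half. ((\<lambda>\<epsilon>. \<Theta> z (z + of_real \<epsilon> * \<i>)) \<longlongrightarrow> a0 z) (at_right 0)) \<and>
     continuous_on right_half a0 \<and>
     (\<forall>z\<in>right_half. \<i> * deriv h z + cnj (\<i> * deriv g z) = of_real (norm (\<i> * deriv h z + cnj (\<i> * deriv g z))) * cis (a0 z))"

text \<open>Blowing up the diagonal, \<open>x = p + e d\<close> with \<open>e \<ge> 0\<close>, gives a starlike parameter set on which the
  divided difference of \<open>f\<close> does not vanish; it has a continuous argument there, and \<open>e = 0\<close> yields
  the argument of the derivative in the vertical direction.\<close>
lemma chord_argument_exists: "\<exists>\<Theta> a0. chord_argument \<Theta> a0"
proof -
  define X :: "(complex \<times> complex \<times> real) set" where
    "X = {(z, d, e). z \<in> right_half \<and> z + of_real e * d \<in> right_half \<and> d \<notin> \<real>\<^sub>\<le>\<^sub>0 \<and> e \<ge> 0}"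
  define G where "G v = (case v of (z, d, e) \<Rightarrow> divided_diff h z (z + of_real e * d) * d + cnj (divided_diff g z (z + of_real e * d) * d))"
    for v :: "complex \<times> complex \<times> real"
  have star: "starlike X"
    unfolding starlike_def
  proof (intro bexI ballI)
    show "(1, 1, 0) \<in> X" by (simp add: X_def complex_nonpos_Reals_iff)
    fix v assume v: "v \<in> X"
    obtain z d e where vv: "v = (z, d, e)" by (cases v) auto
    have zde: "Re z > 0" "Re z + e * Re d > 0" "d \<notin> \<real>\<^sub>\<le>\<^sub>0" "e \<ge> 0" using v by (auto simp: X_def vv)
    show "closed_segment (1, 1, 0) v \<subseteq> X"
    proof
      fix w assume "w \<in> closed_segment (1, 1, 0) v"
      then obtain u where u: "0 \<le> u" "u \<le> 1" "w = (1 - u) *\<^sub>R (1, 1, 0) + u *\<^sub>R v" by (auto simp: in_segment)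
      define z' d' e' where "z' = of_real (1 - u) + of_real u * z" and "d' = of_real (1 - u) + of_real u * d" and "e' = u * e"
      have w: "w = (z', d', e')" by (simp add: u vv z'_def d'_def e'_def scaleR_conv_of_real)
      have Rz: "Re z' > 0"
      proof (cases "u = 1")
        case False
        then have "1 - u > 0" using u by simp
        moreover have "u * Re z \<ge> 0" using u zde by simp
        ultimately show ?thesis by (simp add: z'_def)
      qed (use zde in \<open>simp add: z'_def\<close>)
      moreover have "Re (z' + of_real e' * d') > 0"
      proof (cases "u = 1")
        case True then show ?thesis using zde by (simp add: z'_def d'_def e'_def)
      next
        case False
        then have u1: "1 - u > 0" using u by simp
        have "Re z + u * e * Re d \<ge> 0"
        proof (cases "Re d \<ge> 0")
          case True then show ?thesis using zde u by simp
        next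
          case False
          have "u * (e * Re d) \<ge> 1 * (e * Re d)"
            using False u zde(4) by (intro mult_right_mono_neg) (auto simp: mult_nonneg_nonpos)
          then show ?thesis using zde by (simp add: mult.assoc)
        qed
        then have "0 \<le> u * (Re z + u * e * Re d)" using u by simp
        moreover have "0 \<le> u * e * (1 - u)" using u zde by simp
        moreover have "Re (z' + of_real e' * d') = (1 - u) + u * (Re z + u * e * Re d) + u * e * (1 - u)"
          by (simp add: z'_def d'_def e'_def algebra_simps)
        ultimately show ?thesis using u1 by linarith
      qed
      moreover have "d' \<notin> \<real>\<^sub>\<le>\<^sub>0"
      proof
        assume "d' \<in> \<real>\<^sub>\<le>\<^sub>0"
        then have d': "(1 - u) + u * Re d \<le> 0" "u * Im d = 0" by (auto simp: d'_def complex_nonpos_Reals_iff)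
        then have "u \<noteq> 0" by auto
        then have "Im d = 0" "u > 0" using d' u by auto
        then have "Re d > 0" using zde(3) by (auto simp: complex_nonpos_Reals_iff)
        then have "u * Re d > 0" using \<open>u > 0\<close> by simp
        then show False using d'(1) u by linarith
      qed
      moreover have "e' \<ge> 0" using u zde by (simp add: e'_def)
      ultimately show "w \<in> X" by (simp add: X_def w)
    qed
  qed
  have contG: "continuous_on X G"
    unfolding G_def case_prod_unfold
    by (intro continuous_intros continuous_on_compose2[OF continuous_on_divided_diff[OF h_hol open_U convex_right_half],
          of X "\<lambda>v. (fst v, fst v + of_real (snd (snd v)) * fst (snd v))", simplified]
         continuous_on_compose2[OF continuous_on_divided_diff[OF g_hol open_U convex_right_half],
          of X "\<lambda>v. (fst v, fst v + of_real (snd (snd v)) * fst (snd v))", simplified])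
      (auto simp: X_def)
  have G_pos: "of_real e * G (z, d, e) = f (z + of_real e * d) - f z" if "(z, d, e) \<in> X" for z d e
  proof -
    have i: "z \<in> right_half" "z + of_real e * d \<in> right_half" using that by (auto simp: X_def)
    have dh: "of_real e * d * divided_diff h z (z + of_real e * d) = h (z + of_real e * d) - h z"
      using divided_diff[OF h_hol open_U convex_right_half i] by simp
    have dg: "of_real e * d * divided_diff g z (z + of_real e * d) = g (z + of_real e * d) - g z"
      using divided_diff[OF g_hol open_U convex_right_half i] by simp
    have "of_real e * G (z, d, e) = of_real e * d * divided_diff h z (z + of_real e * d) + cnj (of_real e * d * divided_diff g z (z + of_real e * d))"
      by (simp add: G_def algebra_simps)
    also have "\<dots> = f (z + of_real e * d) - f z" unfolding dh dg using f_eq i by simp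
    finally show ?thesis .
  qed
  have G0: "G (z, d, 0) = deriv h z * d + cnj (deriv g z * d)" for z d by (simp add: G_def divided_diff_same)
  have small: "norm (deriv g z * d) < norm (deriv h z * d)" if "z \<in> right_half" "d \<noteq> 0" for z d
  proof -
    have "norm (deriv g z) \<le> k * norm (deriv h z)" using dil that by auto
    also have "\<dots> < 1 * norm (deriv h z)" using k dh_nz[OF that(1)] by (intro mult_strict_right_mono) auto
    finally show ?thesis using that by (simp add: norm_mult)
  qed
  \<comment> \<open>At \<open>e = 0\<close> the complex linear part of the derivative dominates the
    antilinear part; for \<open>e > 0\<close> injectivity of \<open>f\<close> applies.\<close>
  have G_nz: "G v \<noteq> 0" if "v \<in> X" for v
  proof -
    obtain z d e where vv: "v = (z, d, e)" by (cases v) auto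
    have d: "d \<noteq> 0" using that by (auto simp: X_def vv)
    show ?thesis
    proof (cases "e = 0")
      case True
      have "z \<in> right_half" using that by (auto simp: X_def vv)
      from small[OF this d] show ?thesis unfolding vv True G0
        by (metis add_eq_0_iff2 complex_mod_cnj less_irrefl norm_minus_cancel)
    next
      case False
      have i: "z \<in> right_half" "z + of_real e * d \<in> right_half" using that by (auto simp: X_def vv)
      have "z + of_real e * d \<noteq> z" using False d by simp
      then have "f (z + of_real e * d) \<noteq> f z" using f_inj i by (metis inj_onD)
      then show ?thesis using G_pos[of z d e] that vv by auto
    qed
  qed
  obtain L where L: "continuous_on X L" "\<And>v. v \<in> X \<Longrightarrow> G v = exp (L v)"
    using continuous_logarithm_on_contractible[OF contG starlike_imp_contractible[OF star] G_nz] by blast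
  define A where "A z d e = Im (L (z, d, e))" for z d e
  have GA: "G (z, d, e) = of_real (norm (G (z, d, e))) * cis (A z d e)" if "(z, d, e) \<in> X" for z d e
    using L(2)[OF that] by (simp add: A_def exp_eq_polar norm_mult)
  have dirA: "cis (A z d e) = G (z, d, e) / of_real (norm (G (z, d, e)))" if "(z, d, e) \<in> X" for z d e
    using GA[OF that] G_nz[OF that] by (metis nonzero_mult_div_cancel_left norm_eq_zero of_real_eq_0_iff)
  have contA: "continuous_on S (\<lambda>s. A (u s) (v s) (w s))"
    if "continuous_on S u" "continuous_on S v" "continuous_on S w" "\<And>s. s \<in> S \<Longrightarrow> (u s, v s, w s) \<in> X"
    for S :: "'t::topological_space set" and u v w
    unfolding A_def by (intro continuous_intros continuous_on_compose2[OF L(1)] that) (use that in auto)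
  define \<Theta> where "\<Theta> p x = A p (x - p) 1" for p x
  have XT: "(p, x - p, 1) \<in> X \<longleftrightarrow> (p, x) \<in> chord_set" for p x by (auto simp: X_def chord_set_def)
  have c1: "continuous_on chord_set (\<lambda>(p, x). \<Theta> p x)"
    unfolding \<Theta>_def case_prod_unfold by (intro contA continuous_intros) (use XT in auto)
  have c2: "f x - f p = of_real (norm (f x - f p)) * cis (\<Theta> p x)" if "(p, x) \<in> chord_set" for p x
  proof -
    have "(p, x - p, 1) \<in> X" using that XT by simp
    then show ?thesis using GA[of p "x - p" 1] G_pos[of p "x - p" 1] by (simp add: \<Theta>_def)
  qed
  \<comment> \<open>The same chord can be written with direction \<open>s d\<close> and scale
    \<open>e / s\<close>, and the argument does not depend on \<open>s\<close>.\<close>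
  have scale: "\<Theta> z (z + of_real e * d) = A z d e" if "(z, d, e) \<in> X" "e > 0" for z d e
  proof -
    have *: "(z, of_real s * d, e / s) \<in> X" if "s > 0" for s
      using \<open>(z, d, e) \<in> X\<close> that by (auto simp: X_def nonpos_Reals_scale)
    have "A z (of_real e * d) (e / e) = A z (of_real 1 * d) (e / 1)"
    proof (rule cis_constant_imp_constant[where S = "{0<..}" and c = "cis (A z d e)" and a = "\<lambda>s. A z (of_real s * d) (e / s)"])
      show "continuous_on {0<..} (\<lambda>s. A z (of_real s * d) (e / s))"
        by (intro contA continuous_intros) (use * in auto)
      fix s :: real assume "s \<in> {0<..}"
      then have s: "s > 0" by simp
      have "G (z, of_real s * d, e / s) = of_real s * G (z, d, e)" using s by (simp add: G_def algebra_simps)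
      then show "cis (A z (of_real s * d) (e / s)) = cis (A z d e)"
        unfolding dirA[OF *[OF s]] dirA[OF that(1)] using s by (simp add: norm_mult)
    qed (use that in auto)
    then show ?thesis using that by (simp add: \<Theta>_def)
  qed
  \<comment> \<open>In direction \<open>cis s\<close> the derivative is
    \<open>deriv h z * cis s\<close> times \<open>1 + q * cis (- 2 * s)\<close> with
    \<open>|q| < 1\<close>. The last factor stays in the right half plane and has the same value at
    both ends, so the argument changes exactly by the half turn of the direction.\<close>
  have half_turn: "A z (-\<i>) 0 = A z \<i> 0 - pi" if z: "z \<in> right_half" for z
  proof -
    define q where "q = cnj (deriv g z) / deriv h z"
    have q: "norm q < 1" using small[OF z, of 1] dh_nz[OF z] by (simp add: q_def norm_divide)
    have *: "(z, cis s, 0) \<in> X" if "s \<in> {-pi/2..pi/2}" for s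
    proof -
      have "cis s \<notin> \<real>\<^sub>\<le>\<^sub>0"
      proof
        assume "cis s \<in> \<real>\<^sub>\<le>\<^sub>0"
        then have "cos s \<le> 0" "sin s = 0" by (auto simp: complex_nonpos_Reals_iff)
        moreover have "cos s \<ge> 0" using that by (intro cos_ge_zero) auto
        ultimately show False using sin_cos_squared_add[of s] by simp
      qed
      then show ?thesis using z by (simp add: X_def)
    qed
    let ?a = "\<lambda>s. A z (cis s) 0 - s - Arg (1 + q * cis (- 2 * s))"
    have nq: "norm (q * cis (- 2 * s)) < 1" for s using q by (simp add: norm_mult)
    have "?a (pi/2) = ?a (- pi/2)"
    proof (rule cis_constant_imp_constant[where S = "{-pi/2..pi/2}" and c = "deriv h z / of_real (norm (deriv h z))" and a = ?a])
      show "continuous_on {-pi/2..pi/2} ?a"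
        by (intro continuous_intros contA continuous_on_compose2[OF continuous_on_Arg])
          (use * Arg_small(1)[OF nq] in auto)
      fix s assume s: "s \<in> {-pi/2..pi/2}"
      define c where "c = 1 + q * cis (- 2 * s)"
      have c0: "c \<noteq> 0" using Arg_small(1)[OF nq[of s]] unfolding c_def by auto
      have "G (z, cis s, 0) = deriv h z * cis s * c"
      proof -
        have "cnj (deriv g z) * cis (- s) = deriv h z * cis s * (q * cis (- 2 * s))"
        proof -
          have "deriv h z * cis s * (q * cis (- 2 * s)) = cnj (deriv g z) * (cis s * cis (- 2 * s))"
            using dh_nz[OF z] by (simp add: q_def)
          also have "cis s * cis (- 2 * s) = cis (- s)" by (simp add: cis_mult)
          finally show ?thesis by simp
        qed
        then show ?thesis by (simp add: G0 c_def cis_cnj algebra_simps)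
      qed
      then have "cis (A z (cis s) 0) = deriv h z / of_real (norm (deriv h z)) * cis s * (c / of_real (norm c))"
        using dirA[OF *[OF s]] by (simp add: norm_mult)
      also have "c / of_real (norm c) = cis (Arg c)" using c0 cis_Arg[OF c0] by (simp add: sgn_eq)
      finally have "cis (A z (cis s) 0) = deriv h z / of_real (norm (deriv h z)) * (cis s * cis (Arg c))" by simp
      then show "cis (A z (cis s) 0 - s - Arg (1 + q * cis (- 2 * s))) = deriv h z / of_real (norm (deriv h z))"
        unfolding c_def[symmetric] by (simp add: cis_divide[symmetric])
    qed auto
    moreover have "cis (- pi) = -1" by (simp add: complex_eq_iff)
    ultimately show ?thesis by (simp add: cis_minus_pi_half)
  qed
  have link: "\<Theta> x p = \<Theta> p x - pi" if px: "p \<in> right_half" "x \<in> right_half" "Im p < Im x" for p x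
  proof -
    define z where "z = (1::complex)"
    have z: "z \<in> right_half" by (simp add: z_def)
    have X1: "(z, \<i>, e) \<in> X" "(z + of_real e * \<i>, - \<i>, e) \<in> X" if "e \<ge> 0" for e
      using that by (auto simp: X_def z_def complex_nonpos_Reals_iff)
    \<comment> \<open>As the scale grows from \<open>0\<close>, the chord from \<open>1\<close>
      upwards and its reverse stay opposite. This carries the half turn from the tangent to a proper
      chord; the convex set \<open>T\<close> then carries it to all upward chords.\<close>
    have 1: "A (z + of_real 1 * \<i>) (-\<i>) 1 - A z \<i> 1 = A (z + of_real 0 * \<i>) (-\<i>) 0 - A z \<i> 0"
    proof (rule cis_constant_imp_constant[where S = "{0..1}" and c = "-1" and a = "\<lambda>e. A (z + of_real e * \<i>) (-\<i>) e - A z \<i> e"])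
      show "continuous_on {0..1} (\<lambda>e. A (z + of_real e * \<i>) (-\<i>) e - A z \<i> e)"
        by (intro continuous_intros contA) (use X1 in auto)
      fix e :: real assume "e \<in> {0..1}"
      then have e: "e \<ge> 0" by simp
      have "G (z + of_real e * \<i>, - \<i>, e) = - G (z, \<i>, e)"
      proof (cases "e = 0")
        case True then show ?thesis by (simp add: G0)
      next
        case False
        have "of_real e * G (z + of_real e * \<i>, - \<i>, e) = - (of_real e * G (z, \<i>, e))"
          unfolding G_pos[OF X1(1)[OF e]] G_pos[OF X1(2)[OF e]] by simp
        then have "of_real e * G (z + of_real e * \<i>, - \<i>, e) = of_real e * (- G (z, \<i>, e))" by (simp only: mult_minus_right)
        then show ?thesis using False unfolding mult_cancel_left of_real_eq_0_iff by blast
      qed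
      then have "cis (A (z + of_real e * \<i>) (-\<i>) e) = - cis (A z \<i> e)"
        unfolding dirA[OF X1(1)[OF e]] dirA[OF X1(2)[OF e]] by simp
      then show "cis (A (z + of_real e * \<i>) (-\<i>) e - A z \<i> e) = -1" by (simp add: cis_divide[symmetric])
    qed auto
    have base: "\<Theta> (z + \<i>) z = \<Theta> z (z + \<i>) - pi"
      using 1 half_turn[OF z] scale[OF X1(1)[of 1]] scale[OF X1(2)[of 1]] by simp
    have chord: "(p, x) \<in> chord_set" "(x, p) \<in> chord_set" if "p \<in> right_half" "x \<in> right_half" "Im p < Im x" for p x
      using that by (auto simp: chord_set_def complex_nonpos_Reals_iff)
    define T where "T = {v. fst v \<in> right_half \<and> snd v \<in> right_half \<and> Im (fst v) < Im (snd v)}"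
    have cT: "convex T"
    proof -
      have "convex (right_half \<times> right_half)" by (intro convex_Times convex_right_half)
      moreover have "convex {v::complex\<times>complex. Im (fst v) < Im (snd v)}"
      proof (rule convexI)
        fix x y :: "complex \<times> complex" and u v :: real
        assume a: "x \<in> {v. Im (fst v) < Im (snd v)}" "y \<in> {v. Im (fst v) < Im (snd v)}" "0 \<le> u" "0 \<le> v" "u + v = 1"
        then have "u * Im (fst x) + v * Im (fst y) < u * Im (snd x) + v * Im (snd y)"
          by (cases "u = 0") (auto intro!: add_less_le_mono mult_left_mono mult_strict_left_mono)
        then show "u *\<^sub>R x + v *\<^sub>R y \<in> {v. Im (fst v) < Im (snd v)}" by simp
      qed
      ultimately have "convex ((right_half \<times> right_half) \<inter> {v. Im (fst v) < Im (snd v)})" by (rule convex_Int)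
      also have "(right_half \<times> right_half) \<inter> {v. Im (fst v) < Im (snd v)} = T" by (auto simp: T_def)
      finally show ?thesis .
    qed
    have "\<Theta> (snd (p, x)) (fst (p, x)) - \<Theta> (fst (p, x)) (snd (p, x)) = \<Theta> (snd (z, z + \<i>)) (fst (z, z + \<i>)) - \<Theta> (fst (z, z + \<i>)) (snd (z, z + \<i>))"
    proof (rule cis_constant_imp_constant[where S = T and c = "-1" and a = "\<lambda>v. \<Theta> (snd v) (fst v) - \<Theta> (fst v) (snd v)"])
      show "connected T" by (rule convex_connected[OF cT])
      show "continuous_on T (\<lambda>v. \<Theta> (snd v) (fst v) - \<Theta> (fst v) (snd v))"
        unfolding \<Theta>_def by (intro continuous_intros contA) (auto simp: XT T_def intro: chord simp del: prod.collapse)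
      fix v assume "v \<in> T"
      then have v: "(fst v, snd v) \<in> chord_set" "(snd v, fst v) \<in> chord_set"
        by (auto simp: T_def intro: chord simp del: prod.collapse)
      define a b where "a = fst v" and "b = snd v"
      have "a \<noteq> b" using v by (auto simp: chord_set_def a_def b_def)
      then have ne: "f a \<noteq> f b" using v f_inj by (auto simp: chord_set_def a_def b_def dest: inj_onD)
      have "of_real (norm (f b - f a)) * cis (\<Theta> b a) = - (of_real (norm (f b - f a)) * cis (\<Theta> a b))"
        using c2[OF v(1)] c2[OF v(2)] unfolding a_def b_def by (metis minus_diff_eq norm_minus_commute)
      then have "cis (\<Theta> b a) = - cis (\<Theta> a b)" using ne by (metis mult_cancel_left mult_minus_right norm_eq_zero of_real_eq_0_iff right_minus_eq)
      then show "cis (\<Theta> (snd v) (fst v) - \<Theta> (fst v) (snd v)) = -1" unfolding a_def b_def by (simp add: cis_divide[symmetric])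
    qed (use px z in \<open>auto simp: T_def\<close>)
    then show ?thesis using base by simp
  qed
  have lim0: "((\<lambda>\<epsilon>. \<Theta> z (z + of_real \<epsilon> * \<i>)) \<longlongrightarrow> A z \<i> 0) (at_right 0)" if z: "z \<in> right_half" for z
  proof -
    have X1: "(z, \<i>, e) \<in> X" if "e \<ge> 0" for e using that z by (auto simp: X_def complex_nonpos_Reals_iff)
    have "continuous_on {0..1} (\<lambda>e. A z \<i> e)" by (intro contA continuous_intros) (use X1 in auto)
    then have "((\<lambda>e. A z \<i> e) \<longlongrightarrow> A z \<i> 0) (at 0 within {0..1})" by (auto simp: continuous_on_def)
    then have "((\<lambda>e. A z \<i> e) \<longlongrightarrow> A z \<i> 0) (at_right 0)"
      using at_within_Icc_at_right[of 0 "1::real"] by simp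
    then show ?thesis
      by (rule Lim_transform_eventually) (use scale[OF X1] in \<open>auto simp: eventually_at_right_field intro!: exI[of _ 1]\<close>)
  qed
  have ca0: "continuous_on right_half (\<lambda>z. A z \<i> 0)"
    by (intro contA continuous_intros) (auto simp: X_def complex_nonpos_Reals_iff)
  have a0: "\<i> * deriv h z + cnj (\<i> * deriv g z) = of_real (norm (\<i> * deriv h z + cnj (\<i> * deriv g z))) * cis (A z \<i> 0)" if "z \<in> right_half" for z
  proof -
    have "(z, \<i>, 0) \<in> X" using that by (auto simp: X_def complex_nonpos_Reals_iff)
    from GA[OF this] show ?thesis by (simp add: G0 mult.commute)
  qed
  show ?thesis
    unfolding chord_argument_def using c1 c2 link lim0 ca0 a0 by (intro exI[of _ \<Theta>] exI[of _ "\<lambda>z. A z \<i> 0"]) auto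
qed

end

subsection \<open>Normalization along a reference ray\<close>

lemma Arg_less_pi: "w \<notin> \<real>\<^sub>\<le>\<^sub>0 \<Longrightarrow> \<bar>Arg w\<bar> < pi"
  by (metis Arg_bounded Arg_eq_pi abs_less_iff complex_nonpos_Reals_iff less_eq_real_def linorder_not_le minus_less_iff order_less_le)

text \<open>The sum of two vectors with arguments \<open>0\<close> and \<open>\<delta>\<close> lies
  in the sector of opening less than \<open>pi\<close> between them.\<close>

lemma Arg_between:
  assumes c: "0 \<le> c" and d: "- pi < \<delta>" "\<delta> < pi"
  shows "min 0 \<delta> \<le> Arg (1 + of_real c * cis \<delta>) \<and> Arg (1 + of_real c * cis \<delta>) \<le> max 0 \<delta>"
proof -
  have pos: "0 \<le> Arg (1 + of_real c * cis \<delta>) \<and> Arg (1 + of_real c * cis \<delta>) \<le> \<delta>"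
    if d: "0 \<le> \<delta>" "\<delta> < pi" for \<delta>
  proof (cases "\<delta> = 0")
    case True
    have "1 + of_real c * cis \<delta> = of_real (1 + c)" using True by simp
    then show ?thesis using c True by (simp only: Arg_of_real) simp
  next
    case False
    define z where "z = 1 + of_real c * cis \<delta>"
    have sd: "sin \<delta> > 0" using d False by (intro sin_gt_zero) auto
    have z0: "z \<noteq> 0"
    proof
      assume "z = 0"
      then have "c * sin \<delta> = 0" "1 + c * cos \<delta> = 0" by (auto simp: z_def complex_eq_iff)
      then show False using sd by simp
    qed
    have "Im z \<ge> 0" using c sd by (simp add: z_def)
    then have A0: "0 \<le> Arg z" by (simp add: Arg_less_0)
    have ze: "z = of_real (norm z) * cis (Arg z)" using z0 by (metis rcis_cmod_Arg rcis_def)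
    have "z * cis (- \<delta>) = of_real (norm z) * cis (Arg z - \<delta>)" by (subst ze) (simp add: cis_mult)
    moreover have "z * cis (- \<delta>) = cis (- \<delta>) + of_real c" by (simp add: z_def distrib_right cis_mult)
    ultimately have "Im (cis (- \<delta>) + of_real c) = Im (of_real (norm z) * cis (Arg z - \<delta>))" by simp
    then have "norm z * sin (Arg z - \<delta>) = - sin \<delta>" by simp
    then have "norm z * sin (Arg z - \<delta>) < 0" using sd by simp
    then have "sin (Arg z - \<delta>) < 0" using z0 by (simp add: mult_less_0_iff)
    moreover have "sin (Arg z - \<delta>) \<ge> 0" if "Arg z > \<delta>"
      using that d Arg_le_pi[of z] by (intro sin_ge_zero) auto
    ultimately show ?thesis using A0 unfolding z_def[symmetric] by force
  qed
  show ?thesis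
  proof (cases "\<delta> \<ge> 0")
    case True then show ?thesis using pos[of \<delta>] d by simp
  next
    case False
    define z where "z = 1 + of_real c * cis (- \<delta>)"
    have b: "0 \<le> Arg z" "Arg z \<le> - \<delta>" using pos[of "- \<delta>"] False d by (auto simp: z_def)
    have "1 + of_real c * cis \<delta> = cnj z" by (simp add: z_def cis_cnj)
    moreover have "Arg (cnj z) = - Arg z"
    proof (cases "z = 0")
      case False
      have "Arg z \<noteq> pi" using b d by auto
      then have "z \<notin> \<real>\<^sub>\<le>\<^sub>0" using False Arg_eq_pi[of z] by (auto simp: complex_nonpos_Reals_iff complex_eq_iff)
      then show ?thesis by (auto simp: Arg_cnj Arg_eq_0 complex_nonpos_Reals_iff complex_is_Real_iff)
    qed (use Arg_of_real[of 0] in simp)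
    ultimately show ?thesis using b False by simp
  qed
qed

definition far_set :: "complex \<Rightarrow> real \<Rightarrow> complex set" where
  "far_set p r = {x \<in> right_half. r \<le> norm (x - p) \<and> x - p \<notin> \<real>\<^sub>\<le>\<^sub>0}"

text \<open>Rotating a point about \<open>p\<close> towards the rightward horizontal direction keeps
  its distance from \<open>p\<close> and does not decrease its real part. The arc therefore stays in
  the set and ends on one common ray.\<close>

lemma connected_far_set:
  assumes p: "p \<in> right_half" and r: "r > 0"
  shows "connected (far_set p r)"
proof -
  define ray where "ray = (\<lambda>\<rho>. p + of_real \<rho>) ` {r..}"
  define arc where "arc x = (\<lambda>u. p + of_real (norm (x - p)) * cis (u * Arg (x - p))) ` {0..1}" for x
  have ray: "connected ray" unfolding ray_def by (intro connected_continuous_image continuous_intros) auto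
  have arc: "connected (arc x)" for x
    unfolding arc_def by (intro connected_continuous_image continuous_intros) auto
  have start: "p + of_real (norm (x - p)) \<in> arc x" for x
    unfolding arc_def by (rule image_eqI[of _ _ 0]) auto
  have "x \<in> arc x" for x
  proof -
    have "x - p = of_real (norm (x - p)) * cis (Arg (x - p))"
      by (metis rcis_cmod_Arg rcis_def)
    then show ?thesis unfolding arc_def by (intro image_eqI[of _ _ 1]) (auto simp: algebra_simps)
  qed
  have ray_sub: "ray \<subseteq> far_set p r"
    using p r by (auto simp: ray_def far_set_def complex_nonpos_Reals_iff)
  have arc_sub: "arc x \<subseteq> far_set p r" if x: "x \<in> far_set p r" for x
  proof
    fix y assume "y \<in> arc x"
    then obtain u where u: "0 \<le> u" "u \<le> 1" "y = p + of_real (norm (x - p)) * cis (u * Arg (x - p))"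
      by (auto simp: arc_def)
    define \<rho> \<phi> where "\<rho> = norm (x - p)" and "\<phi> = Arg (x - p)"
    have \<rho>: "\<rho> \<ge> r" using x by (simp add: far_set_def \<rho>_def)
    have \<phi>: "\<bar>\<phi>\<bar> < pi" using x Arg_less_pi by (auto simp: far_set_def \<phi>_def)
    have "x - p = of_real \<rho> * cis \<phi>" unfolding \<rho>_def \<phi>_def by (metis rcis_cmod_Arg rcis_def)
    then have "Re (x - p) = \<rho> * cos \<phi>" by simp
    then have Rx: "Re p + \<rho> * cos \<phi> > 0" using x by (auto simp: far_set_def)
    have "cos \<bar>\<phi>\<bar> \<le> cos (u * \<bar>\<phi>\<bar>)"
      using u \<phi> by (intro cos_monotone_0_pi_le) (auto intro: mult_left_le_one_le)
    then have c: "cos \<phi> \<le> cos (u * \<phi>)" by (cases "\<phi> \<ge> 0") auto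
    have "\<rho> * cos \<phi> \<le> \<rho> * cos (u * \<phi>)" using c \<rho> r by (intro mult_left_mono) auto
    then have "Re y > 0" using Rx u(3) by (simp add: \<rho>_def[symmetric] \<phi>_def[symmetric])
    moreover have "norm (y - p) = \<rho>" using u(3) \<rho> r by (simp add: norm_mult \<rho>_def)
    moreover have "y - p \<notin> \<real>\<^sub>\<le>\<^sub>0"
    proof
      assume "y - p \<in> \<real>\<^sub>\<le>\<^sub>0"
      moreover have "y - p = of_real \<rho> * cis (u * \<phi>)" using u(3) by (simp add: \<rho>_def \<phi>_def)
      ultimately have "\<rho> * cos (u * \<phi>) \<le> 0" "\<rho> * sin (u * \<phi>) = 0" by (auto simp: complex_nonpos_Reals_iff)
      then have cs: "cos (u * \<phi>) \<le> 0" "sin (u * \<phi>) = 0" using \<rho> r by (auto simp: mult_le_0_iff)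
      have "\<bar>u * \<phi>\<bar> \<le> 1 * \<bar>\<phi>\<bar>" unfolding abs_mult using u by (intro mult_right_mono) auto
      then have lt: "\<bar>u * \<phi>\<bar> < pi" using \<phi> by simp
      then have "u * \<phi> = 0" using cs(2) sin_eq_0_pi[of "u * \<phi>"] by auto
      then show False using cs(1) by (metis cos_zero not_one_le_zero)
    qed
    ultimately show "y \<in> far_set p r" using \<rho> by (simp add: far_set_def)
  qed
  have eq: "far_set p r = ray \<union> (\<Union>x\<in>far_set p r. arc x \<union> ray)"
    using ray_sub arc_sub \<open>\<And>x. x \<in> arc x\<close> by blast
  show ?thesis
  proof (cases "far_set p r = {}")
    case False
    have "connected (\<Union>x\<in>far_set p r. arc x \<union> ray)"
    proof (rule connected_Union)
      fix S assume "S \<in> (\<lambda>x. arc x \<union> ray) ` far_set p r"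
      then obtain x where x: "x \<in> far_set p r" "S = arc x \<union> ray" by auto
      have "p + of_real (norm (x - p)) \<in> ray" using x(1) by (auto simp: ray_def far_set_def)
      then show "connected S" unfolding x(2) using start by (intro connected_Un arc ray) auto
    next
      have "p + of_real r \<in> ray" by (auto simp: ray_def)
      then show "\<Inter> ((\<lambda>x. arc x \<union> ray) ` far_set p r) \<noteq> {}" by auto
    qed
    then have "connected (ray \<union> (\<Union>x\<in>far_set p r. arc x \<union> ray))"
      using False ray by (intro connected_Un) (auto simp: ray_def)
    then show ?thesis using eq by simp
  qed auto
qed

lemma cis_mult_norm: "z \<noteq> 0 \<Longrightarrow> cis (Arg z) = z / of_real (norm z)"
  using cis_Arg[of z] by (simp add: sgn_eq)

text \<open>The reference ray is the negative real axis, and \<open>\<gamma>\<close> runs to its tip; the boundary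
  point of the half plane corresponding to that tip is placed at infinity.\<close>
locale ray_config = half_plane_qc f h g k for f h g k +
  fixes \<gamma> :: "real \<Rightarrow> complex"
  assumes omit_neg: "\<And>w. w \<in> \<real>\<^sub>\<le>\<^sub>0 \<Longrightarrow> w \<notin> f ` right_half"
    and escape: "\<And>a. a \<notin> f ` right_half \<Longrightarrow> \<exists>d. norm d = 1 \<and> (\<forall>s\<ge>0. a + of_real s * d \<notin> f ` right_half) \<and>
        (Im a = 0 \<and> d = -1 \<or> (\<forall>s\<ge>0. a + of_real s * d \<notin> \<real>\<^sub>\<le>\<^sub>0))"
    and \<gamma>_cont: "continuous_on {0..<1} \<gamma>" and \<gamma>_in: "\<And>s. s \<in> {0..<1} \<Longrightarrow> \<gamma> s \<in> right_half"
    and \<gamma>_inf: "filterlim \<gamma> at_infinity (at_left 1)" and f_\<gamma>: "((\<lambda>s. f (\<gamma> s)) \<longlongrightarrow> 0) (at_left 1)"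
begin

lemma f_not_nonpos: "z \<in> right_half \<Longrightarrow> f z \<notin> \<real>\<^sub>\<le>\<^sub>0" using omit_neg by blast

lemma f_nz: "z \<in> right_half \<Longrightarrow> f z \<noteq> 0" using f_not_nonpos[of z] by auto

lemma ev_01: "\<forall>\<^sub>F s in at_left 1. s \<in> {0<..<(1::real)}"
  by (auto simp: eventually_at_left_field intro!: exI[of _ 0])

lemma ev_\<gamma>_large: "\<forall>\<^sub>F s in at_left 1. norm (\<gamma> s) > R"
  using \<gamma>_inf by (auto simp: filterlim_at_infinity_conv_norm_at_top filterlim_at_top_dense)

lemma large_chord:
  assumes "p \<in> right_half" "x \<in> right_half" "norm p < norm x"
  shows "(p, x) \<in> chord_set"
proof -
  have "x - p \<notin> \<real>\<^sub>\<le>\<^sub>0"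
  proof
    assume "x - p \<in> \<real>\<^sub>\<le>\<^sub>0"
    then have "Re x \<le> Re p" "Im x = Im p" by (auto simp: complex_nonpos_Reals_iff)
    then have "norm x \<le> norm p" unfolding cmod_def using assms by (intro real_sqrt_le_mono) (auto intro!: power_mono)
    then show False using assms by simp
  qed
  then show ?thesis using assms by (simp add: chord_set_def)
qed

text \<open>Along \<open>\<gamma>\<close> the chord from \<open>f p\<close> tends to
  \<open>- f p\<close>, so its argument tends to \<open>Arg (f p) - pi\<close> up to a multiple of
  \<open>2 * pi\<close>. Since the image avoids the cut, \<open>Arg (f p)\<close> is continuous in
  \<open>p\<close>; the multiple is locally constant and can be subtracted once for all
  \<open>p\<close>.\<close>

lemma chord_argument_normalized:
  "\<exists>\<Theta> a0. chord_argument \<Theta> a0 \<and> (\<forall>p\<in>right_half. ((\<lambda>s. \<Theta> p (\<gamma> s)) \<longlongrightarrow> Arg (f p) - pi) (at_left 1))"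
proof -
  obtain \<Theta> a0 where ca: "chord_argument \<Theta> a0"
    using chord_argument_exists by blast
  have \<Theta>_cont: "continuous_on chord_set (\<lambda>(p, x). \<Theta> p x)"
    and \<Theta>: "\<And>p x. (p, x) \<in> chord_set \<Longrightarrow> f x - f p = of_real (norm (f x - f p)) * cis (\<Theta> p x)"
    using ca by (auto simp: chord_argument_def)
  \<comment> \<open>The correction \<open>Arg (1 - f (\<gamma> s) / f p)\<close> makes the
    comparison exact: \<open>cis (c p s)\<close> equals \<open>-1\<close> for all \<open>s\<close>
    close to \<open>1\<close>, not only in the limit.\<close>
  define c where "c p s = \<Theta> p (\<gamma> s) - Arg (1 - f (\<gamma> s) / f p) - Arg (f p)" for p s
  have loc: "\<exists>\<rho>>0. \<exists>s0\<in>{0..<1}. \<exists>C. cis C = -1 \<and> (\<forall>p\<in>ball p0 \<rho> \<inter> right_half. \<forall>s\<in>{s0<..<1}. c p s = C)"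
    if p0: "p0 \<in> right_half" for p0
  proof -
    define m where "m = norm (f p0)"
    have m: "m > 0" using f_nz[OF p0] by (simp add: m_def)
    have "isCont f p0" using f_cont open_right_half p0 by (simp add: continuous_on_eq_continuous_at)
    then have "\<forall>\<^sub>F p in at p0. dist (f p) (f p0) < m / 2" using m unfolding isCont_def by (intro tendstoD) auto
    then obtain d where d: "d > 0" "\<And>p. p \<noteq> p0 \<Longrightarrow> dist p p0 < d \<Longrightarrow> dist (f p) (f p0) < m / 2"
      by (auto simp: eventually_at)
    have big: "m / 2 < norm (f p)" if "dist p p0 < d" for p
    proof -
      have "dist (f p) (f p0) < m / 2" using d(2)[of p] that m by (cases "p = p0") auto
      then show ?thesis using norm_triangle_ineq2[of "f p0" "f p"] by (simp add: m_def dist_norm norm_minus_commute)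
    qed
    define \<rho> where "\<rho> = min 1 d"
    have "\<forall>\<^sub>F s in at_left 1. norm (f (\<gamma> s)) < m / 2" using tendstoD[OF f_\<gamma>, of "m / 2"] m by simp
    then have "\<forall>\<^sub>F s in at_left 1. norm (f (\<gamma> s)) < m / 2 \<and> norm (\<gamma> s) > norm p0 + 1"
      using ev_\<gamma>_large by eventually_elim auto
    then obtain b where b: "b < 1" "\<And>s. b < s \<Longrightarrow> s < 1 \<Longrightarrow> norm (f (\<gamma> s)) < m / 2 \<and> norm (\<gamma> s) > norm p0 + 1"
      by (auto simp: eventually_at_left_field)
    define s0 where "s0 = max 0 b"
    have s0: "s0 \<in> {0..<1}" using b(1) by (auto simp: s0_def)
    define S where "S = (ball p0 \<rho> \<inter> right_half) \<times> {s0<..<1}"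
    have S: "fst v \<in> right_half" "snd v \<in> {0..<1}" "(fst v, \<gamma> (snd v)) \<in> chord_set" "norm (f (\<gamma> (snd v)) / f (fst v)) < 1"
      if "v \<in> S" for v
    proof -
      have v: "dist (fst v) p0 < d" "dist (fst v) p0 < 1" "fst v \<in> right_half" "s0 < snd v" "snd v < 1"
        using that by (auto simp: S_def \<rho>_def dist_commute)
      show 1: "fst v \<in> right_half" "snd v \<in> {0..<1}" using v by (auto simp: s0_def)
      have bb: "norm (f (\<gamma> (snd v))) < m / 2" "norm (\<gamma> (snd v)) > norm p0 + 1" using b(2)[of "snd v"] v by (auto simp: s0_def)
      have "norm (fst v) \<le> norm p0 + dist (fst v) p0" by (metis dist_norm norm_triangle_sub)
      then show "(fst v, \<gamma> (snd v)) \<in> chord_set" using 1 \<gamma>_in[OF 1(2)] bb(2) v by (intro large_chord) auto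
      show "norm (f (\<gamma> (snd v)) / f (fst v)) < 1" using bb(1) big[OF v(1)] m by (simp add: norm_divide divide_less_eq)
    qed
    have np: "1 - f (\<gamma> (snd v)) / f (fst v) \<notin> \<real>\<^sub>\<le>\<^sub>0" if "v \<in> S" for v
      using Arg_small(1)[of "- (f (\<gamma> (snd v)) / f (fst v))"] S(4)[OF that] by simp
    have "convex S" unfolding S_def by (intro convex_Times convex_Int convex_ball convex_right_half) auto
    then have conn: "connected S" by (rule convex_connected)
    have contc: "continuous_on S (\<lambda>v. c (fst v) (snd v))"
    proof -
      have "continuous_on S (\<lambda>v. \<gamma> (snd v))" by (intro continuous_on_compose2[OF \<gamma>_cont] continuous_intros) (use S in auto)
      moreover from this have "continuous_on S (\<lambda>v. f (\<gamma> (snd v)))"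
        by (rule continuous_on_compose2[OF f_cont]) (use S(2) \<gamma>_in in auto)
      moreover have "continuous_on S (\<lambda>v. f (fst v))"
        by (intro continuous_on_compose2[OF f_cont] continuous_intros) (use S in auto)
      moreover have "continuous_on S (\<lambda>v. \<Theta> (fst v) (\<gamma> (snd v)))"
      proof -
        have "continuous_on S (\<lambda>v. (fst v, \<gamma> (snd v)))" by (intro continuous_intros calculation(1))
        moreover have "(\<lambda>v. (fst v, \<gamma> (snd v))) ` S \<subseteq> chord_set" using S(3) by blast
        ultimately show ?thesis using continuous_on_compose2[OF \<Theta>_cont] by fastforce
      qed
      ultimately show ?thesis unfolding c_def
        by (intro continuous_on_diff continuous_on_compose2[OF continuous_on_Arg] continuous_on_divide continuous_on_const)
          (use np f_not_nonpos S(1) f_nz in auto)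
    qed
    have cisc: "cis (c (fst v) (snd v)) = -1" if v: "v \<in> S" for v
    proof -
      define p x where "p = fst v" and "x = \<gamma> (snd v)"
      have fp: "f p \<noteq> 0" using f_nz S(1)[OF v] by (simp add: p_def)
      have q0: "1 - f x / f p \<noteq> 0" using np[OF v] unfolding p_def x_def by (metis nonpos_Reals_zero_I)
      have fe: "f x - f p = - (f p * (1 - f x / f p))" using fp by (simp add: field_simps)
      have ne: "f x - f p \<noteq> 0" using fe fp q0 by simp
      have "cis (\<Theta> p x) = (f x - f p) / of_real (norm (f x - f p))"
        using \<Theta>[OF S(3)[OF v]] ne unfolding p_def x_def by (metis nonzero_mult_div_cancel_left norm_eq_zero of_real_eq_0_iff)
      also have "\<dots> = - (cis (Arg (f p)) * cis (Arg (1 - f x / f p)))"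
        unfolding cis_mult_norm[OF fp] cis_mult_norm[OF q0] fe by (simp add: norm_mult)
      finally have "cis (\<Theta> p x - Arg (1 - f x / f p) - Arg (f p)) = -1"
        by (simp add: cis_divide[symmetric])
      then show ?thesis by (simp add: c_def p_def x_def)
    qed
    define s1 where "s1 = (s0 + 1) / 2"
    have s1: "s1 \<in> {s0<..<1}" using s0 by (auto simp: s1_def)
    have i: "(p0, s1) \<in> S" using s1 p0 d by (auto simp: S_def \<rho>_def)
    have "c p s = c p0 s1" if "p \<in> ball p0 \<rho> \<inter> right_half" "s \<in> {s0<..<1}" for p s
      using cis_constant_imp_constant[OF conn contc cisc, of "(p, s)" "(p0, s1)"] i that by (simp add: S_def)
    moreover have "cis (c p0 s1) = -1" using cisc[OF i] by simp
    moreover have "\<rho> > 0" using d by (simp add: \<rho>_def)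
    ultimately show ?thesis using s0 by blast
  qed
  \<comment> \<open>The eventual value of \<open>c p\<close> along \<open>\<gamma>\<close>. Local
    constancy in \<open>p\<close> and connectedness of the half plane make it independent of
    \<open>p\<close>.\<close>
  define C where "C p = (THE C. \<forall>\<^sub>F s in at_left 1. c p s = C)" for p
  have ev: "\<forall>\<^sub>F s in at_left 1. c p s = A" if "s0 \<in> {0..<1}" "\<forall>s\<in>{s0<..<1}. c p s = A" for p s0 A
    using that by (auto simp: eventually_at_left_field intro!: exI[of _ s0])
  have C_eq: "C p = A" if "\<forall>\<^sub>F s in at_left 1. c p s = A" for p A
    unfolding C_def
  proof (rule the_equality)
    show "\<forall>\<^sub>F s in at_left 1. c p s = A" by (rule that)
    fix B assume "\<forall>\<^sub>F s in at_left 1. c p s = B"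
    with that have "\<forall>\<^sub>F s in at_left (1::real). B = A" by eventually_elim simp
    then show "B = A" by simp
  qed
  have Cloc: "cis (C p0) = -1 \<and> (\<forall>\<^sub>F s in at_left 1. c p0 s = C p0) \<and> (\<forall>\<^sub>F p in at p0 within right_half. C p0 = C p)"
    if p0: "p0 \<in> right_half" for p0
  proof -
    obtain \<rho> s0 A where l: "\<rho> > 0" "s0 \<in> {0..<1}" "cis A = -1" "\<And>p s. p \<in> ball p0 \<rho> \<inter> right_half \<Longrightarrow> s \<in> {s0<..<1} \<Longrightarrow> c p s = A"
      using loc[OF p0] by blast
    have e: "\<forall>\<^sub>F s in at_left 1. c p s = A" if "p \<in> ball p0 \<rho> \<inter> right_half" for p
      using ev[OF l(2)] l(4)[OF that] by blast
    then have Cp: "C p = A" if "p \<in> ball p0 \<rho> \<inter> right_half" for p using C_eq that by blast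
    have C0: "C p0 = A" using Cp p0 l(1) by simp
    have "\<forall>\<^sub>F p in at p0 within right_half. C p0 = C p"
      unfolding eventually_at using l(1) C0 Cp by (intro exI[of _ \<rho>]) (auto simp: dist_commute)
    then show ?thesis using C0 l(3) e[of p0] p0 l(1) by auto
  qed
  define D where "D = C 1 + pi"
  have CD: "C p = D - pi" if "p \<in> right_half" for p
    using connected_local_const[OF convex_connected[OF convex_right_half], of p 1 C] Cloc that by (simp add: D_def)
  have cisD: "cis (- D) = 1"
    using Cloc[of 1] by (auto simp: D_def cis_mult[symmetric] complex_eq_iff)
  have cisD': "cis (x - D) = cis x" for x using cisD by (metis cis_mult mult.right_neutral uminus_add_conv_diff add.commute diff_conv_add_uminus)
  have "chord_argument (\<lambda>p x. \<Theta> p x - D) (\<lambda>z. a0 z - D)"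
  proof -
    have "continuous_on chord_set (\<lambda>(p, x). \<Theta> p x - D)"
      using continuous_on_diff[OF \<Theta>_cont continuous_on_const[of _ D]] by (simp add: case_prod_unfold)
    then show ?thesis using ca unfolding chord_argument_def cisD' by (auto intro!: tendsto_intros continuous_intros)
  qed
  moreover
  have "((\<lambda>s. \<Theta> p (\<gamma> s) - D) \<longlongrightarrow> Arg (f p) - pi) (at_left 1)" if p: "p \<in> right_half" for p
    proof -
      have "((\<lambda>s. Arg (1 - f (\<gamma> s) / f p)) \<longlongrightarrow> Arg (1 - 0 / f p)) (at_left 1)"
        using f_nz[OF p] by (intro tendsto_intros f_\<gamma> isCont_tendsto_compose[OF continuous_at_Arg]) auto
      then have "((\<lambda>s. C p + Arg (f p) + Arg (1 - f (\<gamma> s) / f p) - D) \<longlongrightarrow> C p + Arg (f p) + 0 - D) (at_left 1)"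
        by (intro tendsto_intros) simp
      moreover have "\<forall>\<^sub>F s in at_left 1. C p + Arg (f p) + Arg (1 - f (\<gamma> s) / f p) - D = \<Theta> p (\<gamma> s) - D"
        using Cloc[OF p] by (auto simp: c_def elim: eventually_mono)
      ultimately show ?thesis using CD[OF p] by (auto intro: Lim_transform_eventually)
    qed
  ultimately show ?thesis by blast
qed

end

lemma cis_pi_cases:
  assumes "cis \<psi> = -1" "- 3 * pi < \<psi>" "\<psi> < 3 * pi"
  shows "\<psi> = pi \<or> \<psi> = - pi"
proof -
  have "cos \<psi> = -1" using assms(1) by (metis cis.sel(1) one_complex.sel(1) uminus_complex.sel(1))
  then have c1: "cos (\<psi> - pi) = 1" by (simp add: cos_diff)
  obtain n :: int where n: "\<psi> - pi = of_int n * 2 * pi" using iffD1[OF cos_one_2pi_int c1] by blast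
  then have "\<psi> = (2 * of_int n + 1) * pi" by (simp add: algebra_simps)
  then have "- 3 < 2 * real_of_int n + 1" "2 * real_of_int n + 1 < 3"
    using assms(2,3) mult_less_cancel_right_pos[of pi "-3" "2 * real_of_int n + 1"] mult_less_cancel_right_pos[of pi "2 * real_of_int n + 1" 3]
    by auto
  then have "n = 0 \<or> n = -1" by linarith
  then show ?thesis using n by auto
qed

text \<open>A direction \<open>\<psi> = pi + \<theta>\<close> with
  \<open>0 < \<theta> \<le> \<beta>\<close> leads from the point of argument \<open>\<beta>\<close>
  down to the nonpositive axis, which it reaches after the length
  \<open>\<rho> * sin \<beta> / sin \<theta>\<close> by the law of sines. Directions below
  \<open>- pi\<close> are handled by conjugation.\<close>

lemma ray_avoids_negative_axis:
  assumes \<rho>: "\<rho> > 0" and \<beta>: "\<bar>\<beta>\<bar> < pi" and \<psi>: "\<bar>\<psi> - \<beta>\<bar> \<le> pi"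
    and av: "\<And>s. s \<ge> 0 \<Longrightarrow> of_real \<rho> * cis \<beta> + of_real s * cis \<psi> \<notin> \<real>\<^sub>\<le>\<^sub>0"
  shows "\<bar>\<psi>\<bar> \<le> pi"
proof -
  have up: "\<psi> \<le> pi" if \<beta>: "\<bar>\<beta>\<bar> < pi" and \<psi>: "\<bar>\<psi> - \<beta>\<bar> \<le> pi"
    and av: "\<And>s. s \<ge> 0 \<Longrightarrow> of_real \<rho> * cis \<beta> + of_real s * cis \<psi> \<notin> \<real>\<^sub>\<le>\<^sub>0" for \<beta> \<psi>
  proof (rule ccontr)
    assume "\<not> \<psi> \<le> pi"
    define \<theta> where "\<theta> = \<psi> - pi"
    have \<theta>: "0 < \<theta>" "\<theta> \<le> \<beta>" "\<beta> < pi" using \<open>\<not> \<psi> \<le> pi\<close> \<psi> \<beta> by (auto simp: \<theta>_def)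
    have st: "sin \<theta> > 0" using \<theta> by (intro sin_gt_zero) auto
    have sb: "sin \<beta> \<ge> 0" using \<theta> by (intro sin_ge_zero) auto
    define s where "s = \<rho> * sin \<beta> / sin \<theta>"
    have s: "s \<ge> 0" using \<rho> st sb by (simp add: s_def)
    have e: "cis \<psi> = - cis \<theta>" by (simp add: \<theta>_def cis_divide[symmetric])
    have "Im (of_real \<rho> * cis \<beta> + of_real s * cis \<psi>) = 0" using st by (simp add: e s_def)
    moreover have "Re (of_real \<rho> * cis \<beta> + of_real s * cis \<psi>) \<le> 0"
    proof -
      have "Re (of_real \<rho> * cis \<beta> + of_real s * cis \<psi>) = \<rho> * (sin \<theta> * cos \<beta> - cos \<theta> * sin \<beta>) / sin \<theta>"
        using st by (simp add: e s_def field_simps)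
      also have "\<dots> = - (\<rho> * sin (\<beta> - \<theta>) / sin \<theta>)" by (simp add: sin_diff algebra_simps diff_divide_distrib)
      also have "\<dots> \<le> 0" using \<rho> st \<theta> by (auto intro!: divide_nonneg_pos mult_nonneg_nonneg sin_ge_zero)
      finally show ?thesis .
    qed
    ultimately show False using av[OF s] by (simp add: complex_nonpos_Reals_iff)
  qed
  have "- \<psi> \<le> pi"
  proof (rule up[of "- \<beta>" "- \<psi>"])
    fix s :: real assume "s \<ge> 0"
    have "of_real \<rho> * cis (- \<beta>) + of_real s * cis (- \<psi>) = cnj (of_real \<rho> * cis \<beta> + of_real s * cis \<psi>)"
      by (simp add: cis_cnj)
    moreover have "cnj z \<in> \<real>\<^sub>\<le>\<^sub>0 \<longleftrightarrow> z \<in> \<real>\<^sub>\<le>\<^sub>0" for z by (simp add: complex_nonpos_Reals_iff)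
    ultimately show "of_real \<rho> * cis (- \<beta>) + of_real s * cis (- \<psi>) \<notin> \<real>\<^sub>\<le>\<^sub>0"
      using av[OF \<open>s \<ge> 0\<close>] by metis
  qed (use \<beta> \<psi> in auto)
  moreover have "\<psi> \<le> pi" using up[OF \<beta> \<psi> av] by blast
  ultimately show ?thesis by (simp add: abs_le_iff)
qed

text \<open>On the half-open segment \<open>Arg\<close> is continuous and equals
  \<open>Arg w\<close> plus the angle turned. The end point may lie on the cut, where the limit can
  be \<open>- pi\<close> although \<open>Arg a\<close> is \<open>pi\<close>; hence the form with
  \<open>Arg (a / w)\<close>.\<close>

lemma Arg_segment_bound:
  assumes av: "\<And>u. u \<in> {0..<1} \<Longrightarrow> w + of_real u * (a - w) \<notin> \<real>\<^sub>\<le>\<^sub>0" and a: "a / w \<notin> \<real>\<^sub>\<le>\<^sub>0"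
  shows "\<bar>Arg w + Arg (a / w)\<bar> \<le> pi"
proof -
  define b where "b u = w + of_real u * (a - w)" for u
  have w: "w \<noteq> 0" using av[of 0] by auto
  define v where "v = a / w"
  have bw: "b u / w = of_real (1 - u) + of_real u * v" for u using w by (simp add: b_def v_def field_simps)
  have bn: "b u / w \<notin> \<real>\<^sub>\<le>\<^sub>0" if u: "u \<in> {0..<1}" for u
  proof
    assume "b u / w \<in> \<real>\<^sub>\<le>\<^sub>0"
    then have *: "(1 - u) + u * Re v \<le> 0" "u * Im v = 0" unfolding bw by (auto simp: complex_nonpos_Reals_iff)
    then have u0: "u > 0" using u by (cases "u = 0") auto
    then have "Im v = 0" using * by simp
    moreover have "Re v \<le> 0"
    proof (rule ccontr)
      assume "\<not> Re v \<le> 0"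
      then have "u * Re v > 0" using u0 by simp
      then show False using *(1) u by simp
    qed
    ultimately show False using a by (simp add: complex_nonpos_Reals_iff v_def)
  qed
  have eq: "Arg (b u) - Arg (b u / w) = Arg (b 0) - Arg (b 0 / w)" if u: "u \<in> {0..<1}" for u
  proof (rule cis_constant_imp_constant[where S = "{0..<1}" and c = "w / of_real (norm w)" and a = "\<lambda>u. Arg (b u) - Arg (b u / w)"])
    show "continuous_on {0..<1} (\<lambda>u. Arg (b u) - Arg (b u / w))"
      unfolding b_def using av bn w by (intro continuous_intros) (auto simp: b_def)
    fix u :: real assume u: "u \<in> {0..<1}"
    have "b u \<noteq> 0" using av[OF u] by (auto simp: b_def)
    then show "cis (Arg (b u) - Arg (b u / w)) = w / of_real (norm w)"
      using w by (simp add: cis_divide[symmetric] cis_mult_norm norm_divide)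
  qed (use u in auto)
  have "b 0 = w" by (simp add: b_def)
  then have "Arg w + Arg (b u / w) = Arg (b u)" if "u \<in> {0..<1}" for u using eq[OF that] w by simp
  then have bd: "\<bar>Arg w + Arg (b u / w)\<bar> \<le> pi" if "u \<in> {0..<1}" for u
    using that Arg_bounded[of "b u"] by (simp add: abs_le_iff)
  have "((\<lambda>u. b u / w) \<longlongrightarrow> b 1 / w) (at_left 1)" unfolding b_def using w by (intro tendsto_intros) auto
  then have "((\<lambda>u. Arg (b u / w)) \<longlongrightarrow> Arg (a / w)) (at_left 1)"
    using a by (intro isCont_tendsto_compose[OF continuous_at_Arg]) (auto simp: b_def)
  then have "((\<lambda>u. \<bar>Arg w + Arg (b u / w)\<bar>) \<longlongrightarrow> \<bar>Arg w + Arg (a / w)\<bar>) (at_left 1)"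
    by (intro tendsto_rabs tendsto_add tendsto_const)
  moreover have "\<forall>\<^sub>F u in at_left (1::real). \<bar>Arg w + Arg (b u / w)\<bar> \<le> pi"
    using bd by (auto simp: eventually_at_left_field intro!: exI[of _ 0])
  ultimately show ?thesis by (intro tendsto_upperbound) auto
qed

section \<open>Leaving a value of \<open>f\<close> along omitted rays\<close>

locale chord_config = ray_config +
  fixes \<Theta> :: "complex \<Rightarrow> complex \<Rightarrow> real" and a0 :: "complex \<Rightarrow> real"
  assumes ca: "chord_argument \<Theta> a0"
    and norm_lim: "\<And>p. p \<in> right_half \<Longrightarrow> ((\<lambda>s. \<Theta> p (\<gamma> s)) \<longlongrightarrow> Arg (f p) - pi) (at_left 1)"
begin

lemma \<Theta>_cont: "continuous_on chord_set (\<lambda>(p, x). \<Theta> p x)"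
  and \<Theta>_polar: "\<And>p x. (p, x) \<in> chord_set \<Longrightarrow> f x - f p = of_real (norm (f x - f p)) * cis (\<Theta> p x)"
  and \<Theta>_swap: "\<And>p x. p \<in> right_half \<Longrightarrow> x \<in> right_half \<Longrightarrow> Im p < Im x \<Longrightarrow> \<Theta> x p = \<Theta> p x - pi"
  and \<Theta>_lim0: "\<And>z. z \<in> right_half \<Longrightarrow> ((\<lambda>\<epsilon>. \<Theta> z (z + of_real \<epsilon> * \<i>)) \<longlongrightarrow> a0 z) (at_right 0)"
  and a0_cont: "continuous_on right_half a0"
  and a0_polar: "\<And>z. z \<in> right_half \<Longrightarrow> \<i> * deriv h z + cnj (\<i> * deriv g z) = of_real (norm (\<i> * deriv h z + cnj (\<i> * deriv g z))) * cis (a0 z)"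
  using ca unfolding chord_argument_def by blast+

lemma chord_ne:
  assumes "(p, x) \<in> chord_set"
  shows "f x \<noteq> f p" "cis (\<Theta> p x) = (f x - f p) / of_real (norm (f x - f p))"
proof -
  have "x \<noteq> p" using assms by (auto simp: chord_set_def)
  then show ne: "f x \<noteq> f p" using assms f_inj by (auto simp: chord_set_def dest: inj_onD)
  then show "cis (\<Theta> p x) = (f x - f p) / of_real (norm (f x - f p))"
    using \<Theta>_polar[OF assms] by (metis nonzero_mult_div_cancel_left norm_eq_zero of_real_eq_0_iff right_minus_eq)
qed

lemma far_set_chord: "x \<in> far_set p r \<Longrightarrow> p \<in> right_half \<Longrightarrow> (p, x) \<in> chord_set"
  by (simp add: far_set_def chord_set_def)

lemma ev_far_set: "p \<in> right_half \<Longrightarrow> \<forall>\<^sub>F s in at_left 1. \<gamma> s \<in> far_set p r"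
  using ev_\<gamma>_large[of "norm p + \<bar>r\<bar>"] ev_01
proof eventually_elim
  case (elim s)
  have i: "\<gamma> s \<in> right_half" using \<gamma>_in elim by auto
  have "norm p < norm (\<gamma> s)" using elim by linarith
  then have "(p, \<gamma> s) \<in> chord_set" using elim i by (intro large_chord)
  moreover have "r \<le> norm (\<gamma> s - p)" using elim norm_triangle_ineq2[of "\<gamma> s" p] by linarith
  ultimately show ?case by (simp add: far_set_def chord_set_def)
qed

text \<open>Leaving \<open>p\<close> through the short segment to the omitted point \<open>a\<close> and then along the omitted ray
  from \<open>a\<close> fixes the branch of the chord argument at all distant points. The angle \<open>\<psi>\<close> is that of
  the ray; it lies in \<open>[-\<pi>, \<pi>]\<close> because the ray does not cross the reference ray.\<close>
lemma escape_segment: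
  assumes p: "p \<in> right_half" and r: "r > 0" and a: "a \<notin> f ` right_half"
    and seg: "\<And>u. u \<in> {0..<1} \<Longrightarrow> f p + of_real u * (a - f p) \<in> f ` right_half"
    and small: "\<And>u. u \<in> {0..<1} \<Longrightarrow> fi (f p + of_real u * (a - f p)) \<in> ball p r"
  shows "\<exists>\<psi>. \<bar>\<psi>\<bar> \<le> pi \<and> (\<forall>x\<in>far_set p r. (f x - f p) / (f x - a) \<notin> \<real>\<^sub>\<le>\<^sub>0 \<and>
      \<psi> - 2 * pi < \<Theta> p x - Arg ((f x - f p) / (f x - a)) \<and> \<Theta> p x - Arg ((f x - f p) / (f x - a)) < \<psi>) \<and>
      (a \<noteq> 0 \<longrightarrow> \<bar>\<psi> - (Arg (f p) + Arg (a / f p))\<bar> \<le> pi)"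
proof -
  define w where "w = f p"
  have w0: "w \<notin> \<real>\<^sub>\<le>\<^sub>0" "w \<noteq> 0" using f_not_nonpos[OF p] f_nz[OF p] by (auto simp: w_def)
  obtain d where d: "norm d = 1" "\<And>s. s \<ge> 0 \<Longrightarrow> a + of_real s * d \<notin> f ` right_half"
      "Im a = 0 \<and> d = -1 \<or> (\<forall>s\<ge>0. a + of_real s * d \<notin> \<real>\<^sub>\<le>\<^sub>0)"
    using escape[OF a] by blast
  have d0: "d \<noteq> 0" using d(1) by auto
  \<comment> \<open>\<open>f x - w\<close> is the product of \<open>q x\<close>, \<open>e x\<close>
    and \<open>- d\<close>. A nonpositive \<open>q x\<close> would put \<open>f x\<close> on the
    segment and hence \<open>x\<close> close to \<open>p\<close>; a nonpositive \<open>e x\<close>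
    would put \<open>f x\<close> on the omitted ray. Both principal arguments are thus continuous on
    the far set and determine \<open>\<Theta> p x\<close> up to a constant.\<close>
  define q where "q x = (f x - w) / (f x - a)" for x
  define e where "e x = (f x - a) / (- d)" for x
  have xa: "f x \<noteq> a" if "x \<in> right_half" for x using a that by blast
  have q: "q x \<notin> \<real>\<^sub>\<le>\<^sub>0" if x: "x \<in> far_set p r" for x
  proof
    assume "q x \<in> \<real>\<^sub>\<le>\<^sub>0"
    define \<tau> where "\<tau> = - Re (q x)"
    have \<tau>: "\<tau> \<ge> 0" "q x = - of_real \<tau>" using \<open>q x \<in> \<real>\<^sub>\<le>\<^sub>0\<close> by (auto simp: \<tau>_def complex_nonpos_Reals_iff complex_eq_iff)
    have xr: "x \<in> right_half" using x by (simp add: far_set_def)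
    have "f x - w = - of_real \<tau> * (f x - a)" using \<tau>(2) xa[OF xr] by (simp add: q_def field_simps)
    then have e1: "of_real (1 + \<tau>) * f x = w + of_real \<tau> * a" by (simp add: algebra_simps)
    define u where "u = \<tau> / (1 + \<tau>)"
    have u: "u \<in> {0..<1}" using \<tau>(1) by (simp add: u_def)
    have n1: "complex_of_real (1 + \<tau>) \<noteq> 0" using \<tau>(1) by (metis add_pos_nonneg less_numeral_extra(1,3) of_real_eq_0_iff)
    have "f x = (w + of_real \<tau> * a) / of_real (1 + \<tau>)" using e1 n1 by (simp add: eq_divide_eq mult.commute)
    also have "\<dots> = w + of_real u * (a - w)"
    proof -
      have "of_real (1 + \<tau>) * (w + of_real u * (a - w)) = w + of_real \<tau> * a"
      proof -
        have "of_real (1 + \<tau>) * of_real u = (of_real \<tau> :: complex)"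
          unfolding of_real_mult[symmetric] using \<tau>(1) by (simp add: u_def)
        then have "of_real (1 + \<tau>) * (w + of_real u * (a - w)) = of_real (1 + \<tau>) * w + of_real \<tau> * (a - w)"
          by (simp only: distrib_left mult.assoc[symmetric])
        then show ?thesis by (simp add: algebra_simps)
      qed
      then show ?thesis using n1 by (metis nonzero_mult_div_cancel_left)
    qed
    finally have "fi (f x) \<in> ball p r" using small[OF u] by (simp add: w_def)
    then have "norm (x - p) < r" using fi(1)[OF xr] by (simp add: dist_norm norm_minus_commute)
    then show False using x by (simp add: far_set_def)
  qed
  have e: "e x \<notin> \<real>\<^sub>\<le>\<^sub>0" if x: "x \<in> right_half" for x
  proof
    assume "e x \<in> \<real>\<^sub>\<le>\<^sub>0"
    then have "e x = of_real (Re (e x))" "Re (e x) \<le> 0" by (auto simp: complex_nonpos_Reals_iff complex_eq_iff)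
    then have "f x - a = of_real (Re (e x)) * (- d)" using d0 by (metis e_def neg_equal_0_iff_equal nonzero_eq_divide_eq)
    then have "f x = a + of_real (- Re (e x)) * d" by (simp add: algebra_simps)
    moreover have "a + of_real (- Re (e x)) * d \<notin> f ` right_half"
      using d(2)[of "- Re (e x)"] \<open>Re (e x) \<le> 0\<close> by simp
    ultimately show False using x by (metis imageI)
  qed
  have far_r: "x \<in> right_half" if "x \<in> far_set p r" for x using that by (simp add: far_set_def)
  obtain x0 where x0: "x0 \<in> far_set p r"
    using eventually_happens'[OF trivial_limit_at_left_real ev_far_set[OF p]] by blast
  define \<psi> where "\<psi> = \<Theta> p x0 - Arg (q x0) - Arg (e x0) + pi"
  have qa: "q x \<noteq> 0" "e x \<noteq> 0" "f x - w \<noteq> 0" if x: "x \<in> far_set p r" for x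
    using q[OF x] e[OF far_r[OF x]] chord_ne(1)[OF far_set_chord[OF x p]] by (auto simp: w_def)
  have cisE: "cis (\<Theta> p x - Arg (q x) - Arg (e x)) = - d" if x: "x \<in> far_set p r" for x
  proof -
    have "f x - w = q x * (e x * (- d))" using d0 xa[OF far_r[OF x]] by (simp add: q_def e_def)
    then have "cis (\<Theta> p x) = q x * (e x * (- d)) / of_real (norm (q x) * norm (e x))"
      using chord_ne(2)[OF far_set_chord[OF x p]] d(1) by (simp add: w_def norm_mult)
    also have "\<dots> = cis (Arg (q x)) * cis (Arg (e x)) * (- d)"
      using qa[OF x] by (simp add: cis_mult_norm)
    finally show ?thesis by (simp add: cis_divide[symmetric])
  qed
  have const: "\<Theta> p x - Arg (q x) - Arg (e x) = \<psi> - pi" if x: "x \<in> far_set p r" for x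
  proof -
    have "\<Theta> p x - Arg (q x) - Arg (e x) = \<Theta> p x0 - Arg (q x0) - Arg (e x0)"
    proof (rule cis_constant_imp_constant[OF connected_far_set[OF p r] _ cisE])
      have cf: "continuous_on (far_set p r) f" by (rule continuous_on_subset[OF f_cont]) (use far_r in auto)
      have ct: "continuous_on (far_set p r) (\<lambda>x. \<Theta> p x)"
      proof -
        have "(\<lambda>x. (p, x)) ` far_set p r \<subseteq> chord_set" using far_set_chord p by auto
        then show ?thesis using continuous_on_compose2[OF \<Theta>_cont, of "far_set p r" "\<lambda>x. (p, x)"] by (simp add: continuous_intros)
      qed
      have cq: "continuous_on (far_set p r) q" unfolding q_def
        using xa far_r by (intro continuous_on_divide continuous_on_diff cf continuous_on_const) auto
      have ce: "continuous_on (far_set p r) e" unfolding e_def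
        using d0 by (intro continuous_on_divide continuous_on_diff cf continuous_on_const) auto
      show "continuous_on (far_set p r) (\<lambda>x. \<Theta> p x - Arg (q x) - Arg (e x))"
        by (intro continuous_on_diff ct continuous_on_Arg' cq ce) (use q e far_r in auto)
    qed (use x x0 in auto)
    then show ?thesis by (simp add: \<psi>_def)
  qed
  have cis\<psi>: "cis \<psi> = d"
  proof -
    have "cis (\<psi> - pi) = - d" using cisE[OF x0] const[OF x0] by simp
    then show ?thesis by (simp add: cis_divide[symmetric])
  qed
  have far_ev: "\<forall>\<^sub>F s in at_left 1. \<gamma> s \<in> far_set p r" by (rule ev_far_set[OF p])
  \<comment> \<open>The normalization along \<open>\<gamma>\<close> selects the branch: there
    \<open>f\<close> tends to \<open>0\<close>, so \<open>q\<close> tends to \<open>w / a\<close>,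
    and what remains is the principal argument of \<open>e\<close>, at most \<open>pi\<close> in
    modulus.\<close>
  have \<beta>: "\<bar>\<psi> - (Arg w + Arg (a / w))\<bar> \<le> pi \<and> a / w \<notin> \<real>\<^sub>\<le>\<^sub>0" if a0: "a \<noteq> 0"
  proof -
    have seg': "w + of_real u * (a - w) \<notin> \<real>\<^sub>\<le>\<^sub>0" if "u \<in> {0..<1}" for u
      using seg[OF that] omit_neg by (auto simp: w_def)
    have aw: "a / w \<notin> \<real>\<^sub>\<le>\<^sub>0"
    proof
      assume "a / w \<in> \<real>\<^sub>\<le>\<^sub>0"
      define \<tau> where "\<tau> = - Re (a / w)"
      have "a / w = - of_real \<tau>" "\<tau> \<ge> 0" using \<open>a / w \<in> \<real>\<^sub>\<le>\<^sub>0\<close> by (auto simp: \<tau>_def complex_nonpos_Reals_iff complex_eq_iff)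
      then have "a = - of_real \<tau> * w" "\<tau> > 0" using w0 a0 by (auto simp: field_simps less_eq_real_def)
      then have "w + c * (a - w) = w * (1 - c * of_real (1 + \<tau>))" for c :: complex
        by (simp add: algebra_simps)
      then have "w + of_real (1 / (1 + \<tau>)) * (a - w) = w * (1 - of_real (1 / (1 + \<tau>)) * of_real (1 + \<tau>))" .
      also have "of_real (1 / (1 + \<tau>)) * of_real (1 + \<tau>) = (1::complex)"
        unfolding of_real_mult[symmetric] using \<open>\<tau> > 0\<close> by simp
      finally have "w + of_real (1 / (1 + \<tau>)) * (a - w) = 0" by simp
      moreover have "1 / (1 + \<tau>) \<in> {0..<1}" using \<open>\<tau> > 0\<close> by simp
      ultimately show False using seg'[of "1 / (1 + \<tau>)"] by auto
    qed
    have "((\<lambda>s. (f (\<gamma> s) - w) / (f (\<gamma> s) - a)) \<longlongrightarrow> (0 - w) / (0 - a)) (at_left 1)"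
      using a0 by (intro tendsto_intros f_\<gamma>) auto
    then have "((\<lambda>s. q (\<gamma> s)) \<longlongrightarrow> w / a) (at_left 1)" by (simp add: q_def)
    moreover have wa: "w / a \<notin> \<real>\<^sub>\<le>\<^sub>0"
    proof
      assume "w / a \<in> \<real>\<^sub>\<le>\<^sub>0"
      then have "inverse (w / a) \<in> \<real>\<^sub>\<le>\<^sub>0" by (simp only: nonpos_Reals_inverse_iff)
      then show False using aw by (simp add: inverse_eq_divide)
    qed
    ultimately have "((\<lambda>s. Arg (q (\<gamma> s))) \<longlongrightarrow> Arg (w / a)) (at_left 1)"
      by (intro isCont_tendsto_compose[OF continuous_at_Arg]) auto
    then have "((\<lambda>s. \<Theta> p (\<gamma> s) - Arg (q (\<gamma> s)) - (\<psi> - pi)) \<longlongrightarrow> Arg (f p) - pi - Arg (w / a) - (\<psi> - pi)) (at_left 1)"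
      by (intro tendsto_diff tendsto_const norm_lim p)
    then have "((\<lambda>s. \<bar>\<Theta> p (\<gamma> s) - Arg (q (\<gamma> s)) - (\<psi> - pi)\<bar>) \<longlongrightarrow> \<bar>Arg (f p) - pi - Arg (w / a) - (\<psi> - pi)\<bar>) (at_left 1)"
      by (rule tendsto_rabs)
    moreover have "\<forall>\<^sub>F s in at_left 1. \<bar>\<Theta> p (\<gamma> s) - Arg (q (\<gamma> s)) - (\<psi> - pi)\<bar> \<le> pi"
      using far_ev
    proof eventually_elim
      case (elim s)
      have "\<Theta> p (\<gamma> s) - Arg (q (\<gamma> s)) - (\<psi> - pi) = Arg (e (\<gamma> s))" using const[OF elim] by simp
      then show ?case using Arg_bounded[of "e (\<gamma> s)"] by (simp add: abs_le_iff)
    qed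
    ultimately have "\<bar>Arg (f p) - pi - Arg (w / a) - (\<psi> - pi)\<bar> \<le> pi" by (intro tendsto_upperbound) auto
    moreover have "Arg (w / a) = - Arg (a / w)"
    proof -
      have "w / a = inverse (a / w)" by simp
      then have "Arg (w / a) = (if a / w \<in> \<real> then Arg (a / w) else - Arg (a / w))" by (simp only: Arg_inverse)
      moreover have "Arg (a / w) = 0" if "a / w \<in> \<real>"
        using that aw by (auto simp: Arg_eq_0 complex_nonpos_Reals_iff complex_is_Real_iff)
      ultimately show ?thesis by auto
    qed
    ultimately show ?thesis using aw by (simp add: w_def abs_le_iff)
  qed
  have "\<bar>\<psi>\<bar> \<le> pi"
  proof (cases "a = 0")
    case True
    \<comment> \<open>The origin lies on the reference ray, so its escape ray cannot avoid that ray
      and has to run along it. Then \<open>\<psi>\<close> is an odd multiple of \<open>pi\<close>,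
      and the normalization leaves only \<open>pi\<close> and \<open>- pi\<close>.\<close>
    have d1: "d = -1" using d(3) True by (force dest: spec[of _ 0])
    have lw: "\<bar>Arg w\<bar> < pi" by (rule Arg_less_pi[OF w0(1)])
    have "\<forall>\<^sub>F s in at_left 1. \<Theta> p (\<gamma> s) < 0 \<and> - 2 * pi < \<Theta> p (\<gamma> s)"
      using order_tendstoD[OF norm_lim[OF p], of 0] order_tendstoD[OF norm_lim[OF p], of "- 2 * pi"] lw
      by (auto simp: w_def abs_less_iff eventually_conj_iff)
    then have "\<forall>\<^sub>F s in at_left 1. \<Theta> p (\<gamma> s) < 0 \<and> - 2 * pi < \<Theta> p (\<gamma> s) \<and> \<gamma> s \<in> far_set p r"
      using far_ev by eventually_elim auto
    then obtain s where s: "\<Theta> p (\<gamma> s) < 0" "- 2 * pi < \<Theta> p (\<gamma> s)" "\<gamma> s \<in> far_set p r"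
      using eventually_happens'[OF trivial_limit_at_left_real] by blast
    have "\<bar>Arg (q (\<gamma> s))\<bar> < pi" "\<bar>Arg (e (\<gamma> s))\<bar> < pi"
      using Arg_less_pi q[OF s(3)] e[OF far_r[OF s(3)]] by auto
    then have "- 3 * pi < \<psi>" "\<psi> < 3 * pi" using const[OF s(3)] s(1,2) by (auto simp: abs_less_iff)
    then show ?thesis using cis_pi_cases[of \<psi>] cis\<psi> d1 by auto
  next
    case False
    define \<beta> where "\<beta> = Arg w + Arg (a / w)"
    have \<psi>\<beta>: "\<bar>\<psi> - \<beta>\<bar> \<le> pi" and aw: "a / w \<notin> \<real>\<^sub>\<le>\<^sub>0" using \<beta>[OF False] by (auto simp: \<beta>_def)
    have \<beta>pi: "\<bar>\<beta>\<bar> \<le> pi" unfolding \<beta>_def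
      by (rule Arg_segment_bound[OF _ aw]) (use seg omit_neg in \<open>auto simp: w_def\<close>)
    have cis\<beta>: "of_real (norm a) * cis \<beta> = a"
    proof -
      have "cis \<beta> = cis (Arg w) * cis (Arg (a / w))" by (simp add: \<beta>_def cis_mult)
      also have "\<dots> = a / of_real (norm a)"
        using w0 False by (simp add: cis_mult_norm norm_divide)
      finally show ?thesis using False by simp
    qed
    show ?thesis
    proof (cases "Im a = 0 \<and> d = -1")
      case True
      have "\<bar>\<psi>\<bar> \<le> 2 * pi" using \<psi>\<beta> \<beta>pi by linarith
      then have "- 3 * pi < \<psi>" "\<psi> < 3 * pi" using pi_gt_zero by linarith+
      then show ?thesis using cis_pi_cases[of \<psi>] cis\<psi> True by auto
    next
      case False2: False
      then have av: "\<And>s. s \<ge> 0 \<Longrightarrow> a + of_real s * d \<notin> \<real>\<^sub>\<le>\<^sub>0" using d(3) by blast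
      have "\<bar>\<beta>\<bar> < pi"
      proof (rule ccontr)
        assume "\<not> \<bar>\<beta>\<bar> < pi"
        then have "\<beta> = pi \<or> \<beta> = - pi" using \<beta>pi by linarith
        then have "cis \<beta> = -1" by (auto simp: complex_eq_iff)
        then have "a = - of_real (norm a)" using cis\<beta> by simp
        then have "a \<in> \<real>\<^sub>\<le>\<^sub>0" by (metis complex_nonpos_Reals_iff Im_complex_of_real Re_complex_of_real neg_le_0_iff_le norm_ge_zero uminus_complex.sel neg_equal_0_iff_equal)
        then show False using av[of 0] by simp
      qed
      then show ?thesis
        using ray_avoids_negative_axis[of "norm a" \<beta> \<psi>] False \<psi>\<beta> av cis\<beta> cis\<psi> by auto
    qed
  qed
  moreover have "\<psi> - 2 * pi < \<Theta> p x - Arg (q x) \<and> \<Theta> p x - Arg (q x) < \<psi>" if x: "x \<in> far_set p r" for x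
    using const[OF x] Arg_less_pi[OF e[OF far_r[OF x]]] by (auto simp: abs_less_iff)
  ultimately show ?thesis using q \<beta> unfolding q_def w_def by (intro exI[of _ \<psi>]) auto
qed

end

subsection \<open>Chord arguments near the boundary\<close>

definition half_open_segment :: "complex \<Rightarrow> complex \<Rightarrow> complex set" where
  "half_open_segment w a = (\<lambda>u. w + of_real u * (a - w)) ` {0..<1}"

lemma half_open_segment_dist:
  assumes "z \<in> half_open_segment w a"
  shows "norm (z - c) \<le> max (norm (w - c)) (norm (a - c))"
proof -
  obtain u where u: "0 \<le> u" "u < 1" "z = w + of_real u * (a - w)" using assms by (auto simp: half_open_segment_def)
  have "z - c = of_real (1 - u) * (w - c) + of_real u * (a - c)" by (simp add: u(3) algebra_simps)
  then have "norm (z - c) \<le> norm (of_real (1 - u) * (w - c)) + norm (of_real u * (a - c))" by (metis norm_triangle_ineq)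
  also have "\<dots> = (1 - u) * norm (w - c) + u * norm (a - c)" using u by (simp add: norm_mult del: of_real_diff)
  also have "\<dots> \<le> (1 - u) * max (norm (w - c)) (norm (a - c)) + u * max (norm (w - c)) (norm (a - c))"
    using u by (intro add_mono mult_left_mono) auto
  finally show ?thesis by (simp add: algebra_simps)
qed

lemma first_exit:
  assumes "open W" "w \<in> W" "b \<notin> W"
  obtains u where "0 < u" "u \<le> 1" "w + of_real u * (b - w) \<notin> W" "half_open_segment w (w + of_real u * (b - w)) \<subseteq> W"
proof -
  define T where "T = {u\<in>{0..1}. w + of_real u * (b - w) \<notin> W}"
  have "T = {0..1} \<inter> (\<lambda>u::real. w + of_real u * (b - w)) -` (- W)" by (auto simp: T_def)
  moreover have "closed ({0..1} \<inter> (\<lambda>u::real. w + of_real u * (b - w)) -` (- W))"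
    using assms(1) by (intro continuous_closed_preimage continuous_intros) auto
  ultimately have "closed T" by simp
  moreover have "bounded T" by (rule bounded_subset[of "{0..1}"]) (auto simp: T_def)
  moreover have "1 \<in> T" using assms(3) by (simp add: T_def)
  ultimately obtain u where u: "u \<in> T" "\<And>v. v \<in> T \<Longrightarrow> u \<le> v"
    using compact_attains_inf[of T] compact_eq_bounded_closed by blast
  have u0: "u > 0" using u(1) assms(2) by (cases "u = 0") (auto simp: T_def)
  have "half_open_segment w (w + of_real u * (b - w)) \<subseteq> W"
  proof
    fix z assume "z \<in> half_open_segment w (w + of_real u * (b - w))"
    then obtain v where v: "0 \<le> v" "v < 1" "z = w + of_real (v * u) * (b - w)" by (auto simp: half_open_segment_def mult.assoc)
    have "v * u < 1 * u" using v u0 by (intro mult_strict_right_mono) auto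
    then have "v * u \<notin> T" using u(2)[of "v * u"] by auto
    moreover have "v * u \<in> {0..1}" using v u0 u(1) by (auto simp: T_def intro!: mult_le_one)
    ultimately show "z \<in> W" using v(3) by (auto simp: T_def)
  qed
  then show thesis using that[of u] u0 u(1) by (auto simp: T_def)
qed

context chord_config
begin

lemma preimage_segment:
  assumes p: "p \<in> right_half" and sub: "half_open_segment (f p) a \<subseteq> f ` right_half"
  shows "connected (fi ` half_open_segment (f p) a)" "fi ` half_open_segment (f p) a \<subseteq> right_half" "p \<in> fi ` half_open_segment (f p) a"
proof -
  have "connected (half_open_segment (f p) a)"
    unfolding half_open_segment_def by (intro connected_continuous_image continuous_intros) auto
  then show "connected (fi ` half_open_segment (f p) a)"
    by (intro connected_continuous_image continuous_on_subset[OF fi_cont] sub)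
  show "fi ` half_open_segment (f p) a \<subseteq> right_half" using fi(2) sub by blast
  have "f p \<in> half_open_segment (f p) a" unfolding half_open_segment_def by (rule image_eqI[of _ _ 0]) auto
  then show "p \<in> fi ` half_open_segment (f p) a" using fi(1)[OF p] by (metis imageI)
qed

lemma escape_segment':
  assumes p: "p \<in> right_half" and r: "r > 0" and a: "a \<notin> f ` right_half"
    and seg: "half_open_segment (f p) a \<subseteq> f ` right_half" and small: "fi ` half_open_segment (f p) a \<subseteq> ball p r"
  shows "\<exists>\<psi>. \<bar>\<psi>\<bar> \<le> pi \<and> (\<forall>x\<in>far_set p r. (f x - f p) / (f x - a) \<notin> \<real>\<^sub>\<le>\<^sub>0 \<and>
      \<psi> - 2 * pi < \<Theta> p x - Arg ((f x - f p) / (f x - a)) \<and> \<Theta> p x - Arg ((f x - f p) / (f x - a)) < \<psi>) \<and>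
      (a \<noteq> 0 \<longrightarrow> \<bar>\<psi> - (Arg (f p) + Arg (a / f p))\<bar> \<le> pi)"
proof -
  have mem: "f p + of_real u * (a - f p) \<in> half_open_segment (f p) a" if "u \<in> {0..<1}" for u
    unfolding half_open_segment_def using that by blast
  show ?thesis using seg small mem by (intro escape_segment p r a) blast+
qed

text \<open>For distant values \<open>f p\<close> the quotient \<open>q\<close> need not be close to
  \<open>1\<close>. As the omitted point lies radially beyond \<open>f p\<close>, one has
  \<open>q = 1 + \<tau> * cis (b - B)\<close>, where \<open>b\<close> and \<open>B\<close> are
  arguments of \<open>f p\<close> and of \<open>f x - a\<close>. Hence
  \<open>\<Theta> p x = B + Arg q\<close> lies between \<open>B\<close> and either \<open>b\<close>
  or \<open>b - 2 * pi\<close>, all of which are in the stated range.\<close>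

lemma radial_segment_bound:
  assumes p: "p \<in> right_half" and r: "r > 0" and a: "of_real l * f p \<notin> f ` right_half" "l > 1"
    and seg: "half_open_segment (f p) (of_real l * f p) \<subseteq> f ` right_half"
    and small: "fi ` half_open_segment (f p) (of_real l * f p) \<subseteq> ball p r" and x: "x \<in> far_set p r"
  shows "- 3 * pi < \<Theta> p x \<and> \<Theta> p x < pi"
proof -
  define w a b where "w = f p" and "a = of_real l * w" and "b = Arg w"
  have w0: "w \<noteq> 0" "\<bar>b\<bar> < pi" using f_nz[OF p] Arg_less_pi f_not_nonpos[OF p] by (auto simp: w_def b_def)
  have a0: "a \<noteq> 0" using w0 assms(4) by (simp add: a_def)
  have aw: "Arg (a / w) = 0" using w0 assms(4) by (simp add: a_def Arg_of_real)
  have xr: "x \<in> right_half" using x by (simp add: far_set_def)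
  define q where "q = (f x - w) / (f x - a)"
  obtain \<psi> where \<psi>: "\<bar>\<psi>\<bar> \<le> pi" "q \<notin> \<real>\<^sub>\<le>\<^sub>0" "\<psi> - 2 * pi < \<Theta> p x - Arg q" "\<Theta> p x - Arg q < \<psi>" "\<bar>\<psi> - b\<bar> \<le> pi"
    using escape_segment'[OF p r a(1) seg small] x a0 aw unfolding q_def w_def a_def b_def by fastforce
  define B where "B = \<Theta> p x - Arg q"
  define R where "R = norm (f x - a)"
  have xa: "f x \<noteq> a" using a(1) xr unfolding a_def w_def by (metis imageI)
  then have R: "R > 0" by (simp add: R_def)
  have fw: "f x - w \<noteq> 0" using chord_ne(1)[OF far_set_chord[OF x p]] by (simp add: w_def)
  have q0: "q \<noteq> 0" using xa fw by (simp add: q_def)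
  have eB: "f x - a = of_real R * cis B"
  proof -
    have "cis B = cis (\<Theta> p x) / cis (Arg q)" by (simp add: B_def cis_divide)
    also have "\<dots> = ((f x - w) / of_real (norm (f x - w))) / (q / of_real (norm q))"
      using chord_ne(2)[OF far_set_chord[OF x p]] q0 by (simp add: w_def cis_mult_norm)
    also have "\<dots> = (f x - a) / of_real R"
      using fw xa by (simp add: q_def R_def norm_divide)
    finally show ?thesis using R by simp
  qed
  define \<tau> where "\<tau> = (l - 1) * norm w / R"
  have \<tau>: "\<tau> \<ge> 0" using assms(4) R by (simp add: \<tau>_def)
  have qe: "q = 1 + of_real \<tau> * cis (b - B)"
  proof -
    have ww: "w = of_real (norm w) * cis b" unfolding b_def by (metis rcis_cmod_Arg rcis_def)
    have "f x - w = (f x - a) + of_real (l - 1) * w" by (simp add: a_def algebra_simps)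
    then have "q = (f x - a) / (f x - a) + of_real (l - 1) * w / (f x - a)" unfolding q_def by (simp only: add_divide_distrib)
    then have "q = 1 + of_real (l - 1) * w / (f x - a)" using xa by simp
    also have "of_real (l - 1) * w / (f x - a) = of_real (l - 1) * (of_real (norm w) * cis b) / (of_real R * cis B)"
      by (subst ww, subst eB) simp
    also have "\<dots> = of_real \<tau> * cis (b - B)" by (simp add: \<tau>_def cis_divide[symmetric])
    finally show ?thesis .
  qed
  have \<Theta>B: "\<Theta> p x = B + Arg q" by (simp add: B_def)
  have Bb: "\<psi> - 2 * pi < B" "B < \<psi>" using \<psi>(3,4) by (simp_all add: B_def)
  show ?thesis
  proof (cases "b - B < pi")
    case True
    have "- pi < b - B" using Bb(2) \<psi>(5) by linarith
    from Arg_between[OF \<tau> this True] have "min 0 (b - B) \<le> Arg q" "Arg q \<le> max 0 (b - B)" by (auto simp: qe)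
    then have "min B b \<le> \<Theta> p x" "\<Theta> p x \<le> max B b" unfolding \<Theta>B by (auto simp: min_def max_def split: if_splits)
    then show ?thesis using Bb \<psi>(1) w0(2) by (auto simp: min_def max_def split: if_splits)
  next
    case False
    define e where "e = b - B - 2 * pi"
    have ce: "cis (b - B) = cis e" by (simp add: e_def cis_divide[symmetric])
    have "e < pi" using Bb(1) \<psi>(5) by (simp add: e_def)
    have "- pi \<le> e" using False by (simp add: e_def)
    show ?thesis
    proof (cases "e = - pi")
      case True
      \<comment> \<open>The two directions are opposite. Here \<open>q\<close> is real, and it is
        positive because it avoids the cut.\<close>
      have "cis e = -1" by (simp add: True complex_eq_iff)
      then have "q = of_real (1 - \<tau>)" using qe ce by simp
      then have "Arg q = 0" using \<psi>(2) by (auto simp: Arg_of_real complex_nonpos_Reals_iff simp del: of_real_diff)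
      then show ?thesis using \<Theta>B Bb \<psi>(1) by linarith
    next
      case False
      then have "- pi < e" using \<open>- pi \<le> e\<close> by simp
      from Arg_between[OF \<tau> this \<open>e < pi\<close>] have "min 0 e \<le> Arg q" "Arg q \<le> max 0 e" by (auto simp: qe ce)
      then have "min B (b - 2 * pi) \<le> \<Theta> p x" "\<Theta> p x \<le> max B (b - 2 * pi)"
        unfolding \<Theta>B e_def by (auto simp: min_def max_def split: if_splits)
      then show ?thesis using Bb \<psi>(1) w0(2) by (auto simp: min_def max_def split: if_splits)
    qed
  qed
qed

text \<open>Without an exit on the radial ray, that ray itself serves as the cut:
  \<open>1 - f x / f p\<close> avoids the nonpositive axis on the far set, and the normalization
  gives \<open>\<Theta> p x = Arg (1 - f x / f p) + Arg (f p) - pi\<close>.\<close>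

lemma radial_ray_bound:
  assumes p: "p \<in> right_half" and r: "r > 0" and ray: "\<And>u. u \<ge> 1 \<Longrightarrow> of_real u * f p \<in> f ` right_half"
    and small: "\<And>u. u \<ge> 1 \<Longrightarrow> fi (of_real u * f p) \<in> ball p r" and x: "x \<in> far_set p r"
  shows "- 3 * pi < \<Theta> p x \<and> \<Theta> p x < pi"
proof -
  define w where "w = f p"
  have w0: "w \<noteq> 0" "\<bar>Arg w\<bar> < pi" using f_nz[OF p] Arg_less_pi f_not_nonpos[OF p] by (auto simp: w_def)
  define q where "q x = 1 - f x / w" for x
  have far_r: "x \<in> right_half" if "x \<in> far_set p r" for x using that by (simp add: far_set_def)
  have q: "q x \<notin> \<real>\<^sub>\<le>\<^sub>0" if x: "x \<in> far_set p r" for x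
  proof
    assume "q x \<in> \<real>\<^sub>\<le>\<^sub>0"
    define u where "u = 1 - Re (q x)"
    have "u \<ge> 1" "q x = 1 - of_real u" using \<open>q x \<in> \<real>\<^sub>\<le>\<^sub>0\<close> by (auto simp: u_def complex_nonpos_Reals_iff complex_eq_iff)
    then have "f x = of_real u * f p" using w0 by (simp add: q_def w_def field_simps)
    then have "x \<in> ball p r" using small[OF \<open>u \<ge> 1\<close>] fi(1)[OF far_r[OF x]] by simp
    then show False using x by (simp add: far_set_def dist_norm norm_minus_commute)
  qed
  have cisE: "cis (\<Theta> p x - Arg (q x)) = - w / of_real (norm w)" if x: "x \<in> far_set p r" for x
  proof -
    have q0: "q x \<noteq> 0" using q[OF x] by auto
    have "f x - f p = - w * q x" using w0 by (simp add: q_def w_def field_simps)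
    then have "cis (\<Theta> p x) = - w * q x / of_real (norm w * norm (q x))"
      using chord_ne(2)[OF far_set_chord[OF x p]] by (simp add: norm_mult)
    also have "\<dots> = (- w / of_real (norm w)) * cis (Arg (q x))" using q0 by (simp add: cis_mult_norm)
    finally show ?thesis by (simp add: cis_divide[symmetric])
  qed
  have const: "\<Theta> p x - Arg (q x) = \<Theta> p y - Arg (q y)" if "x \<in> far_set p r" "y \<in> far_set p r" for x y
  proof (rule cis_constant_imp_constant[OF connected_far_set[OF p r] _ cisE])
    have cf: "continuous_on (far_set p r) f" by (rule continuous_on_subset[OF f_cont]) (use far_r in auto)
    have "(\<lambda>x. (p, x)) ` far_set p r \<subseteq> chord_set" using far_set_chord p by auto
    then have ct: "continuous_on (far_set p r) (\<lambda>x. \<Theta> p x)"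
      using continuous_on_compose2[OF \<Theta>_cont, of "far_set p r" "\<lambda>x. (p, x)"] by (simp add: continuous_intros)
    have cq: "continuous_on (far_set p r) q" unfolding q_def
      using w0 by (intro continuous_on_divide continuous_on_diff cf continuous_on_const) auto
    show "continuous_on (far_set p r) (\<lambda>x. \<Theta> p x - Arg (q x))"
      by (intro continuous_on_diff ct continuous_on_Arg' cq) (use q in auto)
  qed (use that in auto)
  have "((\<lambda>s. q (\<gamma> s)) \<longlongrightarrow> 1 - 0 / w) (at_left 1)"
    unfolding q_def using w0 by (intro tendsto_intros f_\<gamma>) auto
  then have "((\<lambda>s. Arg (q (\<gamma> s))) \<longlongrightarrow> Arg 1) (at_left 1)"
    by (intro isCont_tendsto_compose[OF continuous_at_Arg]) auto
  then have "((\<lambda>s. \<Theta> p (\<gamma> s) - Arg (q (\<gamma> s))) \<longlongrightarrow> Arg (f p) - pi - Arg 1) (at_left 1)"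
    by (intro tendsto_diff norm_lim p)
  moreover have "\<forall>\<^sub>F s in at_left 1. \<Theta> p (\<gamma> s) - Arg (q (\<gamma> s)) = \<Theta> p x - Arg (q x)"
    using ev_far_set[OF p, of r] by eventually_elim (use const x in blast)
  ultimately have "((\<lambda>s. \<Theta> p x - Arg (q x)) \<longlongrightarrow> Arg (f p) - pi - Arg 1) (at_left (1::real))"
    by (rule Lim_transform_eventually)
  then have "\<Theta> p x - Arg (q x) = Arg w - pi"
    by (simp add: tendsto_const_iff w_def)
  then show ?thesis using Arg_less_pi[OF q[OF x]] w0(2) by (auto simp: abs_less_iff)
qed

text \<open>Otherwise continuity of the inverse of \<open>f\<close> at \<open>c\<close> would give
  the sequence a limit inside the half plane.\<close>

lemma boundary_value_omitted:
  assumes p: "\<And>n. p n \<in> right_half" "p \<longlonglongrightarrow> \<i> * of_real y0" and c: "(\<lambda>n. f (p n)) \<longlonglongrightarrow> c"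
  shows "c \<notin> f ` right_half"
proof
  assume c_in: "c \<in> f ` right_half"
  have "isCont fi c" using iffD1[OF continuous_on_eq_continuous_at[OF open_image] fi_cont] c_in by blast
  then have "(\<lambda>n. fi (f (p n))) \<longlonglongrightarrow> fi c" using c isCont_tendsto_compose by blast
  then have "p \<longlonglongrightarrow> fi c" using fi(1) p(1) by simp
  then have "fi c = \<i> * of_real y0" using p(2) LIMSEQ_unique by blast
  then show False using fi(2)[OF c_in] by simp
qed

lemma Arg_near_1:
  assumes "\<delta> > 0"
  obtains \<eta> where "\<eta> > 0" "\<And>q. norm (q - 1) < \<eta> \<Longrightarrow> \<bar>Arg q\<bar> < \<delta>"
proof -
  have "isCont Arg 1" by (rule continuous_at_Arg) auto
  then have "\<forall>\<^sub>F q in at 1. dist (Arg q) (Arg 1) < \<delta>" unfolding isCont_def using assms by (rule tendstoD)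
  then obtain d where "d > 0" "\<And>q. q \<noteq> 1 \<Longrightarrow> dist q 1 < d \<Longrightarrow> dist (Arg q) (Arg 1) < \<delta>" by (auto simp: eventually_at)
  then show thesis using that[of d] assms by (metis Arg_1 diff_zero dist_norm dist_self real_norm_def)
qed

section \<open>Chord arguments along sequences tending to the imaginary axis\<close>

context
  fixes p x :: "nat \<Rightarrow> complex" and y0 t :: real
  assumes p: "\<And>n. p n \<in> right_half" "p \<longlonglongrightarrow> \<i> * of_real y0"
    and x: "\<And>n. x n \<in> right_half" "\<And>n. x n - p n = \<i> * of_real t" and t: "t \<noteq> 0"
begin

lemma vertical_shift_far: "x n \<in> far_set (p n) (\<bar>t\<bar> / 2)"
proof -
  have "Im (x n - p n) = t" by (simp only: x(2)) simp
  then show ?thesis using x t by (auto simp: far_set_def norm_mult complex_nonpos_Reals_iff simp del: minus_complex.sel)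
qed

text \<open>Moving radially outwards from \<open>f (p n)\<close> does not decrease the modulus, so
  the preimage of the radial segment up to its exit, or of the whole ray, is eventually small. The
  two radial bounds cover these two alternatives.\<close>

lemma boundary_bound_infinite:
  assumes inf: "filterlim (\<lambda>n. norm (f (p n))) at_top sequentially"
  shows "\<forall>\<^sub>F n in sequentially. - 3 * pi < \<Theta> (p n) (x n) \<and> \<Theta> (p n) (x n) < pi"
proof -
  let ?r = "\<bar>t\<bar> / 2"
  have r: "?r > 0" using t by simp
  have "\<exists>S. connected S \<and> S \<subseteq> right_half \<and> p n \<in> S \<and> (\<forall>z\<in>S. norm (f (p n)) \<le> norm (f z)) \<and>
      (S \<subseteq> ball (p n) ?r \<longrightarrow> - 3 * pi < \<Theta> (p n) (x n) \<and> \<Theta> (p n) (x n) < pi)" for n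
  proof (cases "\<exists>u\<ge>1. of_real u * f (p n) \<notin> f ` right_half")
    case True
    then obtain u where u: "u \<ge> 1" "of_real u * f (p n) \<notin> f ` right_half" by blast
    have pi: "f (p n) \<in> f ` right_half" using p(1) by blast
    obtain v where v: "0 < v" "v \<le> 1" "f (p n) + of_real v * (of_real u * f (p n) - f (p n)) \<notin> f ` right_half"
      "half_open_segment (f (p n)) (f (p n) + of_real v * (of_real u * f (p n) - f (p n))) \<subseteq> f ` right_half"
      using first_exit[OF open_image pi u(2)] by blast
    define l where "l = 1 + v * (u - 1)"
    have e: "f (p n) + of_real v * (of_real u * f (p n) - f (p n)) = of_real l * f (p n)"
      by (simp add: l_def algebra_simps)
    have a: "of_real l * f (p n) \<notin> f ` right_half" and seg: "half_open_segment (f (p n)) (of_real l * f (p n)) \<subseteq> f ` right_half"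
      using v(3,4) unfolding e by this+
    have "l \<noteq> 1"
    proof
      assume "l = 1"
      then have "complex_of_real l * f (p n) = f (p n)" by simp
      then show False using a pi by metis
    qed
    then have l: "l > 1" using v u by (simp add: l_def)
    let ?S = "fi ` half_open_segment (f (p n)) (of_real l * f (p n))"
    have "norm (f (p n)) \<le> norm (f z)" if z: "z \<in> ?S" for z
    proof -
      obtain s where s: "0 \<le> s" "s < 1" "z = fi (f (p n) + of_real s * (of_real l * f (p n) - f (p n)))"
        using z by (auto simp: half_open_segment_def)
      have "f (p n) + of_real s * (of_real l * f (p n) - f (p n)) \<in> half_open_segment (f (p n)) (of_real l * f (p n))"
        unfolding half_open_segment_def using s by (intro imageI) simp
      then have "f (p n) + of_real s * (of_real l * f (p n) - f (p n)) \<in> f ` right_half" using seg by blast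
      then have "f z = of_real (1 + s * (l - 1)) * f (p n)" using fi(3) s(3) by (simp add: algebra_simps)
      then have "norm (f z) = (1 + s * (l - 1)) * norm (f (p n))" using s l by (simp add: norm_mult del: of_real_add)
      moreover have "1 * norm (f (p n)) \<le> (1 + s * (l - 1)) * norm (f (p n))" using s l by (intro mult_right_mono) auto
      ultimately show ?thesis by simp
    qed
    then show ?thesis
      using preimage_segment[OF p(1) seg] radial_segment_bound[OF p(1) r a l seg _ vertical_shift_far] by (intro exI[of _ ?S]) auto
  next
    case False
    then have ray: "\<And>u. u \<ge> 1 \<Longrightarrow> of_real u * f (p n) \<in> f ` right_half" by blast
    let ?S = "fi ` (\<lambda>u. of_real u * f (p n)) ` {1..}"
    have "connected ((\<lambda>u::real. of_real u * f (p n)) ` {1..})" by (intro connected_continuous_image continuous_intros) auto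
    moreover have "continuous_on ((\<lambda>u. of_real u * f (p n)) ` {1..}) fi"
      by (rule continuous_on_subset[OF fi_cont]) (use ray in auto)
    ultimately have "connected ?S" using connected_continuous_image by blast
    moreover have "?S \<subseteq> right_half" using ray fi(2) by blast
    moreover have "p n \<in> ?S" using fi(1)[OF p(1)] by (intro image_eqI[of _ _ "f (p n)"] image_eqI[of _ _ 1]) auto
    moreover have "norm (f (p n)) \<le> norm (f z)" if z: "z \<in> ?S" for z
    proof -
      obtain u where u: "u \<ge> 1" "z = fi (of_real u * f (p n))" using z by auto
      then have "f z = of_real u * f (p n)" using ray fi(3) by simp
      then show ?thesis using u(1) mult_right_mono[of 1 u "norm (f (p n))"] by (simp add: norm_mult)
    qed
    moreover have "- 3 * pi < \<Theta> (p n) (x n) \<and> \<Theta> (p n) (x n) < pi" if sb: "?S \<subseteq> ball (p n) ?r"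
    proof (rule radial_ray_bound[OF p(1) r ray _ vertical_shift_far])
      fix u :: real assume "u \<ge> 1"
      then have "fi (of_real u * f (p n)) \<in> ?S" by (intro imageI) simp
      then show "fi (of_real u * f (p n)) \<in> ball (p n) ?r" using sb by blast
    qed
    ultimately show ?thesis by (intro exI[of _ ?S]) blast
  qed
  then obtain S where S: "\<And>n. connected (S n)" "\<And>n. S n \<subseteq> right_half" "\<And>n. p n \<in> S n"
    "\<And>n z. z \<in> S n \<Longrightarrow> norm (f (p n)) \<le> norm (f z)"
    "\<And>n. S n \<subseteq> ball (p n) ?r \<Longrightarrow> - 3 * pi < \<Theta> (p n) (x n) \<and> \<Theta> (p n) (x n) < pi"
    by metis
  have "\<forall>\<^sub>F n in sequentially. S n \<subseteq> ball (p n) ?r"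
  proof (rule small_sets_infinite[OF p(2) S(1,2,3) _ r])
    fix M
    have "\<forall>\<^sub>F n in sequentially. M < norm (f (p n))" using inf by (simp add: filterlim_at_top_dense)
    then show "\<forall>\<^sub>F n in sequentially. \<forall>z\<in>S n. M < norm (f z)"
      by eventually_elim (use S(4) less_le_trans in blast)
  qed
  then show ?thesis by eventually_elim (rule S(5))
qed

text \<open>The exit point \<open>a n\<close> on the segment from \<open>f (p n)\<close> to its
  omitted limit \<open>c\<close> comes close to \<open>f (p n)\<close>, while \<open>f (x n)\<close>
  keeps its distance. The quotient therefore tends to \<open>1\<close>, and its argument costs only
  \<open>\<delta>\<close>.\<close>

lemma boundary_bound_apart:
  assumes c: "(\<lambda>n. f (p n)) \<longlonglongrightarrow> c" and \<epsilon>: "\<epsilon> > 0" "\<And>n. \<epsilon> \<le> norm (f (x n) - c)" and \<delta>: "\<delta> > 0"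
  shows "\<forall>\<^sub>F n in sequentially. - 3 * pi - \<delta> < \<Theta> (p n) (x n) \<and> \<Theta> (p n) (x n) < pi + \<delta>"
proof -
  let ?r = "\<bar>t\<bar> / 2"
  have r: "?r > 0" using t by simp
  have co: "c \<notin> f ` right_half" by (rule boundary_value_omitted[OF p c])
  have "\<exists>u. 0 < u \<and> u \<le> 1 \<and> f (p n) + of_real u * (c - f (p n)) \<notin> f ` right_half \<and>
      half_open_segment (f (p n)) (f (p n) + of_real u * (c - f (p n))) \<subseteq> f ` right_half" for n
    using first_exit[OF open_image _ co, of "f (p n)"] p(1) by (metis imageI)
  then obtain u where u: "\<And>n. 0 < u n" "\<And>n. u n \<le> 1" "\<And>n. f (p n) + of_real (u n) * (c - f (p n)) \<notin> f ` right_half"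
      "\<And>n. half_open_segment (f (p n)) (f (p n) + of_real (u n) * (c - f (p n))) \<subseteq> f ` right_half" by metis
  define a where "a n = f (p n) + of_real (u n) * (c - f (p n))" for n
  have a: "a n \<notin> f ` right_half" "half_open_segment (f (p n)) (a n) \<subseteq> f ` right_half" for n using u by (simp_all add: a_def)
  have ac: "norm (a n - c) \<le> norm (f (p n) - c)" "norm (a n - f (p n)) \<le> norm (f (p n) - c)" for n
  proof -
    have "a n - c = of_real (1 - u n) * (f (p n) - c)" by (simp add: a_def algebra_simps)
    then show "norm (a n - c) \<le> norm (f (p n) - c)"
      using u(1,2)[of n] by (simp add: norm_mult mult_left_le_one_le del: of_real_diff)
    have "norm (a n - f (p n)) = u n * norm (f (p n) - c)" using u(1)[of n] by (simp add: a_def norm_mult norm_minus_commute)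
    then show "norm (a n - f (p n)) \<le> norm (f (p n) - c)" using u(1,2)[of n] by (simp add: mult_left_le_one_le)
  qed
  obtain \<eta> where \<eta>: "\<eta> > 0" "\<And>q. norm (q - 1) < \<eta> \<Longrightarrow> \<bar>Arg q\<bar> < \<delta>" using Arg_near_1[OF \<delta>] by blast
  have lim: "\<forall>\<^sub>F n in sequentially. norm (f (p n) - c) < e" if "e > 0" for e
    using tendstoD[OF c that] by (simp add: dist_norm)
  have "\<forall>\<^sub>F n in sequentially. fi ` half_open_segment (f (p n)) (a n) \<subseteq> ball (p n) ?r"
  proof (rule small_sets_finite[OF p(2) preimage_segment[OF p(1) a(2)] co _ r])
    fix e :: real assume "e > 0"
    from lim[OF this] show "\<forall>\<^sub>F n in sequentially. \<forall>z\<in>fi ` half_open_segment (f (p n)) (a n). norm (f z - c) < e"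
    proof eventually_elim
      case (elim n)
      show ?case
      proof
        fix z assume "z \<in> fi ` half_open_segment (f (p n)) (a n)"
        then have "f z \<in> half_open_segment (f (p n)) (a n)" using fi(3) a(2)[of n] by auto
        from half_open_segment_dist[OF this, of c] show "norm (f z - c) < e" using ac(1)[of n] elim by simp
      qed
    qed
  qed
  moreover have "\<forall>\<^sub>F n in sequentially. norm (f (p n) - c) < min (\<epsilon> / 2) (\<eta> * \<epsilon> / 2)" using \<epsilon> \<eta> by (intro lim) auto
  ultimately show ?thesis
  proof eventually_elim
    case (elim n)
    define q where "q = (f (x n) - f (p n)) / (f (x n) - a n)"
    obtain \<psi> where \<psi>: "\<bar>\<psi>\<bar> \<le> pi" "\<psi> - 2 * pi < \<Theta> (p n) (x n) - Arg q" "\<Theta> (p n) (x n) - Arg q < \<psi>"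
      using escape_segment'[OF p(1) r a(1,2) elim(1)] vertical_shift_far[of n] unfolding q_def by blast
    have xa: "\<epsilon> / 2 < norm (f (x n) - a n)"
      using \<epsilon>(2)[of n] elim(2) ac(1)[of n] norm_triangle_ineq4[of "f (x n) - a n" "c - a n"] by (auto simp: norm_minus_commute)
    have "q - 1 = (a n - f (p n)) / (f (x n) - a n)"
    proof -
      have "f (x n) - a n \<noteq> 0" using xa \<epsilon>(1) by auto
      then show ?thesis by (simp add: q_def field_simps)
    qed
    then have "norm (q - 1) = norm (a n - f (p n)) / norm (f (x n) - a n)" by (simp add: norm_divide)
    also have "\<dots> \<le> norm (f (p n) - c) / (\<epsilon> / 2)" using ac(2) xa \<epsilon>(1) by (intro frac_le) auto
    also have "\<dots> < \<eta>" using elim(2) \<epsilon>(1) by (simp add: field_simps)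
    finally have "\<bar>Arg q\<bar> < \<delta>" by (rule \<eta>(2))
    then show ?case using \<psi> by (auto simp: abs_less_iff abs_le_iff)
  qed
qed

text \<open>Here distances do not control the quotient. The segment joining the two values must
  eventually leave the image, since otherwise its preimage would be a small set containing
  \<open>p n\<close> and \<open>x n\<close>, which are \<open>|t|\<close> apart. With the exit point
  on this very segment the quotient is real and positive.\<close>

lemma boundary_bound_together:
  assumes c: "(\<lambda>n. f (p n)) \<longlonglongrightarrow> c" "(\<lambda>n. f (x n)) \<longlonglongrightarrow> c"
  shows "\<forall>\<^sub>F n in sequentially. - 3 * pi < \<Theta> (p n) (x n) \<and> \<Theta> (p n) (x n) < pi"
proof -
  let ?r = "\<bar>t\<bar> / 2"
  have r: "?r > 0" using t by simp
  have co: "c \<notin> f ` right_half" by (rule boundary_value_omitted[OF p c(1)])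
  have lim: "\<forall>\<^sub>F n in sequentially. norm (f (p n) - c) < e \<and> norm (f (x n) - c) < e" if "e > 0" for e
    using tendstoD[OF c(1) that] tendstoD[OF c(2) that] by eventually_elim (simp add: dist_norm)
  define full where "full n \<longleftrightarrow> closed_segment (f (p n)) (f (x n)) \<subseteq> f ` right_half" for n
  \<comment> \<open>The single point \<open>p n\<close> is the default when the segment leaves the
    image, so that the collapse of small sets applies to the whole sequence.\<close>
  define S where "S n = (if full n then fi ` closed_segment (f (p n)) (f (x n)) else {p n})" for n
  have "\<forall>\<^sub>F n in sequentially. S n \<subseteq> ball (p n) ?r"
  proof (rule small_sets_finite[OF p(2) _ _ _ co _ r])
    show "connected (S n)" for n
      unfolding S_def full_def by (auto intro!: connected_continuous_image continuous_on_subset[OF fi_cont])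
    show "S n \<subseteq> right_half" for n using p(1) fi(2) by (auto simp: S_def full_def)
    show "p n \<in> S n" for n
    proof -
      have "f (p n) \<in> closed_segment (f (p n)) (f (x n))" by simp
      then show ?thesis using fi(1)[OF p(1)] unfolding S_def by (metis imageI insertI1)
    qed
    fix e :: real assume "e > 0"
    from lim[OF this] show "\<forall>\<^sub>F n in sequentially. \<forall>z\<in>S n. norm (f z - c) < e"
    proof eventually_elim
      case (elim n)
      show ?case
      proof
        fix z assume z: "z \<in> S n"
        show "norm (f z - c) < e"
        proof (cases "full n")
          case True
          then have "f z \<in> closed_segment (f (p n)) (f (x n))" using z fi(3) by (auto simp: S_def full_def)
          moreover have "closed_segment (f (p n)) (f (x n)) \<subseteq> ball c e"
            using elim by (intro closed_segment_subset convex_ball) (auto simp: dist_norm norm_minus_commute)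
          ultimately show ?thesis by (auto simp: dist_norm norm_minus_commute)
        qed (use z elim in \<open>auto simp: S_def\<close>)
      qed
    qed
  qed
  then have nf: "\<forall>\<^sub>F n in sequentially. \<not> full n"
  proof eventually_elim
    case (elim n)
    show ?case
    proof
      assume "full n"
      have "f (x n) \<in> closed_segment (f (p n)) (f (x n))" by simp
      then have "x n \<in> S n" using \<open>full n\<close> fi(1)[OF x(1)] unfolding S_def by (metis imageI)
      then have "norm (x n - p n) < ?r" using elim by (auto simp: dist_norm norm_minus_commute)
      then show False using x(2)[of n] t by (simp add: norm_mult)
    qed
  qed
  \<comment> \<open>The value \<open>0\<close> for full segments makes the exit segment degenerate,
    again so that the sequence is defined for every \<open>n\<close>.\<close>
  have "\<exists>u. (full n \<longrightarrow> u = 0) \<and> (\<not> full n \<longrightarrow> 0 < u \<and> u < 1 \<and> f (p n) + of_real u * (f (x n) - f (p n)) \<notin> f ` right_half \<and>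
      half_open_segment (f (p n)) (f (p n) + of_real u * (f (x n) - f (p n))) \<subseteq> f ` right_half)" for n
  proof (cases "full n")
    case False
    then obtain b where "b \<in> closed_segment (f (p n)) (f (x n))" "b \<notin> f ` right_half" unfolding full_def by blast
    then obtain s where s: "0 \<le> s" "s \<le> 1" "b = f (p n) + of_real s * (f (x n) - f (p n))"
      by (auto simp: in_segment scaleR_conv_of_real algebra_simps)
    have bo: "f (p n) + of_real s * (f (x n) - f (p n)) \<notin> f ` right_half" using s(3) \<open>b \<notin> f ` right_half\<close> by simp
    have pi: "f (p n) \<in> f ` right_half" using p(1) by blast
    obtain v where v: "0 < v" "v \<le> 1" "f (p n) + of_real v * (f (p n) + of_real s * (f (x n) - f (p n)) - f (p n)) \<notin> f ` right_half"
      "half_open_segment (f (p n)) (f (p n) + of_real v * (f (p n) + of_real s * (f (x n) - f (p n)) - f (p n))) \<subseteq> f ` right_half"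
      using first_exit[OF open_image pi bo] by blast
    define u where "u = v * s"
    have e: "f (p n) + of_real v * (f (p n) + of_real s * (f (x n) - f (p n)) - f (p n)) = f (p n) + of_real u * (f (x n) - f (p n))"
      by (simp add: u_def)
    have "u \<noteq> 0"
    proof
      assume "u = 0"
      then have "f (p n) \<notin> f ` right_half" using v(3) unfolding e by simp
      then show False using pi by simp
    qed
    moreover have "u \<noteq> 1"
    proof
      assume "u = 1"
      then have "f (x n) \<notin> f ` right_half" using v(3) unfolding e by simp
      then show False using x(1) by blast
    qed
    moreover have "0 \<le> u" "u \<le> 1" using v s by (auto simp: u_def mult_le_one)
    ultimately show ?thesis using v(3,4) False unfolding e by (intro exI[of _ u]) auto
  qed auto
  then have "\<forall>n. \<exists>u. (full n \<longrightarrow> u = 0) \<and> (\<not> full n \<longrightarrow> 0 < u \<and> u < 1 \<and> f (p n) + of_real u * (f (x n) - f (p n)) \<notin> f ` right_half \<and>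
      half_open_segment (f (p n)) (f (p n) + of_real u * (f (x n) - f (p n))) \<subseteq> f ` right_half)" by (rule allI)
  from choice[OF this] obtain u where u0: "\<forall>n. (full n \<longrightarrow> u n = 0) \<and> (\<not> full n \<longrightarrow> 0 < u n \<and> u n < 1 \<and> f (p n) + of_real (u n) * (f (x n) - f (p n)) \<notin> f ` right_half \<and>
      half_open_segment (f (p n)) (f (p n) + of_real (u n) * (f (x n) - f (p n))) \<subseteq> f ` right_half)" ..
  have u: "\<And>n. full n \<Longrightarrow> u n = 0" "\<And>n. \<not> full n \<Longrightarrow> 0 < u n" "\<And>n. \<not> full n \<Longrightarrow> u n < 1"
      "\<And>n. \<not> full n \<Longrightarrow> f (p n) + of_real (u n) * (f (x n) - f (p n)) \<notin> f ` right_half"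
      "\<And>n. \<not> full n \<Longrightarrow> half_open_segment (f (p n)) (f (p n) + of_real (u n) * (f (x n) - f (p n))) \<subseteq> f ` right_half" using u0 by blast+
  define a where "a n = f (p n) + of_real (u n) * (f (x n) - f (p n))" for n
  have hs: "half_open_segment (f (p n)) (a n) \<subseteq> f ` right_half" for n
  proof (cases "full n")
    case True
    then have "half_open_segment (f (p n)) (a n) \<subseteq> {f (p n)}" using u(1) by (auto simp: a_def half_open_segment_def)
    then show ?thesis using p(1) by blast
  qed (use u(5) a_def in simp)
  have ac: "norm (a n - c) \<le> max (norm (f (p n) - c)) (norm (f (x n) - c))" for n
  proof -
    have "u n \<in> {0..<1}" using u(1,2,3)[of n] by (cases "full n") auto
    then have "a n \<in> half_open_segment (f (p n)) (f (x n))" by (auto simp: a_def half_open_segment_def)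
    then show ?thesis by (rule half_open_segment_dist)
  qed
  have "\<forall>\<^sub>F n in sequentially. fi ` half_open_segment (f (p n)) (a n) \<subseteq> ball (p n) ?r"
  proof (rule small_sets_finite[OF p(2) preimage_segment[OF p(1) hs] co _ r])
    fix e :: real assume "e > 0"
    from lim[OF this] show "\<forall>\<^sub>F n in sequentially. \<forall>z\<in>fi ` half_open_segment (f (p n)) (a n). norm (f z - c) < e"
    proof eventually_elim
      case (elim n)
      show ?case
      proof
        fix z assume "z \<in> fi ` half_open_segment (f (p n)) (a n)"
        then have "f z \<in> half_open_segment (f (p n)) (a n)" using fi(3) hs[of n] by auto
        from half_open_segment_dist[OF this, of c] show "norm (f z - c) < e" using ac[of n] elim by (auto simp: max_def split: if_splits)
      qed
    qed
  qed
  with nf show ?thesis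
  proof eventually_elim
    case (elim n)
    define q where "q = (f (x n) - f (p n)) / (f (x n) - a n)"
    have a: "a n \<notin> f ` right_half" using u(4)[OF elim(1)] by (simp add: a_def)
    obtain \<psi> where \<psi>: "\<bar>\<psi>\<bar> \<le> pi" "\<psi> - 2 * pi < \<Theta> (p n) (x n) - Arg q" "\<Theta> (p n) (x n) - Arg q < \<psi>"
      using escape_segment'[OF p(1) r a hs elim(2)] vertical_shift_far[of n] unfolding q_def by blast
    have "f (x n) - a n = of_real (1 - u n) * (f (x n) - f (p n))" by (simp add: a_def algebra_simps)
    moreover have "f (x n) - f (p n) \<noteq> 0" using chord_ne(1)[OF far_set_chord[OF vertical_shift_far p(1)]] by simp
    ultimately have "q = of_real (1 / (1 - u n))" using u(3)[OF elim(1)] by (simp add: q_def)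
    then have "Arg q = 0" using u(3)[OF elim(1)] by (simp only: Arg_of_real) simp
    then show ?case using \<psi> by (auto simp: abs_le_iff)
  qed
qed

end

text \<open>A sequence violating the bounds has a subsequence on which \<open>f (p n)\<close> tends
  to infinity, or tends to some \<open>c\<close> together with \<open>f (x n)\<close>, or tends to
  \<open>c\<close> while \<open>f (x n)\<close> stays away from it. Each of the three is
  excluded.\<close>

lemma boundary_bound:
  fixes p x :: "nat \<Rightarrow> complex" and y0 t :: real
  assumes p: "\<And>n. p n \<in> right_half" "p \<longlonglongrightarrow> \<i> * of_real y0"
    and x: "\<And>n. x n \<in> right_half" "\<And>n. x n - p n = \<i> * of_real t" and t: "t \<noteq> 0" and \<delta>: "\<delta> > 0"
  shows "\<forall>\<^sub>F n in sequentially. - 3 * pi - \<delta> < \<Theta> (p n) (x n) \<and> \<Theta> (p n) (x n) < pi + \<delta>"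
proof (rule ccontr)
  define good where "good n \<longleftrightarrow> - 3 * pi - \<delta> < \<Theta> (p n) (x n) \<and> \<Theta> (p n) (x n) < pi + \<delta>" for n
  assume "\<not> ?thesis"
  then have "\<not> eventually good sequentially" unfolding good_def .
  then obtain s where s: "strict_mono (s :: nat \<Rightarrow> nat)" "\<And>n. \<not> good (s n)"
    using not_eventually_sequentiallyD by blast
  have sub: "(p \<circ> s') \<longlonglongrightarrow> \<i> * of_real y0" if "strict_mono s'" for s' :: "nat \<Rightarrow> nat"
    by (rule LIMSEQ_subseq_LIMSEQ[OF p(2) that])
  have key: False if s': "strict_mono s'" "\<And>n. \<not> good (s' n)" and ev: "\<forall>\<^sub>F n in sequentially. good (s' n)" for s' :: "nat \<Rightarrow> nat"
    using ev s'(2) by simp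
  show False
  proof (cases "bounded (range (\<lambda>n. f (p (s n))))")
    case False
    have "\<exists>n>m. real m < norm (f (p (s n)))" for m
    proof (rule ccontr)
      assume "\<not> ?thesis"
      then have "\<And>n. n > m \<Longrightarrow> norm (f (p (s n))) \<le> real m" by (meson not_le)
      then have "bounded ((\<lambda>n. f (p (s n))) ` {m<..})" by (auto simp: bounded_iff)
      moreover have "bounded ((\<lambda>n. f (p (s n))) ` {..m})" by (intro finite_imp_bounded) auto
      moreover have "range (\<lambda>n. f (p (s n))) = (\<lambda>n. f (p (s n))) ` {..m} \<union> (\<lambda>n. f (p (s n))) ` {m<..}" by force
      ultimately show False using False by simp
    qed
    then obtain nx where nx: "\<And>m. nx m > m" "\<And>m. real m < norm (f (p (s (nx m))))" by metis
    define r where "r = rec_nat (nx 0) (\<lambda>_ m. nx m)"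
    have r: "r 0 = nx 0" "r (Suc n) = nx (r n)" for n by (simp_all add: r_def)
    have sr: "strict_mono r" using nx(1) by (simp add: strict_mono_Suc_iff r)
    have big: "real n \<le> norm (f (p (s (r n))))" for n
    proof (cases n)
      case (Suc m)
      have "m < r m"
      proof (induction m)
        case 0 then show ?case using nx(1)[of 0] by (simp add: r)
      next
        case (Suc k)
        moreover have "r k < r (Suc k)" using nx(1) by (simp add: r)
        ultimately show ?case by simp
      qed
      then have "real n \<le> real (r m)" using Suc by simp
      also have "\<dots> < norm (f (p (s (nx (r m)))))" by (rule nx(2))
      finally show ?thesis using Suc by (simp add: r)
    qed simp
    have ss: "strict_mono (s \<circ> r)" using s(1) sr by (rule strict_mono_o)
    have "filterlim (\<lambda>n. norm (f ((p \<circ> (s \<circ> r)) n))) at_top sequentially"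
      by (rule filterlim_at_top_mono[OF filterlim_real_sequentially]) (use big in auto)
    from boundary_bound_infinite[OF _ sub[OF ss] _ _ t this, of "x \<circ> (s \<circ> r)"] p(1) x
    have "\<forall>\<^sub>F n in sequentially. - 3 * pi < \<Theta> (p (s (r n))) (x (s (r n))) \<and> \<Theta> (p (s (r n))) (x (s (r n))) < pi" by simp
    then have "\<forall>\<^sub>F n in sequentially. good ((s \<circ> r) n)" by eventually_elim (use \<delta> in \<open>auto simp: good_def\<close>)
    then show False using key[OF ss] s(2) by simp
  next
    case True
    obtain c r where r: "strict_mono (r :: nat \<Rightarrow> nat)" "((\<lambda>n. f (p (s n))) \<circ> r) \<longlonglongrightarrow> c"
      using bounded_imp_convergent_subsequence[OF True] by blast
    have ss: "strict_mono (s \<circ> r)" using s(1) r(1) by (rule strict_mono_o)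
    have lc: "(\<lambda>n. f ((p \<circ> (s \<circ> r)) n)) \<longlonglongrightarrow> c" using r(2) by (simp add: o_def)
    show False
    proof (cases "(\<lambda>n. f ((x \<circ> (s \<circ> r)) n)) \<longlonglongrightarrow> c")
      case True
      from boundary_bound_together[OF _ sub[OF ss] _ _ t lc True] p(1) x
      have "\<forall>\<^sub>F n in sequentially. - 3 * pi < \<Theta> (p (s (r n))) (x (s (r n))) \<and> \<Theta> (p (s (r n))) (x (s (r n))) < pi" by simp
      then have "\<forall>\<^sub>F n in sequentially. good ((s \<circ> r) n)" by eventually_elim (use \<delta> in \<open>auto simp: good_def\<close>)
      then show False using key[OF ss] s(2) by simp
    next
      case False
      then obtain \<epsilon> where \<epsilon>: "\<epsilon> > 0" "\<not> (\<forall>\<^sub>F n in sequentially. dist (f ((x \<circ> (s \<circ> r)) n)) c < \<epsilon>)"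
        unfolding tendsto_iff by blast
      then obtain r' where r': "strict_mono (r' :: nat \<Rightarrow> nat)" "\<And>n. \<not> dist (f ((x \<circ> (s \<circ> r)) (r' n))) c < \<epsilon>"
        using not_eventually_sequentiallyD[OF \<epsilon>(2)] by blast
      have sss: "strict_mono (s \<circ> r \<circ> r')" using ss r'(1) by (rule strict_mono_o)
      have lc': "(\<lambda>n. f ((p \<circ> (s \<circ> r \<circ> r')) n)) \<longlonglongrightarrow> c"
        using LIMSEQ_subseq_LIMSEQ[OF lc r'(1)] by (simp add: o_def)
      from boundary_bound_apart[OF _ sub[OF sss] _ _ t lc' \<epsilon>(1) _ \<delta>, of "x \<circ> (s \<circ> r \<circ> r')"] p(1) x r'(2)
      have "\<forall>\<^sub>F n in sequentially. good ((s \<circ> r \<circ> r') n)" by (simp add: dist_norm not_less good_def)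
      then show False using key[OF sss] s(2) by simp
    qed
  qed
qed

end

subsection \<open>The cube root of the derivative of the shear\<close>

lemma scaled_cis_between:
  assumes z: "z = of_real \<rho> * cis a" "\<rho> > 0" and \<psi>: "\<psi> < a" "a < \<psi> + pi"
  shows "Im (cis (- \<psi>) * z) > 0"
proof -
  have "Im (cis (- \<psi>) * z) = \<rho> * sin (a - \<psi>)"
    by (simp add: z(1) sin_diff algebra_simps)
  then show ?thesis using z(2) \<psi> by (simp add: sin_gt_zero)
qed

context chord_config
begin

lemma vertical_chord_cont:
  assumes "t > 0"
  shows "continuous_on right_half (\<lambda>z. \<Theta> z (z + \<i> * of_real t))"
proof -
  have "continuous_on right_half (\<lambda>z. (z, z + \<i> * of_real t))" by (intro continuous_intros)
  moreover have "(\<lambda>z. (z, z + \<i> * of_real t)) ` right_half \<subseteq> chord_set"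
    using assms by (auto simp: chord_set_def complex_nonpos_Reals_iff)
  ultimately show ?thesis using continuous_on_compose2[OF \<Theta>_cont] by fastforce
qed

text \<open>Inside the window \<open>v\<close> is a positive harmonic function; it vanishes where the chord argument leaves
  the window, the window stays away from the finite boundary, and on good half circles \<open>v\<close> is small.\<close>
lemma vertical_chord_window:
  assumes t: "t > 0" and z0: "z0 \<in> right_half"
    and bd: "\<And>p y0. (\<And>n. p n \<in> right_half) \<Longrightarrow> p \<longlonglongrightarrow> \<i> * of_real y0 \<Longrightarrow>
      \<forall>\<^sub>F n in sequentially. \<not> (\<psi> < \<Theta> (p n) (p n + \<i> * of_real t) \<and> \<Theta> (p n) (p n + \<i> * of_real t) < \<psi> + pi)"
  shows "\<not> (\<psi> < \<Theta> z0 (z0 + \<i> * of_real t) \<and> \<Theta> z0 (z0 + \<i> * of_real t) < \<psi> + pi)"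
proof
  assume win: "\<psi> < \<Theta> z0 (z0 + \<i> * of_real t) \<and> \<Theta> z0 (z0 + \<i> * of_real t) < \<psi> + pi"
  let ?t = "\<i> * complex_of_real t"
  define A where "A z = \<Theta> z (z + ?t)" for z
  define V where "V = {z\<in>right_half. \<psi> < A z \<and> A z < \<psi> + pi}"
  define v where "v z = Im (cis (- \<psi>) * (f (z + ?t) - f z))" for z
  have sh: "z + ?t \<in> right_half" if "z \<in> right_half" for z using that by simp
  have chord: "(z, z + ?t) \<in> chord_set" if "z \<in> right_half" for z
    using that t by (auto simp: chord_set_def complex_nonpos_Reals_iff)
  have A_cont: "continuous_on right_half A" unfolding A_def by (rule vertical_chord_cont[OF t])
  have polar: "f (z + ?t) - f z = of_real (norm (f (z + ?t) - f z)) * cis (A z)" "norm (f (z + ?t) - f z) > 0" if "z \<in> right_half" for z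
    using \<Theta>_polar[OF chord[OF that]] chord_ne(1)[OF chord[OF that]] by (auto simp: A_def)
  have "V = right_half \<inter> A -` {\<psi><..<\<psi> + pi}" by (auto simp: V_def)
  then have oV: "open V" using continuous_open_preimage[OF A_cont open_right_half] by simp
  have z0V: "z0 \<in> V" using win z0 by (simp add: V_def A_def)
  have v0: "v z0 > 0" unfolding v_def
    using scaled_cis_between[OF polar(1)[OF z0] polar(2)[OF z0]] z0V by (simp add: V_def)
  \<comment> \<open>On the good half circle both values of \<open>f\<close> are below
    \<open>\<epsilon>\<close>, so \<open>|v|\<close> is at most \<open>2 * \<epsilon>\<close>, half
    of its value at \<open>z0\<close>.\<close>
  define \<epsilon> where "\<epsilon> = v z0 / 4"
  have \<epsilon>: "\<epsilon> > 0" using v0 by (simp add: \<epsilon>_def)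
  obtain R where R: "R > norm z0" "\<And>z. z \<in> right_half \<Longrightarrow> norm (z - \<i> * of_real 0) = R \<or> norm (z - ?t) = R \<Longrightarrow> norm (f z - 0) < \<epsilon>"
    using good_half_circles[OF \<gamma>_cont \<gamma>_in \<gamma>_inf f_\<gamma> \<epsilon>, of "norm z0" 0 t] by blast
  have circle: "\<bar>v z\<bar> \<le> v z0 / 2" if z: "z \<in> right_half" "norm z = R" for z
  proof -
    have "norm (f z) < \<epsilon>" using R(2)[OF z(1)] z(2) by simp
    moreover have "norm (f (z + ?t)) < \<epsilon>" using R(2)[OF sh[OF z(1)]] z(2) by simp
    ultimately have "norm (cis (- \<psi>) * (f (z + ?t) - f z)) < 2 * \<epsilon>"
      using norm_triangle_ineq4[of "f (z + ?t)" "f z"] by (simp add: norm_mult)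
    then show ?thesis using abs_Im_le_cmod[of "cis (- \<psi>) * (f (z + ?t) - f z)"] unfolding v_def[symmetric] by (simp add: \<epsilon>_def)
  qed
  \<comment> \<open>Points of the window within radius \<open>R\<close> that approach the imaginary
    axis would accumulate at a finite boundary point, where \<open>bd\<close> excludes them.\<close>
  have "\<exists>\<delta>>0. \<forall>z\<in>V. norm z \<le> R \<longrightarrow> \<delta> \<le> Re z"
  proof (rule ccontr)
    assume "\<not> ?thesis"
    then have "\<forall>n. \<exists>z\<in>V. norm z \<le> R \<and> Re z < inverse (real (Suc n))" by (force simp: not_le)
    then obtain p where p: "\<And>n. p n \<in> V" "\<And>n. norm (p n) \<le> R" "\<And>n. Re (p n) < inverse (real (Suc n))" by metis
    have "bounded (range p)" using p(2) by (auto simp: bounded_iff)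
    then obtain l s where s: "strict_mono (s :: nat \<Rightarrow> nat)" "(p \<circ> s) \<longlonglongrightarrow> l"
      using bounded_imp_convergent_subsequence[of p] by blast
    have pr: "p n \<in> right_half" for n using p(1)[of n] by (simp add: V_def)
    have "(\<lambda>n. Re (p n)) \<longlonglongrightarrow> 0"
      by (rule tendsto_sandwich[OF _ _ tendsto_const LIMSEQ_inverse_real_of_nat])
        (use pr p(3) in \<open>auto intro!: always_eventually less_imp_le\<close>)
    then have "((\<lambda>n. Re (p n)) \<circ> s) \<longlonglongrightarrow> 0" by (rule LIMSEQ_subseq_LIMSEQ[OF _ s(1)])
    moreover have "(\<lambda>n. Re ((p \<circ> s) n)) \<longlonglongrightarrow> Re l" by (intro tendsto_Re s)
    ultimately have "Re l = 0" using LIMSEQ_unique by (fastforce simp: o_def)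
    then have "l = \<i> * of_real (Im l)" by (simp add: complex_eq_iff)
    then have "(p \<circ> s) \<longlonglongrightarrow> \<i> * of_real (Im l)" using s(2) by simp
    then have "\<forall>\<^sub>F n in sequentially. \<not> (\<psi> < A ((p \<circ> s) n) \<and> A ((p \<circ> s) n) < \<psi> + pi)"
      unfolding A_def by (intro bd[of "p \<circ> s" "Im l"]) (use pr in auto)
    then have "\<forall>\<^sub>F n in sequentially. False" by eventually_elim (use p(1) in \<open>auto simp: V_def\<close>)
    then show False by simp
  qed
  then obtain \<delta> where \<delta>: "\<delta> > 0" "\<And>z. z \<in> V \<Longrightarrow> norm z \<le> R \<Longrightarrow> \<delta> \<le> Re z" by blast
  define W where "W = V \<inter> ball 0 R"
  have oW: "open W" using oV by (simp add: W_def open_Int)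
  have "W \<subseteq> {z. \<delta> \<le> Re z} \<inter> cball 0 R" using \<delta>(2) by (auto simp: W_def)
  then have "closure W \<subseteq> {z. \<delta> \<le> Re z} \<inter> cball 0 R"
    by (rule closure_minimal) (intro closed_Int closed_halfspace_Re_ge closed_cball)
  then have cW: "closure W \<subseteq> right_half" "\<And>z. z \<in> closure W \<Longrightarrow> norm z \<le> R" using \<delta>(1) by force+
  \<comment> \<open>A holomorphic function with imaginary part \<open>v\<close>: the imaginary part
    of \<open>cis (- \<psi>) * cnj y\<close> is the negative of that of its conjugate
    \<open>cis \<psi> * y\<close>.\<close>
  define G where "G z = cis (- \<psi>) * (h (z + ?t) - h z) - cis \<psi> * (g (z + ?t) - g z)" for z
  have G_hol: "G holomorphic_on right_half"
  proof -
    have "(h \<circ> (\<lambda>z. z + ?t)) holomorphic_on right_half" "(g \<circ> (\<lambda>z. z + ?t)) holomorphic_on right_half"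
      by (rule holomorphic_on_compose_gen[OF _ h_hol] holomorphic_on_compose_gen[OF _ g_hol]; auto intro!: holomorphic_intros)+
    then show ?thesis unfolding G_def o_def by (intro holomorphic_intros h_hol g_hol)
  qed
  have Gv: "Im (G z) = v z" if "z \<in> right_half" for z
  proof -
    define X Y where "X = h (z + ?t) - h z" and "Y = g (z + ?t) - g z"
    have e: "f (z + ?t) - f z = X + cnj Y"
      using f_eq[OF that] f_eq[OF sh[OF that]] by (simp add: X_def Y_def)
    have "v z = Im (cis (- \<psi>) * (X + cnj Y))" unfolding v_def e ..
    moreover have "G z = cis (- \<psi>) * X - cis \<psi> * Y" by (simp only: G_def X_def Y_def)
    ultimately show ?thesis by (simp add: distrib_left)
  qed
  have "Re (- \<i> * G z0) \<le> v z0 / 2"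
  proof (rule maximum_real_frontier[where f = "\<lambda>z. - \<i> * G z" and S = W and \<xi> = z0])
    have "interior W \<subseteq> right_half" using order_trans[OF interior_subset order_trans[OF closure_subset cW(1)]] .
    then show "(\<lambda>z. - \<i> * G z) holomorphic_on interior W"
      by (intro holomorphic_on_mult holomorphic_on_const holomorphic_on_subset[OF G_hol])
    show "continuous_on (closure W) (\<lambda>z. - \<i> * G z)"
      using cW(1) by (intro continuous_on_mult continuous_on_const continuous_on_subset[OF holomorphic_on_imp_continuous_on[OF G_hol]])
    show "bounded W" by (rule bounded_subset[of "ball 0 R"]) (auto simp: W_def)
    show "z0 \<in> W" using z0V R(1) by (simp add: W_def)
    fix z assume "z \<in> frontier W"
    then have z: "z \<in> closure W" "z \<notin> W" using oW by (auto simp: frontier_def interior_open)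
    have zr: "z \<in> right_half" using cW(1) z(1) by blast
    have "v z \<le> v z0 / 2"
    proof (cases "norm z = R")
      case True
      then show ?thesis using circle[OF zr] by simp
    next
      case False
      then have "z \<notin> V" using z(2) cW(2)[OF z(1)] by (auto simp: W_def)
      have "A z \<in> closure (A ` W)"
      proof -
        have "continuous_on (closure W) A" by (rule continuous_on_subset[OF A_cont cW(1)])
        then have "A ` closure W \<subseteq> closure (A ` W)"
          by (intro image_closure_subset closed_closure closure_subset) auto
        then show ?thesis using z(1) by blast
      qed
      also have "closure (A ` W) \<subseteq> {\<psi>..\<psi> + pi}"
        by (rule closure_minimal) (auto simp: W_def V_def)
      finally have "A z = \<psi> \<or> A z = \<psi> + pi" using \<open>z \<notin> V\<close> zr by (auto simp: V_def)
      then have "v z = 0"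
      proof
        assume a: "A z = \<psi>"
        show ?thesis unfolding v_def by (subst polar(1)[OF zr]) (simp add: a)
      next
        assume a: "A z = \<psi> + pi"
        show ?thesis unfolding v_def by (subst polar(1)[OF zr]) (simp add: a)
      qed
      then show ?thesis using v0 by simp
    qed
    then show "Re (- \<i> * G z) \<le> v z0 / 2" using Gv[OF zr] by simp
  qed
  then show False using Gv[OF z0] v0 by simp
qed

text \<open>Near the boundary, chords leaving \<open>z\<close> and chords leaving
  \<open>z + \<i> t\<close> are each confined to \<open>[-3 pi, pi]\<close>. The first give the
  upper bound; the second are the reversed chords, whose argument is smaller by \<open>pi\<close>,
  and give the lower bound.\<close>

lemma vertical_chord_bounds:
  assumes t: "t > 0" and z: "z \<in> right_half"
  shows "- 2 * pi \<le> \<Theta> z (z + \<i> * of_real t)" "\<Theta> z (z + \<i> * of_real t) \<le> pi"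
proof -
  let ?t = "\<i> * complex_of_real t"
  define a where "a = \<Theta> z (z + ?t)"
  have "\<not> pi < a"
  proof
    assume a: "pi < a"
    \<comment> \<open>A window of length \<open>pi\<close> that contains \<open>a\<close> and whose
      lower end still exceeds \<open>pi\<close>; the length \<open>pi\<close> keeps the sine
      positive inside.\<close>
    define \<psi> where "\<psi> = max ((pi + a) / 2) (a - pi / 2)"
    have \<psi>: "pi < \<psi>" "\<psi> < a" "a < \<psi> + pi" using a by (auto simp: \<psi>_def max_def field_simps)
    have "\<not> (\<psi> < \<Theta> z (z + ?t) \<and> \<Theta> z (z + ?t) < \<psi> + pi)"
    proof (rule vertical_chord_window[OF t z])
      fix p :: "nat \<Rightarrow> complex" and y0 assume p: "\<And>n. p n \<in> right_half" "p \<longlonglongrightarrow> \<i> * of_real y0"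
      have "\<forall>\<^sub>F n in sequentially. - 3 * pi - (\<psi> - pi) < \<Theta> (p n) (p n + ?t) \<and> \<Theta> (p n) (p n + ?t) < pi + (\<psi> - pi)"
        by (rule boundary_bound[OF p, of "\<lambda>n. p n + ?t" t]) (use p t \<psi> in auto)
      then show "\<forall>\<^sub>F n in sequentially. \<not> (\<psi> < \<Theta> (p n) (p n + ?t) \<and> \<Theta> (p n) (p n + ?t) < \<psi> + pi)"
        by eventually_elim auto
    qed
    then show False using \<psi> by (simp add: a_def)
  qed
  then show "\<Theta> z (z + ?t) \<le> pi" by (simp add: a_def)
  have "\<not> a < - 2 * pi"
  proof
    assume a: "a < - 2 * pi"
    define \<psi> where "\<psi> = min ((a - 2 * pi) / 2) (a + pi / 2) - pi"
    have \<psi>: "\<psi> + pi < - 2 * pi" "\<psi> < a" "a < \<psi> + pi" using a by (auto simp: \<psi>_def min_def field_simps)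
    have "\<not> (\<psi> < \<Theta> z (z + ?t) \<and> \<Theta> z (z + ?t) < \<psi> + pi)"
    proof (rule vertical_chord_window[OF t z])
      fix p :: "nat \<Rightarrow> complex" and y0 assume p: "\<And>n. p n \<in> right_half" "p \<longlonglongrightarrow> \<i> * of_real y0"
      have "(\<lambda>n. p n + ?t) \<longlonglongrightarrow> \<i> * of_real y0 + ?t" by (intro tendsto_intros p)
      then have lim: "(\<lambda>n. p n + ?t) \<longlonglongrightarrow> \<i> * of_real (y0 + t)" by (simp add: algebra_simps)
      have "\<forall>\<^sub>F n in sequentially. - 3 * pi - (- 3 * pi - \<psi>) < \<Theta> (p n + ?t) (p n) \<and> \<Theta> (p n + ?t) (p n) < pi + (- 3 * pi - \<psi>)"
        by (rule boundary_bound[OF _ lim, of "p" "- t"]) (use p t \<psi> in auto)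
      then show "\<forall>\<^sub>F n in sequentially. \<not> (\<psi> < \<Theta> (p n) (p n + ?t) \<and> \<Theta> (p n) (p n + ?t) < \<psi> + pi)"
      proof eventually_elim
        case (elim n)
        have "\<Theta> (p n + ?t) (p n) = \<Theta> (p n) (p n + ?t) - pi"
          by (rule \<Theta>_swap) (use p(1)[of n] t in auto)
        then show ?case using elim by auto
      qed
    qed
    then show False using \<psi> by (simp add: a_def)
  qed
  then show "- 2 * pi \<le> \<Theta> z (z + ?t)" by (simp add: a_def)
qed

section \<open>From chords to the derivative of the shear\<close>

lemma tangent_bounds:
  assumes z: "z \<in> right_half"
  shows "- 2 * pi \<le> a0 z" "a0 z \<le> pi"
proof -
  have ev: "\<forall>\<^sub>F t in at_right 0. t > (0::real)" by (rule eventually_at_right_less)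
  have "\<forall>\<^sub>F t in at_right 0. \<Theta> z (z + of_real t * \<i>) \<le> pi"
    using ev by eventually_elim (use vertical_chord_bounds(2)[OF _ z] in \<open>simp add: mult.commute\<close>)
  then show "a0 z \<le> pi" by (intro tendsto_upperbound[OF \<Theta>_lim0[OF z]]) auto
  have "\<forall>\<^sub>F t in at_right 0. - 2 * pi \<le> \<Theta> z (z + of_real t * \<i>)"
    using ev by eventually_elim (use vertical_chord_bounds(1)[OF _ z] in \<open>simp add: mult.commute\<close>)
  then show "- 2 * pi \<le> a0 z" by (intro tendsto_lowerbound[OF \<Theta>_lim0[OF z]]) auto
qed

text \<open>If \<open>\<i> * deriv F z = - s * D\<close> with \<open>s \<ge> 0\<close>, equality of
  the imaginary parts forces \<open>Im D = 0\<close>. Then the derivatives of \<open>h\<close> and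
  \<open>g\<close> have equal real parts, and the remaining equation shows that of \<open>h\<close>
  to be no larger in modulus, against the dilatation bound.\<close>

lemma deriv_quotient:
  assumes z: "z \<in> right_half"
  defines "D \<equiv> \<i> * deriv h z + cnj (\<i> * deriv g z)"
  shows "D \<noteq> 0" "Im (\<i> * deriv F z) = Im D" "\<i> * deriv F z / D \<notin> \<real>\<^sub>\<le>\<^sub>0"
proof -
  let ?a = "deriv h z" and ?b = "deriv g z"
  have "k * norm ?a < 1 * norm ?a" using dh_nz[OF z] k by (intro mult_strict_right_mono) auto
  then have ba: "norm ?b < norm ?a" using dil[OF z] by simp
  have De: "D = \<i> * (?a - cnj ?b)" by (simp add: D_def algebra_simps)
  have Fe: "\<i> * deriv F z = \<i> * (?a - ?b)" by (simp add: deriv_F[OF z])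
  show D0: "D \<noteq> 0" using ba by (auto simp: De)
  show I: "Im (\<i> * deriv F z) = Im D" by (simp add: De Fe)
  show "\<i> * deriv F z / D \<notin> \<real>\<^sub>\<le>\<^sub>0"
  proof
    assume "\<i> * deriv F z / D \<in> \<real>\<^sub>\<le>\<^sub>0"
    then obtain s where s: "s \<ge> 0" "\<i> * deriv F z / D = - of_real s"
      by (metis complex_nonpos_Reals_iff complex_is_Real_iff minus_minus neg_0_le_iff_le of_real_Re of_real_minus)
    then have e: "\<i> * deriv F z = - of_real s * D" using D0 by (simp add: field_simps)
    then have "Im D = - s * Im D" using I by simp
    then have "(1 + s) * Im D = 0" by (simp add: algebra_simps)
    then have I0: "Im D = 0" using s by simp
    then have R0: "Re ?a = Re ?b" by (simp add: De)
    have "Re (\<i> * deriv F z) = - s * Re D" using e by simp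
    then have "- (Im ?a - Im ?b) = s * (Im ?a + Im ?b)" by (simp add: De Fe algebra_simps)
    then have "Im ?a - Im ?b = - s * (Im ?a + Im ?b)" by simp
    then have "(Im ?a - Im ?b) * (Im ?a + Im ?b) = - s * (Im ?a + Im ?b)\<^sup>2" by (simp only: power2_eq_square mult.assoc)
    then have "(Im ?a)\<^sup>2 - (Im ?b)\<^sup>2 = - s * (Im ?a + Im ?b)\<^sup>2"
      by (simp only: power2_eq_square square_diff_square_factored mult.commute)
    moreover have "0 \<le> s * (Im ?a + Im ?b)\<^sup>2" using s(1) by simp
    ultimately have "(Im ?a)\<^sup>2 - (Im ?b)\<^sup>2 \<le> 0" by simp
    moreover have "(norm ?b)\<^sup>2 < (norm ?a)\<^sup>2" using ba by (intro power_strict_mono) auto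
    ultimately show False by (simp add: cmod_power2 R0)
  qed
qed

text \<open>Since \<open>\<i> F'\<close> and the vertical derivative of \<open>f\<close> have the same imaginary part, their arguments
  lie in the same interval \<open>[-2\<pi>, \<pi>]\<close>, which has length \<open>3\<pi>\<close>.\<close>
lemma deriv_F_eq_cube:
  obtains P where "P holomorphic_on right_half" "\<And>z. z \<in> right_half \<Longrightarrow> 0 \<le> Re (P z)"
    "\<And>z. z \<in> right_half \<Longrightarrow> deriv F z = - ((P z) ^ 3)"
proof -
  define D where "D z = \<i> * deriv h z + cnj (\<i> * deriv g z)" for z
  define q where "q z = \<i> * deriv F z / D z" for z
  have q: "D z \<noteq> 0" "Im (\<i> * deriv F z) = Im (D z)" "q z \<notin> \<real>\<^sub>\<le>\<^sub>0" if "z \<in> right_half" for z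
    using deriv_quotient[OF that] by (auto simp: D_def q_def)
  have F0: "deriv F z \<noteq> 0" if "z \<in> right_half" for z using q(3)[OF that] by (auto simp: q_def)
  have dF: "deriv F holomorphic_on right_half" by (rule holomorphic_deriv[OF F_hol open_right_half])
  have "simply_connected right_half" by (rule convex_imp_simply_connected[OF convex_right_half])
  then obtain L where L: "L holomorphic_on right_half" "\<And>z. z \<in> right_half \<Longrightarrow> deriv F z = exp (L z)"
    using simply_connected_eq_holomorphic_log[OF open_right_half] dF F0 by blast
  have Lc: "continuous_on right_half L" by (rule holomorphic_on_imp_continuous_on[OF L(1)])
  have dhc: "continuous_on right_half (deriv h)" "continuous_on right_half (deriv g)" "continuous_on right_half (deriv F)"
    by (intro holomorphic_on_imp_continuous_on holomorphic_deriv h_hol g_hol F_hol open_right_half)+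
  \<comment> \<open>The discrepancy between two arguments of \<open>\<i> * deriv F z\<close>, one
    from the holomorphic logarithm and one from \<open>a0\<close>. It is a constant multiple of
    \<open>2 * pi\<close>, removed in \<open>L'\<close>.\<close>
  define b where "b z = Im (L z) + pi / 2 - a0 z - Arg (q z)" for z
  have b_cont: "continuous_on right_half b"
  proof -
    have "continuous_on right_half q" unfolding q_def
      by (rule continuous_on_divide) (use q(1) in \<open>auto simp: D_def intro!: continuous_intros dhc\<close>)
    then have "continuous_on right_half (\<lambda>z. Arg (q z))" by (rule continuous_on_Arg') (use q(3) in auto)
    then show ?thesis unfolding b_def
      by (intro continuous_on_diff continuous_on_add continuous_on_Im continuous_on_const Lc a0_cont)
  qed
  have b_cis: "cis (b z) = 1" if z: "z \<in> right_half" for z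
  proof -
    have q0: "q z \<noteq> 0" using q(3)[OF z] by auto
    have "deriv F z = of_real (norm (deriv F z)) * cis (Im (L z))"
      using L(2)[OF z] by (simp add: exp_eq_polar norm_mult)
    then have "cis (Im (L z)) = deriv F z / of_real (norm (deriv F z))" using F0[OF z] by (simp add: field_simps)
    moreover have "cis (pi / 2) = \<i>" by (simp add: complex_eq_iff)
    moreover have "cis (a0 z) = D z / of_real (norm (D z))"
      using a0_polar[OF z] q(1)[OF z] unfolding D_def[symmetric] by (simp add: field_simps)
    moreover have "cis (Arg (q z)) = q z / of_real (norm (q z))" by (rule cis_mult_norm[OF q0])
    moreover have "cis (b z) = cis (Im (L z)) * cis (pi / 2) / cis (a0 z) / cis (Arg (q z))"
      by (simp only: b_def cis_divide cis_mult)
    ultimately have "cis (b z) = (deriv F z / of_real (norm (deriv F z))) * \<i> / (D z / of_real (norm (D z))) / (q z / of_real (norm (q z)))"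
      by (simp only:)
    then show ?thesis using F0[OF z] q(1)[OF z] by (simp add: q_def norm_divide norm_mult field_simps)
  qed
  have b_const: "b z = b w" if "z \<in> right_half" "w \<in> right_half" for z w
    by (rule cis_constant_imp_constant[OF convex_connected[OF convex_right_half] b_cont b_cis that])
  have one: "(1::complex) \<in> right_half" by simp
  define B where "B = b 1"
  have cB: "cis B = 1" using b_cis[OF one] by (simp add: B_def)
  define L' where "L' z = L z - \<i> * of_real B" for z
  have L': "deriv F z = exp (L' z)" if z: "z \<in> right_half" for z
    using L(2)[OF z] cB by (simp add: L'_def exp_diff cis_conv_exp)
  have ImL: "Im (L' z) + pi / 2 = a0 z + Arg (q z)" if "z \<in> right_half" for z
    using b_const[OF that one] by (simp add: b_def B_def L'_def)
  have bnd: "- 2 * pi \<le> Im (L' z) + pi / 2 \<and> Im (L' z) + pi / 2 \<le> pi" if z: "z \<in> right_half" for z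
  proof -
    define c where "c = Im (L' z) + pi / 2"
    have ac: "\<bar>c - a0 z\<bar> < pi" using ImL[OF z] Arg_less_pi[OF q(3)[OF z]] by (simp add: c_def)
    have a: "- 2 * pi \<le> a0 z" "a0 z \<le> pi" by (rule tangent_bounds[OF z])+
    have "\<i> * deriv F z = of_real (norm (deriv F z)) * cis c"
    proof -
      have "deriv F z = of_real (norm (deriv F z)) * cis (Im (L' z))" using L'[OF z] by (simp add: exp_eq_polar norm_mult)
      moreover have "cis c = \<i> * cis (Im (L' z))" by (simp add: c_def complex_eq_iff cos_add sin_add)
      ultimately show ?thesis by (metis mult.left_commute)
    qed
    then have s: "norm (deriv F z) * sin c = norm (D z) * sin (a0 z)"
      using q(2)[OF z] a0_polar[OF z] unfolding D_def[symmetric]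
      by (metis Im_complex_of_real Re_complex_of_real add.right_neutral cis.sel(2) mult_zero_left times_complex.sel(2))
    have neg: "sin (a0 z) < 0" if "sin c < 0"
    proof -
      have "norm (deriv F z) * sin c < 0" using that F0[OF z] by (simp add: mult_pos_neg)
      then show ?thesis using s q(1)[OF z] by (simp add: mult_less_0_iff)
    qed
    have a_mid: "- pi < a0 z \<and> a0 z < 0" if "sin (a0 z) < 0"
    proof -
      have "\<not> 0 \<le> a0 z"
      proof
        assume "0 \<le> a0 z"
        then have "sin (a0 z) \<ge> 0" using a by (intro sin_ge_zero)
        then show False using that by simp
      qed
      moreover have "\<not> a0 z \<le> - pi"
      proof
        assume "a0 z \<le> - pi"
        then have "sin (a0 z + 2 * pi) \<ge> 0" using a by (intro sin_ge_zero) auto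
        then show False using that by simp
      qed
      ultimately show ?thesis by simp
    qed
    \<comment> \<open>\<open>c\<close> and \<open>a0 z\<close> differ by less than \<open>pi\<close>
      and have sines of the same sign. Beyond either end of the interval the sine of
      \<open>c\<close> is negative, which places \<open>a0 z\<close> between \<open>- pi\<close> and
      \<open>0\<close>, too far from \<open>c\<close>.\<close>
    have "c \<le> pi"
    proof (rule ccontr)
      assume "\<not> c \<le> pi"
      then have "pi < c" "c < 2 * pi" using ac a by (auto simp: abs_less_iff)
      then have "sin c < 0" by (rule sin_lt_zero)
      then show False using a_mid[OF neg] ac \<open>pi < c\<close> by (auto simp: abs_less_iff)
    qed
    moreover have "- 2 * pi \<le> c"
    proof (rule ccontr)
      assume "\<not> - 2 * pi \<le> c"
      then have c: "- 3 * pi < c" "c < - 2 * pi" using ac a by (auto simp: abs_less_iff)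
      have "sin (c + 4 * pi) < 0" using c by (intro sin_lt_zero) auto
      moreover have "sin (c + 4 * pi) = sin c"
        using sin_periodic[of "c + 2 * pi"] sin_periodic[of c] by (simp add: add.assoc)
      ultimately show False using a_mid[OF neg] ac c by (auto simp: abs_less_iff)
    qed
    ultimately show ?thesis by (simp add: c_def)
  qed
  \<comment> \<open>\<open>Im (L' z)\<close> lies in \<open>[-5 pi / 2, pi / 2]\<close>. Adding
    \<open>pi\<close> centres this interval at \<open>0\<close>, and division by three turns it into
    \<open>[-pi / 2, pi / 2]\<close>.\<close>
  define P where "P z = exp ((L' z + \<i> * pi) / 3)" for z
  show thesis
  proof (rule that[of P])
    show "P holomorphic_on right_half" unfolding P_def L'_def by (intro holomorphic_intros L(1)) auto
    fix z assume z: "z \<in> right_half"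
    have "cos (Im ((L' z + \<i> * pi) / 3)) \<ge> 0"
      using bnd[OF z] by (intro cos_ge_zero) auto
    then show "0 \<le> Re (P z)" by (simp add: P_def Re_exp)
    have "P z ^ 3 = exp (3 * ((L' z + \<i> * pi) / 3))" by (simp only: P_def exp_of_nat_mult[symmetric] of_nat_numeral)
    also have "3 * ((L' z + \<i> * pi) / 3) = L' z + \<i> * pi" by (simp add: field_simps)
    also have "exp (L' z + \<i> * pi) = exp (L' z) * exp (\<i> * pi)" by (rule exp_add)
    finally have "P z ^ 3 = - deriv F z" using L'[OF z] by simp
    then show "deriv F z = - ((P z) ^ 3)" by simp
  qed
qed

end

lemma (in ray_config) derivative_cube:
  obtains P where "P holomorphic_on right_half" "\<And>z. z \<in> right_half \<Longrightarrow> 0 \<le> Re (P z)"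
    "\<And>z. z \<in> right_half \<Longrightarrow> (1 - k) * norm (deriv h z) \<le> norm (P z) ^ 3"
proof -
  obtain \<Theta> a0 where "chord_argument \<Theta> a0" "\<And>p. p \<in> right_half \<Longrightarrow> ((\<lambda>s. \<Theta> p (\<gamma> s)) \<longlongrightarrow> Arg (f p) - pi) (at_left 1)"
    using chord_argument_normalized by blast
  then interpret chord_config f h g k \<gamma> \<Theta> a0 by unfold_locales
  obtain P where P: "P holomorphic_on right_half" "\<And>z. z \<in> right_half \<Longrightarrow> 0 \<le> Re (P z)"
    "\<And>z. z \<in> right_half \<Longrightarrow> deriv F z = - ((P z) ^ 3)"
    using deriv_F_eq_cube by blast
  show thesis
  proof (rule that[OF P(1,2)])
    fix z assume "z \<in> right_half"
    then show "(1 - k) * norm (deriv h z) \<le> norm (P z) ^ 3"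
      using norm_deriv_F(1)[of z] P(3)[of z] by (simp add: norm_power)
  qed
qed

subsection \<open>Dyadic summation\<close>

text \<open>Harnack's inequality for moduli: \<open>(P - b) / (P + cnj b)\<close> with
  \<open>b = P z0\<close> maps into the unit disc and vanishes at \<open>z0\<close>, so Schwarz's
  lemma applies after rescaling the ball.\<close>

lemma positive_real_part_growth:
  assumes P: "P holomorphic_on ball z0 R" "\<And>z. z \<in> ball z0 R \<Longrightarrow> 0 < Re (P z)" and z: "z \<in> ball z0 R"
  shows "norm (P z) * (R - norm (z - z0)) \<le> (R + norm (z - z0)) * norm (P z0)"
proof -
  have R: "R > 0" using z by (metis ball_eq_empty empty_iff not_le)
  have in_ball: "z0 + of_real R * v \<in> ball z0 R" if "norm v < 1" for v
    using that R by (simp add: dist_norm norm_mult)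
  have z0: "z0 \<in> ball z0 R" using R by simp
  define b where "b = P z0"
  have b: "0 < Re b" unfolding b_def by (rule P(2)[OF z0])
  define Q where "Q v = (P (z0 + of_real R * v) - b) / (P (z0 + of_real R * v) + cnj b)" for v
  have nz: "a + cnj b \<noteq> 0" if "0 < Re a" for a
    using that b by (metis add_pos_pos cnj.sel(1) less_irrefl plus_complex.sel(1) zero_complex.sel(1))
  have less: "norm (a - b) < norm (a + cnj b)" if a: "0 < Re a" for a
  proof -
    have "(Re a - Re b)\<^sup>2 < (Re a + Re b)\<^sup>2"
      using mult_pos_pos[OF a b] by (simp add: power2_eq_square algebra_simps)
    then have "(norm (a - b))\<^sup>2 < (norm (a + cnj b))\<^sup>2" by (simp add: cmod_power2)
    then show ?thesis by (rule power2_less_imp_less) simp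
  qed
  have "norm (Q v) \<le> norm v" if v: "norm v < 1" for v
  proof (rule Schwarz_Lemma(1)[OF _ _ _ v])
    have "(P \<circ> (\<lambda>v. z0 + of_real R * v)) holomorphic_on ball 0 1"
      by (rule holomorphic_on_compose_gen[OF _ P(1)]) (use in_ball in \<open>auto intro!: holomorphic_intros\<close>)
    then show "Q holomorphic_on ball 0 1"
      unfolding Q_def o_def using nz P(2) in_ball by (intro holomorphic_intros) auto
    show "Q 0 = 0" by (simp add: Q_def b_def)
    show "norm (Q v) < 1" if "norm v < 1" for v
      using less[OF P(2)[OF in_ball[OF that]]] nz[OF P(2)[OF in_ball[OF that]]] by (simp add: Q_def norm_divide)
  qed
  moreover have "norm ((z - z0) / of_real R) < 1"
    using z R by (simp add: norm_divide dist_norm norm_minus_commute)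
  ultimately have "norm (Q ((z - z0) / of_real R)) \<le> norm (z - z0) / R" using R by (fastforce simp: norm_divide)
  then have "norm ((P z - b) / (P z + cnj b)) \<le> norm (z - z0) / R" using R by (simp add: Q_def)
  then have "R * norm (P z - b) \<le> norm (z - z0) * norm (P z + cnj b)"
    using nz[OF P(2)[OF z]] R by (simp add: norm_divide field_simps)
  also have "\<dots> \<le> norm (z - z0) * (norm (P z) + norm b)"
    using norm_triangle_ineq[of "P z" "cnj b"] by (intro mult_left_mono) auto
  finally have "R * norm (P z - b) \<le> norm (z - z0) * (norm (P z) + norm b)" .
  moreover have "R * (norm (P z) - norm b) \<le> R * norm (P z - b)"
    using R by (intro mult_left_mono norm_triangle_ineq2) auto
  ultimately show ?thesis by (simp add: b_def algebra_simps)
qed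

lemma bounded_means_mono:
  assumes h: "continuous_on unit_disc h" and m: "bounded_means q h" and p: "0 < p" "p \<le> q"
  shows "bounded_means p h"
proof -
  obtain B where B: "\<And>r. 0 \<le> r \<Longrightarrow> r < 1 \<Longrightarrow>
     integral {0..2*pi} (\<lambda>x. norm (h (of_real r * exp (\<i> * of_real x))) powr q) \<le> B"
    using m unfolding bounded_means_def by blast
  have "integral {0..2*pi} (\<lambda>x. norm (h (of_real r * exp (\<i> * of_real x))) powr p) \<le> 2 * pi + B"
    if r: "0 \<le> r" "r < 1" for r
  proof -
    let ?a = "\<lambda>x. norm (h (of_real r * exp (\<i> * of_real x)))"
    have iq: "(\<lambda>x. ?a x powr q) integrable_on {0..2*pi}" by (rule circle_integrable[OF h r]) (use p in simp)
    have "integral {0..2*pi} (\<lambda>x. ?a x powr p) \<le> integral {0..2*pi} (\<lambda>x. 1 + ?a x powr q)"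
    proof (rule integral_le)
      show "(\<lambda>x. ?a x powr p) integrable_on {0..2*pi}" by (rule circle_integrable[OF h r p(1)])
      show "(\<lambda>x. 1 + ?a x powr q) integrable_on {0..2*pi}" by (intro integrable_add iq integrable_const_ivl)
      fix x
      show "?a x powr p \<le> 1 + ?a x powr q"
      proof (cases "?a x \<le> 1")
        case True
        then have "?a x powr p \<le> 1" using p(1) by (intro powr_le1) auto
        then show ?thesis by (simp add: add_increasing2)
      next
        case False
        then have "?a x powr p \<le> ?a x powr q" using p(2) by (intro powr_mono) auto
        then show ?thesis by simp
      qed
    qed
    also have "\<dots> = 2 * pi + integral {0..2*pi} (\<lambda>x. ?a x powr q)"
      using iq by (subst integral_add) auto
    finally show ?thesis using B[OF r] by simp
  qed
  then show ?thesis unfolding bounded_means_def by blast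
qed

text \<open>Harnack on the disc of radius \<open>(1/2)^j\<close> about \<open>w\<close> gives
  \<open>|P| \<le> 3 |P w|\<close> on the concentric disc of half the radius, hence
  \<open>27\<close> for the cubes, and the mean value inequality bounds the increment of
  \<open>h\<close>. The smaller closed disc just reaches the next dyadic circle.\<close>

lemma dyadic_step:
  fixes P1 P2 h :: "complex \<Rightarrow> complex" and j :: nat
  assumes P1: "P1 holomorphic_on unit_disc" "\<And>z. z \<in> unit_disc \<Longrightarrow> 0 < Re (P1 z)"
    and P2: "P2 holomorphic_on unit_disc" "\<And>z. z \<in> unit_disc \<Longrightarrow> 0 < Re (P2 z)"
    and h: "h holomorphic_on unit_disc" and C: "0 \<le> C"
    and bd: "\<And>z. z \<in> unit_disc \<Longrightarrow> norm (deriv h z) \<le> C * (norm (P1 z) ^ 3 + norm (P2 z) ^ 3)"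
    and w: "norm w = 1 - (1/2) ^ j" and z: "norm (z - w) \<le> (1/2) ^ j / 2"
  shows "norm (h z) \<le> norm (h w) + 27 * C * (norm (P1 w) ^ 3 + norm (P2 w) ^ 3) * (1/2) ^ j"
proof -
  define R :: real where "R = (1/2) ^ j"
  have R: "R > 0" by (simp add: R_def)
  have sub: "ball w R \<subseteq> unit_disc"
  proof
    fix u assume "u \<in> ball w R"
    then have "norm (u - w) < R" by (simp add: dist_norm norm_minus_commute)
    then show "u \<in> unit_disc" using norm_triangle_sub[of u w] w by (simp add: R_def)
  qed
  have growth: "norm (P u) \<le> 3 * norm (P w)"
    if P: "P holomorphic_on unit_disc" "\<And>z. z \<in> unit_disc \<Longrightarrow> 0 < Re (P z)" and u: "u \<in> cball w (R / 2)" for P u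
  proof -
    have uR: "norm (u - w) \<le> R / 2" using u by (simp add: dist_norm norm_minus_commute)
    have "norm (P u) * (R - norm (u - w)) \<le> (R + norm (u - w)) * norm (P w)"
    proof (rule positive_real_part_growth)
      show "P holomorphic_on ball w R" by (rule holomorphic_on_subset[OF P(1) sub])
      show "u \<in> ball w R" using uR R by (simp add: dist_norm norm_minus_commute)
    qed (use P(2) sub in blast)
    moreover have "norm (P u) * (R / 2) \<le> norm (P u) * (R - norm (u - w))" using uR by (intro mult_left_mono) auto
    moreover have "(R + norm (u - w)) * norm (P w) \<le> (3 * R / 2) * norm (P w)" using uR by (intro mult_right_mono) auto
    moreover have "(3 * R / 2) * norm (P w) = (3 * norm (P w)) * (R / 2)" by simp
    ultimately have "norm (P u) * (R / 2) \<le> (3 * norm (P w)) * (R / 2)" by linarith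
    then show ?thesis using R by (simp add: mult_le_cancel_right)
  qed
  have csub: "cball w (R / 2) \<subseteq> unit_disc" using sub R by (auto simp: subset_iff)
  define B where "B = 27 * C * (norm (P1 w) ^ 3 + norm (P2 w) ^ 3)"
  have "norm (h z - h w) \<le> B * norm (z - w)"
  proof (rule field_differentiable_bound[where S = "cball w (R / 2)"])
    fix u assume u: "u \<in> cball w (R / 2)"
    then have ud: "u \<in> unit_disc" using csub by blast
    then show "(h has_field_derivative deriv h u) (at u within cball w (R / 2))"
      using holomorphic_derivI[OF h open_ball] by (auto intro: has_field_derivative_at_within)
    have c: "norm (P u) ^ 3 \<le> 27 * norm (P w) ^ 3"
      if "P holomorphic_on unit_disc" "\<And>z. z \<in> unit_disc \<Longrightarrow> 0 < Re (P z)" for P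
    proof -
      have "norm (P u) ^ 3 \<le> (3 * norm (P w)) ^ 3" by (intro power_mono growth that u) auto
      then show ?thesis by (simp add: power_mult_distrib)
    qed
    have "norm (deriv h u) \<le> C * (norm (P1 u) ^ 3 + norm (P2 u) ^ 3)" by (rule bd[OF ud])
    also have "\<dots> \<le> C * (27 * norm (P1 w) ^ 3 + 27 * norm (P2 w) ^ 3)"
      using C c[OF P1] c[OF P2] by (intro mult_left_mono add_mono) auto
    finally show "norm (deriv h u) \<le> B" by (simp add: B_def algebra_simps)
  qed (use z R in \<open>auto simp: R_def dist_norm norm_minus_commute\<close>)
  also have "\<dots> \<le> B * R"
  proof (rule mult_left_mono)
    show "norm (z - w) \<le> R" using z R norm_ge_zero[of "z - w"] unfolding R_def by linarith
  qed (use C in \<open>simp add: B_def\<close>)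
  finally show ?thesis using norm_triangle_sub[of "h z" "h w"] by (simp add: B_def R_def)
qed

text \<open>Only the part \<open>l\<close> of the exponent \<open>3 p\<close> is left to the
  integral means of \<open>P\<close>. The part \<open>3 p - l\<close> is spent on the pointwise
  bound of order \<open>2^j\<close>, which together with \<open>(1/2)^(j p)\<close> leaves the
  factor \<open>2^(j (2 p - l))\<close>.\<close>

lemma dyadic_powr_bound:
  fixes P :: "complex \<Rightarrow> complex"
  assumes P: "P holomorphic_on unit_disc" "\<And>z. z \<in> unit_disc \<Longrightarrow> 0 < Re (P z)"
    and w: "norm w = 1 - (1/2) ^ j" and l: "l \<le> 3 * p"
  shows "(norm (P w) ^ 3 * (1/2) ^ j) powr p \<le> (2 * norm (P 0)) powr (3 * p - l) * (2 powr (2 * p - l)) ^ j * norm (P w) powr l"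
proof -
  have w1: "w \<in> unit_disc" using w by simp
  have pos: "norm (P w) > 0" using P(2)[OF w1] by auto
  have p0: "norm (P 0) > 0" using P(2)[of 0] by auto
  have "norm (P w) * (1 - norm w) \<le> (1 + norm w) * norm (P 0)"
    using positive_real_part_growth[of P 0 1 w] P w1 by simp
  also have "\<dots> \<le> 2 * norm (P 0)" using w by (intro mult_right_mono) auto
  finally have "norm (P w) \<le> 2 * norm (P 0) * 2 ^ j" by (simp add: w field_simps)
  then have "norm (P w) powr (3 * p - l) \<le> (2 * norm (P 0) * 2 ^ j) powr (3 * p - l)" using l by (intro powr_mono2) auto
  also have "\<dots> = (2 * norm (P 0)) powr (3 * p - l) * (2 ^ j) powr (3 * p - l)" by (simp add: powr_mult)
  finally have bd: "norm (P w) powr (3 * p - l) \<le> (2 * norm (P 0)) powr (3 * p - l) * (2 ^ j) powr (3 * p - l)" .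
  have e1: "(norm (P w) ^ 3 * (1/2) ^ j) powr p = norm (P w) powr (3 * p) * ((1/2) ^ j) powr p"
    using pos by (simp add: powr_mult powr_powr flip: powr_numeral)
  also have "norm (P w) powr (3 * p) = norm (P w) powr (3 * p - l) * norm (P w) powr l"
    by (simp flip: powr_add)
  finally have e: "(norm (P w) ^ 3 * (1/2) ^ j) powr p = norm (P w) powr (3 * p - l) * norm (P w) powr l * ((1/2) ^ j) powr p" .
  have "\<dots> \<le> (2 * norm (P 0)) powr (3 * p - l) * (2 ^ j) powr (3 * p - l) * norm (P w) powr l * ((1/2) ^ j) powr p"
    using bd by (intro mult_right_mono) auto
  also have "\<dots> = (2 * norm (P 0)) powr (3 * p - l) * ((2 ^ j) powr (3 * p - l) * ((1/2) ^ j) powr p) * norm (P w) powr l" by simp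
  also have "(2 ^ j) powr (3 * p - l) * ((1/2) ^ j) powr p = (2 powr (2 * p - l)) ^ j"
  proof -
    have a: "(2 ^ j) powr y = 2 powr (real j * y)" for y by (simp add: powr_powr flip: powr_realpow)
    have "((1/2::real) ^ j) powr p = (2 ^ j) powr (- p)" by (simp add: power_divide powr_minus powr_divide field_simps)
    then have "(2 ^ j) powr (3 * p - l) * ((1/2) ^ j) powr p = (2::real) powr (real j * (3 * p - l) + real j * (- p))"
      by (simp only: a powr_add)
    also have "real j * (3 * p - l) + real j * (- p) = (2 * p - l) * real j" by (simp add: algebra_simps)
    also have "2 powr ((2 * p - l) * real j) = (2 powr (2 * p - l)) ^ j"
      by (simp add: powr_powr[symmetric] powr_realpow)
    finally show ?thesis .
  qed
  finally show ?thesis using e by simp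
qed

text \<open>For \<open>p < 1/2\<close> some \<open>l\<close> satisfies \<open>2 p < l < 1\<close>.
  Functions with positive real part have bounded means of order \<open>l\<close>, and the increments
  of the integral of \<open>|h|^p\<close> from one dyadic circle to the next are dominated by a
  geometric series of ratio \<open>2 powr (2 * p - l)\<close>.\<close>

lemma bounded_means_of_cube_bound:
  fixes P1 P2 h :: "complex \<Rightarrow> complex"
  assumes P1: "P1 holomorphic_on unit_disc" "\<And>z. z \<in> unit_disc \<Longrightarrow> 0 < Re (P1 z)"
    and P2: "P2 holomorphic_on unit_disc" "\<And>z. z \<in> unit_disc \<Longrightarrow> 0 < Re (P2 z)"
    and h: "h holomorphic_on unit_disc" and C: "0 \<le> C"
    and bd: "\<And>z. z \<in> unit_disc \<Longrightarrow> norm (deriv h z) \<le> C * (norm (P1 z) ^ 3 + norm (P2 z) ^ 3)"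
    and p0: "0 < p" "p < 1/2"
  shows "bounded_means p h"
proof -
  have hc: "continuous_on unit_disc h" "continuous_on unit_disc P1" "continuous_on unit_disc P2"
    by (intro holomorphic_on_imp_continuous_on h P1(1) P2(1))+
  \<comment> \<open>The lower bound on \<open>p\<close> ensures \<open>l \<le> 3 * p\<close>;
    smaller exponents follow from larger ones at the end.\<close>
  have "bounded_means p h" if p: "1/3 \<le> p" "p < 1/2" for p
  proof -
    define l where "l = (2 * p + 1) / 2"
    have l: "0 < l" "l < 1" "l \<le> 3 * p" "2 * p < l" using p by (auto simp: l_def)
    have mean: "bounded_means l P" if "P holomorphic_on unit_disc" "\<And>z. z \<in> unit_disc \<Longrightarrow> 0 < Re (P z)" for P
      by (rule bounded_means_of_derivative_bound[where Q = P and C = 1 and n = 1]) (use that l in auto)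
    define q where "q = 2 powr (2 * p - l)"
    have q: "0 < q" "q < 1" using l powr_less_mono[of "2 * p - l" 0 2] by (auto simp: q_def)
    let ?e = "\<lambda>r x. complex_of_real r * exp (\<i> * complex_of_real x)"
    obtain B1 where B1: "\<And>r. 0 \<le> r \<Longrightarrow> r < 1 \<Longrightarrow> integral {0..2*pi} (\<lambda>x. norm (P1 (?e r x)) powr l) \<le> B1"
      using mean[OF P1] unfolding bounded_means_def by blast
    obtain B2 where B2: "\<And>r. 0 \<le> r \<Longrightarrow> r < 1 \<Longrightarrow> integral {0..2*pi} (\<lambda>x. norm (P2 (?e r x)) powr l) \<le> B2"
      using mean[OF P2] unfolding bounded_means_def by blast
    define c1 where "c1 = (27 * C) powr p * (2 * norm (P1 0)) powr (3 * p - l)"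
    define c2 where "c2 = (27 * C) powr p * (2 * norm (P2 0)) powr (3 * p - l)"
    have c: "0 \<le> c1" "0 \<le> c2" by (simp_all add: c1_def c2_def)
    define K where "K = c1 * B1 + c2 * B2"
    define I where "I r = integral {0..2*pi} (\<lambda>x. norm (h (?e r x)) powr p)" for r
    define \<rho> where "\<rho> j = 1 - (1/2::real) ^ j" for j :: nat
    have \<rho>: "0 \<le> \<rho> j" "\<rho> j < 1" for j by (simp_all add: \<rho>_def power_le_one)
    have step: "I r \<le> I (\<rho> j) + K * q ^ j" if r: "\<rho> j \<le> r" "r \<le> \<rho> (Suc j)" for r j
    proof -
      have r1: "0 \<le> r" "r < 1" using r \<rho>[of j] \<rho>[of "Suc j"] by linarith+
      have pw: "norm (h (?e r x)) powr p \<le> norm (h (?e (\<rho> j) x)) powr p +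
          (c1 * q ^ j * norm (P1 (?e (\<rho> j) x)) powr l + c2 * q ^ j * norm (P2 (?e (\<rho> j) x)) powr l)" for x
      proof -
        define w where "w = ?e (\<rho> j) x"
        have "norm w = \<rho> j" using \<rho>[of j] by (simp add: w_def norm_mult)
        then have nw: "norm w = 1 - (1/2) ^ j" by (simp add: \<rho>_def)
        have "?e r x - w = of_real (r - \<rho> j) * exp (\<i> * of_real x)" by (simp add: w_def algebra_simps)
        then have "norm (?e r x - w) = r - \<rho> j" using r by (simp add: norm_mult del: of_real_diff)
        then have nz: "norm (?e r x - w) \<le> (1/2) ^ j / 2" using r by (simp add: \<rho>_def)
        define a1 a2 where "a1 = norm (P1 w) ^ 3 * (1/2) ^ j" and "a2 = norm (P2 w) ^ 3 * (1/2) ^ j"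
        have a: "0 \<le> a1" "0 \<le> a2" by (simp_all add: a1_def a2_def)
        have "norm (h (?e r x)) \<le> norm (h w) + 27 * C * (norm (P1 w) ^ 3 + norm (P2 w) ^ 3) * (1/2) ^ j"
          by (rule dyadic_step[OF P1 P2 h C bd nw nz])
        also have "\<dots> = norm (h w) + (27 * C * a1 + 27 * C * a2)" by (simp add: a1_def a2_def algebra_simps)
        finally have "norm (h (?e r x)) powr p \<le> (norm (h w) + (27 * C * a1 + 27 * C * a2)) powr p"
          using p by (intro powr_mono2) auto
        also have "\<dots> \<le> norm (h w) powr p + (27 * C * a1 + 27 * C * a2) powr p"
          using p C a by (intro powr_subadditive) auto
        also have "(27 * C * a1 + 27 * C * a2) powr p \<le> (27 * C * a1) powr p + (27 * C * a2) powr p"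
          using p C a by (intro powr_subadditive) auto
        also have "(27 * C * a1) powr p = (27 * C) powr p * a1 powr p" using a C by (simp only: powr_mult)
        also have "(27 * C * a2) powr p = (27 * C) powr p * a2 powr p" using a C by (simp only: powr_mult)
        also have "(27 * C) powr p * a1 powr p \<le> (27 * C) powr p * ((2 * norm (P1 0)) powr (3 * p - l) * (2 powr (2 * p - l)) ^ j * norm (P1 w) powr l)"
          unfolding a1_def by (intro mult_left_mono dyadic_powr_bound P1 nw l) auto
        also have "(27 * C) powr p * a2 powr p \<le> (27 * C) powr p * ((2 * norm (P2 0)) powr (3 * p - l) * (2 powr (2 * p - l)) ^ j * norm (P2 w) powr l)"
          unfolding a2_def by (intro mult_left_mono dyadic_powr_bound P2 nw l) auto
        finally show ?thesis by (simp add: c1_def c2_def q_def w_def mult.assoc)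
      qed
      have i: "(\<lambda>x. norm (h (?e (\<rho> j) x)) powr p) integrable_on {0..2*pi}"
        "(\<lambda>x. norm (P1 (?e (\<rho> j) x)) powr l) integrable_on {0..2*pi}"
        "(\<lambda>x. norm (P2 (?e (\<rho> j) x)) powr l) integrable_on {0..2*pi}"
        by (intro circle_integrable hc \<rho> l(1); use p in simp)+
      have i1: "(\<lambda>x. c1 * q ^ j * norm (P1 (?e (\<rho> j) x)) powr l) integrable_on {0..2*pi}"
        "(\<lambda>x. c2 * q ^ j * norm (P2 (?e (\<rho> j) x)) powr l) integrable_on {0..2*pi}"
        by (rule integrable_on_mult_right[OF i(2)] integrable_on_mult_right[OF i(3)])+
      have "I r \<le> integral {0..2*pi} (\<lambda>x. norm (h (?e (\<rho> j) x)) powr p +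
          (c1 * q ^ j * norm (P1 (?e (\<rho> j) x)) powr l + c2 * q ^ j * norm (P2 (?e (\<rho> j) x)) powr l))"
        unfolding I_def by (rule integral_le) (use pw i i1 p in \<open>auto intro!: integrable_add circle_integrable hc r1\<close>)
      also have "\<dots> = I (\<rho> j) + (c1 * q ^ j * integral {0..2*pi} (\<lambda>x. norm (P1 (?e (\<rho> j) x)) powr l) +
          c2 * q ^ j * integral {0..2*pi} (\<lambda>x. norm (P2 (?e (\<rho> j) x)) powr l))"
        unfolding I_def using i i1 by (simp add: integral_add integrable_add)
      also have "\<dots> \<le> I (\<rho> j) + (c1 * q ^ j * B1 + c2 * q ^ j * B2)"
        using c q B1[OF \<rho>] B2[OF \<rho>] by (intro add_left_mono add_mono mult_left_mono) auto
      finally show ?thesis by (simp add: K_def algebra_simps)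
    qed
    have "0 \<le> 2 * pi * norm (P1 0) powr l" "0 \<le> 2 * pi * norm (P2 0) powr l" by simp_all
    moreover have "2 * pi * norm (P1 0) powr l \<le> B1" "2 * pi * norm (P2 0) powr l \<le> B2" using B1[of 0] B2[of 0] by simp_all
    ultimately have "0 \<le> B1" "0 \<le> B2" using order_trans by blast+
    then have K: "0 \<le> K" using c by (simp add: K_def)
    \<comment> \<open>The tail of the geometric series is carried along on the left, so that the
      induction closes without partial sums.\<close>
    have sum: "I (\<rho> j) + K * q ^ j / (1 - q) \<le> I 0 + K / (1 - q)" for j
    proof (induction j)
      case (Suc j)
      have "I (\<rho> (Suc j)) \<le> I (\<rho> j) + K * q ^ j" by (rule step) (auto simp: \<rho>_def)
      moreover have "K * q ^ j + K * q ^ Suc j / (1 - q) = K * q ^ j / (1 - q)" using q by (simp add: field_simps)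
      ultimately show ?case using Suc by linarith
    qed (simp add: \<rho>_def)
    have "I r \<le> I 0 + K / (1 - q)" if r: "0 \<le> r" "r < 1" for r
    proof -
      obtain n where n: "(1/2::real) ^ n < 1 - r" using real_arch_pow_inv[of "1 - r" "1/2"] r by auto
      define N where "N = (LEAST n. r \<le> \<rho> n)"
      have "r \<le> \<rho> n" using n by (simp add: \<rho>_def)
      then have N: "r \<le> \<rho> N" unfolding N_def by (rule LeastI)
      have K1: "0 \<le> K * q ^ j / (1 - q)" for j using K q by simp
      show ?thesis
      proof (cases N)
        case 0
        then have "r = 0" using N r by (simp add: \<rho>_def)
        then show ?thesis using K q by simp
      next
        case (Suc j)
        then have "\<not> r \<le> \<rho> j" unfolding N_def using not_less_Least by (metis lessI)
        then have "I r \<le> I (\<rho> j) + K * q ^ j" using N Suc by (intro step) auto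
        moreover have "K * q ^ j \<le> K * q ^ j / (1 - q)" using K q by (simp add: le_divide_eq mult_left_le)
        ultimately show ?thesis using sum[of j] by linarith
      qed
    qed
    then show ?thesis unfolding bounded_means_def I_def by blast
  qed
  from bounded_means_mono[OF hc(1) this[of "max p (1/3)"]] show ?thesis using p0 by auto
qed

subsection \<open>Cayley maps and reference rays\<close>

text \<open>With \<open>half_of\<close> this is a pair of mutually inverse Cayley maps between the
  right half plane and the disc. The boundary point \<open>b\<close> corresponds to infinity and
  \<open>- b\<close> to \<open>0\<close>.\<close>

definition disc_of :: "complex \<Rightarrow> complex \<Rightarrow> complex" where
  "disc_of b \<zeta> = b * (\<zeta> - 1) / (\<zeta> + 1)"

definition half_of :: "complex \<Rightarrow> complex \<Rightarrow> complex" where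
  "half_of b z = (b + z) / (b - z)"

lemma right_half_plus_one: "\<zeta> \<in> right_half \<Longrightarrow> \<zeta> + 1 \<noteq> 0"
  by (metis add_pos_pos less_irrefl mem_Collect_eq one_complex.sel(1) plus_complex.sel(1) zero_complex.sel(1) zero_less_one)

lemma cayley:
  assumes b: "norm b = 1"
  shows "\<zeta> \<in> right_half \<Longrightarrow> disc_of b \<zeta> \<in> unit_disc" "\<zeta> \<in> right_half \<Longrightarrow> half_of b (disc_of b \<zeta>) = \<zeta>"
    "z \<in> unit_disc \<Longrightarrow> half_of b z \<in> right_half" "z \<in> unit_disc \<Longrightarrow> disc_of b (half_of b z) = z"
proof -
  have b0: "b \<noteq> 0" using b by auto
  show "disc_of b \<zeta> \<in> unit_disc" if \<zeta>: "\<zeta> \<in> right_half"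
  proof -
    have "(norm (\<zeta> - 1))\<^sup>2 < (norm (\<zeta> + 1))\<^sup>2" using \<zeta> unfolding cmod_power2 by (simp add: power2_eq_square algebra_simps)
    then have "norm (\<zeta> - 1) < norm (\<zeta> + 1)" by (rule power2_less_imp_less) simp
    then show ?thesis using b right_half_plus_one[OF \<zeta>] by (simp add: disc_of_def norm_divide norm_mult)
  qed
  show "half_of b (disc_of b \<zeta>) = \<zeta>" if \<zeta>: "\<zeta> \<in> right_half"
  proof -
    have n: "\<zeta> + 1 \<noteq> 0" by (rule right_half_plus_one[OF \<zeta>])
    have "b + disc_of b \<zeta> = 2 * b * \<zeta> / (\<zeta> + 1)" "b - disc_of b \<zeta> = 2 * b / (\<zeta> + 1)"
      using n by (simp_all add: disc_of_def field_simps)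
    then show ?thesis using n b0 by (simp add: half_of_def)
  qed
  show "half_of b z \<in> right_half" if z: "z \<in> unit_disc"
  proof -
    have n: "b - z \<noteq> 0" using z b by auto
    have "half_of b z = (b + z) * cnj (b - z) / of_real ((norm (b - z))\<^sup>2)"
      unfolding half_of_def by (subst complex_div_cnj) simp
    then have "Re (half_of b z) = Re ((b + z) * cnj (b - z)) / (norm (b - z))\<^sup>2" by (simp only: Re_divide_of_real)
    moreover have "Re ((b + z) * cnj (b - z)) = (norm b)\<^sup>2 - (norm z)\<^sup>2" by (simp only: cmod_power2) (simp add: power2_eq_square algebra_simps)
    moreover have "(norm z)\<^sup>2 < 1" using z by (simp add: abs_square_less_1)
    ultimately show ?thesis using n b by simp
  qed
  show "disc_of b (half_of b z) = z" if z: "z \<in> unit_disc"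
  proof -
    have n: "b - z \<noteq> 0" using z b by auto
    have "half_of b z - 1 = 2 * z / (b - z)" "half_of b z + 1 = 2 * b / (b - z)"
      using n by (simp_all add: half_of_def field_simps)
    then show ?thesis using n b0 by (simp add: disc_of_def)
  qed
qed

lemma half_of_holomorphic: "norm b = 1 \<Longrightarrow> half_of b holomorphic_on unit_disc"
  unfolding half_of_def by (intro holomorphic_intros) auto

lemma disc_of_derivative:
  assumes "\<zeta> \<in> right_half"
  shows "(disc_of b has_field_derivative 2 * b / (\<zeta> + 1)\<^sup>2) (at \<zeta>)"
  unfolding disc_of_def
  by (rule derivative_eq_intros refl | use right_half_plus_one[OF assms] in \<open>simp add: power2_eq_square field_simps\<close>)+

lemma disc_of_holomorphic: "disc_of b holomorphic_on right_half"
  by (rule holomorphic_on_open[OF open_right_half, THEN iffD2]) (use disc_of_derivative in blast)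

lemma half_of_at_infinity:
  assumes "norm b = 1" "(\<gamma> \<longlongrightarrow> b) F" "\<forall>\<^sub>F s in F. \<gamma> s \<in> unit_disc"
  shows "filterlim (\<lambda>s. half_of b (\<gamma> s)) at_infinity F"
proof -
  have "((\<lambda>s. b - \<gamma> s) \<longlongrightarrow> b - b) F" by (intro tendsto_intros assms)
  moreover have "\<forall>\<^sub>F s in F. b - \<gamma> s \<noteq> 0" using assms(3) by eventually_elim (use assms(1) in auto)
  ultimately have den: "filterlim (\<lambda>s. b - \<gamma> s) (at 0) F" by (simp add: filterlim_at)
  have num: "((\<lambda>s. b + \<gamma> s) \<longlongrightarrow> b + b) F" by (intro tendsto_intros assms)
  have nz: "b + b \<noteq> 0" using assms(1) by (auto simp flip: mult_2)
  have "filterlim (\<lambda>s. (b + \<gamma> s) * inverse (b - \<gamma> s)) at_infinity F"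
    by (rule tendsto_mult_filterlim_at_infinity[OF num nz filterlim_compose[OF filterlim_inverse_at_infinity den]])
  then show ?thesis by (simp add: half_of_def divide_inverse)
qed

text \<open>The conjugate factor on \<open>g\<close> comes from
  \<open>u * cnj (g z) = cnj (cnj u * g z)\<close>.\<close>

lemma (in harmonic_qc) harmonic_qc_affine:
  assumes u: "u \<noteq> 0"
  shows "harmonic_qc (\<lambda>z. u * (f z - a)) (\<lambda>z. u * (h z - a)) (\<lambda>z. cnj u * g z) k U"
proof -
  have dh: "deriv (\<lambda>z. u * (h z - a)) z = u * deriv h z" if "z \<in> U" for z
    by (rule DERIV_imp_deriv) (auto intro!: derivative_eq_intros holomorphic_derivI[OF h_hol open_U that])
  have dg: "deriv (\<lambda>z. cnj u * g z) z = cnj u * deriv g z" if "z \<in> U" for z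
    by (rule DERIV_imp_deriv) (auto intro!: derivative_eq_intros holomorphic_derivI[OF g_hol open_U that])
  show ?thesis
  proof
    show "inj_on (\<lambda>z. u * (f z - a)) U" using f_inj u by (auto simp: inj_on_def)
    show "norm (deriv (\<lambda>z. cnj u * g z) z) \<le> k * norm (deriv (\<lambda>z. u * (h z - a)) z)" if "z \<in> U" for z
      using mult_left_mono[OF dil[OF that] norm_ge_zero[of u]] by (simp add: dh[OF that] dg[OF that] norm_mult ac_simps)
    show "deriv (\<lambda>z. u * (h z - a)) z \<noteq> 0" if "z \<in> U" for z
      using dh_nz[OF that] u by (simp add: dh[OF that])
  qed (use open_U k f_eq in \<open>auto intro!: holomorphic_intros h_hol g_hol simp: algebra_simps\<close>)
qed

lemma half_line_subray: "s \<ge> 0 \<Longrightarrow> t \<ge> 0 \<Longrightarrow> a + of_real t * d + of_real s * d \<in> half_line a d"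
  unfolding half_line_def by (intro CollectI exI[of _ "t + s"]) (simp add: algebra_simps)

lemma half_line_scale:
  assumes "d \<noteq> 0" shows "half_line a (d / of_real (norm d)) = half_line a d"
proof -
  have "x \<in> half_line a (d / of_real (norm d))" if x: "x \<in> half_line a d" for x
  proof -
    obtain t where "t \<ge> 0" "x = a + of_real t * d" using x by (auto simp: half_line_def)
    then show ?thesis unfolding half_line_def using assms by (intro CollectI exI[of _ "t * norm d"]) simp
  qed
  moreover have "x \<in> half_line a d" if x: "x \<in> half_line a (d / of_real (norm d))" for x
  proof -
    obtain t where "t \<ge> 0" "x = a + of_real t * (d / of_real (norm d))" using x by (auto simp: half_line_def)
    then show ?thesis unfolding half_line_def using assms by (intro CollectI exI[of _ "t / norm d"]) simp
  qed
  ultimately show ?thesis by blast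
qed

text \<open>If \<open>a0\<close> lies in the relative interior of a family ray, the reference ray is the rest of that ray;
  otherwise it is a family ray with tip \<open>a0\<close>. With this choice the other family rays
  can meet it only in their own tips.\<close>
lemma reference_ray:
  assumes ccd: "close_to_convex_domain \<Omega>" and a0: "a0 \<notin> \<Omega>"
  shows "\<exists>u. norm u = 1 \<and> (\<forall>s\<ge>0. a0 + of_real s * u \<notin> \<Omega>) \<and>
    (\<forall>a. a \<notin> \<Omega> \<longrightarrow> (\<exists>d. norm d = 1 \<and> (\<forall>s\<ge>0. a + of_real s * d \<notin> \<Omega>) \<and>
       ((\<exists>t. a = a0 + of_real t * u) \<and> d = u \<or> (\<forall>s\<ge>0. a + of_real s * d \<notin> half_line a0 u))))"
proof -
  obtain R :: "(complex \<times> complex) set" where R0: "\<forall>(a,d)\<in>R. d \<noteq> 0" "- \<Omega> = (\<Union>(a,d)\<in>R. half_line a d)"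
    "\<forall>(a1,d1)\<in>R. \<forall>(a2,d2)\<in>R. half_line a1 d1 \<noteq> half_line a2 d2 \<longrightarrow> half_line a1 d1 \<inter> half_line a2 d2 \<subseteq> {a1, a2}"
    using ccd unfolding close_to_convex_domain_def by (elim exE conjE) (rule that)
  have R: "d \<noteq> 0" if "(a, d) \<in> R" for a d using bspec[OF R0(1) that] by simp
  have nc: "half_line a1 d1 \<inter> half_line a2 d2 \<subseteq> {a1, a2}"
    if "(a1, d1) \<in> R" "(a2, d2) \<in> R" "half_line a1 d1 \<noteq> half_line a2 d2" for a1 d1 a2 d2
    using bspec[OF bspec[OF R0(3) that(1), unfolded split_conv] that(2)] that(3) by simp
  have cover: "a \<notin> \<Omega> \<longleftrightarrow> (\<exists>b d. (b, d) \<in> R \<and> a \<in> half_line b d)" for a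
    using arg_cong[OF R0(2), of "\<lambda>X. a \<in> X"] by auto
  \<comment> \<open>The same rays with directions of length one. Rays and tips are unchanged, so the
    non-crossing property is inherited.\<close>
  define N where "N = {(a, d). norm d = 1 \<and> (\<exists>d'. d = d' / of_real (norm d') \<and> (a, d') \<in> R)}"
  have N1: "norm d = 1" "half_line a d \<inter> \<Omega> = {}" if ad: "(a, d) \<in> N" for a d
  proof -
    obtain d' where d': "norm d = 1" "d = d' / of_real (norm d')" "(a, d') \<in> R" using ad by (auto simp: N_def)
    show "norm d = 1" by (rule d'(1))
    have "half_line a d = half_line a d'" using half_line_scale[OF R[OF d'(3)]] d'(2) by simp
    then show "half_line a d \<inter> \<Omega> = {}" using cover d'(3) by auto
  qed
  have N2: "\<exists>b d. (b, d) \<in> N \<and> a \<in> half_line b d" if a: "a \<notin> \<Omega>" for a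
  proof -
    obtain b d' where bd: "(b, d') \<in> R" "a \<in> half_line b d'" using a cover by blast
    have "(b, d' / of_real (norm d')) \<in> N" using bd(1) R[OF bd(1)] by (auto simp: N_def norm_divide)
    then show ?thesis using half_line_scale[OF R[OF bd(1)]] bd(2) by blast
  qed
  have N3: "half_line a1 d1 \<inter> half_line a2 d2 \<subseteq> {a1, a2}"
    if n: "(a1, d1) \<in> N" "(a2, d2) \<in> N" "half_line a1 d1 \<noteq> half_line a2 d2" for a1 d1 a2 d2
  proof -
    obtain e1 e2 where "(a1, e1) \<in> R" "half_line a1 d1 = half_line a1 e1" "(a2, e2) \<in> R" "half_line a2 d2 = half_line a2 e2"
    proof -
      obtain e1 e2 where e: "(a1, e1) \<in> R" "d1 = e1 / of_real (norm e1)" "(a2, e2) \<in> R" "d2 = e2 / of_real (norm e2)"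
        using n(1,2) by (auto simp: N_def)
      show thesis by (rule that[of e1 e2]) (use e half_line_scale R in auto)
    qed
    then show ?thesis using nc[of a1 e1 a2 e2] n(3) by simp
  qed
  \<comment> \<open>\<open>t0\<close> is the position of \<open>a0\<close> on the family ray from
    \<open>b\<close>. The condition \<open>tip\<close> matters when \<open>a0\<close> is the tip
    \<open>b\<close> itself: then every family ray through \<open>b\<close> has to start
    there.\<close>
  have main: ?thesis
    if n: "(b, u) \<in> N" "0 \<le> t0" "a0 = b + of_real t0 * u"
      and tip: "\<And>b' d'. (b', d') \<in> N \<Longrightarrow> b \<in> half_line b' d' \<Longrightarrow> t0 = 0 \<Longrightarrow> b = b'" for b u t0
  proof (rule exI[of _ u], intro conjI allI impI)
    show u1: "norm u = 1" by (rule N1(1)[OF n(1)])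
    have sub: "a0 + of_real s * u \<in> half_line b u" if "0 \<le> s" for s
      unfolding n(3) by (rule half_line_subray[OF that n(2)])
    then show om: "a0 + of_real s * u \<notin> \<Omega>" if "0 \<le> s" for s using N1(2)[OF n(1)] that by blast
    have L: "half_line a0 u \<subseteq> half_line b u" using sub by (auto simp: half_line_def[of a0])
    fix a assume a: "a \<notin> \<Omega>"
    show "\<exists>d. norm d = 1 \<and> (\<forall>s\<ge>0. a + of_real s * d \<notin> \<Omega>) \<and>
       ((\<exists>t. a = a0 + of_real t * u) \<and> d = u \<or> (\<forall>s\<ge>0. a + of_real s * d \<notin> half_line a0 u))"
    proof (cases "a \<in> half_line b u")
      case True
      then obtain t where t: "t \<ge> 0" "a = b + of_real t * u" by (auto simp: half_line_def)
      have "a + of_real s * u \<notin> \<Omega>" if "s \<ge> 0" for s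
        using half_line_subray[OF that t(1), of b u] N1(2)[OF n(1)] t(2) by blast
      moreover have "a = a0 + of_real (t - t0) * u" by (simp add: t(2) n(3) algebra_simps)
      ultimately show ?thesis using u1 by blast
    next
      case False
      obtain b' d where bd: "(b', d) \<in> N" "a \<in> half_line b' d" using N2[OF a] by blast
      then obtain t where t: "t \<ge> 0" "a = b' + of_real t * d" by (auto simp: half_line_def)
      have d1: "norm d = 1" by (rule N1(1)[OF bd(1)])
      have ne: "half_line b u \<noteq> half_line b' d" using False bd(2) by blast
      have sd: "a + of_real s * d \<in> half_line b' d" if "s \<ge> 0" for s
        unfolding t(2) by (rule half_line_subray[OF that t(1)])
      then have "\<forall>s\<ge>0. a + of_real s * d \<notin> \<Omega>" using N1(2)[OF bd(1)] by blast
      moreover have "a + of_real s * d \<notin> half_line a0 u" if s: "s \<ge> 0" for s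
      proof
        assume x: "a + of_real s * d \<in> half_line a0 u"
        then have "a + of_real s * d \<in> half_line b u \<inter> half_line b' d" using L sd[OF s] by blast
        \<comment> \<open>A common point is one of the two tips. The tip \<open>b'\<close> is
          reached only for \<open>s = 0\<close>, and then \<open>a\<close> would lie on the ray from
          \<open>b\<close>. The tip \<open>b\<close> lies on the reference ray only if
          \<open>t0 = 0\<close>, and then \<open>tip\<close> yields \<open>b = b'\<close>.\<close>
        then have "a + of_real s * d = b \<or> a + of_real s * d = b'" using N3[OF n(1) bd(1) ne] by blast
        moreover have "a + of_real s * d \<noteq> b'"
        proof
          assume e: "a + of_real s * d = b'"
          then have "of_real (t + s) * d = 0" by (simp add: t(2) algebra_simps)
          then have "t + s = 0" using d1 by (metis mult_eq_0_iff norm_zero of_real_eq_0_iff zero_neq_one)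
          then have "s = 0" using t(1) s by linarith
          then show False using x False L by auto
        qed
        ultimately have eb: "a + of_real s * d = b" by blast
        obtain t' where t': "t' \<ge> 0" "b = a0 + of_real t' * u" using x unfolding eb by (auto simp: half_line_def)
        then have "of_real (t' + t0) * u = 0" by (simp add: n(3) algebra_simps)
        then have "t' + t0 = 0" using u1 by (metis mult_eq_0_iff norm_zero of_real_eq_0_iff zero_neq_one)
        then have "t0 = 0" using t'(1) n(2) by linarith
        moreover have "b \<in> half_line b' d" using sd[OF s] eb by simp
        ultimately have "b = b'" using tip bd(1) by blast
        then show False using \<open>a + of_real s * d \<noteq> b'\<close> eb by simp
      qed
      ultimately show ?thesis using d1 by blast
    qed
  qed
  obtain b u where bu: "(b, u) \<in> N" "a0 \<in> half_line b u" using N2[OF a0] by blast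
  show ?thesis
  proof (cases "\<exists>b' d' t. (b', d') \<in> N \<and> t > 0 \<and> a0 = b' + of_real t * d'")
    case True
    then obtain b' d' t where n: "(b', d') \<in> N" "t > 0" "a0 = b' + of_real t * d'" by blast
    show ?thesis by (rule main[OF n(1) _ n(3)]) (use n(2) in auto)
  next
    case False
    obtain t where t: "t \<ge> 0" "a0 = b + of_real t * u" using bu(2) by (auto simp: half_line_def)
    have no: "\<not> t > 0" if "(b', d') \<in> N" "a0 = b' + of_real t * d'" for b' d' t using False that by blast
    have "t = 0" using no[OF bu(1) t(2)] t(1) by simp
    show ?thesis
    proof (rule main[OF bu(1) t])
      fix b' d' assume n': "(b', d') \<in> N" "b \<in> half_line b' d'" "t = 0"
      then obtain t' where t': "t' \<ge> 0" "b = b' + of_real t' * d'" by (auto simp: half_line_def)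
      have "a0 = b" using t(2) \<open>t = 0\<close> by simp
      then have "t' = 0" using no[OF n'(1), of t'] t' by simp
      then show "b = b'" using t'(2) by simp
    qed
  qed
qed

subsection \<open>Accessible boundary points\<close>

locale disc_qc = harmonic_qc f h g k unit_disc for f h g k
begin

lemma to_half_plane:
  assumes b: "norm b = 1"
  shows "half_plane_qc (\<lambda>\<zeta>. f (disc_of b \<zeta>)) (\<lambda>\<zeta>. h (disc_of b \<zeta>)) (\<lambda>\<zeta>. g (disc_of b \<zeta>)) k"
  unfolding half_plane_qc_def
proof (rule harmonic_qc_compose[OF open_right_half disc_of_holomorphic])
  show "inj_on (disc_of b) right_half" by (rule inj_on_inverseI[of _ "half_of b"]) (rule cayley(2)[OF b])
  show "disc_of b ` right_half \<subseteq> unit_disc" using cayley(1)[OF b] by blast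
qed

section \<open>Preimages of segments that end at omitted points\<close>

context
  fixes w a :: complex
  assumes seg: "half_open_segment w a \<subseteq> f ` unit_disc" and a: "a \<notin> f ` unit_disc"
begin

definition "path_to s = fi (w + of_real s * (a - w))"

lemma path_to:
  shows "s \<in> {0..<1} \<Longrightarrow> path_to s \<in> unit_disc" "s \<in> {0..<1} \<Longrightarrow> f (path_to s) = w + of_real s * (a - w)"
    "continuous_on {0..<1} path_to" "((\<lambda>s. f (path_to s)) \<longlongrightarrow> a) (at_left 1)"
proof -
  have mem: "w + of_real s * (a - w) \<in> f ` unit_disc" if "s \<in> {0..<1}" for s :: real
    using seg that unfolding half_open_segment_def by blast
  show "s \<in> {0..<1} \<Longrightarrow> path_to s \<in> unit_disc" "s \<in> {0..<1} \<Longrightarrow> f (path_to s) = w + of_real s * (a - w)"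
    unfolding path_to_def using fi(2,3)[OF mem] by blast+
  show "continuous_on {0..<1} path_to" unfolding path_to_def
    by (rule continuous_on_compose2[OF fi_cont]) (use mem in \<open>auto intro!: continuous_intros\<close>)
  have "((\<lambda>s. w + of_real s * (a - w)) \<longlongrightarrow> w + of_real 1 * (a - w)) (at_left 1)" by (intro tendsto_intros)
  then have "((\<lambda>s. w + of_real s * (a - w)) \<longlongrightarrow> a) (at_left 1)" by simp
  moreover have "\<forall>\<^sub>F s in at_left (1::real). s \<in> {0..<1}" by (auto simp: eventually_at_left_field intro!: exI[of _ 0])
  then have "\<forall>\<^sub>F s in at_left 1. w + of_real s * (a - w) = f (path_to s)"
    by eventually_elim (use fi(3)[OF mem] in \<open>simp add: path_to_def\<close>)
  ultimately show "((\<lambda>s. f (path_to s)) \<longlongrightarrow> a) (at_left 1)" by (rule Lim_transform_eventually)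
qed

text \<open>A subsequence converges to a point \<open>b\<close> of the circle, since a limit inside
  the disc would make \<open>a\<close> a value of \<open>f\<close>. The tails of the path are
  connected and their images shrink to the omitted \<open>a\<close>, so some tails lie in
  arbitrarily small balls, and the whole path converges.\<close>

lemma path_to_lands: "\<exists>b. norm b = 1 \<and> (path_to \<longlongrightarrow> b) (at_left 1)"
proof -
  define s where "s n = 1 - inverse (real (Suc n))" for n
  have s01: "s n \<in> {0..<1}" for n by (simp add: s_def field_simps)
  have s1: "s \<longlonglongrightarrow> 1"
    unfolding s_def using tendsto_diff[OF tendsto_const LIMSEQ_inverse_real_of_nat, of 1] by simp
  have "bounded (range (\<lambda>n. path_to (s n)))"
    by (rule bounded_subset[of unit_disc]) (use path_to(1)[OF s01] in auto)
  then obtain b r where r: "strict_mono (r :: nat \<Rightarrow> nat)" "((\<lambda>n. path_to (s n)) \<circ> r) \<longlonglongrightarrow> b"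
    using bounded_imp_convergent_subsequence by blast
  have sr: "(\<lambda>n. s (r n)) \<longlonglongrightarrow> 1" using LIMSEQ_subseq_LIMSEQ[OF s1 r(1)] by (simp add: o_def)
  have pr: "(\<lambda>n. path_to (s (r n))) \<longlonglongrightarrow> b" using r(2) by (simp add: o_def)
  have fr: "(\<lambda>n. f (path_to (s (r n)))) \<longlonglongrightarrow> a"
  proof -
    have "(\<lambda>n. w + of_real (s (r n)) * (a - w)) \<longlonglongrightarrow> w + of_real 1 * (a - w)" by (intro tendsto_intros sr)
    then show ?thesis using path_to(2)[OF s01] by simp
  qed
  have "b \<in> cball 0 1"
    by (rule Lim_in_closed_set[OF closed_cball _ _ pr]) (use path_to(1)[OF s01] in \<open>auto intro!: always_eventually less_imp_le\<close>)
  moreover have "b \<notin> unit_disc"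
  proof
    assume b: "b \<in> unit_disc"
    then have "isCont f b" using continuous_on_eq_continuous_at[OF open_ball] f_cont by blast
    then have "(\<lambda>n. f (path_to (s (r n)))) \<longlonglongrightarrow> f b" using isCont_tendsto_compose[OF _ pr] by blast
    then have "a = f b" using LIMSEQ_unique fr by blast
    then show False using a b by blast
  qed
  ultimately have b: "norm b = 1" by simp
  then have mb: "norm (- b) = 1" by simp
  have b0: "b \<noteq> 0" using b by auto
  \<comment> \<open>Sending \<open>- b\<close> to infinity places \<open>b\<close> at the finite
    boundary point \<open>0\<close>, where the collapse of small sets applies.\<close>
  interpret H: half_plane_qc "\<lambda>\<zeta>. f (disc_of (- b) \<zeta>)" "\<lambda>\<zeta>. h (disc_of (- b) \<zeta>)" "\<lambda>\<zeta>. g (disc_of (- b) \<zeta>)" k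
    by (rule to_half_plane[OF mb])
  define q where "q t = half_of (- b) (path_to t)" for t
  have q: "q t \<in> right_half" "disc_of (- b) (q t) = path_to t" if "t \<in> {0..<1}" for t
    using cayley(3,4)[OF mb path_to(1)[OF that]] by (auto simp: q_def)
  have q_cont: "continuous_on {0..<1} q"
    unfolding q_def using path_to(1) half_of_holomorphic[OF mb, THEN holomorphic_on_imp_continuous_on]
    by (intro continuous_on_compose2[OF _ path_to(3)]) auto
  have p0: "(\<lambda>n. q (s (r n))) \<longlonglongrightarrow> \<i> * of_real 0"
  proof -
    have "(\<lambda>n. (- b + path_to (s (r n))) / (- b - path_to (s (r n)))) \<longlonglongrightarrow> (- b + b) / (- b - b)"
      using b0 by (intro tendsto_intros pr) simp
    then show ?thesis by (simp add: q_def half_of_def)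
  qed
  have ev: "\<forall>\<^sub>F n in sequentially. q ` {s (r n)..<1} \<subseteq> ball (q (s (r n))) \<epsilon>" if "\<epsilon> > 0" for \<epsilon>
  proof (rule H.small_sets_finite[OF p0 _ _ _ _ _ that])
    have sub: "{s n..<1} \<subseteq> {0..<1}" for n using s01[of n] by auto
    show "connected (q ` {s (r n)..<1})" for n
      by (intro connected_continuous_image continuous_on_subset[OF q_cont] sub) auto
    show "q ` {s (r n)..<1} \<subseteq> right_half" for n using q(1) sub[of "r n"] by blast
    show "q (s (r n)) \<in> q ` {s (r n)..<1}" for n using s01[of "r n"] by auto
    show "a \<notin> (\<lambda>\<zeta>. f (disc_of (- b) \<zeta>)) ` right_half" using a cayley(1)[OF mb] by blast
    fix e :: real assume e: "e > 0"
    have "(\<lambda>n. (1 - s (r n)) * norm (a - w)) \<longlonglongrightarrow> (1 - 1) * norm (a - w)" by (intro tendsto_intros sr)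
    then have "\<forall>\<^sub>F n in sequentially. (1 - s (r n)) * norm (a - w) < e" using e by (intro order_tendstoD) auto
    then show "\<forall>\<^sub>F n in sequentially. \<forall>z\<in>q ` {s (r n)..<1}. norm (f (disc_of (- b) z) - a) < e"
    proof eventually_elim
      case (elim n)
      show ?case
      proof
        fix z assume "z \<in> q ` {s (r n)..<1}"
        then obtain t where t: "s (r n) \<le> t" "t < 1" "z = q t" by auto
        then have t01: "t \<in> {0..<1}" using s01[of "r n"] by auto
        have "f (disc_of (- b) z) - a = of_real (1 - t) * (w - a)"
          using path_to(2)[OF t01] by (simp add: t(3) q(2)[OF t01] algebra_simps)
        then have "norm (f (disc_of (- b) z) - a) = (1 - t) * norm (a - w)"
          using t(2) by (simp add: norm_mult norm_minus_commute del: of_real_diff)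
        also have "\<dots> \<le> (1 - s (r n)) * norm (a - w)" using t(1) by (intro mult_right_mono) auto
        finally show "norm (f (disc_of (- b) z) - a) < e" using elim by simp
      qed
    qed
  qed
  have "(q \<longlongrightarrow> 0) (at_left 1)"
  proof (rule tendstoI)
    fix e :: real assume e: "e > 0"
    have "\<forall>\<^sub>F n in sequentially. norm (q (s (r n))) < e / 2" using tendstoD[OF p0, of "e / 2"] e by simp
    moreover have "\<forall>\<^sub>F n in sequentially. q ` {s (r n)..<1} \<subseteq> ball (q (s (r n))) (e / 2)" using ev[of "e / 2"] e by simp
    ultimately obtain n where n: "norm (q (s (r n))) < e / 2" "q ` {s (r n)..<1} \<subseteq> ball (q (s (r n))) (e / 2)"
      using eventually_happens'[OF sequentially_bot eventually_conj] by blast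
    have "dist (q t) 0 < e" if t: "s (r n) < t" "t < 1" for t
    proof -
      have "t \<in> {s (r n)..<1}" using t by simp
      then have "q t \<in> ball (q (s (r n))) (e / 2)" using n(2) by blast
      then show ?thesis using n(1) norm_triangle_sub[of "q t" "q (s (r n))"] by (simp add: dist_norm norm_minus_commute)
    qed
    then show "\<forall>\<^sub>F t in at_left 1. dist (q t) 0 < e"
      using s01[of "r n"] by (auto simp: eventually_at_left_field)
  qed
  then have "((\<lambda>t. - b * (q t - 1) / (q t + 1)) \<longlongrightarrow> - b * (0 - 1) / (0 + 1)) (at_left 1)" by (intro tendsto_intros) auto
  moreover have "\<forall>\<^sub>F t in at_left (1::real). t \<in> {0..<1}" by (auto simp: eventually_at_left_field intro!: exI[of _ 0])
  then have "\<forall>\<^sub>F t in at_left 1. - b * (q t - 1) / (q t + 1) = path_to t"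
    by eventually_elim (use q(2) in \<open>simp add: disc_of_def\<close>)
  ultimately have "(path_to \<longlongrightarrow> b) (at_left 1)" by (auto dest: Lim_transform_eventually)
  then show ?thesis using b by blast
qed

lemma path_to_half_plane:
  assumes b: "norm b = 1" "(path_to \<longlongrightarrow> b) (at_left 1)"
  shows "continuous_on {0..<1} (\<lambda>s. half_of b (path_to s))" "\<And>s. s \<in> {0..<1} \<Longrightarrow> half_of b (path_to s) \<in> right_half"
    "filterlim (\<lambda>s. half_of b (path_to s)) at_infinity (at_left 1)"
    "((\<lambda>s. f (disc_of b (half_of b (path_to s)))) \<longlongrightarrow> a) (at_left 1)"
proof -
  have ev: "\<forall>\<^sub>F t in at_left (1::real). t \<in> {0..<1}" by (auto simp: eventually_at_left_field intro!: exI[of _ 0])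
  show "continuous_on {0..<1} (\<lambda>s. half_of b (path_to s))"
    using path_to(1) half_of_holomorphic[OF b(1), THEN holomorphic_on_imp_continuous_on]
    by (intro continuous_on_compose2[OF _ path_to(3)]) auto
  show "half_of b (path_to s) \<in> right_half" if "s \<in> {0..<1}" for s by (rule cayley(3)[OF b(1) path_to(1)[OF that]])
  have "\<forall>\<^sub>F t in at_left 1. path_to t \<in> unit_disc" using ev by eventually_elim (rule path_to(1))
  then show "filterlim (\<lambda>s. half_of b (path_to s)) at_infinity (at_left 1)" by (rule half_of_at_infinity[OF b])
  have "\<forall>\<^sub>F s in at_left 1. f (path_to s) = f (disc_of b (half_of b (path_to s)))"
    using ev by eventually_elim (simp add: cayley(4)[OF b(1) path_to(1)])
  then show "((\<lambda>s. f (disc_of b (half_of b (path_to s)))) \<longlongrightarrow> a) (at_left 1)"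
    by (rule Lim_transform_eventually[OF path_to(4)])
qed

text \<open>The image is rotated so that the reference ray at \<open>a\<close> becomes the negative
  axis, and \<open>b\<close>, where the path with end value \<open>a\<close> lands, is placed at
  infinity. The weight \<open>|b - z|^2\<close> comes from the derivative of the Cayley map, which
  is \<open>(b - z)^2 / (2 b)\<close> in terms of \<open>z\<close>.\<close>

lemma derivative_bound_at_landing_point:
  assumes ccd: "close_to_convex_domain (f ` unit_disc)" and b: "norm b = 1" "(path_to \<longlongrightarrow> b) (at_left 1)"
  shows "\<exists>P. P holomorphic_on unit_disc \<and> (\<forall>z\<in>unit_disc. 0 < Re (P z)) \<and>
    (\<forall>z\<in>unit_disc. (1 - k) * (norm (deriv h z) * (norm (b - z))\<^sup>2) \<le> 2 * norm (P z) ^ 3)"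
proof -
  obtain u where u: "norm u = 1" "\<And>s. s \<ge> 0 \<Longrightarrow> a + of_real s * u \<notin> f ` unit_disc"
    "\<And>c. c \<notin> f ` unit_disc \<Longrightarrow> \<exists>d. norm d = 1 \<and> (\<forall>s\<ge>0. c + of_real s * d \<notin> f ` unit_disc) \<and>
       ((\<exists>t. c = a + of_real t * u) \<and> d = u \<or> (\<forall>s\<ge>0. c + of_real s * d \<notin> half_line a u))"
    using reference_ray[OF ccd a] by blast
  \<comment> \<open>Since \<open>v * u = -1\<close>, multiplication by \<open>v\<close> turns the
    direction \<open>u\<close> into the negative real one.\<close>
  define v where "v = - cnj u"
  have uv: "v * u = -1" using u(1) by (simp add: v_def complex_norm_square[symmetric] mult.commute)
  have v1: "norm v = 1" using u(1) by (simp add: v_def)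
  then have v0: "v \<noteq> 0" by auto
  interpret H0: half_plane_qc "\<lambda>\<zeta>. f (disc_of b \<zeta>)" "\<lambda>\<zeta>. h (disc_of b \<zeta>)" "\<lambda>\<zeta>. g (disc_of b \<zeta>)" k
    by (rule to_half_plane[OF b(1)])
  define fH where "fH \<zeta> = v * (f (disc_of b \<zeta>) - a)" for \<zeta>
  define hH where "hH \<zeta> = v * (h (disc_of b \<zeta>) - a)" for \<zeta>
  define gH where "gH \<zeta> = cnj v * g (disc_of b \<zeta>)" for \<zeta>
  have imH: "fH ` right_half = (\<lambda>y. v * (y - a)) ` (f ` unit_disc)"
  proof -
    have "z \<in> disc_of b ` right_half" if "z \<in> unit_disc" for z
      using image_eqI[where f = "disc_of b", OF cayley(4)[OF b(1) that, symmetric] cayley(3)[OF b(1) that]] .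
    then have "disc_of b ` right_half = unit_disc" using cayley(1)[OF b(1)] by blast
    moreover have "fH ` right_half = (\<lambda>y. v * (y - a)) ` (f ` (disc_of b ` right_half))" unfolding fH_def image_image ..
    ultimately show ?thesis by simp
  qed
  have mem: "v * (y - a) \<in> fH ` right_half \<longleftrightarrow> y \<in> f ` unit_disc" for y
    unfolding imH using v0 by auto
  have mem': "x \<in> fH ` right_half \<longleftrightarrow> a - x * u \<in> f ` unit_disc" for x
  proof -
    have "v * ((a - x * u) - a) = - ((v * u) * x)" by (simp add: algebra_simps)
    then have "v * ((a - x * u) - a) = x" using uv by simp
    then show ?thesis using mem[of "a - x * u"] by simp
  qed
  interpret H: ray_config fH hH gH k "\<lambda>s. half_of b (path_to s)"
  proof -
    have hp: "half_plane_qc fH hH gH k"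
      unfolding half_plane_qc_def fH_def hH_def gH_def by (rule H0.harmonic_qc_affine[OF v0])
    show "ray_config fH hH gH k (\<lambda>s. half_of b (path_to s))"
    proof (intro ray_config.intro hp ray_config_axioms.intro)
      show "x \<notin> fH ` right_half" if "x \<in> \<real>\<^sub>\<le>\<^sub>0" for x
      proof -
        have "x = - of_real (- Re x)" "0 \<le> - Re x" using that by (auto simp: complex_nonpos_Reals_iff complex_eq_iff)
        then show ?thesis unfolding mem' using u(2)[of "- Re x"] by (metis add_uminus_conv_diff minus_mult_left minus_minus)
      qed
      fix x assume "x \<notin> fH ` right_half"
      then have c: "a - x * u \<notin> f ` unit_disc" unfolding mem' .
      obtain d where d: "norm d = 1" "\<And>s. s \<ge> 0 \<Longrightarrow> (a - x * u) + of_real s * d \<notin> f ` unit_disc"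
        "(\<exists>t. a - x * u = a + of_real t * u) \<and> d = u \<or> (\<forall>s\<ge>0. (a - x * u) + of_real s * d \<notin> half_line a u)"
        using u(3)[OF c] by blast
      have e: "a - (x + of_real s * (v * d)) * u = (a - x * u) + of_real s * d" for s
      proof -
        have "a - (x + of_real s * (v * d)) * u = (a - x * u) - of_real s * ((v * u) * d)" by (simp add: algebra_simps)
        then show ?thesis by (simp add: uv)
      qed
      show "\<exists>d. norm d = 1 \<and> (\<forall>s\<ge>0. x + of_real s * d \<notin> fH ` right_half) \<and>
        (Im x = 0 \<and> d = -1 \<or> (\<forall>s\<ge>0. x + of_real s * d \<notin> \<real>\<^sub>\<le>\<^sub>0))"
      proof (rule exI[of _ "v * d"], intro conjI)
        show "norm (v * d) = 1" by (simp add: norm_mult v1 d(1))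
        show "\<forall>s\<ge>0. x + of_real s * (v * d) \<notin> fH ` right_half" unfolding mem' e using d(2) by blast
        show "Im x = 0 \<and> v * d = -1 \<or> (\<forall>s\<ge>0. x + of_real s * (v * d) \<notin> \<real>\<^sub>\<le>\<^sub>0)"
          using d(3)
        proof
          assume A: "(\<exists>t. a - x * u = a + of_real t * u) \<and> d = u"
          then obtain t where "a - x * u = a + of_real t * u" by blast
          then have "- x * u = of_real t * u" by (simp add: diff_conv_add_uminus del: add_uminus_conv_diff)
          then have "- x = of_real t" using u(1) by (metis mult_cancel_right norm_zero zero_neq_one)
          then have "x = - of_real t" by (metis minus_minus)
          then show ?thesis using A uv by simp
        next
          assume A: "\<forall>s\<ge>0. (a - x * u) + of_real s * d \<notin> half_line a u"
          have "x + of_real s * (v * d) \<notin> \<real>\<^sub>\<le>\<^sub>0" if s: "s \<ge> 0" for s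
          proof
            define y where "y = x + of_real s * (v * d)"
            assume "x + of_real s * (v * d) \<in> \<real>\<^sub>\<le>\<^sub>0"
            then have "y = - of_real (- Re y)" "0 \<le> - Re y" by (auto simp: y_def complex_nonpos_Reals_iff complex_eq_iff)
            then have "a - y * u = a + of_real (- Re y) * u" by (metis add_uminus_conv_diff minus_mult_left minus_minus)
            then have "a - y * u \<in> half_line a u" unfolding half_line_def using \<open>0 \<le> - Re y\<close> by blast
            then show False using A s e[of s] unfolding y_def by simp
          qed
          then show ?thesis by blast
        qed
      qed
    next
      show "continuous_on {0..<1} (\<lambda>s. half_of b (path_to s))" by (rule path_to_half_plane(1)[OF b])
      show "half_of b (path_to s) \<in> right_half" if "s \<in> {0..<1}" for s by (rule path_to_half_plane(2)[OF b that])
      show "filterlim (\<lambda>s. half_of b (path_to s)) at_infinity (at_left 1)" by (rule path_to_half_plane(3)[OF b])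
      have "((\<lambda>s. v * (f (disc_of b (half_of b (path_to s))) - a)) \<longlongrightarrow> v * (a - a)) (at_left 1)"
        by (intro tendsto_mult tendsto_diff tendsto_const path_to_half_plane(4)[OF b])
      then show "((\<lambda>s. fH (half_of b (path_to s))) \<longlongrightarrow> 0) (at_left 1)" by (simp add: fH_def)
    qed
  qed
  obtain P where P: "P holomorphic_on right_half" "\<And>z. z \<in> right_half \<Longrightarrow> 0 \<le> Re (P z)"
    "\<And>z. z \<in> right_half \<Longrightarrow> (1 - k) * norm (deriv hH z) \<le> norm (P z) ^ 3"
    using H.derivative_cube by blast
  have bound: "(1 - k) * (norm (deriv h z) * (norm (b - z))\<^sup>2) \<le> 2 * norm (P (half_of b z)) ^ 3" if z: "z \<in> unit_disc" for z
  proof -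
    define \<zeta> where "\<zeta> = half_of b z"
    have \<zeta>: "\<zeta> \<in> right_half" "disc_of b \<zeta> = z" using cayley(3,4)[OF b(1) z] by (auto simp: \<zeta>_def)
    have bz: "b - z \<noteq> 0" using z b(1) by auto
    have z1: "\<zeta> + 1 = 2 * b / (b - z)" using bz by (simp add: \<zeta>_def half_of_def field_simps)
    have "((\<lambda>\<zeta>. h (disc_of b \<zeta>)) has_field_derivative deriv h z * (2 * b / (\<zeta> + 1)\<^sup>2)) (at \<zeta>)"
      using DERIV_chain2[OF _ disc_of_derivative[OF \<zeta>(1)]] holomorphic_derivI[OF h_hol open_ball] z \<zeta>(2) by metis
    then have "(hH has_field_derivative v * (deriv h z * (2 * b / (\<zeta> + 1)\<^sup>2))) (at \<zeta>)"
      unfolding hH_def by (auto intro!: derivative_eq_intros)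
    then have "deriv hH \<zeta> = v * (deriv h z * (2 * b / (\<zeta> + 1)\<^sup>2))" by (rule DERIV_imp_deriv)
    also have "2 * b / (\<zeta> + 1)\<^sup>2 = (b - z)\<^sup>2 / (2 * b)"
    proof -
      have "b \<noteq> 0" using b(1) by auto
      then show ?thesis using bz by (simp add: z1 power2_eq_square)
    qed
    finally have "norm (deriv hH \<zeta>) = norm (deriv h z) * (norm (b - z))\<^sup>2 / 2"
      by (simp add: b(1) norm_mult norm_divide norm_power v1)
    then have "(1 - k) * (norm (deriv h z) * (norm (b - z))\<^sup>2) = 2 * ((1 - k) * norm (deriv hH \<zeta>))" by simp
    then show ?thesis using P(3)[OF \<zeta>(1)] unfolding \<zeta>_def by linarith
  qed
  show ?thesis
  \<comment> \<open>Adding \<open>1\<close> makes the real part strictly positive and, because the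
    real part of \<open>P\<close> is nonnegative, does not decrease the modulus.\<close>
  proof (intro exI[of _ "\<lambda>z. P (half_of b z) + 1"] conjI ballI)
    have "(P \<circ> half_of b) holomorphic_on unit_disc"
      by (rule holomorphic_on_compose_gen[OF half_of_holomorphic[OF b(1)] P(1)]) (use cayley(3)[OF b(1)] in blast)
    then show "(\<lambda>z. P (half_of b z) + 1) holomorphic_on unit_disc" by (auto simp: o_def intro!: holomorphic_intros)
    fix z assume z: "z \<in> unit_disc"
    have R: "0 \<le> Re (P (half_of b z))" by (rule P(2)[OF cayley(3)[OF b(1) z]])
    then show "0 < Re (P (half_of b z) + 1)" by simp
    have "(norm (P (half_of b z)))\<^sup>2 \<le> (norm (P (half_of b z) + 1))\<^sup>2"
      using R unfolding cmod_power2 by (simp add: power2_eq_square algebra_simps)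
    then have "norm (P (half_of b z)) \<le> norm (P (half_of b z) + 1)" by (rule power2_le_imp_le) simp
    then have "norm (P (half_of b z)) ^ 3 \<le> norm (P (half_of b z) + 1) ^ 3" by (intro power_mono) auto
    then show "(1 - k) * (norm (deriv h z) * (norm (b - z))\<^sup>2) \<le> 2 * norm (P (half_of b z) + 1) ^ 3"
      using bound[OF z] by linarith
  qed
qed

end

text \<open>With \<open>b\<close> at infinity, the first path provides arbitrarily large half
  circles on which \<open>f\<close> is close to \<open>a1\<close>. The second path has to cross one
  of them at a point where \<open>f\<close> is already close to \<open>a2\<close>.\<close>

lemma landing_points_distinct:
  assumes s1: "half_open_segment w a1 \<subseteq> f ` unit_disc" "a1 \<notin> f ` unit_disc"
    and s2: "half_open_segment w a2 \<subseteq> f ` unit_disc" "a2 \<notin> f ` unit_disc"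
    and b: "norm b = 1" "(path_to w a1 \<longlongrightarrow> b) (at_left 1)" "(path_to w a2 \<longlongrightarrow> b) (at_left 1)"
  shows "a1 = a2"
proof (rule ccontr)
  assume ne: "a1 \<noteq> a2"
  define \<epsilon> where "\<epsilon> = norm (a1 - a2) / 2"
  have \<epsilon>: "\<epsilon> > 0" using ne by (simp add: \<epsilon>_def)
  interpret H: half_plane_qc "\<lambda>\<zeta>. f (disc_of b \<zeta>)" "\<lambda>\<zeta>. h (disc_of b \<zeta>)" "\<lambda>\<zeta>. g (disc_of b \<zeta>)" k
    by (rule to_half_plane[OF b(1)])
  note p1 = path_to_half_plane[OF s1 b(1,2)] and p2 = path_to_half_plane[OF s2 b(1,3)]
  let ?q = "\<lambda>s. half_of b (path_to w a2 s)"
  have "\<forall>\<^sub>F s in at_left 1. norm (f (disc_of b (?q s)) - a2) < \<epsilon>" using tendstoD[OF p2(4) \<epsilon>] by (simp add: dist_norm)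
  then obtain c where c: "c < 1" "\<And>s. c < s \<Longrightarrow> s < 1 \<Longrightarrow> norm (f (disc_of b (?q s)) - a2) < \<epsilon>"
    by (auto simp: eventually_at_left_field)
  define s0 where "s0 = max 0 ((c + 1) / 2)"
  have s0: "s0 \<in> {0..<1}" "c < s0" using c(1) by (auto simp: s0_def max_def field_simps)
  obtain R where R: "R > norm (?q s0)" "\<And>z. z \<in> right_half \<Longrightarrow> norm z = R \<Longrightarrow> norm (f (disc_of b z) - a1) < \<epsilon>"
    using H.good_half_circles[OF p1 \<epsilon>, of "norm (?q s0)" 0 0] by auto
  have e1: "\<forall>\<^sub>F s in at_left 1. norm (?q s) > R"
    using p2(3) by (auto simp: filterlim_at_infinity_conv_norm_at_top filterlim_at_top_dense)
  have e2: "\<forall>\<^sub>F s in at_left 1. s > s0 \<and> s < (1::real)"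
    using s0 by (auto simp: eventually_at_left_field intro!: exI[of _ s0])
  obtain s1' where s1': "norm (?q s1') > R" "s1' > s0" "s1' < 1"
    using eventually_happens'[OF trivial_limit_at_left_real eventually_conj[OF e1 e2]] by blast
  have "continuous_on {s0..s1'} (\<lambda>s. norm (?q s))"
    using s0 s1' by (intro continuous_on_norm continuous_on_subset[OF p2(1)]) auto
  then obtain s where s: "s0 \<le> s" "s \<le> s1'" "norm (?q s) = R"
    using IVT'[of "\<lambda>s. norm (?q s)" s0 R s1'] R(1) s1' by auto
  have "s \<in> {0..<1}" "c < s" using s s0 s1' by auto
  then have "norm (f (disc_of b (?q s)) - a1) < \<epsilon>" "norm (f (disc_of b (?q s)) - a2) < \<epsilon>"
    using R(2)[OF p2(2) s(3)] c(2) by auto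
  then have "norm (a1 - a2) < 2 * \<epsilon>"
    using norm_triangle_ineq4[of "f (disc_of b (?q s)) - a2" "f (disc_of b (?q s)) - a1"] by simp
  then show False by (simp add: \<epsilon>_def)
qed

end

subsection \<open>The geometric classes\<close>

context disc_qc
begin

text \<open>Two omitted points \<open>a\<close> and \<open>a + u\<close> of one omitted ray are
  viewed from a value \<open>w\<close> off the line of that ray. The segments from \<open>w\<close>
  to them meet only in \<open>w\<close>, so their first exits from the image differ.\<close>

lemma two_accessible_points:
  assumes ccd: "close_to_convex_domain (f ` unit_disc)"
  obtains w a1 a2 where "half_open_segment w a1 \<subseteq> f ` unit_disc" "a1 \<notin> f ` unit_disc"
    "half_open_segment w a2 \<subseteq> f ` unit_disc" "a2 \<notin> f ` unit_disc" "a1 \<noteq> a2"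
proof -
  let ?\<Omega> = "f ` unit_disc"
  obtain a where a: "a \<notin> ?\<Omega>" using image_neq_UNIV[OF bounded_ball] by auto
  obtain u where u: "norm u = 1" "\<And>s. s \<ge> 0 \<Longrightarrow> a + of_real s * u \<notin> ?\<Omega>"
    using reference_ray[OF ccd a] by blast
  have au: "a + u \<notin> ?\<Omega>" using u(2)[of 1] by simp
  have uu: "cnj u * u = 1" using u(1) by (metis complex_norm_square mult.commute of_real_1 one_power2)
  \<comment> \<open>Signed distance from the line through \<open>a\<close> in direction
    \<open>u\<close>; since the image is open, some value has a nonzero distance.\<close>
  define m where "m w = Im (cnj u * (w - a))" for w
  obtain w where w: "w \<in> ?\<Omega>" "m w \<noteq> 0"
  proof (cases "m (f 0) = 0")
    case True
    have "f 0 \<in> ?\<Omega>" by simp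
    then obtain e where e: "e > 0" "ball (f 0) e \<subseteq> ?\<Omega>" using open_image open_contains_ball by blast
    define w where "w = f 0 + \<i> * of_real (e / 2) * u"
    have "w \<in> ball (f 0) e" using e(1) u(1) by (simp add: w_def dist_norm norm_mult)
    moreover have "cnj u * (w - a) = cnj u * (f 0 - a) + \<i> * of_real (e / 2) * (cnj u * u)" by (simp add: w_def algebra_simps)
    then have "m w = m (f 0) + e / 2" unfolding m_def by (simp only: uu) simp
    ultimately show thesis using that[of w] True e by auto
  next
    case False
    then show thesis using that[of "f 0"] by simp
  qed
  obtain s where s: "0 < s" "s \<le> 1" "w + of_real s * (a - w) \<notin> ?\<Omega>" "half_open_segment w (w + of_real s * (a - w)) \<subseteq> ?\<Omega>"
    by (rule first_exit[OF open_image w(1) a])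
  obtain t where t: "0 < t" "t \<le> 1" "w + of_real t * (a + u - w) \<notin> ?\<Omega>" "half_open_segment w (w + of_real t * (a + u - w)) \<subseteq> ?\<Omega>"
    by (rule first_exit[OF open_image w(1) au])
  have "w + of_real s * (a - w) \<noteq> w + of_real t * (a + u - w)"
  proof
    assume "w + of_real s * (a - w) = w + of_real t * (a + u - w)"
    then have e: "of_real s * (a - w) = of_real t * (a + u - w)" by simp
    have "Im (cnj u * (of_real s * (a - w))) = - (s * m w)" by (simp add: m_def algebra_simps)
    moreover have "cnj u * (of_real t * (a + u - w)) = of_real t * (cnj u * u) - of_real t * (cnj u * (w - a))" by (simp add: algebra_simps)
    then have "Im (cnj u * (of_real t * (a + u - w))) = - (t * m w)" unfolding uu m_def by simp
    ultimately have "s = t" using w(2) by (simp add: e)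
    then have "a - w = a + u - w" using e s(1) by simp
    then show False using u(1) by auto
  qed
  then show thesis using that s t by blast
qed

lemma bounded_means_close_to_convex:
  assumes ccd: "close_to_convex_domain (f ` unit_disc)" and p: "0 < p" "p < 1/2"
  shows "bounded_means p h \<and> bounded_means p g"
proof -
  obtain w a1 a2 where a1: "half_open_segment w a1 \<subseteq> f ` unit_disc" "a1 \<notin> f ` unit_disc"
    and a2: "half_open_segment w a2 \<subseteq> f ` unit_disc" "a2 \<notin> f ` unit_disc" and ne: "a1 \<noteq> a2"
    using two_accessible_points[OF ccd] by blast
  obtain b1 where b1: "norm b1 = 1" "(path_to w a1 \<longlongrightarrow> b1) (at_left 1)" using path_to_lands[OF a1] by blast
  obtain b2 where b2: "norm b2 = 1" "(path_to w a2 \<longlongrightarrow> b2) (at_left 1)" using path_to_lands[OF a2] by blast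
  have b12: "b1 \<noteq> b2" using landing_points_distinct[OF a1 a2 b1] b2(2) ne by blast
  obtain P1 where P1: "P1 holomorphic_on unit_disc" "\<And>z. z \<in> unit_disc \<Longrightarrow> 0 < Re (P1 z)"
    "\<And>z. z \<in> unit_disc \<Longrightarrow> (1 - k) * (norm (deriv h z) * (norm (b1 - z))\<^sup>2) \<le> 2 * norm (P1 z) ^ 3"
    using derivative_bound_at_landing_point[OF a1 ccd b1] by blast
  obtain P2 where P2: "P2 holomorphic_on unit_disc" "\<And>z. z \<in> unit_disc \<Longrightarrow> 0 < Re (P2 z)"
    "\<And>z. z \<in> unit_disc \<Longrightarrow> (1 - k) * (norm (deriv h z) * (norm (b2 - z))\<^sup>2) \<le> 2 * norm (P2 z) ^ 3"
    using derivative_bound_at_landing_point[OF a2 ccd b2] by blast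
  \<comment> \<open>No \<open>z\<close> is close to both landing points:
    \<open>|b1 - b2|^2 \<le> 2 (|b1 - z|^2 + |b2 - z|^2)\<close>. Hence the sum of the two weighted
    bounds carries a weight bounded below. The factor \<open>4\<close> in \<open>C\<close> is this
    \<open>2\<close> times the \<open>2\<close> of the weighted bounds.\<close>
  define X where "X = (1 - k) * (norm (b1 - b2))\<^sup>2"
  have X: "X > 0" using k b12 by (simp add: X_def)
  define C where "C = 4 / X"
  have C: "0 \<le> C" using X by (simp add: C_def)
  have bd: "norm (deriv h z) \<le> C * (norm (P1 z) ^ 3 + norm (P2 z) ^ 3)" if z: "z \<in> unit_disc" for z
  proof -
    define x y where "x = norm (b1 - z)" and "y = norm (b2 - z)"
    have "norm (b1 - b2) \<le> x + y" using norm_triangle_ineq4[of "b1 - z" "b2 - z"] by (simp add: x_def y_def)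
    then have "(norm (b1 - b2))\<^sup>2 \<le> (x + y)\<^sup>2" by (intro power_mono) auto
    also have "\<dots> \<le> 2 * (x\<^sup>2 + y\<^sup>2)" using sum_squares_bound[of x y] by (simp add: power2_sum)
    finally have "(1 - k) * norm (deriv h z) * (norm (b1 - b2))\<^sup>2 \<le> (1 - k) * norm (deriv h z) * (2 * (x\<^sup>2 + y\<^sup>2))"
      using k by (intro mult_left_mono) auto
    also have "\<dots> = 2 * ((1 - k) * (norm (deriv h z) * x\<^sup>2) + (1 - k) * (norm (deriv h z) * y\<^sup>2))" by (simp add: algebra_simps)
    also have "\<dots> \<le> 2 * (2 * norm (P1 z) ^ 3 + 2 * norm (P2 z) ^ 3)"
      unfolding x_def y_def by (intro mult_left_mono add_mono P1(3) P2(3) z) auto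
    finally have "norm (deriv h z) * X \<le> 4 * (norm (P1 z) ^ 3 + norm (P2 z) ^ 3)" by (simp add: X_def algebra_simps)
    then show ?thesis using X by (simp add: C_def field_simps)
  qed
  have "norm (deriv g z) \<le> norm (deriv h z)" if "z \<in> unit_disc" for z
    using dil[OF that] mult_right_mono[of k 1 "norm (deriv h z)"] k by simp
  then have "norm (deriv g z) \<le> C * (norm (P1 z) ^ 3 + norm (P2 z) ^ 3)" if "z \<in> unit_disc" for z
    using bd[OF that] that order_trans by blast
  then show ?thesis
    using bounded_means_of_cube_bound[OF P1(1,2) P2(1,2) h_hol C bd p]
      bounded_means_of_cube_bound[OF P1(1,2) P2(1,2) g_hol C _ p] by blast
qed

text \<open>Multiplication by \<open>cnj u\<close> makes the line horizontal and leaves the moduli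
  of \<open>h\<close> and \<open>g\<close> unchanged.\<close>

lemma bounded_means_line:
  assumes u: "norm u = 1" and conn: "connected {t. c + of_real t * u \<in> f ` unit_disc}" and c: "c \<notin> f ` unit_disc"
    and p: "0 < p" "p < 1/2"
  shows "bounded_means p h \<and> bounded_means p g"
proof -
  have uu: "cnj u * u = 1" using u by (metis complex_norm_square mult.commute of_real_1 one_power2)
  define v where "v = cnj u"
  have v0: "v \<noteq> 0" using u by (auto simp: v_def)
  interpret H: harmonic_qc "\<lambda>z. v * (f z - 0)" "\<lambda>z. v * (h z - 0)" "\<lambda>z. cnj v * g z" k unit_disc
    by (rule harmonic_qc_affine[OF v0])
  have mem: "v * y \<in> (\<lambda>z. v * (f z - 0)) ` unit_disc \<longleftrightarrow> y \<in> f ` unit_disc" for y using v0 by auto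
  have mem2: "Complex x (Im (v * c)) \<in> (\<lambda>z. v * (f z - 0)) ` unit_disc \<longleftrightarrow> c + of_real (x - Re (v * c)) * u \<in> f ` unit_disc" for x
  proof -
    have "v * (c + of_real (x - Re (v * c)) * u) = v * c + of_real (x - Re (v * c)) * (v * u)" by (simp only: distrib_left mult.left_commute)
    also have "\<dots> = Complex x (Im (v * c))" using uu by (simp add: v_def complex_eq_iff)
    finally show ?thesis using mem[of "c + of_real (x - Re (v * c)) * u"] by simp
  qed
  have "{x. Complex x (Im (v * c)) \<in> (\<lambda>z. v * (f z - 0)) ` unit_disc} = (\<lambda>t. t + Re (v * c)) ` {t. c + of_real t * u \<in> f ` unit_disc}"
    unfolding mem2 by (auto intro!: image_eqI[of _ _ "_ - Re (v * c)"])
  also have "connected \<dots>" by (intro connected_continuous_image conn continuous_intros)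
  finally have "bounded_means p (\<lambda>z. v * (h z - 0)) \<and> bounded_means p (\<lambda>z. cnj v * g z)"
    using H.bounded_means_horizontal[OF refl _ _ p, of "Im (v * c)" "Re (v * c)"] c mem2[of "Re (v * c)"] by simp
  then show ?thesis using u by (simp add: bounded_means_def norm_mult v_def)
qed

text \<open>The line through \<open>0\<close> and an omitted point meets the image in a set starlike
  about \<open>0\<close>, hence connected, and that set is not the whole line.\<close>

lemma bounded_means_starlike:
  assumes star: "\<And>y. y \<in> f ` unit_disc \<Longrightarrow> closed_segment 0 y \<subseteq> f ` unit_disc" and p: "0 < p" "p < 1/2"
  shows "bounded_means p h \<and> bounded_means p g"
proof -
  obtain c where c: "c \<notin> f ` unit_disc" using image_neq_UNIV[OF bounded_ball] by auto
  have "0 \<in> f ` unit_disc" using star[of "f 0"] by auto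
  then have c0: "c \<noteq> 0" using c by auto
  define u where "u = c / of_real (norm c)"
  have u: "norm u = 1" "c = of_real (norm c) * u" using c0 by (simp_all add: u_def norm_divide)
  define S where "S = {t. c + of_real t * u \<in> f ` unit_disc}"
  have e: "c + of_real t * u = of_real (norm c + t) * u" for t by (subst u(2)) (simp add: algebra_simps)
  have "- norm c \<in> S" using \<open>0 \<in> f ` unit_disc\<close> by (simp add: S_def e)
  moreover have "closed_segment (- norm c) t \<subseteq> S" if t: "t \<in> S" for t
  proof
    fix s assume "s \<in> closed_segment (- norm c) t"
    then obtain l where l: "0 \<le> l" "l \<le> 1" "s = (1 - l) * (- norm c) + l * t" by (auto simp: in_segment)
    have "norm c + s = l * (norm c + t)" by (simp add: l(3) algebra_simps)
    then have "c + of_real s * u = of_real l * (c + of_real t * u)" unfolding e by simp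
    then have "c + of_real s * u \<in> closed_segment 0 (c + of_real t * u)"
      using l(1,2) by (auto simp: in_segment scaleR_conv_of_real)
    then show "s \<in> S" using star t by (auto simp: S_def)
  qed
  ultimately have "starlike S" unfolding starlike_def by blast
  then have "connected S" by (rule starlike_imp_connected)
  then show ?thesis unfolding S_def by (rule bounded_means_line[OF u(1) _ c p])
qed

text \<open>The line used is the one in direction \<open>u\<close> through an omitted point
  \<open>c\<close>; the projection \<open>Re (cnj u * (y - c))\<close> turns its slice into a
  connected set of parameters.\<close>

lemma bounded_means_convex_direction:
  assumes conn: "\<And>a. connected ({a + of_real t * u | t. True} \<inter> f ` unit_disc)" and u: "norm u = 1" and p: "0 < p" "p < 1/2"
  shows "bounded_means p h \<and> bounded_means p g"
proof -
  obtain c where c: "c \<notin> f ` unit_disc" using image_neq_UNIV[OF bounded_ball] by auto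
  have uu: "cnj u * u = 1" using u by (metis complex_norm_square mult.commute of_real_1 one_power2)
  have "(\<lambda>y. Re (cnj u * (y - c))) ` ({c + of_real t * u | t. True} \<inter> f ` unit_disc) = {t. c + of_real t * u \<in> f ` unit_disc}"
  proof -
    have t: "Re (cnj u * ((c + of_real t * u) - c)) = t" for t
    proof -
      have "cnj u * ((c + of_real t * u) - c) = of_real t * (cnj u * u)" by simp
      then show ?thesis by (simp only: uu mult_1_right Re_complex_of_real)
    qed
    show ?thesis
    proof (intro equalityI subsetI)
      fix x assume "x \<in> {t. c + of_real t * u \<in> f ` unit_disc}"
      then show "x \<in> (\<lambda>y. Re (cnj u * (y - c))) ` ({c + of_real t * u | t. True} \<inter> f ` unit_disc)"
        using t[of x] by (intro image_eqI[of _ _ "c + of_real x * u"]) auto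
    next
      fix x assume "x \<in> (\<lambda>y. Re (cnj u * (y - c))) ` ({c + of_real t * u | t. True} \<inter> f ` unit_disc)"
      then obtain s where s: "x = Re (cnj u * ((c + of_real s * u) - c))" "c + of_real s * u \<in> f ` unit_disc" by blast
      show "x \<in> {t. c + of_real t * u \<in> f ` unit_disc}" using s(2) unfolding s(1) t by simp
    qed
  qed
  moreover have "connected ((\<lambda>y. Re (cnj u * (y - c))) ` ({c + of_real t * u | t. True} \<inter> f ` unit_disc))"
    by (intro connected_continuous_image conn continuous_intros)
  ultimately have "connected {t. c + of_real t * u \<in> f ` unit_disc}" by simp
  then show ?thesis by (rule bounded_means_line[OF u _ c p])
qed

end

text \<open>The derivative of \<open>f\<close> is a real linear map and determines its complex
  linear and antilinear parts; the vectors \<open>1\<close> and \<open>\<i>\<close> separate the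
  two.\<close>

lemma harmonic_decomp_derivatives_unique:
  assumes d: "harmonic_decomp f h1 g1" "harmonic_decomp f h2 g2" and z: "z \<in> unit_disc"
  shows "deriv h1 z = deriv h2 z" "deriv g1 z = deriv g2 z"
proof -
  have der: "(f has_derivative (\<lambda>v. deriv h z * v + cnj (deriv g z * v))) (at z)" if "harmonic_decomp f h g" for h g
  proof -
    have hg: "h holomorphic_on unit_disc" "g holomorphic_on unit_disc" "\<And>z. z \<in> unit_disc \<Longrightarrow> f z = h z + cnj (g z)"
      using that by (auto simp: harmonic_decomp_def)
    have "(h has_derivative (*) (deriv h z)) (at z)" "(g has_derivative (*) (deriv g z)) (at z)"
      using holomorphic_derivI[OF hg(1) open_ball z] holomorphic_derivI[OF hg(2) open_ball z]
      by (simp_all add: has_field_derivative_def)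
    then have "((\<lambda>z. h z + cnj (g z)) has_derivative (\<lambda>v. deriv h z * v + cnj (deriv g z * v))) (at z)"
      by (intro has_derivative_add has_derivative_cnj)
    then show ?thesis
      by (rule has_derivative_transform_within_open[OF _ open_ball z]) (use hg(3) in simp)
  qed
  have eq: "deriv h1 z * v + cnj (deriv g1 z * v) = deriv h2 z * v + cnj (deriv g2 z * v)" for v
    using has_derivative_unique[OF der[OF d(1)] der[OF d(2)]] by (rule fun_cong)
  define x y where "x = deriv h1 z - deriv h2 z" and "y = cnj (deriv g1 z - deriv g2 z)"
  have "x + y = 0" using eq[of 1] by (simp add: x_def y_def algebra_simps)
  moreover have "\<i> * (x - y) = 0" using eq[of \<i>] by (simp add: x_def y_def algebra_simps)
  ultimately have "x = 0" "y = 0" by auto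
  then show "deriv h1 z = deriv h2 z" "deriv g1 z = deriv g2 z" by (simp_all add: x_def y_def)
qed

text \<open>\<open>class_SH\<close> and \<open>K_qc\<close> each provide a decomposition of their
  own. The dilatation bound passes from one to the other because the derivatives agree.\<close>

lemma K_qc_disc_qc:
  assumes K: "K \<ge> 1" and f: "f \<in> class_SH" and qc: "K_qc K f"
  obtains h g where "harmonic_decomp f h g" "disc_qc f h g ((K - 1) / (K + 1))"
proof -
  obtain h g where d: "harmonic_decomp f h g" and sp: "\<And>z. z \<in> unit_disc \<Longrightarrow> (norm (deriv g z))\<^sup>2 < (norm (deriv h z))\<^sup>2"
    and inj: "inj_on f unit_disc" using f unfolding class_SH_def by blast
  obtain h2 g2 where d2: "harmonic_decomp f h2 g2" and q: "\<And>z. z \<in> unit_disc \<Longrightarrow> norm (deriv g2 z / deriv h2 z) \<le> (K - 1) / (K + 1)"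
    using qc unfolding K_qc_def by blast
  have nz: "deriv h z \<noteq> 0" if "z \<in> unit_disc" for z using sp[OF that] by auto
  have "harmonic_qc f h g ((K - 1) / (K + 1)) unit_disc"
  proof
    show "norm (deriv g z) \<le> (K - 1) / (K + 1) * norm (deriv h z)" if z: "z \<in> unit_disc" for z
      using q[OF z] nz[OF z] unfolding harmonic_decomp_derivatives_unique[OF d d2 z, symmetric]
      by (simp add: norm_divide pos_divide_le_eq)
  qed (use d inj nz K in \<open>auto simp: harmonic_decomp_def\<close>)
  then show thesis using that[OF d] by (simp add: disc_qc_def)
qed

theorem theorem3:
  fixes K :: real and f :: "complex \<Rightarrow> complex"
  assumes "K \<ge> 1"
  shows "(f \<in> class_KH \<and> K_qc K f \<longrightarrow> (\<forall>p. 0 < p \<and> p < 1 \<longrightarrow> f \<in> harmonic_hardy p))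
       \<and> ((f \<in> class_CH \<or> f \<in> class_SH_star \<or> (\<exists>\<theta>. 0 \<le> \<theta> \<and> \<theta> < pi \<and> f \<in> class_KH_dir \<theta>))
            \<and> K_qc K f \<longrightarrow> (\<forall>p. 0 < p \<and> p < 1/2 \<longrightarrow> f \<in> harmonic_hardy p))"
proof (intro conjI impI allI)
  fix p :: real assume f: "f \<in> class_KH \<and> K_qc K f" and p: "0 < p \<and> p < 1"
  then have fS: "f \<in> class_SH" "convex (f ` unit_disc)" by (auto simp: class_KH_def)
  obtain h g where d: "harmonic_decomp f h g" and "disc_qc f h g ((K - 1) / (K + 1))"
    using K_qc_disc_qc[OF assms fS(1)] f by blast
  then interpret disc_qc f h g "(K - 1) / (K + 1)" by simp
  have "bounded_means p h \<and> bounded_means p g" using bounded_means_convex[OF refl fS(2)] p by blast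
  then show "f \<in> harmonic_hardy p" using harmonic_hardyI[OF d, of p] p by simp
next
  fix p :: real
  assume f: "(f \<in> class_CH \<or> f \<in> class_SH_star \<or> (\<exists>\<theta>. 0 \<le> \<theta> \<and> \<theta> < pi \<and> f \<in> class_KH_dir \<theta>)) \<and> K_qc K f"
    and p: "0 < p \<and> p < 1/2"
  then have fS: "f \<in> class_SH" by (auto simp: class_CH_def class_SH_star_def class_KH_dir_def)
  obtain h g where d: "harmonic_decomp f h g" and "disc_qc f h g ((K - 1) / (K + 1))"
    using K_qc_disc_qc[OF assms fS] f by blast
  then interpret disc_qc f h g "(K - 1) / (K + 1)" by simp
  consider "close_to_convex_domain (f ` unit_disc)" | "\<forall>w\<in>f ` unit_disc. closed_segment 0 w \<subseteq> f ` unit_disc"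
    | \<theta> where "\<forall>a. connected ({a + of_real t * exp (\<i> * of_real \<theta>) | t. True} \<inter> f ` unit_disc)"
    using f by (auto simp: class_CH_def class_SH_star_def class_KH_dir_def)
  then have "bounded_means p h \<and> bounded_means p g"
  proof cases
    case 1
    then show ?thesis using bounded_means_close_to_convex p by blast
  next
    case 2
    then show ?thesis using bounded_means_starlike p by blast
  next
    case 3
    have "norm (exp (\<i> * complex_of_real \<theta>)) = 1" by simp
    then show ?thesis using bounded_means_convex_direction[of "exp (\<i> * of_real \<theta>)" p] 3 p by blast
  qed
  then show "f \<in> harmonic_hardy p" using harmonic_hardyI[OF d, of p] p by simp
qed

end
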